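(* Fix $c_0>0$ and an integer $m>5/2$. For each $c\ge c_0$ let $(u_0^c,E_0^c,B_0^c)\in H^m(\mathbb{R}^3)$ be divergence-free initial data such that $(u_0^c,B_0^c)\to(u_0,B_0)$ strongly in $L^2(\mathbb{R}^3)$ as $c\to\infty$ for some $(u_0,B_0)\in H^m(\mathbb{R}^3)$, and $\sup_{c\ge c_0}\|E_0^c\|_{H^1}<+\infty$. Assume there exists $T>0$ such that for each $c\ge c_0$ there is a solution $(u^c,E^c,B^c)\in C([0,T];H^m(\mathbb{R}^3))$ of the Euler-Maxwell system (EM) with initial data $(u_0^c,E_0^c,B_0^c)$ and electric current $j^c$, and that $(\overline u,\overline B)\in C([0,T];H^m(\mathbb{R}^3))$ is the solution of (MHD) with initial data $(u_0,B_0)$. Assume there are constants $M,\overline M>0$ independent of $c\ge c_0$ such that for all $c\ge c_0$ $$\int_0^T\|B^c(t)\|_{L^\infty}^2\,dt+\int_0^T\|j^c(t)\|_{L^\infty}\,dt\le M,$$ $$\sup_{t\in[0,T]}\left(\|\overline u(t)\|_{H^m}+\|\overline B(t)\|_{H^m}\right)+\left(\int_0^T\|\nabla\overline B(t)\|_{H^m}^2\,dt\right)^{1/2}\le\overline M.$$ Then $$\lim_{c\to\infty}\|(u^c-\overline u,\,B^c-\overline B)\|_{L^\infty(0,T;L^2(\mathbb{R}^3))}=0,$$ and $$\lim_{c\to\infty}\|E^c\|_{L^p(0,T;L^2(\mathbb{R}^3))}=0\quad\text{for every }p\in[1,\infty).$$ For $p=\infty$: if $\|E_0^c\|_{L^2(\mathbb{R}^3)}\to0$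 as $c\to\infty$, then $E^c\to0$ in $L^\infty(0,T;L^2(\mathbb{R}^3))$ as $c\to\infty$. Conversely, if $\|E_0^c\|_{L^2(\mathbb{R}^3)}$ does not tend to zero as $c\to\infty$, then $E^c$ does not converge to any limit in $L^\infty(0,T;L^2(\mathbb{R}^3))$ as $c\to\infty$.
   Context: All fields are functions of $t\ge0$ and $x\in\mathbb{R}^3$; $u,E,B,j$ take values in $\mathbb{R}^3$ and $p$ in the systems below is the scalar pressure (elsewhere a Lebesgue exponent). $\mathbb{P}=I+\nabla(-\Delta)^{-1}\operatorname{div}$ is the Leray projection. The speed of light is $c\ge c_0$. Euler-Maxwell system (EM), with electrical conductivity equal to $1$: $$\partial_tu+(u\cdot\nabla)u+\nabla p=j\times B,\quad \frac1c\partial_tE-\nabla\times B=-j,\quad \frac1c\partial_tB+\nabla\times E=0,\quad j=cE+\mathbb{P}(u\times B),$$ with $\operatorname{div}u=\operatorname{div}E=\operatorname{div}B=\operatorname{div}j=0$. MHD system (MHD): $$\partial_tu+(u\cdot\nabla)u+\nabla p=(\nabla\times B)\times B,\qquad \partial_tB-\Delta B=\nabla\times(u\times B),\qquad \operatorname{div}u=\operatorname{div}B=0.$$ *)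

theory Defs
  imports "HOL-Analysis.Analysis" "HOL-Probability.Essential_Supremum"
begin

unbundle cross3_syntax

type_synonym R3 = "real^3"

text \<open>Powers of elements of \<open>[0,\<infinity>]\<close>, only used with positive exponents.\<close>

definition ennpowr :: "ennreal \<Rightarrow> real \<Rightarrow> ennreal" where
  "ennpowr a r = (if a = \<infinity> then \<infinity> else ennreal (enn2real a powr r))"

definition L2norm :: "(R3 \<Rightarrow> 'b::euclidean_space) \<Rightarrow> ennreal" where
  "L2norm f = ennpowr (\<integral>\<^sup>+x. ennreal ((norm (f x))\<^sup>2) \<partial>lebesgue) (1/2)"

definition L2 :: "(R3 \<Rightarrow> 'b::euclidean_space) set" where
  "L2 = {f. f \<in> borel_measurable lebesgue \<and> L2norm f < \<infinity>}"

definition Linfnorm :: "(R3 \<Rightarrow> 'b::euclidean_space) \<Rightarrow> ennreal" where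
  "Linfnorm f = esssup lebesgue (\<lambda>x. ennreal (norm (f x)))"

definition loc_integrable :: "(R3 \<Rightarrow> 'b::euclidean_space) \<Rightarrow> bool" where
  "loc_integrable f \<longleftrightarrow> (\<forall>K. compact K \<longrightarrow> set_integrable lebesgue K f)"

definition partial :: "3 \<Rightarrow> (R3 \<Rightarrow> real) \<Rightarrow> R3 \<Rightarrow> real" where
  "partial i \<phi> x = frechet_derivative \<phi> (at x) (axis i 1)"

primrec Ck :: "nat \<Rightarrow> (R3 \<Rightarrow> real) \<Rightarrow> bool" where
  "Ck 0 \<phi> \<longleftrightarrow> continuous_on UNIV \<phi>"
| "Ck (Suc k) \<phi> \<longleftrightarrow> \<phi> differentiable_on UNIV \<and> (\<forall>i. Ck k (partial i \<phi>))"

definition test_functions :: "(R3 \<Rightarrow> real) set" where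
  "test_functions = {\<phi>. (\<forall>k. Ck k \<phi>) \<and> compact (closure {x. \<phi> x \<noteq> 0})}"

definition grad :: "(R3 \<Rightarrow> real) \<Rightarrow> R3 \<Rightarrow> R3" where
  "grad \<phi> x = (\<chi> i. partial i \<phi> x)"

definition laplacian :: "(R3 \<Rightarrow> real) \<Rightarrow> R3 \<Rightarrow> real" where
  "laplacian \<phi> x = (\<Sum>i\<in>UNIV. partial i (partial i \<phi>) x)"

type_synonym multi_index = "nat^3"

definition mi_order :: "multi_index \<Rightarrow> nat" where
  "mi_order \<alpha> = (\<Sum>i\<in>UNIV. \<alpha> $ i)"

definition multi_partial :: "multi_index \<Rightarrow> (R3 \<Rightarrow> real) \<Rightarrow> R3 \<Rightarrow> real" where
  "multi_partial \<alpha> \<phi> =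
     (partial 1 ^^ (\<alpha> $ 1)) ((partial 2 ^^ (\<alpha> $ 2)) ((partial 3 ^^ (\<alpha> $ 3)) \<phi>))"

definition has_weak_deriv ::
    "multi_index \<Rightarrow> (R3 \<Rightarrow> 'b::euclidean_space) \<Rightarrow> (R3 \<Rightarrow> 'b) \<Rightarrow> bool" where
  "has_weak_deriv \<alpha> f g \<longleftrightarrow> loc_integrable f \<and> loc_integrable g \<and>
     (\<forall>\<phi>\<in>test_functions. (\<integral>x. multi_partial \<alpha> \<phi> x *\<^sub>R f x \<partial>lebesgue)
        = (-1) ^ mi_order \<alpha> *\<^sub>R (\<integral>x. \<phi> x *\<^sub>R g x \<partial>lebesgue))"

text \<open>A representative of the weak derivative, which is unique almost everywhere. It is
  meaningful only where a weak derivative exists, as is the case for elements of \<open>H\<^sup>m\<close> of order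
  at most \<open>m\<close>.\<close>

definition weak_deriv :: "multi_index \<Rightarrow> (R3 \<Rightarrow> 'b::euclidean_space) \<Rightarrow> R3 \<Rightarrow> 'b" where
  "weak_deriv \<alpha> f = (SOME g. has_weak_deriv \<alpha> f g)"

abbreviation weak_partial :: "3 \<Rightarrow> (R3 \<Rightarrow> 'b::euclidean_space) \<Rightarrow> R3 \<Rightarrow> 'b" where
  "weak_partial i \<equiv> weak_deriv (axis i 1)"

definition weakly_differentiable :: "(R3 \<Rightarrow> 'b::euclidean_space) \<Rightarrow> bool" where
  "weakly_differentiable f \<longleftrightarrow> (\<forall>i. \<exists>g. has_weak_deriv (axis i 1) f g)"

definition weak_grad :: "(R3 \<Rightarrow> 'b::euclidean_space) \<Rightarrow> R3 \<Rightarrow> 'b^3" where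
  "weak_grad f x = (\<chi> i. weak_partial i f x)"

definition weak_laplacian :: "(R3 \<Rightarrow> 'b::euclidean_space) \<Rightarrow> R3 \<Rightarrow> 'b" where
  "weak_laplacian f x = (\<Sum>i\<in>UNIV. weak_deriv (axis i 2) f x)"

definition weak_curl :: "(R3 \<Rightarrow> R3) \<Rightarrow> R3 \<Rightarrow> R3" where
  "weak_curl f x = vector
     [weak_partial 2 f x $ 3 - weak_partial 3 f x $ 2,
      weak_partial 3 f x $ 1 - weak_partial 1 f x $ 3,
      weak_partial 1 f x $ 2 - weak_partial 2 f x $ 1]"

definition advect :: "(R3 \<Rightarrow> R3) \<Rightarrow> (R3 \<Rightarrow> R3) \<Rightarrow> R3 \<Rightarrow> R3" where
  "advect v w x = (\<Sum>i\<in>UNIV. v x $ i *\<^sub>R weak_partial i w x)"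

definition div_free :: "(R3 \<Rightarrow> R3) \<Rightarrow> bool" where
  "div_free f \<longleftrightarrow> loc_integrable f \<and>
     (\<forall>\<phi>\<in>test_functions. (\<integral>x. f x \<bullet> grad \<phi> x \<partial>lebesgue) = 0)"

definition Hspace :: "nat \<Rightarrow> (R3 \<Rightarrow> 'b::euclidean_space) set" where
  "Hspace m = {f \<in> L2. \<forall>\<alpha>. mi_order \<alpha> \<le> m \<longrightarrow> (\<exists>g\<in>L2. has_weak_deriv \<alpha> f g)}"

definition Hnorm :: "nat \<Rightarrow> (R3 \<Rightarrow> 'b::euclidean_space) \<Rightarrow> ennreal" where
  "Hnorm m f = (if f \<in> Hspace m
     then ennpowr (\<Sum>\<alpha> | mi_order \<alpha> \<le> m. (L2norm (weak_deriv \<alpha> f))\<^sup>2) (1/2) else \<infinity>)"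

definition CHspace :: "real \<Rightarrow> nat \<Rightarrow> (real \<Rightarrow> R3 \<Rightarrow> 'b::euclidean_space) set" where
  "CHspace T m = {f. \<forall>t\<in>{0..T}. f t \<in> Hspace m \<and>
     ((\<lambda>s. Hnorm m (\<lambda>x. f s x - f t x)) \<longlongrightarrow> 0) (at t within {0..T})}"

definition LpL2norm :: "real \<Rightarrow> real \<Rightarrow> (real \<Rightarrow> R3 \<Rightarrow> 'b::euclidean_space) \<Rightarrow> ennreal" where
  "LpL2norm p T f = ennpowr (\<integral>\<^sup>+t. ennpowr (L2norm (f t)) p \<partial>lebesgue_on {0..T}) (1/p)"

definition LinfL2norm :: "real \<Rightarrow> (real \<Rightarrow> R3 \<Rightarrow> 'b::euclidean_space) \<Rightarrow> ennreal" where
  "LinfL2norm T f = esssup (lebesgue_on {0..T}) (\<lambda>t. L2norm (f t))"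

text \<open>Strong measurability: almost everywhere limit in \<open>L\<^sup>2\<close> of simple functions.\<close>

definition strongly_measurable_L2 :: "real \<Rightarrow> (real \<Rightarrow> R3 \<Rightarrow> 'b::euclidean_space) \<Rightarrow> bool" where
  "strongly_measurable_L2 T f \<longleftrightarrow> (\<exists>s.
     (\<forall>n::nat. finite (s n ` {0..T}) \<and> s n ` {0..T} \<subseteq> L2 \<and>
        (\<forall>g. {t\<in>{0..T}. s n t = g} \<in> sets lebesgue)) \<and>
     (AE t in lebesgue_on {0..T}. (\<lambda>n. L2norm (\<lambda>x. s n t x - f t x)) \<longlonglongrightarrow> 0))"

definition LinfL2 :: "real \<Rightarrow> (real \<Rightarrow> R3 \<Rightarrow> 'b::euclidean_space) set" where
  "LinfL2 T = {f. (AE t in lebesgue_on {0..T}. f t \<in> L2) \<and>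
     strongly_measurable_L2 T f \<and> LinfL2norm T f < \<infinity>}"

text \<open>\<open>g = \<bbbP> f\<close> with \<open>\<bbbP> = I + \<nabla>(-\<Delta>)\<^sup>-\<^sup>1 div\<close> on \<open>L\<^sup>2\<close>. Here \<open>q = (-\<Delta>)\<^sup>-\<^sup>1 div f\<close> is the solution of
  \<open>-\<Delta>q = div f\<close> (in the sense of distributions) with \<open>\<nabla>q \<in> L\<^sup>2\<close>; these two conditions determine
  \<open>\<nabla>q\<close>, since a harmonic function with square-integrable gradient is constant.\<close>

definition is_Leray_projection :: "(R3 \<Rightarrow> R3) \<Rightarrow> (R3 \<Rightarrow> R3) \<Rightarrow> bool" where
  "is_Leray_projection f g \<longleftrightarrow> f \<in> L2 \<and> g \<in> L2 \<and>
     (\<exists>q. weakly_differentiable q \<and> weak_grad q \<in> L2 \<and>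
        (\<forall>\<phi>\<in>test_functions. (\<integral>x. q x * (- laplacian \<phi> x) \<partial>lebesgue)
           = - (\<integral>x. f x \<bullet> grad \<phi> x \<partial>lebesgue)) \<and>
        (AE x in lebesgue. g x = f x + weak_grad q x))"

text \<open>\<open>f' = \<partial>\<^sub>t f\<close> on \<open>[0,T]\<close> in the sense of distributions in \<open>x\<close> (one-sided at the end points).
  The remaining terms of the systems below are continuous in \<open>t\<close> along
  solutions in \<open>C([0,T]; H\<^sup>m)\<close>, \<open>m > 5/2\<close>, so that this agrees with the sense of
  distributions on \<open>(0,T) \<times> \<real>\<^sup>3\<close>.\<close>

definition has_time_deriv ::
    "real \<Rightarrow> (real \<Rightarrow> R3 \<Rightarrow> R3) \<Rightarrow> (real \<Rightarrow> R3 \<Rightarrow> R3) \<Rightarrow> bool" where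
  "has_time_deriv T f f' \<longleftrightarrow>
     (\<forall>t\<in>{0..T}. loc_integrable (f t) \<and> loc_integrable (f' t) \<and>
       (\<forall>\<phi>\<in>test_functions.
         ((\<lambda>s. \<integral>x. \<phi> x *\<^sub>R f s x \<partial>lebesgue) has_vector_derivative
          (\<integral>x. \<phi> x *\<^sub>R f' t x \<partial>lebesgue)) (at t within {0..T})))"

definition Euler_Maxwell ::
    "real \<Rightarrow> real \<Rightarrow> (real \<Rightarrow> R3 \<Rightarrow> R3) \<Rightarrow> (real \<Rightarrow> R3 \<Rightarrow> R3) \<Rightarrow> (real \<Rightarrow> R3 \<Rightarrow> R3) \<Rightarrow>
     (real \<Rightarrow> R3 \<Rightarrow> R3) \<Rightarrow> bool" where
  "Euler_Maxwell c T u E B j \<longleftrightarrow>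
     (\<exists>u' E' B' p P.
        has_time_deriv T u u' \<and> has_time_deriv T E E' \<and> has_time_deriv T B B' \<and>
        (\<forall>t\<in>{0..T}.
           weakly_differentiable (p t :: R3 \<Rightarrow> real) \<and>
           is_Leray_projection (\<lambda>x. u t x \<times> B t x) (P t) \<and>
           j t \<in> borel_measurable lebesgue \<and>
           (AE x in lebesgue.
              u' t x + advect (u t) (u t) x + weak_grad (p t) x = j t x \<times> B t x \<and>
              (1/c) *\<^sub>R E' t x - weak_curl (B t) x = - j t x \<and>
              (1/c) *\<^sub>R B' t x + weak_curl (E t) x = 0 \<and>
              j t x = c *\<^sub>R E t x + P t x) \<and>
           div_free (u t) \<and> div_free (E t) \<and> div_free (B t) \<and> div_free (j t)))"

definition MHD :: "real \<Rightarrow> (real \<Rightarrow> R3 \<Rightarrow> R3) \<Rightarrow> (real \<Rightarrow> R3 \<Rightarrow> R3) \<Rightarrow> bool" where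
  "MHD T u B \<longleftrightarrow>
     (\<exists>u' B' p.
        has_time_deriv T u u' \<and> has_time_deriv T B B' \<and>
        (\<forall>t\<in>{0..T}.
           weakly_differentiable (p t :: R3 \<Rightarrow> real) \<and>
           (AE x in lebesgue.
              u' t x + advect (u t) (u t) x + weak_grad (p t) x = weak_curl (B t) x \<times> B t x \<and>
              B' t x - weak_laplacian (B t) x = weak_curl (\<lambda>y. u t y \<times> B t y) x) \<and>
           div_free (u t) \<and> div_free (B t)))"

end

theory Submission
  imports Defs
begin

text \<open>The proof compares the two systems through a relative energy. The deviations are \<open>w = u - ubar\<close>,
\<open>b = B - Bbar\<close>, and the electric field without its initial layer, \<open>er(t) = E(t) - exp(-c\<^sup>2 t) E(0)\<close>. The layer
solves the stiff part \<open>E'/c = - c E\<close> of Ampere's law with Ohm's law inserted. With \<open>y\<close> the sum of the squares of the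
\<open>L\<^sup>2\<close> norms of \<open>w\<close>, \<open>b\<close> and \<open>er\<close>, the cancellations of the energy balance (the Lorentz force against the electromotive
part of Ohm's law, the two curls against each other, pressure and projection against divergence-free fields)
leave \<open>y' \<le> K y + 2 rem\<close>, where \<open>K\<close> depends only on bounds of the limit solution
(\<open>relative_energy_identity\<close>, \<open>y'_le\<close>). The dissipation of the current deviation absorbs its product with \<open>ubar \<times> b\<close>.

The remainder consists of three terms that are not small pointwise in time but are small after integration in time,
which is all that Gronwall's inequality needs (\<open>gronwall\<close>, \<open>remainder_bound\<close>).
The layer against the curl of \<open>b\<close> costs the curl of the initial field times the integral of \<open>c exp(-c\<^sup>2 t)\<close>, which
is \<open>O(1/c)\<close>. For the layer against \<open>B\<close>, the initial field is split into a part that is small in \<open>L\<^sup>2\<close>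
and a bounded part, uniformly in \<open>c\<close> because the initial fields are bounded in \<open>H\<^sup>1\<close> (\<open>H1_split\<close>); the small part uses the
square integrability in time of the supremum of \<open>B\<close>. The last term is the product of
\<open>G = curl Bbar - ubar \<times> Bbar\<close> with \<open>er'/c\<close>. There is no time derivative of \<open>G\<close> to integrate by parts; instead, \<open>G\<close> is
frozen on the cells of a time grid, where the integral is an increment of \<open>er/c\<close> and hence \<open>O(1/c)\<close>, and the error of
freezing is small by uniform continuity of \<open>G\<close> in \<open>H\<^sup>1\<close> (\<open>frozen_bound\<close>).

Hence \<open>y\<close> tends to zero uniformly on \<open>[0,T]\<close>. This is the convergence of \<open>u\<close> and \<open>B\<close>, and it shows that \<open>E\<close> is its initial
layer up to a uniformly small error. The layer has width \<open>1/c\<^sup>2\<close>, so it disappears in \<open>L\<^sup>p\<close> for finite \<open>p\<close>; in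
\<open>L\<^sup>\<infinity>\<close> its size is that of the initial field. Any limit in \<open>L\<^sup>\<infinity>\<close> is zero, because \<open>E\<close> vanishes at
every positive time, and continuity at time zero then makes the initial fields vanish (\<open>initial_field_vanishes\<close>).

The equations hold in the sense of distributions, so the calculus behind these identities has to be justified in \<open>L\<^sup>2\<close>.
Fields are treated as elements \<open>cl f\<close> of the Hilbert space of classes of square-integrable functions. Three facts carry the weight:
\<open>H\<^sup>2\<close> is bounded in \<open>L\<^sup>\<infinity>\<close> (\<open>sobolev\<close>), so all products are square-integrable; curls of test fields are dense
among the divergence-free fields (\<open>test_curl_dense\<close>), so gradients drop out; and a time derivative that is known against a
dense set of test fields and is continuous in \<open>L\<^sup>2\<close> differentiates the square of the norm (\<open>time_derivative_norm\<close>).\<close>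

section \<open>Square-integrable functions\<close>

lemma ennpowr_half_less_top: "ennpowr a (1/2) < top \<longleftrightarrow> a < top"
 by (auto simp: ennpowr_def less_top)

lemma ennpowr_half: "a >= 0 ==> ennpowr (ennreal a) (1/2) = ennreal (sqrt a)"
 by (simp add: ennpowr_def powr_half_sqrt)

lemma L2_iff:
 "f \<in> L2 \<longleftrightarrow> f \<in> borel_measurable lebesgue \<and> integrable lebesgue (%x. (norm (f x))\<^sup>2)"
 by (auto simp: L2_def L2norm_def ennpowr_half_less_top integrable_iff_bounded)

lemma L2_measurable [measurable_dest]: "f \<in> L2 ==> f \<in> borel_measurable lebesgue"
 by (simp add: L2_iff)

lemma L2_integrable: "f \<in> L2 ==> integrable lebesgue (%x. (norm (f x))\<^sup>2)"
 by (simp add: L2_iff)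

lemma L2norm_eq: "f \<in> L2 ==> L2norm f = ennreal (sqrt (\<integral>x. (norm (f x))\<^sup>2 \<partial>lebesgue))"
 unfolding L2norm_def by (subst nn_integral_eq_integral) (auto simp: L2_integrable ennpowr_half)

lemma L2_dominated:
 assumes f: "f \<in> L2" and g: "g \<in> borel_measurable lebesgue"
  and le: "AE x in lebesgue. norm (g x) <= K * norm (f x)"
 shows "g \<in> L2"
proof -
 have "integrable lebesgue (%x. K\<^sup>2 * (norm (f x))\<^sup>2)"
  using L2_integrable[OF f] by simp
 then have "integrable lebesgue (%x. (norm (g x))\<^sup>2)"
 proof (rule Bochner_Integration.integrable_bound)
  show "(%x. (norm (g x))\<^sup>2) \<in> borel_measurable lebesgue" using g by simp
  show "AE x in lebesgue. norm ((norm (g x))\<^sup>2) <= norm (K\<^sup>2 * (norm (f x))\<^sup>2)"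
   using le by eventually_elim (simp add: power_mult_distrib[symmetric] power_mono)
 qed
 then show ?thesis using g by (simp add: L2_iff)
qed

lemma L2_zero [simp]: "(%x. 0) \<in> L2"
 by (simp add: L2_iff)

lemma L2_add: assumes "f \<in> L2" "g \<in> L2" shows "(%x. f x + g x) \<in> L2"
proof -
 have "integrable lebesgue (%x. 2 * (norm (f x))\<^sup>2 + 2 * (norm (g x))\<^sup>2)"
  using assms by (simp add: L2_integrable)
 then have "integrable lebesgue (%x. (norm (f x + g x))\<^sup>2)"
 proof (rule Bochner_Integration.integrable_bound)
  show "(%x. (norm (f x + g x))\<^sup>2) \<in> borel_measurable lebesgue" using assms by measurable
  have "(norm (f x + g x))\<^sup>2 <= 2 * (norm (f x))\<^sup>2 + 2 * (norm (g x))\<^sup>2" for x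
  proof -
   have "(norm (f x + g x))\<^sup>2 <= (norm (f x) + norm (g x))\<^sup>2"
    by (intro power_mono norm_triangle_ineq) auto
   also have "\<dots> <= 2 * (norm (f x))\<^sup>2 + 2 * (norm (g x))\<^sup>2"
    using sum_squares_ge_zero[of "norm (f x) - norm (g x)" 0]
    by (simp add: power2_eq_square algebra_simps)
   finally show ?thesis .
  qed
  then show "AE x in lebesgue. norm ((norm (f x + g x))\<^sup>2) <= norm (2 * (norm (f x))\<^sup>2 + 2 * (norm (g x))\<^sup>2)"
   by simp
 qed
 moreover have "(%x. f x + g x) \<in> borel_measurable lebesgue" using assms by measurable
 ultimately show ?thesis unfolding L2_iff by simp
qed

lemma L2_bounded_linear:
 assumes "f \<in> L2" "bounded_linear h" shows "(%x. h (f x)) \<in> L2"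
proof -
 obtain K where K: "!!x. norm (h x) <= norm x * K"
  using bounded_linear.bounded[OF assms(2)] by blast
 have m: "(%x. h (f x)) \<in> borel_measurable lebesgue"
  by (rule measurable_compose[OF L2_measurable[OF assms(1)]
     borel_measurable_continuous_onI[OF linear_continuous_on[OF assms(2)]]])
 have "AE x in lebesgue. norm (h (f x)) <= K * norm (f x)"
  by (rule AE_I2) (metis K mult.commute)
 then show ?thesis by (rule L2_dominated[OF assms(1) m])
qed

lemma L2_scaleR: "f \<in> L2 ==> (%x. c *\<^sub>R f x) \<in> L2"
 by (rule L2_bounded_linear) (auto intro: bounded_linear_scaleR_right)
lemma L2_mult: "f \<in> L2 ==> (%x. (c::real) * f x) \<in> L2"
 using L2_scaleR[of f c] by simp
lemma L2_uminus: "f \<in> L2 ==> (%x. - f x) \<in> L2"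
 using L2_scaleR[of f "-1"] by simp
lemma L2_diff: "f \<in> L2 ==> g \<in> L2 ==> (%x. f x - g x) \<in> L2"
 using L2_add[of f "%x. - g x"] L2_uminus[of g] by simp
lemma L2_sum: "(!!i. i \<in> I ==> f i \<in> L2) ==> (%x. \<Sum>i\<in>I. f i x) \<in> L2"
 by (induction I rule: infinite_finite_induct) (simp_all add: L2_add)
lemma L2_nth: "f \<in> L2 ==> (%x. f x $ i) \<in> L2"
 by (rule L2_bounded_linear[OF _ bounded_linear_vec_nth])

lemma L2_cong_AE:
 assumes "f \<in> L2" "AE x in lebesgue. f x = g x" shows "g \<in> L2"
proof -
 have "g \<in> borel_measurable lebesgue"
  using borel_measurable_AE[OF L2_measurable[OF assms(1)] assms(2)] .
 then show ?thesis
  by (rule L2_dominated[OF assms(1), of g 1]) (use assms(2) in eventually_elim, simp)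
qed

lemmas L2_intros = L2_add L2_scaleR L2_mult L2_uminus L2_diff L2_sum L2_nth

lemma L2_inner_integrable:
 assumes "f \<in> L2" "g \<in> L2" shows "integrable lebesgue (%x. f x \<bullet> g x)"
proof -
 have "integrable lebesgue (%x. (norm (f x))\<^sup>2 + (norm (g x))\<^sup>2)"
  using assms by (simp add: L2_integrable)
 then show ?thesis
 proof (rule Bochner_Integration.integrable_bound)
  show "(%x. f x \<bullet> g x) \<in> borel_measurable lebesgue" using assms by measurable
  have "\<bar>f x \<bullet> g x\<bar> <= (norm (f x))\<^sup>2 + (norm (g x))\<^sup>2" for x
  proof -
   have "\<bar>f x \<bullet> g x\<bar> <= norm (f x) * norm (g x)" by (rule Cauchy_Schwarz_ineq2)
   also have "\<dots> <= (norm (f x))\<^sup>2 + (norm (g x))\<^sup>2"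
    using sum_squares_ge_zero[of "norm (f x) - norm (g x)" 0]
     sum_squares_ge_zero[of "norm (f x)" "norm (g x)"]
    unfolding power2_eq_square by (simp add: algebra_simps) (smt (verit) mult_nonneg_nonneg norm_ge_zero)
   finally show ?thesis .
  qed
  then show "AE x in lebesgue. norm (f x \<bullet> g x) <= norm ((norm (f x))\<^sup>2 + (norm (g x))\<^sup>2)" by simp
 qed
qed

lemma L2_vec_iff:
 fixes f :: "R3 => real^'n"
 shows "f \<in> L2 \<longleftrightarrow> (\<forall>i. (%x. f x $ i) \<in> L2)"
proof
 assume *: "\<forall>i. (%x. f x $ i) \<in> L2"
 have "(%x. \<Sum>i\<in>UNIV. f x $ i *\<^sub>R axis i (1::real)) \<in> L2"
  by (intro L2_sum L2_bounded_linear[of "%x. f x $ _", OF _ bounded_linear_scaleR_left]) (use * in simp)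
 moreover have "(%x. \<Sum>i\<in>UNIV. f x $ i *\<^sub>R axis i (1::real)) = f"
  by (simp add: fun_eq_iff vec_eq_iff axis_def if_distrib cong: if_cong)
 ultimately show "f \<in> L2" by simp
qed (simp add: L2_nth)

text \<open>The Hilbert space itself, as a quotient by almost everywhere equality. It makes
 Cauchy-Schwarz, continuity and the calculus of real inner product spaces available for
 \<open>L\<^sup>2\<close>-valued functions of time.\<close>

quotient_type (overloaded) 'b hl = "R3 => 'b::euclidean_space" /
 partial: "%f g. f \<in> L2 \<and> g \<in> L2 \<and> (AE x in lebesgue. f x = g x)"
proof (rule part_equivpI)
 show "\<exists>f::R3 => 'b. f \<in> L2 \<and> f \<in> L2 \<and> (AE x in lebesgue. f x = f x)"
  by (rule exI[of _ "%x. 0"]) simp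
 show "symp (%f g::R3 => 'b. f \<in> L2 \<and> g \<in> L2 \<and> (AE x in lebesgue. f x = g x))"
  by (auto simp: symp_def elim!: eventually_mono)
 show "transp (%f g::R3 => 'b. f \<in> L2 \<and> g \<in> L2 \<and> (AE x in lebesgue. f x = g x))"
  unfolding transp_def by (intro allI impI conjI; (elim conjE)?; (assumption | (erule (1) eventually_elim2, simp)))
qed

instantiation hl :: (euclidean_space) real_inner
begin
lift_definition zero_hl :: "'a hl" is "%x. 0" by simp
lift_definition plus_hl :: "'a hl => 'a hl => 'a hl" is "%f g x. f x + g x"
 by (elim conjE, intro conjI, (rule L2_add; assumption), (rule L2_add; assumption), erule (1) eventually_elim2, simp)
lift_definition minus_hl :: "'a hl => 'a hl => 'a hl" is "%f g x. f x - g x"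
 by (elim conjE, intro conjI, (rule L2_diff; assumption), (rule L2_diff; assumption), erule (1) eventually_elim2, simp)
lift_definition uminus_hl :: "'a hl => 'a hl" is "%f x. - f x"
 by (elim conjE, intro conjI, (rule L2_uminus; assumption), (rule L2_uminus; assumption), erule eventually_mono, simp)
lift_definition scaleR_hl :: "real => 'a hl => 'a hl" is "%c f x. c *\<^sub>R f x"
 by (elim conjE, intro conjI, (rule L2_scaleR; assumption), (rule L2_scaleR; assumption), erule eventually_mono, simp)
lift_definition inner_hl :: "'a hl => 'a hl => real" is "%f g. \<integral>x. f x \<bullet> g x \<partial>lebesgue"
proof -
 fix f f' g g' :: "R3 => 'a"
 assume "f \<in> L2 \<and> f' \<in> L2 \<and> (AE x in lebesgue. f x = f' x)"
  and "g \<in> L2 \<and> g' \<in> L2 \<and> (AE x in lebesgue. g x = g' x)"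
 then have m: "f \<in> L2" "f' \<in> L2" "g \<in> L2" "g' \<in> L2"
  and ae: "AE x in lebesgue. f x = f' x" "AE x in lebesgue. g x = g' x" by simp_all
 show "(\<integral>x. f x \<bullet> g x \<partial>lebesgue) = (\<integral>x. f' x \<bullet> g' x \<partial>lebesgue)"
 proof (rule integral_cong_AE)
  show "(%x. f x \<bullet> g x) \<in> borel_measurable lebesgue" "(%x. f' x \<bullet> g' x) \<in> borel_measurable lebesgue"
   using m by measurable
  show "AE x in lebesgue. f x \<bullet> g x = f' x \<bullet> g' x"
   using ae by eventually_elim simp
 qed
qed
definition "norm_hl (f::'a hl) = sqrt (f \<bullet> f)"
definition "dist_hl (f::'a hl) g = norm (f - g)"
definition "sgn_hl (f::'a hl) = scaleR (inverse (norm f)) f"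
definition "uniformity_hl = (INF e\<in>{0<..}. principal {(x, y::'a hl). dist x y < e})"
definition "open_hl (U::'a hl set) = (\<forall>x\<in>U. \<forall>\<^sub>F (x', y) in uniformity. x' = x \<longrightarrow> y \<in> U)"
instance
proof
 fix a b c :: "'a hl" and r s :: real
 show "a + b + c = a + (b + c)" by transfer (simp add: algebra_simps L2_intros)
 show "a + b = b + a" by transfer (simp add: algebra_simps L2_intros)
 show "0 + a = a" by transfer (simp add: L2_intros)
 show "- a + a = 0" by transfer (simp add: L2_intros)
 show "a - b = a + - b" by transfer (simp add: L2_intros)
 show "r *\<^sub>R (a + b) = r *\<^sub>R a + r *\<^sub>R b" by transfer (simp add: algebra_simps L2_intros)
 show "(r + s) *\<^sub>R a = r *\<^sub>R a + s *\<^sub>R a" by transfer (simp add: algebra_simps L2_intros)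
 show "r *\<^sub>R s *\<^sub>R a = (r * s) *\<^sub>R a" by transfer (simp add: L2_intros)
 show "1 *\<^sub>R a = a" by transfer (simp add: L2_intros)
 show "dist a b = norm (a - b)" by (rule dist_hl_def)
 show "sgn a = scaleR (inverse (norm a)) a" unfolding sgn_hl_def ..
 show "uniformity = (INF e\<in>{0<..}. principal {(x, y::'a hl). dist x y < e})" by (rule uniformity_hl_def)
 show "open U = (\<forall>x\<in>U. \<forall>\<^sub>F (x', y) in uniformity. x' = x \<longrightarrow> y \<in> U)" for U :: "'a hl set"
  by (rule open_hl_def)
 show "a \<bullet> b = b \<bullet> a" by transfer (simp add: inner_commute)
 show "(a + b) \<bullet> c = a \<bullet> c + b \<bullet> c"
  by transfer (simp add: inner_add_left L2_inner_integrable)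
 show "r *\<^sub>R a \<bullet> b = r * (a \<bullet> b)" by transfer simp
 show "0 <= a \<bullet> a" by transfer simp
 show "(a \<bullet> a = 0) = (a = 0)"
 proof transfer
  fix a :: "R3 => 'a"
  assume "a \<in> L2 \<and> a \<in> L2 \<and> (AE x in lebesgue. a x = a x)"
  then have a: "a \<in> L2" by simp
  have "((\<integral>x. a x \<bullet> a x \<partial>lebesgue) = 0) = (AE x in lebesgue. a x \<bullet> a x = 0)"
   by (rule integral_nonneg_eq_0_iff_AE) (simp_all add: L2_inner_integrable a)
  then show "((\<integral>x. a x \<bullet> a x \<partial>lebesgue) = 0) =
    (a \<in> L2 \<and> (%x. 0) \<in> (L2 :: (R3 => 'a) set) \<and> (AE x in lebesgue. a x = 0))"
   using a by simp
 qed
 show "norm a = sqrt (a \<bullet> a)" by (rule norm_hl_def)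
qed
end

abbreviation cl :: "(R3 => 'b::euclidean_space) => 'b hl" where "cl \<equiv> abs_hl"

lemma cl_eq_iff: "f \<in> L2 ==> g \<in> L2 ==> cl f = cl g \<longleftrightarrow> (AE x in lebesgue. f x = g x)"
 using Quotient_rel[OF Quotient_hl, of f g] by simp

lemma cl_cong: "f \<in> L2 ==> (AE x in lebesgue. f x = g x) ==> cl f = cl g"
 using L2_cong_AE cl_eq_iff by blast

lemma cl_add: "f \<in> L2 ==> g \<in> L2 ==> cl (%x. f x + g x) = cl f + cl g"
 by (simp add: plus_hl.abs_eq)
lemma cl_diff: "f \<in> L2 ==> g \<in> L2 ==> cl (%x. f x - g x) = cl f - cl g"
 by (simp add: minus_hl.abs_eq)
lemma cl_uminus: "f \<in> L2 ==> cl (%x. - f x) = - cl f"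
 by (simp add: uminus_hl.abs_eq)
lemma cl_scaleR: "f \<in> L2 ==> cl (%x. c *\<^sub>R f x) = c *\<^sub>R cl f"
 by (simp add: scaleR_hl.abs_eq)
lemma cl_zero: "cl (%x. 0) = 0" by (simp add: zero_hl_def)
lemma cl_sum: "(!!i. i \<in> I ==> f i \<in> L2) ==> cl (%x. \<Sum>i\<in>I. f i x) = (\<Sum>i\<in>I. cl (f i))"
 by (induction I rule: infinite_finite_induct) (simp_all add: cl_zero cl_add L2_sum)
lemma inner_cl: "f \<in> L2 ==> g \<in> L2 ==> cl f \<bullet> cl g = (\<integral>x. f x \<bullet> g x \<partial>lebesgue)"
 by (simp add: inner_hl.abs_eq)
lemma norm_cl_sq: "f \<in> L2 ==> (norm (cl f))\<^sup>2 = (\<integral>x. (norm (f x))\<^sup>2 \<partial>lebesgue)"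
 by (simp add: inner_cl power2_norm_eq_inner)
lemma norm_cl: "f \<in> L2 ==> norm (cl f) = sqrt (\<integral>x. (norm (f x))\<^sup>2 \<partial>lebesgue)"
 using norm_cl_sq[of f] by (metis norm_ge_zero real_sqrt_unique)
lemma L2norm_cl: "f \<in> L2 ==> L2norm f = ennreal (norm (cl f))"
 by (simp add: norm_cl L2norm_eq)

lemma norm_cl_le:
 assumes f: "f \<in> L2" and g: "g \<in> borel_measurable lebesgue" and K: "K >= 0"
  and le: "AE x in lebesgue. norm (g x) <= K * norm (f x)"
 shows "g \<in> L2" "norm (cl g) <= K * norm (cl f)"
proof -
 show g2: "g \<in> L2" using L2_dominated[OF f g le] .
 have "(norm (cl g))\<^sup>2 <= K\<^sup>2 * (norm (cl f))\<^sup>2"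
  unfolding norm_cl_sq[OF f] norm_cl_sq[OF g2] integral_mult_right_zero[symmetric]
 proof (intro integral_mono_AE)
  show "integrable lebesgue (%x. (norm (g x))\<^sup>2)" "integrable lebesgue (%x. K\<^sup>2 * (norm (f x))\<^sup>2)"
   using f g2 by (simp_all add: L2_integrable)
  show "AE x in lebesgue. (norm (g x))\<^sup>2 <= K\<^sup>2 * (norm (f x))\<^sup>2"
   using le by eventually_elim (simp add: power_mult_distrib[symmetric] power_mono)
 qed
 then have "(norm (cl g))\<^sup>2 <= (K * norm (cl f))\<^sup>2" by (simp add: power_mult_distrib)
 then show "norm (cl g) <= K * norm (cl f)"
  by (rule power2_le_imp_le) (use K in auto)
qed

lemma norm_cl_scale_bound:
 fixes a :: "R3 => real"
 assumes "f \<in> L2" "a \<in> borel_measurable lebesgue" "K >= 0" "AE x in lebesgue. \<bar>a x\<bar> <= K"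
 shows "(%x. a x *\<^sub>R f x) \<in> L2" "norm (cl (%x. a x *\<^sub>R f x)) <= K * norm (cl f)"
proof -
 have 1: "(%x. a x *\<^sub>R f x) \<in> borel_measurable lebesgue" using assms by measurable
 have 2: "AE x in lebesgue. norm (a x *\<^sub>R f x) <= K * norm (f x)"
  using assms(4) by eventually_elim (simp add: mult_right_mono)
 show "(%x. a x *\<^sub>R f x) \<in> L2" "norm (cl (%x. a x *\<^sub>R f x)) <= K * norm (cl f)"
  using norm_cl_le[OF assms(1) 1 assms(3) 2] by auto
qed

section \<open>Smooth functions and test functions\<close>

lemma partial_eq: "(\<phi> has_derivative \<phi>') (at x) ==> partial i \<phi> x = \<phi>' (axis i 1)"
 unfolding partial_def using frechet_derivative_at by metis

lemma has_derivative_grad: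
 assumes "\<phi> differentiable (at x)"
 shows "(\<phi> has_derivative (%h. grad \<phi> x \<bullet> h)) (at x)"
proof -
 let ?D = "frechet_derivative \<phi> (at x)"
 have D: "(\<phi> has_derivative ?D) (at x)" using assms frechet_derivative_works by blast
 then have lin: "linear ?D" by (rule has_derivative_linear)
 have "?D h = grad \<phi> x \<bullet> h" for h
 proof -
  have "h = (\<Sum>i\<in>UNIV. h $ i *\<^sub>R axis i 1)"
   by (simp add: vec_eq_iff axis_def if_distrib cong: if_cong)
  then have "?D h = ?D (\<Sum>i\<in>UNIV. h $ i *\<^sub>R axis i 1)" by simp
  also have "\<dots> = (\<Sum>i\<in>UNIV. h $ i * ?D (axis i 1))"
   by (simp add: linear_sum[OF lin] linear_cmul[OF lin])
  also have "\<dots> = grad \<phi> x \<bullet> h"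
   by (simp add: grad_def partial_def inner_vec_def mult.commute)
  finally show ?thesis .
 qed
 then have "?D = (%h. grad \<phi> x \<bullet> h)" by (simp add: fun_eq_iff)
 then show ?thesis using D by simp
qed

definition smooth :: "(R3 => real) => bool" where
 "smooth \<phi> \<longleftrightarrow> (\<forall>k. Ck k \<phi>)"

lemma differentiable_UNIV_at: "\<phi> differentiable_on UNIV \<longleftrightarrow> (\<forall>x. \<phi> differentiable (at x))"
 by (simp add: differentiable_on_def)

lemma Ck_Suc_imp: "Ck (Suc k) \<phi> ==> Ck k \<phi>"
 by (induction k arbitrary: \<phi>) (auto simp: differentiable_imp_continuous_on)

lemma smooth_iff: "smooth \<phi> \<longleftrightarrow> \<phi> differentiable_on UNIV \<and> (\<forall>i. smooth (partial i \<phi>))"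
 (is "_ \<longleftrightarrow> ?R")
proof
 assume "smooth \<phi>"
 then show ?R unfolding smooth_def by (metis Ck.simps(2))
next
 assume ?R
 then have "Ck (Suc k) \<phi>" for k by (simp add: smooth_def)
 then show "smooth \<phi>" unfolding smooth_def using Ck_Suc_imp by blast
qed

lemma smooth_coinduct:
 assumes "\<phi> \<in> S" and "!!\<psi>. \<psi> \<in> S ==> \<psi> differentiable_on UNIV \<and> (\<forall>i. partial i \<psi> \<in> S)"
 shows "smooth \<phi>"
proof -
 have "\<forall>\<psi>\<in>S. Ck k \<psi>" for k
  by (induction k) (auto dest: assms(2) simp: differentiable_imp_continuous_on)
 then show ?thesis using assms(1) by (simp add: smooth_def)
qed

lemma smooth_differentiable: "smooth \<phi> ==> \<phi> differentiable (at x)"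
 using smooth_iff differentiable_UNIV_at by blast

lemma smooth_partial: "smooth \<phi> ==> smooth (partial i \<phi>)"
 using smooth_iff by blast

lemma smooth_has_derivative: "smooth \<phi> ==> (\<phi> has_derivative (%h. grad \<phi> x \<bullet> h)) (at x)"
 using has_derivative_grad smooth_differentiable by blast

lemma smooth_continuous: "smooth \<phi> ==> continuous_on UNIV \<phi>"
 using smooth_iff differentiable_imp_continuous_on by blast

lemma continuous_measurable_lebesgue:
 fixes \<phi> :: "R3 => 'b::euclidean_space"
 shows "continuous_on UNIV \<phi> ==> \<phi> \<in> borel_measurable lebesgue"
 by (rule measurable_completion) (simp add: borel_measurable_continuous_onI)

lemma smooth_measurable: "smooth \<phi> ==> \<phi> \<in> borel_measurable lebesgue"
 by (rule continuous_measurable_lebesgue[OF smooth_continuous])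

lemma partial_add:
 "\<phi> differentiable (at x) ==> \<psi> differentiable (at x) ==>
  partial i (%y. \<phi> y + \<psi> y) x = partial i \<phi> x + partial i \<psi> x"
 by (subst partial_eq[OF has_derivative_add[OF has_derivative_grad has_derivative_grad]])
   (simp_all add: grad_def inner_axis)

lemma partial_mult:
 assumes "\<phi> differentiable (at x)" "\<psi> differentiable (at x)"
 shows "partial i (%y. \<phi> y * \<psi> y) x = partial i \<phi> x * \<psi> x + \<phi> x * partial i \<psi> x"
 by (subst partial_eq[OF has_derivative_mult[OF has_derivative_grad has_derivative_grad]])
   (simp_all add: grad_def inner_axis assms)

lemma partial_const: "partial i (%y. c) x = 0"
 by (subst partial_eq[OF has_derivative_const]) simp

lemma smooth_const: "smooth (%x. c)"
proof (rule smooth_coinduct[where S="range (%c x. c)"])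
 fix \<psi> :: "R3 => real" assume "\<psi> \<in> range (%c x. c)"
 then show "\<psi> differentiable_on UNIV \<and> (\<forall>i. partial i \<psi> \<in> range (%c x. c))"
  by (auto simp: fun_eq_iff partial_const differentiable_on_def intro!: image_eqI[of _ _ 0])
qed auto

lemma Ck_add: "Ck k \<phi> ==> Ck k \<psi> ==> Ck k (%x. \<phi> x + \<psi> x)"
proof (induction k arbitrary: \<phi> \<psi>)
 case (Suc k)
 have "partial i (%x. \<phi> x + \<psi> x) = (%x. partial i \<phi> x + partial i \<psi> x)" for i
  using Suc.prems by (auto simp: fun_eq_iff partial_add differentiable_UNIV_at)
 with Suc show ?case by (auto simp: differentiable_on_def)
qed (auto intro: continuous_on_add)

lemma Ck_mult: "Ck k \<phi> ==> Ck k \<psi> ==> Ck k (%x. \<phi> x * \<psi> x)"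
proof (induction k arbitrary: \<phi> \<psi>)
 case (Suc k)
 have "partial i (%x. \<phi> x * \<psi> x) = (%x. partial i \<phi> x * \<psi> x + \<phi> x * partial i \<psi> x)" for i
  using Suc.prems by (auto simp: fun_eq_iff partial_mult differentiable_UNIV_at)
 with Suc Ck_Suc_imp[OF Suc.prems(1)] Ck_Suc_imp[OF Suc.prems(2)]
 show ?case by (auto simp: differentiable_on_def intro!: Ck_add)
qed (auto intro: continuous_on_mult)

lemma smooth_add: "smooth \<phi> ==> smooth \<psi> ==> smooth (%x. \<phi> x + \<psi> x)"
 by (simp add: smooth_def Ck_add)
lemma smooth_mult: "smooth \<phi> ==> smooth \<psi> ==> smooth (%x. \<phi> x * \<psi> x)"
 by (simp add: smooth_def Ck_mult)
lemma smooth_cmult: "smooth \<phi> ==> smooth (%x. c * \<phi> x)"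
 by (simp add: smooth_mult smooth_const)
lemma smooth_uminus: "smooth \<phi> ==> smooth (%x. - \<phi> x)"
 using smooth_cmult[of \<phi> "-1"] by simp
lemma smooth_diff: "smooth \<phi> ==> smooth \<psi> ==> smooth (%x. \<phi> x - \<psi> x)"
 using smooth_add[of \<phi> "%x. - \<psi> x"] smooth_uminus by simp

lemma partial_cmult: "\<phi> differentiable (at x) ==> partial i (%y. c * \<phi> y) x = c * partial i \<phi> x"
 by (subst partial_mult) (auto simp: partial_const)
lemma partial_uminus: "\<phi> differentiable (at x) ==> partial i (%y. - \<phi> y) x = - partial i \<phi> x"
 using partial_cmult[of \<phi> x i "-1"] by simp
lemma partial_diff:
 "\<phi> differentiable (at x) ==> \<psi> differentiable (at x) ==>
  partial i (%y. \<phi> y - \<psi> y) x = partial i \<phi> x - partial i \<psi> x"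
 using partial_add[of \<phi> x "%y. - \<psi> y"] partial_uminus[of \<psi>] by (simp add: differentiable_minus)

lemma has_derivative_affine:
 assumes "(\<kappa> has_derivative (%h. g \<bullet> h)) (at (b + a *\<^sub>R x))"
 shows "((%x. \<kappa> (b + a *\<^sub>R x)) has_derivative (%h. (a *\<^sub>R g) \<bullet> h)) (at x)"
proof -
 have "((%x. b + a *\<^sub>R x) has_derivative (%h. a *\<^sub>R h)) (at x)"
  by (auto intro!: derivative_eq_intros)
 from has_derivative_compose[OF this assms] show ?thesis by (simp add: algebra_simps)
qed

lemma partial_affine:
 assumes "smooth \<kappa>"
 shows "partial i (%x. \<kappa> (b + a *\<^sub>R x)) x = a * partial i \<kappa> (b + a *\<^sub>R x)"
 by (subst partial_eq[OF has_derivative_affine[OF smooth_has_derivative[OF assms]]])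
   (simp add: grad_def inner_axis)

lemma smooth_affine:
 assumes "smooth \<kappa>" shows "smooth (%x. \<kappa> (b + a *\<^sub>R x))"
proof -
 let ?S = "{%x. c * \<kappa> (b + a *\<^sub>R x) | c \<kappa>. smooth \<kappa>}"
 show ?thesis
 proof (rule smooth_coinduct[where S="?S"])
  show "(%x. \<kappa> (b + a *\<^sub>R x)) \<in> ?S"
   using assms by (intro CollectI exI[of _ 1] exI[of _ \<kappa>]) auto
  fix \<psi> assume "\<psi> \<in> ?S"
  then obtain c \<kappa> where \<psi>: "\<psi> = (%x. c * \<kappa> (b + a *\<^sub>R x))" and k: "smooth \<kappa>" by auto
  have d: "(%x. \<kappa> (b + a *\<^sub>R x)) differentiable (at x)" for x
   using has_derivative_affine[OF smooth_has_derivative[OF k]] differentiable_def by blast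
  have "partial i \<psi> = (%x. (c * a) * partial i \<kappa> (b + a *\<^sub>R x))" for i
   by (simp add: \<psi> fun_eq_iff partial_cmult[OF d] partial_affine[OF k])
  then show "\<psi> differentiable_on UNIV \<and> (\<forall>i. partial i \<psi> \<in> ?S)"
   using smooth_partial[OF k] d unfolding \<psi>
   by (auto simp: differentiable_on_def intro!: derivative_intros exI)
 qed
qed

subsection \<open>Equality of mixed partial derivatives\<close>

lemma DERIV_along_axis:
 assumes "smooth \<phi>"
 shows "((%s. \<phi> (x + s *\<^sub>R axis i 1)) has_real_derivative partial i \<phi> (x + s *\<^sub>R axis i 1)) (at s)"
proof -
 have "((%s. x + s *\<^sub>R axis i 1) has_derivative (%h. h *\<^sub>R axis i 1)) (at s)"
  by (auto intro!: derivative_eq_intros)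
 from has_derivative_compose[OF this smooth_has_derivative[OF assms]] show ?thesis
  by (simp add: has_field_derivative_def grad_def inner_axis mult.commute[of _ "partial i \<phi> _"])
qed

text \<open>A second difference quotient is, by two applications of the mean value theorem, a mixed
 second derivative at some nearby point, in either order of differentiation.\<close>

lemma second_difference:
 assumes "smooth \<phi>" "h > 0"
 obtains s r where "0 < s" "s < h" "0 < r" "r < h"
  "\<phi> (x + h *\<^sub>R axis i 1 + h *\<^sub>R axis j 1) - \<phi> (x + h *\<^sub>R axis i 1) - \<phi> (x + h *\<^sub>R axis j 1) + \<phi> x
   = h * h * partial j (partial i \<phi>) (x + s *\<^sub>R axis i 1 + r *\<^sub>R axis j 1)"
proof -
 let ?g = "%s. \<phi> (x + h *\<^sub>R axis j 1 + s *\<^sub>R axis i 1) - \<phi> (x + s *\<^sub>R axis i 1)"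
 have "\<exists>s. 0 < s \<and> s < h \<and> ?g h - ?g 0 = (h - 0) * (partial i \<phi> (x + h *\<^sub>R axis j 1 + s *\<^sub>R axis i 1)
   - partial i \<phi> (x + s *\<^sub>R axis i 1))"
  by (rule MVT2[OF assms(2)]) (intro derivative_intros DERIV_along_axis assms)
 then obtain s where s: "0 < s" "s < h" "?g h - ?g 0 = h * (partial i \<phi> (x + h *\<^sub>R axis j 1 + s *\<^sub>R axis i 1)
   - partial i \<phi> (x + s *\<^sub>R axis i 1))" by auto
 let ?k = "%r. partial i \<phi> (x + s *\<^sub>R axis i 1 + r *\<^sub>R axis j 1)"
 have "\<exists>r. 0 < r \<and> r < h \<and> ?k h - ?k 0 = (h - 0) * partial j (partial i \<phi>) (x + s *\<^sub>R axis i 1 + r *\<^sub>R axis j 1)"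
  by (rule MVT2[OF assms(2)]) (intro DERIV_along_axis smooth_partial assms)
 then obtain r where r: "0 < r" "r < h"
  "?k h - ?k 0 = h * partial j (partial i \<phi>) (x + s *\<^sub>R axis i 1 + r *\<^sub>R axis j 1)" by auto
 show ?thesis
 proof (rule that[OF s(1,2) r(1,2)])
  have "\<phi> (x + h *\<^sub>R axis i 1 + h *\<^sub>R axis j 1) - \<phi> (x + h *\<^sub>R axis i 1) - \<phi> (x + h *\<^sub>R axis j 1) + \<phi> x = ?g h - ?g 0"
   by (simp add: add.assoc add.commute[of "h *\<^sub>R axis i 1"])
  also have "\<dots> = h * (?k h - ?k 0)"
   unfolding s(3) by (simp add: add.assoc add.commute[of "h *\<^sub>R axis j 1"])
  finally show "\<phi> (x + h *\<^sub>R axis i 1 + h *\<^sub>R axis j 1) - \<phi> (x + h *\<^sub>R axis i 1) - \<phi> (x + h *\<^sub>R axis j 1) + \<phi> x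
   = h * h * partial j (partial i \<phi>) (x + s *\<^sub>R axis i 1 + r *\<^sub>R axis j 1)" unfolding r(3) by simp
 qed
qed

lemma partial_commute:
 assumes sm: "smooth \<phi>" shows "partial i (partial j \<phi>) = partial j (partial i \<phi>)"
proof
 fix x
 let ?A = "partial i (partial j \<phi>)" and ?B = "partial j (partial i \<phi>)"
 have cA: "isCont ?A x" and cB: "isCont ?B x"
  using smooth_continuous[OF smooth_partial[OF smooth_partial[OF sm]]]
  by (auto simp: continuous_on_eq_continuous_at)
 show "?A x = ?B x"
 proof (rule ccontr)
  assume ne: "?A x ~= ?B x"
  define e where "e = \<bar>?A x - ?B x\<bar> / 2"
  have "e > 0" using ne by (simp add: e_def)
  obtain d1 where d1: "d1 > 0" "!!y. dist y x < d1 ==> dist (?A y) (?A x) < e"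
   using cA \<open>e > 0\<close> unfolding continuous_at_eps_delta by blast
  obtain d2 where d2: "d2 > 0" "!!y. dist y x < d2 ==> dist (?B y) (?B x) < e"
   using cB \<open>e > 0\<close> unfolding continuous_at_eps_delta by blast
  define h where "h = min d1 d2 / 3"
  have h: "h > 0" "2 * h < d1" "2 * h < d2" using d1 d2 by (auto simp: h_def)
  have near: "dist (x + s *\<^sub>R axis k 1 + r *\<^sub>R axis l 1) x < 2 * h"
   if "0 < s" "s < h" "0 < r" "r < h" for s r and k l :: 3
  proof -
   have "norm (s *\<^sub>R axis k (1::real) + r *\<^sub>R axis l 1) <= s + r"
    using that by (intro norm_triangle_le) (simp add: norm_axis_1)
   then show ?thesis using that by (simp add: dist_norm add.assoc)
  qed
  obtain s r where 1: "0 < s" "s < h" "0 < r" "r < h"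
   "\<phi> (x + h *\<^sub>R axis i 1 + h *\<^sub>R axis j 1) - \<phi> (x + h *\<^sub>R axis i 1) - \<phi> (x + h *\<^sub>R axis j 1) + \<phi> x
   = h * h * ?B (x + s *\<^sub>R axis i 1 + r *\<^sub>R axis j 1)"
   using second_difference[OF sm h(1)] by metis
  obtain s' r' where 2: "0 < s'" "s' < h" "0 < r'" "r' < h"
   "\<phi> (x + h *\<^sub>R axis j 1 + h *\<^sub>R axis i 1) - \<phi> (x + h *\<^sub>R axis j 1) - \<phi> (x + h *\<^sub>R axis i 1) + \<phi> x
   = h * h * ?A (x + s' *\<^sub>R axis j 1 + r' *\<^sub>R axis i 1)"
   using second_difference[OF sm h(1)] by metis
  have "h * h * ?B (x + s *\<^sub>R axis i 1 + r *\<^sub>R axis j 1) = h * h * ?A (x + s' *\<^sub>R axis j 1 + r' *\<^sub>R axis i 1)"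
   unfolding 1(5)[symmetric] 2(5)[symmetric] by (simp add: algebra_simps)
  then have eq: "?B (x + s *\<^sub>R axis i 1 + r *\<^sub>R axis j 1) = ?A (x + s' *\<^sub>R axis j 1 + r' *\<^sub>R axis i 1)"
   using h(1) by simp
  have "dist (?A (x + s' *\<^sub>R axis j 1 + r' *\<^sub>R axis i 1)) (?A x) < e"
   by (rule d1(2)) (use near[OF 2(1-4), of j i] h in linarith)
  moreover have "dist (?B (x + s *\<^sub>R axis i 1 + r *\<^sub>R axis j 1)) (?B x) < e"
   by (rule d2(2)) (use near[OF 1(1-4), of i j] h in linarith)
  ultimately have "dist (?A x) (?B x) < 2 * e"
   unfolding eq by (simp add: dist_real_def abs_if split: if_splits)
  then show False by (simp add: e_def dist_real_def)
 qed
qed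

subsection \<open>One-dimensional bumps\<close>

text \<open>The analogue of \<open>Ck\<close> on the line, with the derivative quantified existentially.\<close>

primrec D1 :: "nat => (real => real) => bool" where
 "D1 0 f \<longleftrightarrow> continuous_on UNIV f"
| "D1 (Suc k) f \<longleftrightarrow> (\<exists>f'. (\<forall>t. (f has_real_derivative f' t) (at t)) \<and> D1 k f')"

lemma D1_Suc_imp: "D1 (Suc k) f ==> D1 k f"
proof (induction k arbitrary: f)
 case 0
 then obtain f' where "!!t. (f has_real_derivative f' t) (at t)" by auto
 then have "isCont f t" for t using DERIV_isCont by blast
 then show ?case by (simp add: continuous_on_eq_continuous_at)
next
 case (Suc k)
 then show ?case by (metis D1.simps(2))
qed

lemma D1_add: "D1 k f ==> D1 k g ==> D1 k (%t. f t + g t)"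
proof (induction k arbitrary: f g)
 case (Suc k)
 then obtain f' g' where "\<forall>t. (f has_real_derivative f' t) (at t)" "D1 k f'"
  "\<forall>t. (g has_real_derivative g' t) (at t)" "D1 k g'" by auto
 with Suc.IH show ?case by (auto intro!: exI[of _ "%t. f' t + g' t"] derivative_intros)
qed (auto intro: continuous_on_add)

lemma D1_mult: "D1 k f ==> D1 k g ==> D1 k (%t. f t * g t)"
proof (induction k arbitrary: f g)
 case (Suc k)
 then obtain f' g' where *: "\<forall>t. (f has_real_derivative f' t) (at t)" "D1 k f'"
  "\<forall>t. (g has_real_derivative g' t) (at t)" "D1 k g'" by auto
 have "\<forall>t. ((%t. f t * g t) has_real_derivative f' t * g t + f t * g' t) (at t)"
  using * by (auto intro!: derivative_eq_intros)
 moreover have "D1 k (%t. f' t * g t + f t * g' t)"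
  using * Suc D1_Suc_imp by (intro D1_add) blast+
 ultimately show ?case by auto
qed (auto intro: continuous_on_mult)

lemma D1_const: "D1 k (%t. c)"
proof (induction k arbitrary: c)
 case (Suc k)
 then show ?case by (auto intro!: exI[of _ "%t. 0"] derivative_eq_intros)
qed auto

lemma D1_inverse: "D1 k f ==> (!!t. f t ~= 0) ==> D1 k (%t. inverse (f t))"
proof (induction k arbitrary: f)
 case (Suc k)
 then obtain f' where *: "\<forall>t. (f has_real_derivative f' t) (at t)" "D1 k f'" by auto
 have inv: "D1 k (%t. inverse (f t))" using Suc D1_Suc_imp by blast
 have "\<forall>t. ((%t. inverse (f t)) has_real_derivative (- 1) * (inverse (f t) * (f' t * inverse (f t)))) (at t)"
  using * Suc.prems(2) by (auto intro!: derivative_eq_intros)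
 moreover have "D1 k (%t. (- 1) * (inverse (f t) * (f' t * inverse (f t))))"
  using inv *(2) by (intro D1_mult D1_const)
 ultimately show ?case by (auto simp del: mult_minus1)
qed (auto intro: continuous_on_inverse)

lemma D1_affine: "D1 k f ==> D1 k (%t. f (a * t + b))"
proof (induction k arbitrary: f)
 case 0
 then show ?case by (auto intro!: continuous_on_compose2[of UNIV f] continuous_intros)
next
 case (Suc k)
 then obtain f' where *: "\<forall>t. (f has_real_derivative f' t) (at t)" "D1 k f'" by auto
 have "\<forall>t. ((%t. f (a * t + b)) has_real_derivative f' (a * t + b) * a) (at t)"
 proof
  fix t
  have "((%t. a * t + b) has_real_derivative a) (at t)" by (auto intro!: derivative_eq_intros)
  from DERIV_chain2[OF spec[OF *(1)] this] show "((%t. f (a * t + b)) has_real_derivative f' (a * t + b) * a) (at t)" .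
 qed
 moreover have "D1 k (%t. f' (a * t + b) * a)" using Suc.IH[OF *(2)] by (intro D1_mult D1_const)
 ultimately show ?case by auto
qed

text \<open>The powers make the family closed under differentiation.\<close>

definition expinv :: "nat => real => real" where
 "expinv n t = (if t <= 0 then 0 else exp (- (1/t)) / t ^ n)"

lemma power_div_fact_le_exp: "(u::real) >= 0 ==> u ^ n / fact n <= exp u"
 using sum_le_suminf[OF summable_exp_generic[of u], of "{n}"]
 by (simp add: exp_def divide_inverse mult.commute)

lemma expinv_bound: "\<bar>expinv n t\<bar> <= fact (n + 2) * t\<^sup>2"
proof (cases "t <= 0")
 case False
 then have t: "t > 0" by simp
 define N F where "N = n + 2" and "F = (fact (n + 2) :: real)"
 have F: "F > 0" by (simp add: F_def)
 have "(1/t) ^ N / F <= exp (1/t)"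
  using t power_div_fact_le_exp[of "1/t" N] by (simp add: N_def F_def)
 then have "exp (- (1/t)) <= F * t ^ N"
  using t F by (simp add: exp_minus power_one_over field_simps)
 then have "exp (- (1/t)) <= fact (n + 2) * t ^ (n + 2)"
  unfolding N_def F_def .
 then have "exp (- (1/t)) / t ^ n <= fact (n + 2) * t ^ (n + 2) / t ^ n"
  using t by (intro divide_right_mono) auto
 also have "\<dots> = fact (n + 2) * t\<^sup>2" using t by (simp add: power_add power2_eq_square)
 finally show ?thesis using t by (simp add: expinv_def)
qed (simp add: expinv_def)

lemma quotient_algebra:
 fixes t p X r :: real
 assumes "t ~= 0" "p ~= 0"
 shows "(X * (1 / (t * t)) * (t * p) - X * ((1 + r) * p)) / (t * p * (t * p))
  = X / (t * (t * (t * p))) - (1 + r) * (X / (t * (t * p)))"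
 using assms by (simp add: field_simps)

lemma expinv_deriv: "(expinv n has_real_derivative expinv (n + 2) t - real n * expinv (n + 1) t) (at t)"
proof -
 consider "t > 0" | "t < 0" | "t = 0" by linarith
 then show ?thesis
 proof cases
  assume t: "t > 0"
  have "((%t. exp (- (1/t)) / t ^ n) has_real_derivative expinv (n + 2) t - real n * expinv (n + 1) t) (at t)"
  proof (cases n)
   case 0
   then show ?thesis using t
    by (auto intro!: derivative_eq_intros simp: expinv_def field_simps power2_eq_square)
  next
   case (Suc m)
   have e: "((%t. exp (- (1/t))) has_real_derivative exp (- (1/t)) * (1 / (t * t))) (at t)"
    using t by (auto intro!: derivative_eq_intros simp: power2_eq_square)
   have p: "((%t. t ^ Suc m) has_real_derivative (1 + real m) * t ^ m) (at t)"
    using DERIV_pow[of "Suc m" t] by simp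
   have "t ^ Suc m ~= 0" using t by simp
   from DERIV_divide[OF e p this]
   have d: "((%t. exp (- (1/t)) / t ^ Suc m) has_real_derivative
     (exp (- (1/t)) * (1 / (t * t)) * (t * t ^ m) - exp (- (1/t)) * ((1 + real m) * t ^ m))
     / (t * t ^ m * (t * t ^ m))) (at t)" by (simp only: power_Suc)
   have e1: "expinv (Suc m + 2) t = exp (- (1/t)) / (t * (t * (t * t ^ m)))"
    and e2: "expinv (Suc m + 1) t = exp (- (1/t)) / (t * (t * t ^ m))"
    using t by (simp_all add: expinv_def)
   have "t ~= 0" "t ^ m ~= 0" using t by simp_all
   note e3 = quotient_algebra[OF this, of "exp (- (1/t))" "real m"]
   have e4: "real (Suc m) = 1 + real m" by simp
   show ?thesis unfolding Suc e1 e2 e4 using d unfolding e3 .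
  qed
  note d = this
  have "eventually (%s. s \<in> {0<..}) (nhds t)" using t by (intro eventually_nhds_in_open) auto
  then have ev: "eventually (%s. exp (- (1/s)) / s ^ n = expinv n s) (nhds t)"
   by eventually_elim (auto simp: expinv_def)
  show ?thesis by (rule DERIV_cong_ev[OF refl ev refl, THEN iffD1, OF d])
 next
  assume t: "t < 0"
  have "eventually (%s. s \<in> {..<0}) (nhds t)" using t by (intro eventually_nhds_in_open) auto
  then have ev: "eventually (%s. 0 = expinv n s) (nhds t)"
   by eventually_elim (auto simp: expinv_def)
  have d: "((%s. 0) has_real_derivative expinv (n + 2) t - real n * expinv (n + 1) t) (at t)"
   using t by (auto simp: expinv_def)
  show ?thesis by (rule DERIV_cong_ev[OF refl ev refl, THEN iffD1, OF d])
 next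
  assume t: "t = 0"
  have "((%h. (expinv n (0 + h) - expinv n 0) / h) \<longlongrightarrow> 0) (at 0)"
  proof (rule Lim_null_comparison)
   show "\<forall>\<^sub>F h in at 0. norm ((expinv n (0 + h) - expinv n 0) / h) <= fact (n + 2) * \<bar>h\<bar>"
   proof (rule eventually_at_topological[THEN iffD2], intro exI[of _ UNIV] conjI ballI impI open_UNIV UNIV_I)
    fix h :: real assume "h ~= 0"
    then show "norm ((expinv n (0 + h) - expinv n 0) / h) <= fact (n + 2) * \<bar>h\<bar>"
     using divide_right_mono[OF expinv_bound[of n h], of "\<bar>h\<bar>"]
     by (simp add: expinv_def[of n 0] power2_eq_square abs_mult_self_eq[symmetric, of h] del: abs_mult_self_eq fact_Suc)
   qed
   have "((%h. fact (n + 2) * \<bar>h\<bar>) \<longlongrightarrow> fact (n + 2) * \<bar>0::real\<bar>) (at 0)"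
    by (intro tendsto_intros)
   then show "((%h. fact (n + 2) * \<bar>h\<bar>) \<longlongrightarrow> 0) (at (0::real))" by simp
  qed
  then show ?thesis using t by (simp add: DERIV_def expinv_def)
 qed
qed

lemma D1_expinv: "D1 k (expinv n)"
proof (induction k arbitrary: n)
 case 0
 have "isCont (expinv n) t" for t using DERIV_isCont[OF expinv_deriv] .
 then show ?case by (simp add: continuous_on_eq_continuous_at)
next
 case (Suc k)
 have "D1 k (%t. expinv (n + 2) t + (- real n) * expinv (n + 1) t)"
  by (intro D1_add D1_mult D1_const Suc)
 then have "D1 k (%t. expinv (n + 2) t - real n * expinv (n + 1) t)" by simp
 then show ?case unfolding D1.simps by (intro exI conjI allI) (rule expinv_deriv)
qed

text \<open>A smooth function that is 0 left of \<open>-1\<close> and 1 right of \<open>1\<close>, and its derivative.\<close>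

definition step :: "real => real" where
 "step t = expinv 0 (1 + t) * inverse (expinv 0 (1 + t) + expinv 0 (1 - t))"

definition step' :: "real => real" where
 "step' t = (expinv 2 (1 + t) * expinv 0 (1 - t) + expinv 0 (1 + t) * expinv 2 (1 - t))
   * (inverse (expinv 0 (1 + t) + expinv 0 (1 - t)))\<^sup>2"

lemma expinv_nonneg: "expinv n t >= 0" by (simp add: expinv_def)
lemma expinv_pos: "t > 0 ==> expinv n t > 0" by (simp add: expinv_def)
lemma step_denom_pos: "expinv 0 (1 + t) + expinv 0 (1 - t) > 0"
proof (cases "t > 0")
 case True
 then show ?thesis by (intro add_pos_nonneg[OF expinv_pos expinv_nonneg]) simp
next
 case False
 then show ?thesis by (intro add_nonneg_pos[OF expinv_nonneg expinv_pos]) simp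
qed

lemma step_algebra:
 fixes A B A' B' :: real
 assumes "A + B ~= 0"
 shows "A' * 1 * inverse (A + B) + - (inverse (A + B) * (A' * 1 + B' * - 1) * inverse (A + B)) * A
  = (A' * B + A * B') * (inverse (A + B))\<^sup>2"
proof -
 have "inverse (A + B) * (A + B) = 1" using assms by simp
 then show ?thesis by algebra
qed

lemma step_deriv: "(step has_real_derivative step' t) (at t)"
proof -
 let ?D = "expinv 0 (1 + t) + expinv 0 (1 - t)"
 have e0: "(expinv 0 has_real_derivative expinv 2 s) (at s)" for s
  using expinv_deriv[of 0 s] by (simp add: numeral_2_eq_2)
 have a: "((%t. expinv 0 (1 + t)) has_real_derivative expinv 2 (1 + t) * 1) (at t)"
  by (rule DERIV_chain2[OF e0]) (auto intro!: derivative_eq_intros)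
 have b: "((%t. expinv 0 (1 - t)) has_real_derivative expinv 2 (1 - t) * (-1)) (at t)"
  by (rule DERIV_chain2[OF e0]) (auto intro!: derivative_eq_intros)
 have ne: "?D ~= 0" using step_denom_pos[of t] by simp
 show ?thesis unfolding step_def[abs_def] step'_def
  by (rule DERIV_cong[OF DERIV_mult[OF a DERIV_inverse'[OF DERIV_add[OF a b] ne]]])
    (rule step_algebra[OF ne])
qed

lemma D1_step: "D1 k step"
proof -
 have m: "D1 k (%t. expinv 0 (1 + t))" "D1 k (%t. expinv 0 (1 - t))"
  using D1_affine[OF D1_expinv, of k 0 1 1] D1_affine[OF D1_expinv, of k 0 "-1" 1]
  by (simp_all add: add.commute)
 have "expinv 0 (1 + t) + expinv 0 (1 - t) ~= 0" for t using step_denom_pos[of t] by simp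
 then show ?thesis unfolding step_def[abs_def] by (intro D1_mult D1_inverse D1_add m)
qed

lemma D1_step': "D1 k step'"
proof -
 obtain f' where "\<forall>t. (step has_real_derivative f' t) (at t)" "D1 k f'"
  using D1_step[of "Suc k"] by auto
 moreover from this have "f' = step'" using DERIV_unique[OF _ step_deriv] by blast
 ultimately show ?thesis by simp
qed

lemma step_left: "t <= -1 ==> step t = 0" by (simp add: step_def expinv_def)
lemma step_right: "t >= 1 ==> step t = 1" using step_denom_pos[of t] by (simp add: step_def expinv_def)
lemma step_bounds: "0 <= step t" "step t <= 1"
 using step_denom_pos[of t] expinv_nonneg[of 0 "1 + t"] expinv_nonneg[of 0 "1 - t"]
 by (simp_all add: step_def field_simps)
lemma step'_nonneg: "step' t >= 0" by (simp add: step'_def expinv_nonneg)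
lemma step'_outside: "\<bar>t\<bar> >= 1 ==> step' t = 0" by (auto simp: step'_def expinv_def abs_if split: if_splits)
lemma step'_0: "step' 0 > 0" using step_denom_pos[of 0] by (simp add: step'_def expinv_def)
lemma step'_continuous: "continuous_on UNIV step'" using D1_step'[of 0] by simp

lemma Ck_coord: "D1 (Suc k) f ==> Ck k (%x. f (x $ i))"
proof (induction k arbitrary: f)
 case 0
 then have "continuous_on UNIV f" using D1_Suc_imp[of 0 f] by simp
 then show ?case by (auto intro!: continuous_on_compose2[of UNIV f] continuous_intros)
next
 case (Suc k)
 then obtain f' where f: "\<forall>t. (f has_real_derivative f' t) (at t)" "D1 (Suc k) f'" by (metis D1.simps(2))
 have c: "((%x. x $ i) has_derivative (%h. h $ i)) (at x)" for x :: R3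
  by (rule bounded_linear_imp_has_derivative[OF bounded_linear_vec_nth])
 have d: "((%x. f (x $ i)) has_derivative (%h. f' (x $ i) * h $ i)) (at x)" for x :: R3
  using has_derivative_compose[OF c f(1)[rule_format, of "x $ i", unfolded has_field_derivative_def]] .
 have p: "partial j (%x. f (x $ i)) = (%x. (if i = j then 1 else 0) * f' (x $ i))" for j
  by (auto simp: fun_eq_iff partial_eq[OF d] axis_def)
 have "Ck k (%x. (if i = j then 1 else 0) * f' (x $ i))" for j
  using Suc.IH[OF f(2)] smooth_const[of "if i = j then 1 else 0"]
  by (intro Ck_mult) (auto simp: smooth_def)
 then show ?case using d p by (auto simp: differentiable_on_def differentiable_def)
qed

lemma smooth_coord: "(!!k. D1 k f) ==> smooth (%x. f (x $ i))"
 by (simp add: smooth_def Ck_coord)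

lemma partial_coord:
 assumes "(f has_real_derivative d) (at (x $ i))"
 shows "partial j (%x. f (x $ i)) x = (if i = j then d else 0)"
proof -
 have "((%x. f (x $ i)) has_derivative (%h. d * h $ i)) (at x)"
  using has_derivative_compose[OF bounded_linear_imp_has_derivative[OF bounded_linear_vec_nth]
   assms[unfolded has_field_derivative_def]] .
 from partial_eq[OF this] show ?thesis by (simp add: axis_def)
qed

lemma lebesgue_affine_R3:
 fixes b :: R3 assumes "a ~= 0"
 shows "lebesgue = density (distr lebesgue lebesgue (%x. b + a *\<^sub>R x)) (%_. ennreal (\<bar>a\<bar> ^ 3))"
  and "(%x. b + a *\<^sub>R x) \<in> lebesgue \<rightarrow>\<^sub>M lebesgue"
proof -
 have T: "b + (\<Sum>j\<in>Basis. (a * (x \<bullet> j)) *\<^sub>R j) = b + a *\<^sub>R x" for x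
 proof -
  have "(\<Sum>j\<in>Basis. (a * (x \<bullet> j)) *\<^sub>R j) = a *\<^sub>R (\<Sum>j\<in>Basis. (x \<bullet> j) *\<^sub>R j)"
   by (simp add: scaleR_sum_right)
  then show ?thesis by (simp only: euclidean_representation)
 qed
 have P: "(\<Prod>j\<in>(Basis::R3 set). \<bar>a\<bar>) = \<bar>a\<bar> ^ 3" by simp
 show "lebesgue = density (distr lebesgue lebesgue (%x. b + a *\<^sub>R x)) (%_. ennreal (\<bar>a\<bar> ^ 3))"
  by (rule lebesgue_affine_euclidean[of "%_. a" b, unfolded T P, OF assms])
 show "(%x. b + a *\<^sub>R x) \<in> lebesgue \<rightarrow>\<^sub>M lebesgue"
  by (rule lebesgue_affine_measurable[of "%_. a" b, unfolded T, OF assms])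
qed

lemma measurable_affine:
 "f \<in> borel_measurable lebesgue ==> a ~= 0 ==> (%x. f (b + a *\<^sub>R x :: R3)) \<in> borel_measurable lebesgue"
 by (rule measurable_compose[OF lebesgue_affine_R3(2)])

lemma integral_affine:
 fixes f :: "R3 => 'b::{banach, second_countable_topology}"
 assumes f: "f \<in> borel_measurable lebesgue" and a: "a ~= 0"
 shows "(\<integral>x. f x \<partial>lebesgue) = \<bar>a\<bar> ^ 3 *\<^sub>R (\<integral>x. f (b + a *\<^sub>R x) \<partial>lebesgue)"
proof -
 have "(\<integral>x. f x \<partial>lebesgue) = (\<integral>x. f x \<partial>density (distr lebesgue lebesgue (%x. b + a *\<^sub>R x)) (%_. ennreal (\<bar>a\<bar> ^ 3)))"
  by (rule arg_cong[OF lebesgue_affine_R3(1)[OF a, of b], of "%M. \<integral>x. f x \<partial>M"])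
 also have "\<dots> = (\<integral>x. \<bar>a\<bar> ^ 3 *\<^sub>R f x \<partial>distr lebesgue lebesgue (%x. b + a *\<^sub>R x))"
  using f by (subst integral_density) auto
 also have "\<dots> = (\<integral>x. \<bar>a\<bar> ^ 3 *\<^sub>R f (b + a *\<^sub>R x) \<partial>lebesgue)"
  using f by (subst integral_distr[OF lebesgue_affine_R3(2)[OF a]]) auto
 finally show ?thesis by simp
qed

lemma nn_integral_affine:
 assumes f: "f \<in> borel_measurable lebesgue" and a: "a ~= 0"
 shows "(\<integral>\<^sup>+x. f x \<partial>lebesgue) = ennreal (\<bar>a\<bar> ^ 3) * (\<integral>\<^sup>+x. f (b + a *\<^sub>R x :: R3) \<partial>lebesgue)"
proof -
 have "(\<integral>\<^sup>+x. f x \<partial>lebesgue) = (\<integral>\<^sup>+x. f x \<partial>density (distr lebesgue lebesgue (%x. b + a *\<^sub>R x)) (%_. ennreal (\<bar>a\<bar> ^ 3)))"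
  by (rule arg_cong[OF lebesgue_affine_R3(1)[OF a, of b], of "%M. \<integral>\<^sup>+x. f x \<partial>M"])
 also have "\<dots> = (\<integral>\<^sup>+x. ennreal (\<bar>a\<bar> ^ 3) * f x \<partial>distr lebesgue lebesgue (%x. b + a *\<^sub>R x))"
  using f by (subst nn_integral_density) auto
 also have "\<dots> = (\<integral>\<^sup>+x. ennreal (\<bar>a\<bar> ^ 3) * f (b + a *\<^sub>R x) \<partial>lebesgue)"
  using f by (subst nn_integral_distr[OF lebesgue_affine_R3(2)[OF a]]) auto
 also have "\<dots> = ennreal (\<bar>a\<bar> ^ 3) * (\<integral>\<^sup>+x. f (b + a *\<^sub>R x) \<partial>lebesgue)"
  using measurable_affine[OF f a] by (subst nn_integral_cmult) auto
 finally show ?thesis .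
qed

lemma integrable_affine:
 fixes f :: "R3 => 'b::{banach, second_countable_topology}"
 assumes f: "integrable lebesgue f" and a: "a ~= 0"
 shows "integrable lebesgue (%x. f (b + a *\<^sub>R x))"
proof -
 have m: "f \<in> borel_measurable lebesgue" using f by simp
 have "ennreal (\<bar>a\<bar> ^ 3) * (\<integral>\<^sup>+x. ennreal (norm (f (b + a *\<^sub>R x))) \<partial>lebesgue) < \<infinity>"
  using f m nn_integral_affine[of "%x. ennreal (norm (f x))" a b] a
  by (auto simp: integrable_iff_bounded)
 moreover have "ennreal (\<bar>a\<bar> ^ 3) ~= 0" using a by simp
 ultimately have "(\<integral>\<^sup>+x. ennreal (norm (f (b + a *\<^sub>R x))) \<partial>lebesgue) < \<infinity>"
  by (auto simp: ennreal_mult_less_top)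
 then show ?thesis using measurable_affine[OF m a] by (simp add: integrable_iff_bounded)
qed

subsection \<open>Test functions\<close>

lemma test_iff: "\<phi> \<in> test_functions \<longleftrightarrow> smooth \<phi> \<and> (\<exists>R. \<forall>x. \<phi> x ~= 0 \<longrightarrow> norm x <= R)"
proof -
 have "compact (closure {x. \<phi> x ~= 0}) \<longleftrightarrow> (\<exists>R. \<forall>x. \<phi> x ~= 0 \<longrightarrow> norm x <= R)"
  by (auto simp: compact_closure bounded_iff)
 then show ?thesis by (auto simp: test_functions_def smooth_def)
qed

lemma test_smooth: "\<phi> \<in> test_functions ==> smooth \<phi>" by (simp add: test_iff)

lemma test_supportE:
 assumes "\<phi> \<in> test_functions" obtains R where "R > 0" "!!x. norm x > R ==> \<phi> x = 0"
proof -
 obtain R where "\<forall>x. \<phi> x ~= 0 \<longrightarrow> norm x <= R" using assms test_iff by blast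
 then show ?thesis using that[of "max R 1"] by force
qed

lemma partial_outside:
 assumes "!!x. norm x > R ==> \<phi> x = 0" "norm x > R" shows "partial i \<phi> x = 0"
proof -
 have "(\<phi> has_derivative (%h. 0)) (at x)"
 proof (rule has_derivative_transform_within_open[of "%x. 0" _ _ _ "{x. norm x > R}"])
  show "open {x::R3. norm x > R}" by (intro open_Collect_less continuous_intros)
 qed (use assms in auto)
 from partial_eq[OF this] show ?thesis by simp
qed

lemma test_partial: assumes "\<phi> \<in> test_functions" shows "partial i \<phi> \<in> test_functions"
proof -
 obtain R where R: "!!x. norm x > R ==> \<phi> x = 0" using test_supportE[OF assms] by blast
 then have "\<forall>x. partial i \<phi> x ~= 0 \<longrightarrow> norm x <= R" using partial_outside[of R \<phi>] not_le by blast
 then show ?thesis using assms smooth_partial unfolding test_iff by blast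
qed

lemma test_add: assumes "\<phi> \<in> test_functions" "\<psi> \<in> test_functions" shows "(%x. \<phi> x + \<psi> x) \<in> test_functions"
proof -
 obtain R where R: "!!x. norm x > R ==> \<phi> x = 0" using test_supportE[OF assms(1)] by blast
 obtain S where S: "!!x. norm x > S ==> \<psi> x = 0" using test_supportE[OF assms(2)] by blast
 have "\<forall>x. \<phi> x + \<psi> x ~= 0 \<longrightarrow> norm x <= max R S" using R S by (metis add.left_neutral max.strict_boundedE not_le)
 then show ?thesis using assms smooth_add unfolding test_iff by blast
qed

lemma test_mult_smooth: assumes "\<phi> \<in> test_functions" "smooth \<psi>" shows "(%x. \<phi> x * \<psi> x) \<in> test_functions"
proof -
 obtain R where R: "!!x. norm x > R ==> \<phi> x = 0" using test_supportE[OF assms(1)] by blast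
 then have "\<forall>x. \<phi> x * \<psi> x ~= 0 \<longrightarrow> norm x <= R" by (metis mult_eq_0_iff not_le)
 then show ?thesis using assms smooth_mult unfolding test_iff by blast
qed

lemma test_cmult: "\<phi> \<in> test_functions ==> (%x. c * \<phi> x) \<in> test_functions"
 using test_mult_smooth[of \<phi> "%x. c"] by (simp add: smooth_const mult.commute)
lemma test_uminus: "\<phi> \<in> test_functions ==> (%x. - \<phi> x) \<in> test_functions"
 using test_cmult[of \<phi> "-1"] by simp
lemma test_diff: "\<phi> \<in> test_functions ==> \<psi> \<in> test_functions ==> (%x. \<phi> x - \<psi> x) \<in> test_functions"
 using test_add[of \<phi> "%x. - \<psi> x"] test_uminus by simp
lemma test_zero: "(%x. 0) \<in> test_functions"
 by (simp add: test_iff smooth_const)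
lemma test_affine:
 assumes "\<phi> \<in> test_functions" "a ~= 0" shows "(%x. \<phi> (b + a *\<^sub>R x)) \<in> test_functions"
proof -
 obtain R where R: "!!x. norm x > R ==> \<phi> x = 0" using test_supportE[OF assms(1)] by blast
 have "norm x <= (R + norm b) / \<bar>a\<bar>" if "\<phi> (b + a *\<^sub>R x) ~= 0" for x
 proof -
  have "norm (b + a *\<^sub>R x) <= R" using R that not_le by blast
  moreover have "norm (a *\<^sub>R x) <= norm (b + a *\<^sub>R x) + norm b"
   using norm_triangle_ineq4[of "b + a *\<^sub>R x" b] by simp
  ultimately show ?thesis using assms(2) by (simp add: pos_le_divide_eq mult.commute)
 qed
 then show ?thesis using assms smooth_affine unfolding test_iff by blast
qed

lemma test_reflect: "\<phi> \<in> test_functions ==> (%y. \<phi> (x - y)) \<in> test_functions"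
 using test_affine[of \<phi> "-1" x] by simp

lemma partial_reflect: "smooth \<phi> ==> partial i (%y. \<phi> (x - y)) y = - partial i \<phi> (x - y)"
 using partial_affine[of \<phi> i x "-1" y] by simp

lemma continuous_support_bounded:
 fixes \<phi> :: "R3 => real"
 assumes "continuous_on UNIV \<phi>" "!!x. norm x > R ==> \<phi> x = 0"
 obtains K where "K > 0" "!!x. \<bar>\<phi> x\<bar> <= K"
proof -
 have "compact (\<phi> ` cball 0 R)"
  using assms(1) by (intro compact_continuous_image) (auto intro: continuous_on_subset)
 then obtain K where K: "!!y. y \<in> \<phi> ` cball 0 R ==> norm y <= K"
  using compact_imp_bounded bounded_iff by metis
 have "\<bar>\<phi> x\<bar> <= max K 1" for x
 proof (cases "norm x > R")
  case False
  then have "norm (\<phi> x) <= K" by (intro K imageI) auto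
  then show ?thesis by simp
 qed (use assms(2) in auto)
 then show ?thesis using that[of "max K 1"] by simp
qed

lemma test_bounded: assumes "\<phi> \<in> test_functions" obtains K where "K > 0" "!!x. \<bar>\<phi> x\<bar> <= K"
 using continuous_support_bounded smooth_continuous test_smooth test_supportE assms by metis

lemma grad_bounded:
 assumes "\<phi> \<in> test_functions" obtains K where "K > 0" "!!x. norm (grad \<phi> x) <= K"
proof -
 have "\<exists>K. K > 0 \<and> (\<forall>x. \<bar>partial i \<phi> x\<bar> <= K)" for i
  using test_bounded[OF test_partial[OF assms]] by metis
 then obtain K where K: "!!i. K i > 0" "!!i x. \<bar>partial i \<phi> x\<bar> <= K i" by metis
 have "norm (grad \<phi> x) <= (\<Sum>i\<in>UNIV. K i)" for x
  by (rule order_trans[OF norm_le_l1_cart sum_mono]) (simp add: grad_def K)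
 moreover have "(\<Sum>i\<in>UNIV. K i) > 0" using K(1) by (intro sum_pos) auto
 ultimately show ?thesis using that by blast
qed

lemma test_lipschitz:
 assumes "\<phi> \<in> test_functions" obtains L where "L > 0" "!!x y. \<bar>\<phi> x - \<phi> y\<bar> <= L * norm (x - y)"
proof -
 obtain L where L: "L > 0" "!!x. norm (grad \<phi> x) <= L" using grad_bounded[OF assms] by blast
 have "norm (\<phi> x - \<phi> y) <= L * norm (x - y)" for x y
 proof (rule differentiable_bound[of UNIV])
  show "(\<phi> has_derivative (%h. grad \<phi> x \<bullet> h)) (at x within UNIV)" for x
   using smooth_has_derivative[OF test_smooth[OF assms]] .
  show "onorm (%h. grad \<phi> x \<bullet> h) <= L" for x
  proof (rule onorm_bound)
   show "norm (grad \<phi> x \<bullet> h) <= L * norm h" for h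
    using order_trans[OF Cauchy_Schwarz_ineq2 mult_right_mono[OF L(2)[of x] norm_ge_zero]] by simp
  qed (use L in simp)
 qed auto
 then show ?thesis using that[OF L(1)] by simp
qed

lemma indicator_cball_integrable: "integrable lebesgue (indicator (cball (0::R3) R) :: R3 => real)"
 using emeasure_lborel_cball_finite[of 0 R] by (simp add: integrable_indicator_iff)

lemma bounded_support_integrable:
 fixes f :: "R3 => real"
 assumes "f \<in> borel_measurable lebesgue" "!!x. norm x > R ==> f x = 0" "!!x. \<bar>f x\<bar> <= K"
 shows "integrable lebesgue f" "f \<in> L2"
proof -
 have i: "integrable lebesgue (%x. C * indicator (cball (0::R3) R) x :: real)" for C
  using indicator_cball_integrable by simp
 show "integrable lebesgue f"
 proof (rule Bochner_Integration.integrable_bound[OF i[of K] assms(1) AE_I2])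
  show "norm (f x) <= norm (K * indicator (cball 0 R) x)" for x
   using assms(2)[of x] assms(3)[of x] by (simp split: split_indicator)
 qed
 have "integrable lebesgue (%x. (norm (f x))\<^sup>2)"
 proof (rule Bochner_Integration.integrable_bound[OF i[of "K\<^sup>2"]])
  show "(%x. (norm (f x))\<^sup>2) \<in> borel_measurable lebesgue" using assms(1) by simp
  have "(f x)\<^sup>2 <= K\<^sup>2 * indicator (cball 0 R) x" for x
   using assms(2)[of x] power_mono[OF assms(3)[of x], of 2] by (auto split: split_indicator)
  then show "AE x in lebesgue. norm ((norm (f x))\<^sup>2) <= norm (K\<^sup>2 * indicator (cball 0 R) x)"
   by simp
 qed
 then show "f \<in> L2" using assms(1) by (simp add: L2_iff)
qed

lemma test_integrable: "\<phi> \<in> test_functions ==> integrable lebesgue \<phi>"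
 and test_L2: "\<phi> \<in> test_functions ==> \<phi> \<in> L2"
 by (metis bounded_support_integrable smooth_measurable test_smooth test_supportE test_bounded)+

lemma loc_integrable_measurable:
 fixes f :: "R3 => 'b::euclidean_space"
 assumes "loc_integrable f" shows "f \<in> borel_measurable lebesgue"
proof (rule borel_measurable_LIMSEQ_metric)
 show "(%x. indicator (cball 0 (real n)) x *\<^sub>R f x) \<in> borel_measurable lebesgue" for n
  by (rule borel_measurable_integrable, rule assms[unfolded loc_integrable_def set_integrable_def, rule_format, OF compact_cball])
 fix x :: R3
 have "eventually (%n. indicator (cball 0 (real n)) x *\<^sub>R f x = f x) sequentially"
  using eventually_ge_at_top[of "nat \<lceil>norm x\<rceil>"] by eventually_elim (simp add: nat_le_iff ceiling_le_iff indicator_def)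
 then show "(%n. indicator (cball 0 (real n)) x *\<^sub>R f x) \<longlonglongrightarrow> f x" by (rule tendsto_eventually)
qed

lemma loc_integrable_scale:
 fixes f :: "R3 => 'b::euclidean_space" and a :: "R3 => real"
 assumes "loc_integrable f" "a \<in> borel_measurable lebesgue"
  "!!x. norm x > R ==> a x = 0" "!!x. \<bar>a x\<bar> <= K"
 shows "integrable lebesgue (%x. a x *\<^sub>R f x)"
proof -
 have "integrable lebesgue (%x. K *\<^sub>R (indicator (cball 0 R) x *\<^sub>R f x))"
  by (intro integrable_scaleR_right) (rule assms(1)[unfolded loc_integrable_def set_integrable_def, rule_format, OF compact_cball])
 then show ?thesis
 proof (rule Bochner_Integration.integrable_bound)
  show "(%x. a x *\<^sub>R f x) \<in> borel_measurable lebesgue"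
   using loc_integrable_measurable[OF assms(1)] assms(2) by measurable
  have "norm (a x *\<^sub>R f x) <= norm (K *\<^sub>R (indicator (cball 0 R) x *\<^sub>R f x))" for x
   using assms(3)[of x] order_trans[OF assms(4)[of x] abs_ge_self]
   by (auto split: split_indicator intro: mult_right_mono)
  then show "AE x in lebesgue. norm (a x *\<^sub>R f x) <= norm (K *\<^sub>R (indicator (cball 0 R) x *\<^sub>R f x))" by simp
 qed
qed

lemma test_scale_integrable:
 fixes f :: "R3 => 'b::euclidean_space"
 assumes "loc_integrable f" "\<phi> \<in> test_functions"
 shows "integrable lebesgue (%x. \<phi> x *\<^sub>R f x)"
proof -
 obtain R where R: "!!x. norm x > R ==> \<phi> x = 0" using test_supportE[OF assms(2)] by blast
 obtain K where K: "!!x. \<bar>\<phi> x\<bar> <= K" using test_bounded[OF assms(2)] by blast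
 show ?thesis by (rule loc_integrable_scale[OF assms(1) smooth_measurable[OF test_smooth[OF assms(2)]] R K])
qed

lemma L2_loc_integrable:
 fixes f :: "R3 => 'b::euclidean_space" assumes "f \<in> L2" shows "loc_integrable f"
 unfolding loc_integrable_def set_integrable_def
proof (intro allI impI)
 fix K :: "R3 set" assume K: "compact K"
 have mK: "K \<in> sets lebesgue" using K by (simp add: borel_compact)
 have "integrable lebesgue (indicator K :: R3 => real)"
  using mK emeasure_compact_finite[OF K] main_part_sets[OF mK]
  by (simp add: integrable_indicator_iff borel_compact[OF K])
 then have "integrable lebesgue (%x. indicator K x + (norm (f x))\<^sup>2)"
  using L2_integrable[OF assms] by simp
 then show "integrable lebesgue (%x. indicator K x *\<^sub>R f x)"
 proof (rule Bochner_Integration.integrable_bound)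
  show "(%x. indicator K x *\<^sub>R f x) \<in> borel_measurable lebesgue"
   using assms mK by measurable
  have "r <= 1 + r\<^sup>2" for r :: real using sum_squares_ge_zero[of "r - 1/2" 0]
   by (simp add: power2_eq_square algebra_simps)
  then have "norm (indicator K x *\<^sub>R f x) <= norm (indicator K x + (norm (f x))\<^sup>2)" for x
   by (auto split: split_indicator)
  then show "AE x in lebesgue. norm (indicator K x *\<^sub>R f x) <= norm (indicator K x + (norm (f x))\<^sup>2)"
   by simp
 qed
qed

lemma loc_integrable_diff: "loc_integrable f ==> loc_integrable g ==> loc_integrable (%x. f x - g x)"
 by (simp add: loc_integrable_def set_integrable_def scaleR_diff_right)
lemma loc_integrable_bounded_linear:
 assumes "loc_integrable f" "bounded_linear h" shows "loc_integrable (%x. h (f x))"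
proof -
 have "integrable lebesgue (%x. h (indicator K x *\<^sub>R f x))" if "compact K" for K
  using assms(1) that by (intro integrable_bounded_linear[OF assms(2)])
   (simp add: loc_integrable_def set_integrable_def)
 then show ?thesis
  by (simp add: loc_integrable_def set_integrable_def linear_cmul[OF bounded_linear.linear[OF assms(2)]])
qed
text \<open>The integral of a derivative of a test function is the limit of the integrals of its
 difference quotients, which vanish by translation invariance.\<close>

lemma integral_partial_zero:
 assumes "\<phi> \<in> test_functions" shows "(\<integral>x. partial i \<phi> x \<partial>lebesgue) = 0"
proof -
 obtain R where R: "R > 0" "!!x. norm x > R ==> \<phi> x = 0" using test_supportE[OF assms] by blast
 obtain L where L: "L > 0" "!!x y. \<bar>\<phi> x - \<phi> y\<bar> <= L * norm (x - y)" using test_lipschitz[OF assms] by blast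
 define h where "h n = 1 / real (Suc n)" for n
 have h: "h n > 0" "h n <= 1" for n by (auto simp: h_def)
 let ?e = "axis i 1 :: R3"
 define F where "F n x = (\<phi> (x + h n *\<^sub>R ?e) - \<phi> x) / h n" for n x
 have mphi: "\<phi> \<in> borel_measurable lebesgue" by (rule smooth_measurable[OF test_smooth[OF assms]])
 have mt: "(%x. \<phi> (x + b)) \<in> borel_measurable lebesgue" for b
  using measurable_affine[OF mphi, of 1 b] by (simp add: add.commute)
 have it: "integrable lebesgue (%x. \<phi> (x + b))" for b
  using integrable_affine[OF test_integrable[OF assms], of 1 b] by (simp add: add.commute)
 have zero: "(\<integral>x. F n x \<partial>lebesgue) = 0" for n
 proof -
  have "(\<integral>x. \<phi> (x + h n *\<^sub>R ?e) \<partial>lebesgue) = (\<integral>x. \<phi> x \<partial>lebesgue)"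
   using integral_affine[OF mphi, of 1 "h n *\<^sub>R ?e"] by (simp add: add.commute)
  then show ?thesis unfolding F_def using it[of "h n *\<^sub>R ?e"] it[of 0] by simp
 qed
 have "(%n. \<integral>x. F n x \<partial>lebesgue) \<longlonglongrightarrow> (\<integral>x. partial i \<phi> x \<partial>lebesgue)"
 proof (rule integral_dominated_convergence[where w="%x. L * indicator (cball 0 (R + 1)) x"])
  show "partial i \<phi> \<in> borel_measurable lebesgue"
   by (rule smooth_measurable[OF test_smooth[OF test_partial[OF assms]]])
  show "F n \<in> borel_measurable lebesgue" for n unfolding F_def using mt[of "h n *\<^sub>R ?e"] mphi by measurable
  show "integrable lebesgue (%x. L * indicator (cball (0::R3) (R + 1)) x)"
   using indicator_cball_integrable by simp
  show "AE x in lebesgue. (%n. F n x) \<longlonglongrightarrow> partial i \<phi> x"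
  proof (rule AE_I2)
   fix x
   have "((%s. \<phi> (x + s *\<^sub>R ?e)) has_real_derivative partial i \<phi> (x + 0 *\<^sub>R ?e)) (at 0)"
    by (rule DERIV_along_axis[OF test_smooth[OF assms]])
   then have "((%s. (\<phi> (x + s *\<^sub>R ?e) - \<phi> x) / s) \<longlongrightarrow> partial i \<phi> x) (at 0)"
    by (simp add: DERIV_def)
   moreover have "filterlim h (at 0) sequentially"
    unfolding filterlim_at using LIMSEQ_inverse_real_of_nat
    by (auto simp: h_def[abs_def] inverse_eq_divide)
   ultimately show "(%n. F n x) \<longlonglongrightarrow> partial i \<phi> x"
    unfolding F_def by (rule filterlim_compose)
  qed
  show "AE x in lebesgue. norm (F n x) <= L * indicator (cball 0 (R + 1)) x" for n
  proof (rule AE_I2)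
   fix x
   show "norm (F n x) <= L * indicator (cball 0 (R + 1)) x"
   proof (cases "norm x <= R + 1")
    case True
    have "\<bar>\<phi> (x + h n *\<^sub>R ?e) - \<phi> x\<bar> <= L * h n"
     using L(2)[of "x + h n *\<^sub>R ?e" x] h[of n] by (simp add: norm_axis_1)
    then show ?thesis using True h(1)[of n] by (simp add: F_def divide_le_eq)
   next
    case False
    have "norm x <= norm (x + h n *\<^sub>R ?e) + norm (h n *\<^sub>R ?e)"
     using norm_triangle_ineq4[of "x + h n *\<^sub>R ?e" "h n *\<^sub>R ?e"] by simp
    then have "norm (x + h n *\<^sub>R ?e) > R" using False h[of n] by (simp add: norm_axis_1)
    then show ?thesis using False R by (simp add: F_def)
   qed
  qed
 qed
 then show ?thesis using LIMSEQ_unique[OF _ tendsto_const[of 0 sequentially]] by (simp add: zero)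
qed

lemma test_by_parts:
 assumes "\<phi> \<in> test_functions" "smooth \<psi>"
 shows "(\<integral>x. partial i \<phi> x * \<psi> x \<partial>lebesgue) = - (\<integral>x. \<phi> x * partial i \<psi> x \<partial>lebesgue)"
proof -
 have t: "(%x. \<phi> x * \<psi> x) \<in> test_functions" "(%x. partial i \<phi> x * \<psi> x) \<in> test_functions"
  "(%x. \<phi> x * partial i \<psi> x) \<in> test_functions"
  using assms by (auto intro!: test_mult_smooth smooth_partial test_partial)
 have "partial i (%x. \<phi> x * \<psi> x) = (%x. partial i \<phi> x * \<psi> x + \<phi> x * partial i \<psi> x)"
  using assms by (auto simp: fun_eq_iff partial_mult smooth_differentiable test_smooth)
 then show ?thesis using integral_partial_zero[OF t(1), of i] test_integrable[OF t(2)] test_integrable[OF t(3)]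
  by simp
qed

subsection \<open>Cutoffs and mollifiers\<close>

lemma smooth_prod: "(!!i. i \<in> I ==> smooth (f i)) ==> smooth (%x. \<Prod>i\<in>I. f i x)"
 by (induction I rule: infinite_finite_induct) (simp_all add: smooth_mult smooth_const)

lemma smooth_coord_affine: "(!!k. D1 k f) ==> smooth (%x. f (a * x $ i + b))"
 by (rule smooth_coord[of "%t. f (a * t + b)"]) (rule D1_affine)

text \<open>The neutral factors and summands match the affine substitutions of the smoothness lemmas.\<close>

definition cutoff :: "R3 => real" where
 "cutoff x = (\<Prod>i\<in>UNIV. step (1 * x $ i + 2) * step (- 1 * x $ i + 2))"

definition cutoff_at :: "nat => R3 => real" where
 "cutoff_at n x = cutoff (0 + (1 / real (Suc n)) *\<^sub>R x)"

lemma cutoff_test: "cutoff \<in> test_functions"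
proof -
 have "smooth cutoff" unfolding cutoff_def[abs_def]
  by (intro smooth_prod smooth_mult smooth_coord_affine D1_step)
 moreover have "norm x <= 9" if "cutoff x ~= 0" for x
 proof -
  have "\<bar>x $ i\<bar> <= 3" for i
  proof -
   have "step (1 * x $ i + 2) * step (- 1 * x $ i + 2) ~= 0"
    using that by (simp add: cutoff_def)
   then have "\<not> (1 * x $ i + 2 <= -1)" "\<not> (- 1 * x $ i + 2 <= -1)"
    using step_left by fastforce+
   then show ?thesis by linarith
  qed
  then have "(\<Sum>i\<in>UNIV. \<bar>x $ i\<bar>) <= (\<Sum>i\<in>(UNIV::3 set). 3)" by (intro sum_mono)
  then show ?thesis using norm_le_l1_cart[of x] by simp
 qed
 ultimately show ?thesis unfolding test_iff by blast
qed

lemma cutoff_bounds: "0 <= cutoff x" "cutoff x <= 1"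
proof -
 show "0 <= cutoff x" unfolding cutoff_def by (intro prod_nonneg ballI mult_nonneg_nonneg step_bounds)
 show "cutoff x <= 1" unfolding cutoff_def
  by (intro prod_le_1 conjI mult_nonneg_nonneg mult_le_one step_bounds)
qed

lemma cutoff_one: assumes "norm x <= 1" shows "cutoff x = 1"
proof -
 have "step (1 * x $ i + 2) * step (- 1 * x $ i + 2) = 1" for i
  using component_le_norm_cart[of x i] assms step_right[of "1 * x $ i + 2"] step_right[of "- 1 * x $ i + 2"]
  by (simp add: abs_le_iff)
 then show ?thesis by (simp add: cutoff_def)
qed

lemma cutoff_at_test: "cutoff_at n \<in> test_functions"
 unfolding cutoff_at_def[abs_def] by (rule test_affine[OF cutoff_test]) simp

lemma cutoff_at_bounds: "\<bar>cutoff_at n x\<bar> <= 1"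
 using cutoff_bounds by (simp add: cutoff_at_def)

lemma cutoff_at_one: "norm x <= real (Suc n) ==> cutoff_at n x = 1"
 unfolding cutoff_at_def by (rule cutoff_one) (simp add: divide_le_eq)

lemma cutoff_at_tendsto: "(%n. cutoff_at n x) \<longlonglongrightarrow> 1"
proof (rule tendsto_eventually)
 show "eventually (%n. cutoff_at n x = 1) sequentially"
  using eventually_ge_at_top[of "nat \<lceil>norm x\<rceil>"]
  by eventually_elim (rule cutoff_at_one, simp add: nat_le_iff ceiling_le_iff)
qed

lemma cutoff_at_partial:
 obtains C where "C > 0" "!!n i x. \<bar>partial i (cutoff_at n) x\<bar> <= C / real (Suc n)"
proof -
 obtain C where C: "C > 0" "!!x. norm (grad cutoff x) <= C" using grad_bounded[OF cutoff_test] by blast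
 have "\<bar>partial i cutoff x\<bar> <= C" for i x
  using component_le_norm_cart[of "grad cutoff x" i] C(2)[of x] by (simp add: grad_def)
 then have "\<bar>partial i (cutoff_at n) x\<bar> <= C / real (Suc n)" for n i x
  unfolding cutoff_at_def[abs_def] partial_affine[OF test_smooth[OF cutoff_test]]
  by (simp add: abs_mult divide_right_mono)
 then show ?thesis using C(1) that by blast
qed

section \<open>Bump functions and mollifiers\<close>

text \<open>Product bumps with width \<open>a\<close> in the first direction and \<open>b\<close> in the others; \<open>bump_potential\<close>
 is a compactly supported first-coordinate antiderivative of a difference of two of them.\<close>

definition bump :: "real => real => R3 => real" where
 "bump a b x = (step' ((1/a) * x $ 1 + 0) / a) * (step' ((1/b) * x $ 2 + 0) / b) * (step' ((1/b) * x $ 3 + 0) / b)"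

definition bump_potential :: "real => real => R3 => real" where
 "bump_potential e L x = (step ((1/e) * x $ 1 + 0) - step ((1/L) * x $ 1 + 0))
   * (step' ((1/e) * x $ 2 + 0) / e) * (step' ((1/e) * x $ 3 + 0) / e)"

lemma smooth_divide: "smooth f ==> smooth (%x. f x / c)"
 using smooth_cmult[of f "inverse c"] by (simp add: field_simps)

lemma bump_smooth: "smooth (bump a b)"
 unfolding bump_def[abs_def] by (intro smooth_mult smooth_divide smooth_coord_affine D1_step')

lemma bump_potential_smooth: "smooth (bump_potential e L)"
 unfolding bump_potential_def[abs_def]
 by (intro smooth_mult smooth_divide smooth_diff smooth_coord_affine D1_step' D1_step)

lemma norm_le_three: "(!!i. \<bar>(x::R3) $ i\<bar> <= c) ==> norm x <= 3 * c"
 using norm_le_l1_cart[of x] sum_mono[of UNIV "%i. \<bar>x $ i\<bar>" "%i. c"] by simp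

lemma step'_scaled_nonzero: "a > 0 ==> step' ((1/a) * t + 0) ~= 0 ==> \<bar>t\<bar> <= a"
 using step'_outside[of "t / a"] by (simp add: field_simps abs_le_iff) (metis abs_ge_self abs_minus_cancel
  abs_divide abs_of_pos le_divide_eq_1_pos linorder_le_cases order_trans)

lemma bump_support:
 assumes "a > 0" "b > 0" "bump a b x ~= 0"
 shows "\<bar>x $ 1\<bar> <= a" "\<bar>x $ 2\<bar> <= b" "\<bar>x $ 3\<bar> <= b"
 using assms step'_scaled_nonzero unfolding bump_def by (metis div_0 mult_zero_left mult_zero_right)+

lemma forall_three: "(\<forall>i::3. P i) \<longleftrightarrow> P 1 \<and> P 2 \<and> P 3"
 by (rule forall_3)

lemma bump_test: assumes "a > 0" "b > 0" shows "bump a b \<in> test_functions"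
proof -
 have "norm x <= 3 * max a b" if "bump a b x ~= 0" for x
 proof (rule norm_le_three)
  have "\<forall>i. \<bar>x $ i\<bar> <= max a b"
   using bump_support[OF assms that] unfolding forall_three by linarith
  then show "\<bar>x $ i\<bar> <= max a b" for i by blast
 qed
 then show ?thesis using bump_smooth unfolding test_iff by blast
qed

lemma bump_potential_test: assumes "e > 0" "L > 0" shows "bump_potential e L \<in> test_functions"
proof -
 have "norm x <= 3 * max e L" if nz: "bump_potential e L x ~= 0" for x
 proof (rule norm_le_three)
  have "\<bar>x $ 2\<bar> <= e" "\<bar>x $ 3\<bar> <= e"
   using nz step'_scaled_nonzero[OF assms(1)] unfolding bump_potential_def by (metis div_0 mult_zero_left mult_zero_right)+
  moreover have "\<bar>x $ 1\<bar> <= max e L"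
  proof (rule ccontr)
   assume "\<not> \<bar>x $ 1\<bar> <= max e L"
   then consider "x $ 1 >= e \<and> x $ 1 >= L" | "x $ 1 <= - e \<and> x $ 1 <= - L" by linarith
   then have "step ((1/e) * x $ 1 + 0) = step ((1/L) * x $ 1 + 0)"
    using assms by cases (simp_all add: step_right step_left field_simps)
   then show False using nz by (simp add: bump_potential_def)
  qed
  ultimately have "\<forall>i. \<bar>x $ i\<bar> <= max e L"
   unfolding forall_three by linarith
  then show "\<bar>x $ i\<bar> <= max e L" for i by blast
 qed
 then show ?thesis using bump_potential_smooth unfolding test_iff by blast
qed

lemma bump_nonneg: "a > 0 ==> b > 0 ==> bump a b x >= 0"
 unfolding bump_def by (intro mult_nonneg_nonneg divide_nonneg_pos step'_nonneg) auto

lemma partial_coord_affine: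
 assumes "!!t. (f has_real_derivative f' t) (at t)"
 shows "partial j (%x. f (a * x $ i + 0)) x = (if i = j then f' (a * x $ i + 0) * a else 0)"
proof (rule partial_coord[of "%t. f (a * t + 0)"])
 have "((%t. a * t + 0) has_real_derivative a) (at (x $ i))" by (auto intro!: derivative_eq_intros)
 from DERIV_chain2[OF assms this]
 show "((%t. f (a * t + 0)) has_real_derivative f' (a * x $ i + 0) * a) (at (x $ i))" .
qed

lemma bump_potential_partial:
 assumes "e > 0" "L > 0"
 shows "partial 1 (bump_potential e L) = (%x. bump e e x - bump L e x)"
proof
 fix x
 have ds: "smooth (%x. step (a * x $ i + 0))" for a i by (intro smooth_coord_affine D1_step)
 have ds': "smooth (%x. step' (a * x $ i + 0) / c)" for a c i by (intro smooth_divide smooth_coord_affine D1_step')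
 have z: "partial 1 (%x. step' (a * x $ i + 0) / e) x = 0" if "i ~= 1" for a i
 proof -
  obtain f' where f': "!!t. (step' has_real_derivative f' t) (at t)"
   using D1_step'[of 1] by auto
  have "partial 1 (%x. inverse e * step' (a * x $ i + 0)) x = inverse e * partial 1 (%x. step' (a * x $ i + 0)) x"
   by (intro partial_cmult smooth_differentiable smooth_coord_affine D1_step')
  also have "\<dots> = 0" using that by (subst partial_coord_affine[OF f']) simp
  finally show ?thesis by (simp add: divide_inverse mult.commute)
 qed
 have z2: "partial 1 (%x. step' ((1/e) * x $ 2 + 0) / e) x = 0"
  and z3: "partial 1 (%x. step' ((1/e) * x $ 3 + 0) / e) x = 0"
  by (rule z, simp)+
 have d: "partial 1 (%x. step ((1/e) * x $ 1 + 0) - step ((1/L) * x $ 1 + 0)) x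
   = step' ((1/e) * x $ 1 + 0) * (1/e) - step' ((1/L) * x $ 1 + 0) * (1/L)"
  by (subst partial_diff[OF smooth_differentiable[OF ds] smooth_differentiable[OF ds]])
    (simp only: partial_coord_affine[OF step_deriv] if_True refl)
 show "partial 1 (bump_potential e L) x = bump e e x - bump L e x"
  unfolding bump_potential_def[abs_def]
  by (subst partial_mult, (intro smooth_differentiable smooth_mult smooth_diff ds ds')+,
    subst partial_mult, (intro smooth_differentiable smooth_mult smooth_diff ds ds')+)
    (simp only: d z2 z3 bump_def, simp add: algebra_simps)
qed

definition bump_mass :: real where "bump_mass = (\<integral>x. bump 1 1 x \<partial>lebesgue)"

lemma box_bound:
 fixes f :: "R3 => real"
 assumes "f \<in> borel_measurable lebesgue" "!!x. x \<notin> cbox a b ==> f x = 0" "!!x. \<bar>f x\<bar> <= K"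
  "cbox a b ~= {}"
 shows "integrable lebesgue f" "(\<integral>x. f x \<partial>lebesgue) <= K * (\<Prod>i\<in>UNIV. b $ i - a $ i)"
proof -
 have i: "integrable lebesgue (indicator (cbox a b) :: R3 => real)"
  using emeasure_lborel_cbox_finite[of a b] by (simp add: integrable_indicator_iff)
 then have i': "integrable lebesgue (%x. K * indicator (cbox a b) x)" by simp
 have le: "\<bar>f x\<bar> <= K * indicator (cbox a b) x" for x
  using assms(2)[of x] assms(3)[of x] by (auto split: split_indicator)
 show int: "integrable lebesgue f"
  by (rule Bochner_Integration.integrable_bound[OF i' assms(1) AE_I2])
    (use order_trans[OF le abs_ge_self] in simp)
 have "(\<integral>x. f x \<partial>lebesgue) <= (\<integral>x. K * indicator (cbox a b) x \<partial>lebesgue)"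
  by (rule integral_mono[OF int i']) (use le in \<open>auto simp: abs_le_iff\<close>)
 also have "\<dots> = K * measure lebesgue (cbox a b)" by simp
 also have "measure lebesgue (cbox a b) = (\<Prod>i\<in>UNIV. b $ i - a $ i)"
  using content_cbox_cart[OF assms(4)] by simp
 finally show "(\<integral>x. f x \<partial>lebesgue) <= K * (\<Prod>i\<in>UNIV. b $ i - a $ i)" .
qed

lemma bump_mass_pos: "bump_mass > 0"
proof -
 have t: "bump 1 1 \<in> test_functions" by (rule bump_test) auto
 have nn: "bump 1 1 x >= 0" for x by (rule bump_nonneg) auto
 have "bump_mass ~= 0"
 proof
  assume "bump_mass = 0"
  then have ae: "AE x in lebesgue. bump 1 1 x = 0"
   unfolding bump_mass_def using test_integrable[OF t] nn
   by (subst (asm) integral_nonneg_eq_0_iff_AE) auto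
  let ?U = "{x. bump 1 1 x > 0}"
  have "open ?U" by (intro open_Collect_less continuous_on_const smooth_continuous bump_smooth)
  moreover have "0 \<in> ?U" by (simp add: bump_def step'_0)
  moreover have "negligible ?U"
  proof -
   have "{x \<in> space lebesgue. \<not> bump 1 1 x = 0} \<in> null_sets lebesgue"
    using ae by (subst (asm) completion.AE_iff_null_sets)
   moreover have "{x \<in> space lebesgue. \<not> bump 1 1 x = 0} = ?U"
    using nn by (auto simp: less_le)
   ultimately show ?thesis by (simp add: negligible_iff_null_sets)
  qed
  ultimately show False using open_not_negligible by blast
 qed
 moreover have "bump_mass >= 0" unfolding bump_mass_def using nn by simp
 ultimately show ?thesis by simp
qed

definition mollifier :: "nat => R3 => real" where
 "mollifier n x = bump (1 / real (Suc n)) (1 / real (Suc n)) x / bump_mass"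

lemma test_divide: "\<phi> \<in> test_functions ==> (%x. \<phi> x / c) \<in> test_functions"
 using test_cmult[of \<phi> "inverse c"] by (simp add: field_simps)

lemma mollifier_test: "mollifier n \<in> test_functions"
 unfolding mollifier_def[abs_def] by (intro test_divide bump_test) auto

lemma mollifier_nonneg: "mollifier n x >= 0"
 unfolding mollifier_def using bump_mass_pos by (intro divide_nonneg_pos bump_nonneg) auto

lemma mollifier_support: assumes "norm x > 3 / real (Suc n)" shows "mollifier n x = 0"
proof (rule ccontr)
 assume "mollifier n x ~= 0"
 then have "bump (1 / real (Suc n)) (1 / real (Suc n)) x ~= 0" by (auto simp: mollifier_def)
 then have "\<forall>i. \<bar>x $ i\<bar> <= 1 / real (Suc n)"
  using bump_support[of "1 / real (Suc n)" "1 / real (Suc n)" x] unfolding forall_three by simp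
 then have "norm x <= 3 * (1 / real (Suc n))" by (intro norm_le_three) blast
 then show False using assms by simp
qed

lemma mollifier_integral: "(\<integral>x. mollifier n x \<partial>lebesgue) = 1"
proof -
 let ?m = "real (Suc n)"
 have "bump_mass = \<bar>?m\<bar> ^ 3 *\<^sub>R (\<integral>x. bump 1 1 (0 + ?m *\<^sub>R x) \<partial>lebesgue)"
  unfolding bump_mass_def by (rule integral_affine[OF smooth_measurable[OF bump_smooth]]) simp
 also have "\<dots> = (\<integral>x. ?m ^ 3 * bump 1 1 (0 + ?m *\<^sub>R x) \<partial>lebesgue)" by simp
 also have "(%x. ?m ^ 3 * bump 1 1 (0 + ?m *\<^sub>R x)) = bump (1/?m) (1/?m)"
  by (auto simp: fun_eq_iff bump_def power3_eq_cube field_simps)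
 finally show ?thesis using bump_mass_pos by (simp add: mollifier_def[abs_def])
qed

section \<open>Convolution with test functions\<close>

definition conv :: "(R3 => real) => (R3 => real) => R3 => real" where
 "conv f \<kappa> x = (\<integral>y. \<kappa> (x - y) * f y \<partial>lebesgue)"

lemma test_times_integrable:
 fixes f :: "R3 => real"
 shows "loc_integrable f ==> \<phi> \<in> test_functions ==> integrable lebesgue (%y. \<phi> y * f y)"
 using test_scale_integrable[of f \<phi>] by simp

lemma conv_integrable:
 "loc_integrable f ==> \<kappa> \<in> test_functions ==> integrable lebesgue (%y. \<kappa> (x - y) * f y)"
 by (rule test_times_integrable[OF _ test_reflect])

lemma test_taylor:
 assumes "\<kappa> \<in> test_functions"
 obtains M where "M > 0" "!!z h. \<bar>\<kappa> (z + h) - \<kappa> z - grad \<kappa> z \<bullet> h\<bar> <= M * (norm h)\<^sup>2"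
proof -
 have "\<exists>L. L > 0 \<and> (\<forall>x y. \<bar>partial i \<kappa> x - partial i \<kappa> y\<bar> <= L * norm (x - y))" for i
  using test_lipschitz[OF test_partial[OF assms]] by metis
 then obtain L where L: "!!i. L i > 0" "!!i x y. \<bar>partial i \<kappa> x - partial i \<kappa> y\<bar> <= L i * norm (x - y)"
  by metis
 define M where "M = (\<Sum>i\<in>UNIV. L i)"
 have M: "M > 0" unfolding M_def using L(1) by (intro sum_pos) auto
 have gl: "norm (grad \<kappa> x - grad \<kappa> y) <= M * norm (x - y)" for x y
  unfolding M_def sum_distrib_right
  by (rule order_trans[OF norm_le_l1_cart sum_mono]) (simp add: grad_def L)
 have "\<bar>\<kappa> (z + h) - \<kappa> z - grad \<kappa> z \<bullet> h\<bar> <= M * (norm h)\<^sup>2" for z h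
 proof -
  have "norm (\<kappa> (z + h) - \<kappa> z - grad \<kappa> z \<bullet> ((z + h) - z)) <= norm ((z + h) - z) * (M * norm h)"
  proof (rule differentiable_bound_linearization[where S="cball z (norm h)" and ?x0.0=z
     and f'="%w k. grad \<kappa> w \<bullet> k"])
   show "z + t *\<^sub>R (z + h - z) \<in> cball z (norm h)" if "t \<in> {0..1}" for t
    using that mult_right_mono[of t 1 "norm h"] by (simp add: dist_norm)
   show "(\<kappa> has_derivative (%k. grad \<kappa> w \<bullet> k)) (at w within cball z (norm h))" for w
    by (rule has_derivative_at_withinI[OF smooth_has_derivative[OF test_smooth[OF assms]]])
   show "onorm ((%k. grad \<kappa> w \<bullet> k) - (%k. grad \<kappa> z \<bullet> k)) <= M * norm h"
    if w: "w \<in> cball z (norm h)" for w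
   proof (rule onorm_bound)
    fix k
    have "\<bar>(grad \<kappa> w - grad \<kappa> z) \<bullet> k\<bar> <= norm (grad \<kappa> w - grad \<kappa> z) * norm k"
     by (rule Cauchy_Schwarz_ineq2)
    also have "\<dots> <= M * norm h * norm k"
    proof (rule mult_right_mono)
     have "norm (w - z) <= norm h" using w by (simp add: dist_norm norm_minus_commute)
     then show "norm (grad \<kappa> w - grad \<kappa> z) <= M * norm h"
      using order_trans[OF gl[of w z] mult_left_mono[of "norm (w - z)" "norm h" M]] M by simp
    qed simp
    finally show "norm (((%k. grad \<kappa> w \<bullet> k) - (%k. grad \<kappa> z \<bullet> k)) k) <= M * norm h * norm k"
     by (simp add: inner_diff_left)
   qed (use M in simp)
  qed auto
  then show ?thesis by (simp add: power2_eq_square mult.commute mult.left_commute)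
 qed
 then show ?thesis using that M by blast
qed

text \<open>The kernel has bounded support and a uniform second order Taylor bound, so that differentiation
passes under the integral for every locally integrable function.\<close>

lemma conv_has_derivative:
 assumes f: "loc_integrable f" and k: "\<kappa> \<in> test_functions"
 shows "(conv f \<kappa> has_derivative (%h. (\<chi> i. conv f (partial i \<kappa>) x) \<bullet> h)) (at x)"
proof -
 obtain M where M: "M > 0" "!!z h. \<bar>\<kappa> (z + h) - \<kappa> z - grad \<kappa> z \<bullet> h\<bar> <= M * (norm h)\<^sup>2"
  using test_taylor[OF k] by blast
 obtain R where R: "R > 0" "!!x. norm x > R ==> \<kappa> x = 0" using test_supportE[OF k] by blast
 have fm: "f \<in> borel_measurable lebesgue" by (rule loc_integrable_measurable[OF f])
 define B where "B = cball (0::R3) (norm x + R + 1)"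
 have fi: "integrable lebesgue (%y. indicator B y * \<bar>f y\<bar>)"
  using integrable_norm[of lebesgue "%y. indicator B y *\<^sub>R f y"] f compact_cball
  by (simp add: B_def loc_integrable_def set_integrable_def abs_mult)
 define C where "C = (\<integral>y. indicator B y * \<bar>f y\<bar> \<partial>lebesgue)"
 have C: "C >= 0" unfolding C_def by (intro integral_nonneg_AE AE_I2) simp
 let ?D = "%h. (\<chi> i. conv f (partial i \<kappa>) x) \<bullet> h"
 have D: "?D h = (\<integral>y. (grad \<kappa> (x - y) \<bullet> h) * f y \<partial>lebesgue)"
  "integrable lebesgue (%y. (grad \<kappa> (x - y) \<bullet> h) * f y)" for h
 proof -
  have i: "integrable lebesgue (%y. h $ i * (partial i \<kappa> (x - y) * f y))" for i
   using conv_integrable[OF f test_partial[OF k]] by simp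
  have e: "(%y. (grad \<kappa> (x - y) \<bullet> h) * f y) = (%y. \<Sum>i\<in>UNIV. h $ i * (partial i \<kappa> (x - y) * f y))"
   by (simp add: fun_eq_iff inner_vec_def grad_def sum_distrib_left mult.commute mult.left_commute)
  show "integrable lebesgue (%y. (grad \<kappa> (x - y) \<bullet> h) * f y)" unfolding e using i by simp
  show "?D h = (\<integral>y. (grad \<kappa> (x - y) \<bullet> h) * f y \<partial>lebesgue)"
   unfolding e using i by (simp add: inner_vec_def conv_def mult.commute)
 qed
 have est: "\<bar>conv f \<kappa> (x + h) - conv f \<kappa> x - ?D h\<bar> <= (M * (norm h)\<^sup>2) * C" if h: "norm h <= 1" for h
 proof -
  let ?g = "%y. (\<kappa> (x + h - y) - \<kappa> (x - y) - grad \<kappa> (x - y) \<bullet> h) * f y"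
  have ig: "integrable lebesgue ?g"
   using conv_integrable[OF f k, of "x + h"] conv_integrable[OF f k, of x] D(2)[of h]
   by (simp add: left_diff_distrib)
  have e: "conv f \<kappa> (x + h) - conv f \<kappa> x - ?D h = (\<integral>y. ?g y \<partial>lebesgue)"
   unfolding D(1) unfolding conv_def using conv_integrable[OF f k, of "x + h"] conv_integrable[OF f k, of x] D(2)[of h]
   by (simp add: left_diff_distrib)
  have "\<bar>conv f \<kappa> (x + h) - conv f \<kappa> x - ?D h\<bar> <= (\<integral>y. \<bar>?g y\<bar> \<partial>lebesgue)"
   unfolding e by (rule integral_abs_bound)
  also have "\<dots> <= (\<integral>y. (M * (norm h)\<^sup>2) * (indicator B y * \<bar>f y\<bar>) \<partial>lebesgue)"
  proof (rule integral_mono)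
   show "integrable lebesgue (%y. \<bar>?g y\<bar>)" by (rule integrable_abs[OF ig])
   show "integrable lebesgue (%y. (M * (norm h)\<^sup>2) * (indicator B y * \<bar>f y\<bar>))" using fi by simp
   fix y
   show "\<bar>?g y\<bar> <= (M * (norm h)\<^sup>2) * (indicator B y * \<bar>f y\<bar>)"
   proof (cases "y \<in> B")
    case True
    have "\<bar>\<kappa> (x + h - y) - \<kappa> (x - y) - grad \<kappa> (x - y) \<bullet> h\<bar> <= M * (norm h)\<^sup>2"
     using M(2)[of "x - y" h] by (simp add: algebra_simps)
    then show ?thesis using True by (simp add: abs_mult mult_right_mono)
   next
    case False
    then have y: "norm y > norm x + R + 1" by (simp add: B_def)
    have "norm (x - y) >= norm y - norm x" using norm_triangle_ineq2[of y x] by (simp add: norm_minus_commute)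
    then have a: "norm (x - y) > R + 1" using y by linarith
    have "norm (x - y) <= norm (x + h - y) + norm h"
     using norm_triangle_ineq4[of "x + h - y" h] by (simp add: algebra_simps)
    then have b: "norm (x + h - y) > R" using a h by linarith
    have "grad \<kappa> (x - y) = 0"
    proof -
     have "partial i \<kappa> (x - y) = 0" for i
      by (rule partial_outside[of R]) (use R(2) a in auto)
     then show ?thesis by (simp add: grad_def vec_eq_iff)
    qed
    then show ?thesis using R(2)[of "x - y"] R(2)[OF b] a False by simp
   qed
  qed
  also have "\<dots> = (M * (norm h)\<^sup>2) * C" by (simp add: C_def)
  finally show ?thesis .
 qed
 show ?thesis unfolding has_derivative_at_alt
 proof (intro conjI allI impI)
  show "bounded_linear ?D" by (rule bounded_linear_inner_right)
  fix e :: real assume e: "e > 0"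
  define d where "d = min 1 (e / (M * C + 1))"
  have MC: "M * C + 1 > 0" using M C by (simp add: add_nonneg_pos)
  have d: "d > 0" using e MC by (simp add: d_def)
  have "norm (conv f \<kappa> y - conv f \<kappa> x - ?D (y - x)) <= e * norm (y - x)" if y: "norm (y - x) < d" for y
  proof -
   have "norm (conv f \<kappa> y - conv f \<kappa> x - ?D (y - x)) <= (M * (norm (y - x))\<^sup>2) * C"
    using est[of "y - x"] y by (simp add: d_def)
   also have "\<dots> = (norm (y - x) * (M * C)) * norm (y - x)" by (simp add: power2_eq_square)
   also have "\<dots> <= e * norm (y - x)"
   proof (rule mult_right_mono)
    have "norm (y - x) * (M * C) <= e / (M * C + 1) * (M * C + 1)"
     using y M C MC e by (intro mult_mono) (auto simp: d_def)
    then show "norm (y - x) * (M * C) <= e" using MC by simp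
   qed simp
   finally show ?thesis .
  qed
  then show "\<exists>d>0. \<forall>y. norm (y - x) < d \<longrightarrow> norm (conv f \<kappa> y - conv f \<kappa> x - ?D (y - x)) <= e * norm (y - x)"
   using d by blast
 qed
qed

lemma partial_conv:
 "loc_integrable f ==> \<kappa> \<in> test_functions ==> partial i (conv f \<kappa>) = conv f (partial i \<kappa>)"
 by (rule ext) (simp add: partial_eq[OF conv_has_derivative] inner_axis)

lemma smooth_conv: assumes "loc_integrable f" "\<kappa> \<in> test_functions" shows "smooth (conv f \<kappa>)"
proof (rule smooth_coinduct[where S="conv f ` test_functions"])
 fix \<psi> assume "\<psi> \<in> conv f ` test_functions"
 then obtain k where k: "\<psi> = conv f k" "k \<in> test_functions" by blast
 have "\<psi> differentiable (at x)" for x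
  unfolding k(1) using conv_has_derivative[OF assms(1) k(2)] differentiable_def by blast
 then show "\<psi> differentiable_on UNIV \<and> (\<forall>i. partial i \<psi> \<in> conv f ` test_functions)"
  using partial_conv[OF assms(1) k(2)] test_partial[OF k(2)] by (simp add: differentiable_UNIV_at k(1))
qed (use assms in blast)

lemma conv_diff: "loc_integrable f ==> loc_integrable g ==> \<kappa> \<in> test_functions ==>
 conv (%x. f x - g x) \<kappa> x = conv f \<kappa> x - conv g \<kappa> x"
 unfolding conv_def using conv_integrable by (simp add: right_diff_distrib)

lemma conv_diff_kernel: "loc_integrable f ==> \<kappa> \<in> test_functions ==> \<nu> \<in> test_functions ==>
 conv f (%x. \<kappa> x - \<nu> x) x = conv f \<kappa> x - conv f \<nu> x"
 unfolding conv_def using conv_integrable by (simp add: left_diff_distrib)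

lemma conv_pointwise_bound:
 assumes f: "f \<in> L2" and k: "\<kappa> \<in> test_functions"
 shows "(conv f \<kappa> x)\<^sup>2 <= (\<integral>y. \<bar>\<kappa> y\<bar> \<partial>lebesgue) * (\<integral>y. \<bar>\<kappa> (x - y)\<bar> * (f y)\<^sup>2 \<partial>lebesgue)"
  and "integrable lebesgue (%y. \<bar>\<kappa> (x - y)\<bar> * (f y)\<^sup>2)"
proof -
 have kt: "(%y. \<kappa> (x - y)) \<in> test_functions" by (rule test_reflect[OF k])
 have km: "(%y. \<kappa> (x - y)) \<in> borel_measurable lebesgue" by (rule smooth_measurable[OF test_smooth[OF kt]])
 obtain R where R: "!!y. norm y > R ==> \<kappa> (x - y) = 0" using test_supportE[OF kt] by blast
 obtain K where K: "K > 0" "!!y. \<bar>\<kappa> (x - y)\<bar> <= K" using test_bounded[OF kt] by blast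
 let ?a = "%y. sqrt \<bar>\<kappa> (x - y)\<bar>"
 have am: "?a \<in> borel_measurable lebesgue" using km by measurable
 have ab: "\<bar>?a y\<bar> <= sqrt K" for y using K by simp
 have a2: "?a \<in> L2" by (rule bounded_support_integrable(2)[OF am _ ab, of R]) (simp add: R)
 have b2: "(%y. ?a y *\<^sub>R \<bar>f y\<bar>) \<in> L2"
 proof (rule norm_cl_scale_bound(1)[OF _ am, of _ "sqrt K"])
  show "(%y. \<bar>f y\<bar>) \<in> L2"
   by (rule L2_dominated[OF f borel_measurable_abs[OF L2_measurable[OF f]], of 1]) simp
 qed (use K in simp_all)
 have aa: "cl ?a \<bullet> cl ?a = (\<integral>y. \<bar>\<kappa> (x - y)\<bar> \<partial>lebesgue)"
  by (subst inner_cl[OF a2 a2]) simp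
 have bb: "cl (%y. ?a y *\<^sub>R \<bar>f y\<bar>) \<bullet> cl (%y. ?a y *\<^sub>R \<bar>f y\<bar>) = (\<integral>y. \<bar>\<kappa> (x - y)\<bar> * (f y)\<^sup>2 \<partial>lebesgue)"
 proof -
  have "(sqrt \<bar>k\<bar> * \<bar>v\<bar>) * (sqrt \<bar>k\<bar> * \<bar>v\<bar>) = \<bar>k\<bar> * v\<^sup>2" for k v :: real
   by (simp add: power2_eq_square[symmetric] power_mult_distrib)
  then show ?thesis by (subst inner_cl[OF b2 b2]) simp
 qed
 have abp: "cl ?a \<bullet> cl (%y. ?a y *\<^sub>R \<bar>f y\<bar>) = (\<integral>y. \<bar>\<kappa> (x - y) * f y\<bar> \<partial>lebesgue)"
  by (subst inner_cl[OF a2 b2]) (simp add: abs_mult flip: mult.assoc)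
 have "integrable lebesgue (%y. (norm (?a y *\<^sub>R \<bar>f y\<bar>))\<^sup>2)" by (rule L2_integrable[OF b2])
 then show "integrable lebesgue (%y. \<bar>\<kappa> (x - y)\<bar> * (f y)\<^sup>2)"
  by (simp add: power_mult_distrib)
 have "\<bar>conv f \<kappa> x\<bar> <= cl ?a \<bullet> cl (%y. ?a y *\<^sub>R \<bar>f y\<bar>)"
  unfolding abp conv_def by (rule integral_abs_bound)
 then have "(conv f \<kappa> x)\<^sup>2 <= (cl ?a \<bullet> cl (%y. ?a y *\<^sub>R \<bar>f y\<bar>))\<^sup>2"
  by (rule power2_le_iff_abs_le[THEN iffD2, rotated]) (unfold abp, simp)
 also have "\<dots> <= (\<integral>y. \<bar>\<kappa> (x - y)\<bar> \<partial>lebesgue) * (\<integral>y. \<bar>\<kappa> (x - y)\<bar> * (f y)\<^sup>2 \<partial>lebesgue)"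
  unfolding aa[symmetric] bb[symmetric] by (rule Cauchy_Schwarz_ineq)
 also have "(\<integral>y. \<bar>\<kappa> (x - y)\<bar> \<partial>lebesgue) = (\<integral>y. \<bar>\<kappa> y\<bar> \<partial>lebesgue)"
  using integral_affine[of "%y. \<bar>\<kappa> y\<bar>" "-1" x] smooth_measurable[OF test_smooth[OF k]] by simp
 finally show "(conv f \<kappa> x)\<^sup>2 <= (\<integral>y. \<bar>\<kappa> y\<bar> \<partial>lebesgue) * (\<integral>y. \<bar>\<kappa> (x - y)\<bar> * (f y)\<^sup>2 \<partial>lebesgue)" .
qed

text \<open>Young's inequality. A Borel representative of \<open>f\<close> makes the integrand jointly measurable.\<close>

lemma conv_L2:
 assumes f: "f \<in> L2" and k: "\<kappa> \<in> test_functions"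
 shows "conv f \<kappa> \<in> L2" "norm (cl (conv f \<kappa>)) <= (\<integral>y. \<bar>\<kappa> y\<bar> \<partial>lebesgue) * norm (cl f)"
proof -
 define A where "A = (\<integral>y. \<bar>\<kappa> y\<bar> \<partial>lebesgue)"
 have A: "A >= 0" unfolding A_def by simp
 have cm: "conv f \<kappa> \<in> borel_measurable lebesgue"
  by (rule smooth_measurable[OF smooth_conv[OF L2_loc_integrable[OF f] k]])
 obtain g where g: "g \<in> borel_measurable lborel" "AE x in lborel. f x = g x"
  using completion_ex_borel_measurable_real[OF L2_measurable[OF f]] by blast
 have kb[measurable]: "\<kappa> \<in> borel_measurable borel"
  by (rule borel_measurable_continuous_onI[OF smooth_continuous[OF test_smooth[OF k]]])
 have gb[measurable]: "g \<in> borel_measurable borel" using g(1) by simp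
 have aeg: "AE x in lebesgue. f x = g x" using AE_completion[OF g(2)] .
 have P: "pair_sigma_finite (lborel :: R3 measure) (lborel :: R3 measure)" ..
 have kn: "(\<integral>\<^sup>+x. ennreal \<bar>\<kappa> (x - y)\<bar> \<partial>lborel) = ennreal A" for y
 proof -
  have m: "\<kappa> \<in> borel_measurable lebesgue" by (rule smooth_measurable[OF test_smooth[OF k]])
  have "(\<integral>\<^sup>+x. ennreal \<bar>\<kappa> (x - y)\<bar> \<partial>lborel) = (\<integral>\<^sup>+x. ennreal \<bar>\<kappa> (x - y)\<bar> \<partial>lebesgue)"
   by (simp add: nn_integral_completion)
  also have "\<dots> = (\<integral>\<^sup>+x. ennreal \<bar>\<kappa> x\<bar> \<partial>lebesgue)"
   using nn_integral_affine[of "%x. ennreal \<bar>\<kappa> x\<bar>" 1 "-y"] m by simp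
  also have "\<dots> = ennreal A" unfolding A_def
   by (rule nn_integral_eq_integral) (use test_integrable[OF k] in auto)
  finally show ?thesis .
 qed
 have step1: "ennreal ((conv f \<kappa> x)\<^sup>2) <= ennreal A * (\<integral>\<^sup>+y. ennreal (\<bar>\<kappa> (x - y)\<bar> * (g y)\<^sup>2) \<partial>lborel)" for x
 proof -
  have "ennreal ((conv f \<kappa> x)\<^sup>2) <= ennreal (A * (\<integral>y. \<bar>\<kappa> (x - y)\<bar> * (f y)\<^sup>2 \<partial>lebesgue))"
   unfolding A_def by (rule ennreal_leI[OF conv_pointwise_bound(1)[OF f k]])
  also have "\<dots> = ennreal A * (\<integral>\<^sup>+y. ennreal (\<bar>\<kappa> (x - y)\<bar> * (f y)\<^sup>2) \<partial>lebesgue)"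
   using nn_integral_eq_integral[OF conv_pointwise_bound(2)[OF f k, of x]] A by (simp add: ennreal_mult')
  also have "(\<integral>\<^sup>+y. ennreal (\<bar>\<kappa> (x - y)\<bar> * (f y)\<^sup>2) \<partial>lebesgue) = (\<integral>\<^sup>+y. ennreal (\<bar>\<kappa> (x - y)\<bar> * (g y)\<^sup>2) \<partial>lebesgue)"
   by (rule nn_integral_cong_AE) (use aeg in \<open>eventually_elim, simp\<close>)
  also have "\<dots> = (\<integral>\<^sup>+y. ennreal (\<bar>\<kappa> (x - y)\<bar> * (g y)\<^sup>2) \<partial>lborel)" by (rule nn_integral_completion)
  finally show ?thesis .
 qed
 have "(\<integral>\<^sup>+x. ennreal ((conv f \<kappa> x)\<^sup>2) \<partial>lebesgue) = (\<integral>\<^sup>+x. ennreal ((conv f \<kappa> x)\<^sup>2) \<partial>lborel)"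
  by (rule nn_integral_completion)
 also have "\<dots> <= (\<integral>\<^sup>+x. ennreal A * (\<integral>\<^sup>+y. ennreal (\<bar>\<kappa> (x - y)\<bar> * (g y)\<^sup>2) \<partial>lborel) \<partial>lborel)"
  by (rule nn_integral_mono) (rule step1)
 also have "\<dots> = ennreal A * (\<integral>\<^sup>+x. (\<integral>\<^sup>+y. ennreal (\<bar>\<kappa> (x - y)\<bar> * (g y)\<^sup>2) \<partial>lborel) \<partial>lborel)"
  by (rule nn_integral_cmult) measurable
 also have "(\<integral>\<^sup>+x. (\<integral>\<^sup>+y. ennreal (\<bar>\<kappa> (x - y)\<bar> * (g y)\<^sup>2) \<partial>lborel) \<partial>lborel)
   = (\<integral>\<^sup>+y. (\<integral>\<^sup>+x. ennreal (\<bar>\<kappa> (x - y)\<bar> * (g y)\<^sup>2) \<partial>lborel) \<partial>lborel)"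
  by (rule pair_sigma_finite.Fubini'[OF P, symmetric]) measurable
 also have "\<dots> = (\<integral>\<^sup>+y. ennreal A * ennreal ((g y)\<^sup>2) \<partial>lborel)"
 proof (rule nn_integral_cong)
  fix y
  have "(\<integral>\<^sup>+x. ennreal (\<bar>\<kappa> (x - y)\<bar> * (g y)\<^sup>2) \<partial>lborel)
    = (\<integral>\<^sup>+x. ennreal \<bar>\<kappa> (x - y)\<bar> * ennreal ((g y)\<^sup>2) \<partial>lborel)"
   by (simp add: ennreal_mult')
  also have "\<dots> = ennreal A * ennreal ((g y)\<^sup>2)"
   by (subst nn_integral_multc) (measurable, simp add: kn)
  finally show "(\<integral>\<^sup>+x. ennreal (\<bar>\<kappa> (x - y)\<bar> * (g y)\<^sup>2) \<partial>lborel) = ennreal A * ennreal ((g y)\<^sup>2)" .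
 qed
 also have "\<dots> = ennreal A * (\<integral>\<^sup>+y. ennreal ((g y)\<^sup>2) \<partial>lborel)"
  by (rule nn_integral_cmult) measurable
 also have "(\<integral>\<^sup>+y. ennreal ((g y)\<^sup>2) \<partial>lborel) = (\<integral>\<^sup>+y. ennreal ((g y)\<^sup>2) \<partial>lebesgue)"
  by (rule nn_integral_completion[symmetric])
 also have "\<dots> = (\<integral>\<^sup>+y. ennreal ((f y)\<^sup>2) \<partial>lebesgue)"
  by (rule nn_integral_cong_AE) (use aeg in \<open>eventually_elim, simp\<close>)
 also have "\<dots> = ennreal ((norm (cl f))\<^sup>2)"
  unfolding norm_cl_sq[OF f] using nn_integral_eq_integral[OF L2_integrable[OF f]] by simp
 finally have main: "(\<integral>\<^sup>+x. ennreal ((conv f \<kappa> x)\<^sup>2) \<partial>lebesgue) <= ennreal (A * (A * (norm (cl f))\<^sup>2))"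
  using A by (simp add: ennreal_mult')
 have int: "integrable lebesgue (%x. (conv f \<kappa> x)\<^sup>2)"
  unfolding integrable_iff_bounded using cm main by (auto intro: le_less_trans)
 then show c2: "conv f \<kappa> \<in> L2" using cm by (simp add: L2_iff)
 have "ennreal ((norm (cl (conv f \<kappa>)))\<^sup>2) <= ennreal (A * (A * (norm (cl f))\<^sup>2))"
  using main nn_integral_eq_integral[OF int] unfolding norm_cl_sq[OF c2] by simp
 then have "(norm (cl (conv f \<kappa>)))\<^sup>2 <= (A * norm (cl f))\<^sup>2"
  using A by (simp add: power2_eq_square ac_simps)
 then show "norm (cl (conv f \<kappa>)) <= (\<integral>y. \<bar>\<kappa> y\<bar> \<partial>lebesgue) * norm (cl f)"
  unfolding A_def[symmetric] by (rule power2_le_imp_le) (use A in simp)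
qed

section \<open>Approximation in \<open>L\<^sup>2\<close>\<close>

lemma L2_dominated_convergence:
 fixes f :: "R3 => 'b::euclidean_space"
 assumes f: "f \<in> borel_measurable lebesgue" and s: "!!n. s n \<in> borel_measurable lebesgue"
  and w: "w \<in> L2" and lim: "AE x in lebesgue. (%n. s n x) \<longlonglongrightarrow> f x"
  and bd: "!!n. AE x in lebesgue. norm (s n x) <= \<bar>w x :: real\<bar>"
 shows "f \<in> L2" "!!n. s n \<in> L2" "(%n. cl (s n)) \<longlonglongrightarrow> cl f"
proof -
 show s2: "s n \<in> L2" for n
  by (rule L2_dominated[OF w s, where K=1]) (use bd[of n] in simp)
 have "AE x in lebesgue. \<forall>n. norm (s n x) <= \<bar>w x\<bar>" using bd by (simp add: AE_all_countable)
 then have fb: "AE x in lebesgue. norm (f x) <= \<bar>w x\<bar>"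
  using lim
 proof eventually_elim
  case (elim x)
  show ?case by (rule Lim_bounded[OF tendsto_norm[OF elim(2)], of 0]) (use elim(1) in blast)
 qed
 then show f2: "f \<in> L2" by (intro L2_dominated[OF w f, where K=1]) simp
 have "(%n. \<integral>x. (norm (s n x - f x))\<^sup>2 \<partial>lebesgue) \<longlonglongrightarrow> (\<integral>x. 0 \<partial>(lebesgue::R3 measure))"
 proof (rule integral_dominated_convergence[where w="%x. 4 * (w x)\<^sup>2"])
  show "integrable lebesgue (%x. 4 * (w x)\<^sup>2)" using L2_integrable[OF w] by simp
  show "(%x. (norm (s n x - f x))\<^sup>2) \<in> borel_measurable lebesgue" for n using s f by measurable
  show "AE x in lebesgue. (%n. (norm (s n x - f x))\<^sup>2) \<longlonglongrightarrow> 0"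
   using lim
  proof eventually_elim
   case (elim x)
   have "(%n. (norm (s n x - f x))\<^sup>2) \<longlonglongrightarrow> (norm (f x - f x))\<^sup>2"
    by (intro tendsto_intros elim)
   then show ?case by simp
  qed
  show "AE x in lebesgue. norm ((norm (s n x - f x))\<^sup>2) <= 4 * (w x)\<^sup>2" for n
   using bd[of n] fb
  proof eventually_elim
   case (elim x)
   have "norm (s n x - f x) <= 2 * \<bar>w x\<bar>" using norm_triangle_ineq4[of "s n x" "f x"] elim by linarith
   then have "(norm (s n x - f x))\<^sup>2 <= (2 * \<bar>w x\<bar>)\<^sup>2" by (rule power_mono) simp
   then show ?case by (simp add: power_mult_distrib)
  qed
 qed simp
 then have "(%n. (norm (cl (s n) - cl f))\<^sup>2) \<longlonglongrightarrow> 0"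
  by (simp add: cl_diff[OF s2 f2, symmetric] norm_cl_sq[OF L2_diff[OF s2 f2]])
 then have "(%n. sqrt ((norm (cl (s n) - cl f))\<^sup>2)) \<longlonglongrightarrow> sqrt 0" by (rule tendsto_real_sqrt)
 then have "(%n. norm (cl (s n) - cl f)) \<longlonglongrightarrow> 0" by simp
 then show "(%n. cl (s n)) \<longlonglongrightarrow> cl f" using Lim_null tendsto_norm_zero_iff by blast
qed

lemma cutoff_at_L2:
 fixes F :: "R3 => real" assumes F: "F \<in> L2"
 shows "(%x. cutoff_at n x * F x) \<in> L2" "(%n. cl (%x. cutoff_at n x * F x)) \<longlonglongrightarrow> cl F"
proof -
 have m: "cutoff_at n \<in> borel_measurable lebesgue" for n by (rule smooth_measurable[OF test_smooth[OF cutoff_at_test]])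
 have Fm: "F \<in> borel_measurable lebesgue" by (rule L2_measurable[OF F])
 have 1: "(%x. cutoff_at n x * F x) \<in> borel_measurable lebesgue" for n
  by (rule borel_measurable_times[OF m Fm])
 have 2: "AE x in lebesgue. (%n. cutoff_at n x * F x) \<longlonglongrightarrow> F x"
  using tendsto_mult[OF cutoff_at_tendsto tendsto_const] by (intro AE_I2) fastforce
 have 3: "AE x in lebesgue. norm (cutoff_at n x * F x) <= \<bar>F x\<bar>" for n
  using mult_right_mono[OF cutoff_at_bounds] by (intro AE_I2) (fastforce simp: abs_mult)
 show "(%x. cutoff_at n x * F x) \<in> L2" "(%n. cl (%x. cutoff_at n x * F x)) \<longlonglongrightarrow> cl F"
  using L2_dominated_convergence[OF Fm 1 F 2 3] by auto
qed

text \<open>A measurable function is an almost everywhere limit of continuous ones, which may be truncated in size and in space.\<close>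

lemma L2_continuous_dense:
 fixes f :: "R3 => real"
 assumes f: "f \<in> L2" and e: "e > 0"
 obtains g R where "continuous_on UNIV g" "!!x. norm x > R ==> g x = 0" "g \<in> L2" "norm (cl f - cl g) < e" "R > 0"
proof -
 have fm: "f \<in> borel_measurable lebesgue" by (rule L2_measurable[OF f])
 have mc: "cutoff_at n \<in> borel_measurable lebesgue" for n by (rule smooth_measurable[OF test_smooth[OF cutoff_at_test]])
 define clamp where "clamp n t = max (- real n) (min (real n) t)" for n :: nat and t :: real
 have clamp_le: "\<bar>clamp n t\<bar> <= real n" "\<bar>clamp n t\<bar> <= \<bar>t\<bar>" for n t by (auto simp: clamp_def)
 have clamp_cont: "continuous_on UNIV (clamp n)" for n unfolding clamp_def by (intro continuous_intros)
 have clamp_m: "(%x. clamp n (h x)) \<in> borel_measurable lebesgue" if "h \<in> borel_measurable lebesgue" for n and h :: "R3 => real"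
  unfolding clamp_def using that by measurable
 define F where "F n x = cutoff_at n x * clamp n (f x)" for n x
 have Fm: "F n \<in> borel_measurable lebesgue" for n unfolding F_def by (rule borel_measurable_times[OF mc clamp_m[OF fm]])
 have F: "(%n. cl (F n)) \<longlonglongrightarrow> cl f" "!!n. F n \<in> L2"
 proof -
  have 2: "AE x in lebesgue. (%n. F n x) \<longlonglongrightarrow> f x"
  proof (rule AE_I2)
   fix x
   have "eventually (%n. clamp n (f x) = f x) sequentially"
    using eventually_ge_at_top[of "nat \<lceil>\<bar>f x\<bar>\<rceil>"]
    by eventually_elim (auto simp: clamp_def nat_le_iff ceiling_le_iff)
   then have "(%n. clamp n (f x)) \<longlonglongrightarrow> f x" by (rule tendsto_eventually)
   from tendsto_mult[OF cutoff_at_tendsto this] show "(%n. F n x) \<longlonglongrightarrow> f x" unfolding F_def by simp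
  qed
  have 3: "AE x in lebesgue. norm (F n x) <= \<bar>f x\<bar>" for n
  proof (rule AE_I2)
   fix x
   have "\<bar>F n x\<bar> <= 1 * \<bar>f x\<bar>" unfolding F_def abs_mult
    by (rule mult_mono[OF cutoff_at_bounds clamp_le(2)]) auto
   then show "norm (F n x) <= \<bar>f x\<bar>" by simp
  qed
  show "(%n. cl (F n)) \<longlonglongrightarrow> cl f" "!!n. F n \<in> L2"
   using L2_dominated_convergence[OF fm Fm f 2 3] by auto
 qed
 from LIMSEQ_D[OF F(1), of "e/2"] e obtain k where k: "norm (cl (F k) - cl f) < e/2" by auto
 obtain N g where N: "negligible N" and g: "!!n. continuous_on UNIV (g n)"
  and gl: "!!x. x \<notin> N ==> (%n. g n x) \<longlonglongrightarrow> (if x \<in> UNIV then f x else 0)"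
  using lebesgue_measurable_imp_measurable_on[OF fm, of UNIV] unfolding measurable_on_def by auto
 define G where "G n x = cutoff_at k x * clamp k (g n x)" for n x
 have Gc: "continuous_on UNIV (G n)" for n unfolding G_def
  by (intro continuous_on_mult smooth_continuous test_smooth cutoff_at_test continuous_on_compose2[OF clamp_cont g]) auto
 have aeN: "AE x in lebesgue. x \<notin> N" using N
  by (simp add: negligible_iff_null_sets AE_not_in)
 have lim: "AE x in lebesgue. (%n. G n x) \<longlonglongrightarrow> F k x"
  using aeN
 proof eventually_elim
  case (elim x)
  have "(%n. clamp k (g n x)) \<longlonglongrightarrow> clamp k (f x)"
   using gl[OF elim] unfolding clamp_def by (intro tendsto_intros) auto
  then show ?case unfolding G_def F_def by (intro tendsto_intros)
 qed
 have w: "(%x. cutoff_at k x * real k) \<in> L2"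
  using test_L2[OF test_cmult[OF cutoff_at_test, of "real k"]] by (simp add: mult.commute)
 have bd: "AE x in lebesgue. norm (G n x) <= \<bar>cutoff_at k x * real k\<bar>" for n
  by (rule AE_I2) (simp add: G_def abs_mult mult_left_mono clamp_le)
 have Gm: "G n \<in> borel_measurable lebesgue" for n by (rule continuous_measurable_lebesgue[OF Gc])
 note G = L2_dominated_convergence[OF Fm Gm w lim bd]
 from LIMSEQ_D[OF G(3), of "e/2"] e obtain n where n: "norm (cl (G n) - cl (F k)) < e/2" by auto
 obtain R where R: "R > 0" "!!x. norm x > R ==> cutoff_at k x = 0" using test_supportE[OF cutoff_at_test] by blast
 show ?thesis
 proof (rule that[OF Gc _ G(2), of R n])
  show "norm x > R ==> G n x = 0" for x using R by (simp add: G_def)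
  have "norm (cl f - cl (G n)) <= norm (cl (F k) - cl f) + norm (cl (G n) - cl (F k))"
   using norm_triangle_ineq[of "cl f - cl (F k)" "cl (F k) - cl (G n)"] by (simp add: norm_minus_commute)
  then show "norm (cl f - cl (G n)) < e" using k n by linarith
  show "R > 0" by fact
 qed
qed

lemma uniformly_close:
 fixes g :: "R3 => real"
 assumes c: "continuous_on UNIV g" and s: "!!x. norm x > R ==> g x = 0" and e: "e > 0"
 obtains d where "0 < d" "d <= 1" "!!x y. norm (x - y) < d ==> \<bar>g x - g y\<bar> < e"
proof -
 have "uniformly_continuous_on (cball 0 (R + 1)) g"
  by (rule compact_uniformly_continuous[OF continuous_on_subset[OF c]]) auto
 then obtain d where d: "d > 0" "!!x y. x \<in> cball 0 (R + 1) ==> y \<in> cball 0 (R + 1) ==> dist y x < d ==> dist (g y) (g x) < e"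
  using e unfolding uniformly_continuous_on_def by metis
 show ?thesis
 proof (rule that[of "min d 1"])
  fix x y :: R3 assume xy: "norm (x - y) < min d 1"
  have t: "norm x <= norm y + norm (x - y)" "norm y <= norm x + norm (x - y)"
   using norm_triangle_sub[of x y] norm_triangle_sub[of y x] by (simp_all add: norm_minus_commute)
  show "\<bar>g x - g y\<bar> < e"
  proof (cases "norm x <= R + 1 \<and> norm y <= R + 1")
   case True
   then show ?thesis using d(2)[of y x] xy by (simp add: dist_norm)
  next
   case False
   then have "norm x > R" "norm y > R" using t xy by auto
   then show ?thesis using s e by simp
  qed
 qed (use d in auto)
qed

lemma norm_cl_bounded_support:
 fixes f :: "R3 => real"
 assumes "f \<in> borel_measurable lebesgue" "!!x. norm x > R ==> f x = 0" "!!x. \<bar>f x\<bar> <= K"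
 shows "norm (cl f) <= K * sqrt (measure lebesgue (cball (0::R3) R))"
proof -
 have b: "f \<in> L2" by (rule bounded_support_integrable(2)[OF assms])
 have K: "K >= 0" using assms(3)[of 0] by simp
 have "(norm (cl f))\<^sup>2 = (\<integral>x. (norm (f x))\<^sup>2 \<partial>lebesgue)" by (rule norm_cl_sq[OF b])
 also have "\<dots> <= (\<integral>x. K\<^sup>2 * indicator (cball (0::R3) R) x \<partial>lebesgue)"
 proof (rule integral_mono[OF L2_integrable[OF b]])
  show "integrable lebesgue (%x. K\<^sup>2 * indicator (cball (0::R3) R) x)" using indicator_cball_integrable by simp
  show "(norm (f x))\<^sup>2 <= K\<^sup>2 * indicator (cball 0 R) x" for x
   using assms(2)[of x] power_mono[OF assms(3)[of x], of 2] by (auto split: split_indicator)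
 qed
 also have "\<dots> = (K * sqrt (measure lebesgue (cball (0::R3) R)))\<^sup>2"
  by (simp add: power_mult_distrib)
 finally show ?thesis by (rule power2_le_imp_le) (use K in simp)
qed

lemma conv_mollifier_uniform:
 assumes c: "continuous_on UNIV g" and g: "loc_integrable g"
  and close: "!!x y. norm (x - y) < d ==> \<bar>g x - g y\<bar> < e" and n: "3 / real (Suc n) < d"
 shows "\<bar>conv g (mollifier n) x - g x\<bar> <= e"
proof -
 have i1: "integrable lebesgue (%y. mollifier n (x - y) * g y)" by (rule conv_integrable[OF g mollifier_test])
 have i2: "integrable lebesgue (%y. mollifier n (x - y))" by (rule test_integrable[OF test_reflect[OF mollifier_test]])
 have one: "(\<integral>y. mollifier n (x - y) \<partial>lebesgue) = 1"
  using integral_affine[of "mollifier n" "-1" x] smooth_measurable[OF test_smooth[OF mollifier_test]]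
  by (simp add: mollifier_integral)
 have eq: "conv g (mollifier n) x - g x = (\<integral>y. mollifier n (x - y) * g y - mollifier n (x - y) * g x \<partial>lebesgue)"
  unfolding conv_def using i1 i2 one by simp
 have "\<bar>conv g (mollifier n) x - g x\<bar> <= (\<integral>y. \<bar>mollifier n (x - y) * g y - mollifier n (x - y) * g x\<bar> \<partial>lebesgue)"
  unfolding eq by (rule integral_abs_bound)
 also have "\<dots> <= (\<integral>y. e * mollifier n (x - y) \<partial>lebesgue)"
 proof (rule integral_mono)
  show "integrable lebesgue (%y. \<bar>mollifier n (x - y) * g y - mollifier n (x - y) * g x\<bar>)"
   using i1 i2 by (intro integrable_abs) simp
  show "integrable lebesgue (%y. e * mollifier n (x - y))" using i2 by simp
  fix y
  show "\<bar>mollifier n (x - y) * g y - mollifier n (x - y) * g x\<bar> <= e * mollifier n (x - y)"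
  proof (cases "norm (x - y) < d")
   case True
   have "\<bar>mollifier n (x - y) * (g y - g x)\<bar> <= mollifier n (x - y) * e"
    unfolding abs_mult using close[OF True] mollifier_nonneg[of n "x - y"]
    by (intro mult_mono) (auto simp: abs_minus_commute)
   then show ?thesis by (simp add: algebra_simps)
  next
   case False
   then have "mollifier n (x - y) = 0" by (intro mollifier_support) (use n in linarith)
   then show ?thesis by simp
  qed
 qed
 also have "\<dots> = e" using one by simp
 finally show ?thesis .
qed

lemma conv_support:
 assumes "!!x. norm x > R ==> g x = 0" "!!x. norm x > S ==> \<kappa> x = 0" "norm x > R + S"
 shows "conv g \<kappa> x = 0"
proof -
 have z: "\<kappa> (x - y) * g y = 0" for y
 proof (cases "norm y > R")
  case False
  have "norm x <= norm (x - y) + norm y" using norm_triangle_sub[of x y] by simp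
  then have "norm (x - y) > S" using False assms(3) by linarith
  then show ?thesis by (simp add: assms(2))
 qed (simp add: assms(1))
 show ?thesis unfolding conv_def z by simp
qed

text \<open>The convergence is uniform for continuous functions of bounded support. Density gives the general case, since Young's inequality bounds mollification by the norm.\<close>

lemma conv_mollifier_L2:
 assumes f: "f \<in> L2" shows "(%n. cl (conv f (mollifier n))) \<longlonglongrightarrow> cl f"
proof (rule LIMSEQ_I)
 fix e :: real assume e: "e > 0"
 obtain g R where g: "continuous_on UNIV g" "!!x. norm x > R ==> g x = 0" "g \<in> L2" "norm (cl f - cl g) < e/4" "R > 0"
  using L2_continuous_dense[OF f, of "e/4"] e by auto
 have gl: "loc_integrable g" by (rule L2_loc_integrable[OF g(3)])
 have fl: "loc_integrable f" by (rule L2_loc_integrable[OF f])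
 define m where "m = sqrt (measure lebesgue (cball (0::R3) (R + 3)))"
 have m: "m >= 0" by (simp add: m_def)
 define e' where "e' = (e / 4) / (m + 1)"
 have e': "e' > 0" using e m by (simp add: e'_def)
 obtain d where d: "0 < d" "!!x y. norm (x - y) < d ==> \<bar>g x - g y\<bar> < e'"
  using uniformly_close[OF g(1,2) e'] by blast
 obtain N where N: "3 / d < real N" using reals_Archimedean2 by blast
 show "\<exists>no. \<forall>n\<ge>no. norm (cl (conv f (mollifier n)) - cl f) < e"
 proof (intro exI allI impI)
  fix n assume n: "n >= N"
  have nd: "3 / real (Suc n) < d"
  proof -
   have "3 / d < real (Suc n)" using N n by simp
   then show ?thesis using d(1) by (simp add: field_simps)
  qed
  have t: "mollifier n \<in> test_functions" by (rule mollifier_test)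
  have ms: "mollifier n x = 0" if "norm x > 3" for x
  proof (rule mollifier_support)
   have "3 / real (Suc n) <= 3" by (simp add: divide_le_eq)
   then show "norm x > 3 / real (Suc n)" using that by linarith
  qed
  have cg2: "conv g (mollifier n) \<in> L2" by (rule conv_L2(1)[OF g(3) t])
  have cf2: "conv f (mollifier n) \<in> L2" by (rule conv_L2(1)[OF f t])
  have fg: "(%x. f x - g x) \<in> L2" by (rule L2_diff[OF f g(3)])
  have A: "norm (cl (conv g (mollifier n)) - cl g) <= e' * m"
   unfolding m_def cl_diff[OF cg2 g(3), symmetric]
  proof (rule norm_cl_bounded_support)
   show "(%x. conv g (mollifier n) x - g x) \<in> borel_measurable lebesgue"
    by (rule L2_measurable[OF L2_diff[OF cg2 g(3)]])
   show "conv g (mollifier n) x - g x = 0" if "norm x > R + 3" for x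
    using conv_support[of R g 3 "mollifier n" x, OF g(2) ms that] g(2)[of x] that by simp
   show "\<bar>conv g (mollifier n) x - g x\<bar> <= e'" for x
    by (rule conv_mollifier_uniform[OF g(1) gl d(2) nd])
  qed
  have "e' * m <= e' * (m + 1)" using e' m by simp
  also have "\<dots> = e/4"
  proof -
   have "m + 1 ~= 0" using m by simp
   moreover have "a / q * q = a" if "q ~= 0" for a q :: real using that by simp
   ultimately show ?thesis unfolding e'_def by blast
  qed
  finally have A': "norm (cl (conv g (mollifier n)) - cl g) <= e/4" using A by linarith
  have "cl (conv f (mollifier n)) - cl (conv g (mollifier n)) = cl (conv (%x. f x - g x) (mollifier n))"
   unfolding cl_diff[OF cf2 cg2, symmetric] by (simp add: conv_diff[OF fl gl t, symmetric, abs_def])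
  also have "norm \<dots> <= (\<integral>y. \<bar>mollifier n y\<bar> \<partial>lebesgue) * norm (cl (%x. f x - g x))"
   by (rule conv_L2(2)[OF fg t])
  also have "\<dots> = norm (cl f - cl g)"
   by (simp add: mollifier_nonneg mollifier_integral cl_diff[OF f g(3)])
  finally have B: "norm (cl (conv f (mollifier n)) - cl (conv g (mollifier n))) <= norm (cl f - cl g)" .
  have "norm (cl (conv f (mollifier n)) - cl f) <= norm (cl (conv f (mollifier n)) - cl (conv g (mollifier n)))
   + (norm (cl (conv g (mollifier n)) - cl g) + norm (cl g - cl f))"
   using norm_triangle_ineq[of "cl (conv f (mollifier n)) - cl (conv g (mollifier n))" "cl (conv g (mollifier n)) - cl f"]
    norm_triangle_ineq[of "cl (conv g (mollifier n)) - cl g" "cl g - cl f"] by simp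
  then show "norm (cl (conv f (mollifier n)) - cl f) < e"
   using A' B g(4) e by (simp add: norm_minus_commute[of "cl g"])
 qed
qed

lemma norm_tendsto_zero_iff: "((%n. f n) \<longlonglongrightarrow> (l::'a::real_normed_vector)) \<longleftrightarrow> (%n. norm (f n - l)) \<longlonglongrightarrow> 0"
 using Lim_null[of f l sequentially] tendsto_norm_zero_iff[of "%n. f n - l" sequentially] by simp

lemma L2_AE_subseq:
 fixes f :: "R3 => real"
 assumes f: "f \<in> L2" and s: "!!n. s n \<in> L2" and lim: "(%n. cl (s n)) \<longlonglongrightarrow> cl f"
 obtains r where "strict_mono r" "AE x in lebesgue. (%n. s (r n) x) \<longlonglongrightarrow> f x"
proof -
 have d: "(%x. s n x - f x) \<in> L2" for n by (rule L2_diff[OF s f])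
 have i: "integrable lebesgue (%x. (s n x - f x)\<^sup>2)" for n using L2_integrable[OF d[of n]] by simp
 have "(%n. (norm (cl (s n) - cl f))\<^sup>2) \<longlonglongrightarrow> 0\<^sup>2"
  using lim unfolding norm_tendsto_zero_iff[of "%n. cl (s n)"] by (rule tendsto_power)
 then have "(%n. \<integral>x. norm ((s n x - f x)\<^sup>2) \<partial>lebesgue) \<longlonglongrightarrow> 0"
  by (simp add: cl_diff[OF s f, symmetric] norm_cl_sq[OF d])
 from tendsto_L1_AE_subseq[OF i this]
 obtain r where r: "strict_mono r" "AE x in lebesgue. (%n. (s (r n) x - f x)\<^sup>2) \<longlonglongrightarrow> 0" by blast
 have "AE x in lebesgue. (%n. s (r n) x) \<longlonglongrightarrow> f x"
  using r(2)
 proof eventually_elim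
  case (elim x)
  have "(%n. sqrt ((s (r n) x - f x)\<^sup>2)) \<longlonglongrightarrow> sqrt 0" by (rule tendsto_real_sqrt[OF elim])
  then have "(%n. norm (s (r n) x - f x)) \<longlonglongrightarrow> 0" by simp
  then show ?case unfolding norm_tendsto_zero_iff[of "%n. s (r n) x"] .
 qed
 then show ?thesis using that r(1) by blast
qed

section \<open>Weak derivatives\<close>

text \<open>The sign of \<open>d\<close> on a ball is a bounded
 limit of test functions.\<close>

lemma fundamental_lemma_real:
 fixes d :: "R3 => real"
 assumes d: "loc_integrable d" and z: "!!\<phi>. \<phi> \<in> test_functions ==> (\<integral>x. \<phi> x * d x \<partial>lebesgue) = 0"
 shows "AE x in lebesgue. d x = 0"
proof -
 have dm: "d \<in> borel_measurable lebesgue" by (rule loc_integrable_measurable[OF d])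
 have "AE x in lebesgue. x \<in> cball 0 (real R) \<longrightarrow> d x = 0" for R :: nat
 proof -
  define s where "s x = sgn (d x) * indicator (cball 0 (real R)) x" for x
  have sm: "s \<in> borel_measurable lebesgue" unfolding s_def
   by (intro borel_measurable_times borel_measurable_indicator fmeasurableD[OF lmeasurable_cball])
    (use dm in measurable)
  have sb: "\<bar>s x\<bar> <= 1" for x by (auto simp: s_def sgn_if split: split_indicator)
  have ss: "s x = 0" if "norm x > real R" for x using that by (simp add: s_def)
  have s2: "s \<in> L2" by (rule bounded_support_integrable(2)[OF sm ss sb])
  have sl: "loc_integrable s" by (rule L2_loc_integrable[OF s2])
  let ?c = "%n. conv s (mollifier n)"
  have c2: "?c n \<in> L2" for n by (rule conv_L2(1)[OF s2 mollifier_test])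
  have ms: "mollifier n x = 0" if "norm x > 3" for x n
  proof (rule mollifier_support)
   have "3 / real (Suc n) <= 3" by (simp add: divide_le_eq)
   then show "norm x > 3 / real (Suc n)" using that by linarith
  qed
  have cs: "?c n x = 0" if "norm x > real R + 3" for n x
   by (rule conv_support[OF ss ms that])
  have ct: "?c n \<in> test_functions" for n
   unfolding test_iff using smooth_conv[OF sl mollifier_test] cs not_le by metis
  have cb: "\<bar>?c n x\<bar> <= 1" for n x
  proof -
   have one: "(\<integral>y. mollifier n (x - y) \<partial>lebesgue) = 1"
    using integral_affine[of "mollifier n" "-1" x] smooth_measurable[OF test_smooth[OF mollifier_test]]
    by (simp add: mollifier_integral)
   have "\<bar>?c n x\<bar> <= (\<integral>y. \<bar>mollifier n (x - y) * s y\<bar> \<partial>lebesgue)"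
    unfolding conv_def by (rule integral_abs_bound)
   also have "\<dots> <= (\<integral>y. mollifier n (x - y) \<partial>lebesgue)"
   proof (rule integral_mono)
    show "integrable lebesgue (%y. \<bar>mollifier n (x - y) * s y\<bar>)"
     by (rule integrable_abs[OF conv_integrable[OF sl mollifier_test]])
    show "integrable lebesgue (%y. mollifier n (x - y))"
     by (rule test_integrable[OF test_reflect[OF mollifier_test]])
    show "\<bar>mollifier n (x - y) * s y\<bar> <= mollifier n (x - y)" for y
     using mult_left_mono[OF sb mollifier_nonneg] mollifier_nonneg[of n "x - y"] by (simp add: abs_mult)
   qed
   finally show ?thesis using one by simp
  qed
  obtain r where r: "strict_mono r" "AE x in lebesgue. (%n. ?c (r n) x) \<longlonglongrightarrow> s x"
   by (rule L2_AE_subseq[OF s2 c2 conv_mollifier_L2[OF s2]])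
  have ib: "integrable lebesgue (%x. indicator (cball 0 r') x * \<bar>d x\<bar>)" for r'
   using integrable_norm[of lebesgue "%y. indicator (cball 0 r') y *\<^sub>R d y"] d compact_cball
   by (simp add: loc_integrable_def set_integrable_def abs_mult)
  have "(%n. \<integral>x. ?c (r n) x * d x \<partial>lebesgue) \<longlonglongrightarrow> (\<integral>x. s x * d x \<partial>lebesgue)"
  proof (rule integral_dominated_convergence[OF _ _ ib[of "real R + 3"]])
   show "(%x. s x * d x) \<in> borel_measurable lebesgue" using sm dm by measurable
   show "(%x. ?c (r n) x * d x) \<in> borel_measurable lebesgue" for n
    using L2_measurable[OF c2] dm by measurable
   show "AE x in lebesgue. (%n. ?c (r n) x * d x) \<longlonglongrightarrow> s x * d x"
    using r(2) by eventually_elim (intro tendsto_intros)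
   have "norm (?c (r n) x * d x) <= indicator (cball 0 (real R + 3)) x * \<bar>d x\<bar>" for n x
    using cs[of x "r n"] mult_right_mono[OF cb[of "r n" x], of "\<bar>d x\<bar>"] by (auto simp: abs_mult split: split_indicator)
   then show "AE x in lebesgue. norm (?c (r n) x * d x) <= indicator (cball 0 (real R + 3)) x * \<bar>d x\<bar>" for n
    by simp
  qed
  then have "(\<integral>x. s x * d x \<partial>lebesgue) = 0"
   using z[OF ct] LIMSEQ_unique[OF _ tendsto_const[of 0 sequentially]] by simp
  moreover have "(%x. s x * d x) = (%x. indicator (cball 0 (real R)) x * \<bar>d x\<bar>)"
   by (auto simp: s_def fun_eq_iff abs_sgn mult.commute split: split_indicator)
  ultimately have "(\<integral>x. indicator (cball 0 (real R)) x * \<bar>d x\<bar> \<partial>lebesgue) = 0" by simp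
  then have "AE x in lebesgue. indicator (cball 0 (real R)) x * \<bar>d x\<bar> = 0"
   by (subst (asm) integral_nonneg_eq_0_iff_AE[OF ib]) auto
  then show ?thesis by eventually_elim (auto split: split_indicator)
 qed
 then have "\<forall>R::nat. AE x in lebesgue. x \<in> cball 0 (real R) \<longrightarrow> d x = 0" by blast
 then have "AE x in lebesgue. \<forall>R::nat. x \<in> cball 0 (real R) \<longrightarrow> d x = 0" by (rule AE_all_countable[THEN iffD2])
 then show ?thesis
 proof eventually_elim
  case (elim x)
  obtain R where "norm x <= real R" using real_arch_simple by blast
  then show ?case using elim by auto
 qed
qed

lemma fundamental_lemma:
 fixes f g :: "R3 => 'b::euclidean_space"
 assumes f: "loc_integrable f" and g: "loc_integrable g"
  and eq: "!!\<phi>. \<phi> \<in> test_functions ==> (\<integral>x. \<phi> x *\<^sub>R f x \<partial>lebesgue) = (\<integral>x. \<phi> x *\<^sub>R g x \<partial>lebesgue)"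
 shows "AE x in lebesgue. f x = g x"
proof -
 have "AE x in lebesgue. (f x - g x) \<bullet> b = 0" for b :: 'b
 proof (rule fundamental_lemma_real)
  show "loc_integrable (%x. (f x - g x) \<bullet> b)"
   by (rule loc_integrable_bounded_linear[OF loc_integrable_diff[OF f g] bounded_linear_inner_left])
  fix \<phi> assume t: "\<phi> \<in> test_functions"
  have i: "integrable lebesgue (%x. \<phi> x *\<^sub>R f x)" "integrable lebesgue (%x. \<phi> x *\<^sub>R g x)"
   by (rule test_scale_integrable[OF f t], rule test_scale_integrable[OF g t])
  have "(\<integral>x. \<phi> x * ((f x - g x) \<bullet> b) \<partial>lebesgue) = (\<integral>x. (\<phi> x *\<^sub>R f x) \<bullet> b - (\<phi> x *\<^sub>R g x) \<bullet> b \<partial>lebesgue)"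
   by (simp add: inner_diff_left right_diff_distrib)
  also have "\<dots> = (\<integral>x. (\<phi> x *\<^sub>R f x) \<bullet> b \<partial>lebesgue) - (\<integral>x. (\<phi> x *\<^sub>R g x) \<bullet> b \<partial>lebesgue)"
   by (rule Bochner_Integration.integral_diff) (intro integrable_inner_left i)+
  also have "\<dots> = (\<integral>x. \<phi> x *\<^sub>R f x \<partial>lebesgue) \<bullet> b - (\<integral>x. \<phi> x *\<^sub>R g x \<partial>lebesgue) \<bullet> b"
   by (simp only: integral_inner_left[OF i(1)] integral_inner_left[OF i(2)])
  also have "\<dots> = 0" by (simp add: eq[OF t])
  finally show "(\<integral>x. \<phi> x * ((f x - g x) \<bullet> b) \<partial>lebesgue) = 0" .
 qed
 then have "AE x in lebesgue. \<forall>b\<in>Basis. (f x - g x) \<bullet> b = 0" by (intro AE_finite_allI) auto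
 then show ?thesis by eventually_elim (auto simp: euclidean_eq_iff[of "f _"] inner_diff_left)
qed

lemma exhaust_three: "(i::3) = 1 \<or> i = 2 \<or> i = 3" by (rule exhaust_3)

lemma multi_partial_axis: "multi_partial (axis i 1) \<phi> = partial i \<phi>"
 using exhaust_three[of i] by (auto simp: multi_partial_def axis_def)

lemma mi_order_axis: "mi_order (axis i k) = k"
 by (simp add: mi_order_def axis_def if_distrib cong: if_cong)

lemma mi_order_add: "mi_order (\<alpha> + \<beta>) = mi_order \<alpha> + mi_order \<beta>"
 by (simp add: mi_order_def sum.distrib)

lemma smooth_funpow: "smooth \<phi> ==> smooth ((partial j ^^ n) \<phi>)"
 by (induction n) (simp_all add: smooth_partial)

lemma partial_funpow: "smooth \<phi> ==> partial i ((partial j ^^ n) \<phi>) = (partial j ^^ n) (partial i \<phi>)"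
proof (induction n)
 case (Suc n)
 have "partial i ((partial j ^^ Suc n) \<phi>) = partial j (partial i ((partial j ^^ n) \<phi>))"
  using partial_commute[OF smooth_funpow[OF Suc.prems, where j=j and n=n], where i=i and j=j] by simp
 then show ?case using Suc by simp
qed simp

lemma multi_partial_add_axis:
 assumes "smooth \<phi>" shows "multi_partial (\<alpha> + axis i 1) \<phi> = multi_partial \<alpha> (partial i \<phi>)"
proof -
 note sm = smooth_funpow[OF assms]
 consider "i = 1" | "i = 2" | "i = 3" using exhaust_three by blast
 then show ?thesis
 proof cases
  case 1
  then show ?thesis
   using partial_funpow[OF smooth_funpow[OF sm], where i=1 and j=1 and n="\<alpha> $ 1"]
    partial_funpow[OF sm, where i=1 and j=2 and n="\<alpha> $ 2"] partial_funpow[OF assms, where i=1 and j=3 and n="\<alpha> $ 3"]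
   by (simp add: multi_partial_def axis_def)
 next
  case 2
  then show ?thesis
   using partial_funpow[OF sm, where i=2 and j=2 and n="\<alpha> $ 2"] partial_funpow[OF assms, where i=2 and j=3 and n="\<alpha> $ 3"]
   by (simp add: multi_partial_def axis_def)
 next
  case 3
  then show ?thesis
   using partial_funpow[OF assms, where i=3 and j=3 and n="\<alpha> $ 3"]
   by (simp add: multi_partial_def axis_def)
 qed
qed

lemma multi_partial_zero: "multi_partial 0 \<phi> = \<phi>" "mi_order 0 = 0"
 by (simp_all add: multi_partial_def mi_order_def)

lemma multi_partial_test: assumes "\<phi> \<in> test_functions" shows "multi_partial \<alpha> \<phi> \<in> test_functions"
proof -
 have "(partial j ^^ n) \<psi> \<in> test_functions" if "\<psi> \<in> test_functions" for j n \<psi>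
  using that by (induction n) (simp_all add: test_partial)
 then show ?thesis using assms by (simp add: multi_partial_def)
qed

lemma has_weak_deriv_unique:
 assumes "has_weak_deriv \<alpha> f g" "has_weak_deriv \<alpha> f h" shows "AE x in lebesgue. g x = h x"
proof (rule fundamental_lemma)
 show "loc_integrable g" "loc_integrable h" using assms by (auto simp: has_weak_deriv_def)
 fix \<phi> assume "\<phi> \<in> test_functions"
 then have "(-1::real) ^ mi_order \<alpha> *\<^sub>R (\<integral>x. \<phi> x *\<^sub>R g x \<partial>lebesgue) = (-1::real) ^ mi_order \<alpha> *\<^sub>R (\<integral>x. \<phi> x *\<^sub>R h x \<partial>lebesgue)"
  using assms by (simp add: has_weak_deriv_def)
 then show "(\<integral>x. \<phi> x *\<^sub>R g x \<partial>lebesgue) = (\<integral>x. \<phi> x *\<^sub>R h x \<partial>lebesgue)" by simp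
qed

lemma weak_deriv_works: "has_weak_deriv \<alpha> f g ==> has_weak_deriv \<alpha> f (weak_deriv \<alpha> f)"
 unfolding weak_deriv_def by (rule someI[of "has_weak_deriv \<alpha> f"])

lemma weak_deriv_AE: "has_weak_deriv \<alpha> f g ==> AE x in lebesgue. weak_deriv \<alpha> f x = g x"
 using has_weak_deriv_unique weak_deriv_works by blast

text \<open>First order weak derivatives in \<open>L\<^sup>2\<close> as a relation, free of a choice of representatives.\<close>

definition wd :: "3 => (R3 => real) => (R3 => real) => bool" where
 "wd i f g \<longleftrightarrow> f \<in> L2 \<and> g \<in> L2 \<and>
  (\<forall>\<phi>\<in>test_functions. (\<integral>x. partial i \<phi> x * f x \<partial>lebesgue) = - (\<integral>x. \<phi> x * g x \<partial>lebesgue))"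

lemma wd_L2: "wd i f g ==> f \<in> L2" "wd i f g ==> g \<in> L2" by (auto simp: wd_def)

lemma wd_iff_inner:
 "wd i f g \<longleftrightarrow> f \<in> L2 \<and> g \<in> L2 \<and> (\<forall>\<phi>\<in>test_functions. cl (partial i \<phi>) \<bullet> cl f = - (cl \<phi> \<bullet> cl g))"
 by (auto simp: wd_def inner_cl test_L2 test_partial)

lemma wd_cong_AE:
 assumes "wd i f g" "AE x in lebesgue. f x = f' x" "AE x in lebesgue. g x = g' x" shows "wd i f' g'"
 using assms cl_cong[OF wd_L2(1)[OF assms(1)] assms(2)] cl_cong[OF wd_L2(2)[OF assms(1)] assms(3)]
  L2_cong_AE[OF wd_L2(1)[OF assms(1)] assms(2)] L2_cong_AE[OF wd_L2(2)[OF assms(1)] assms(3)]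
 unfolding wd_iff_inner by simp

lemma wd_unique:
 assumes "wd i f g" "wd i f h" shows "AE x in lebesgue. g x = h x"
proof (rule fundamental_lemma)
 show "loc_integrable g" "loc_integrable h" using assms wd_L2 L2_loc_integrable by blast+
qed (use assms in \<open>auto simp: wd_def\<close>)

lemma wd_add: "wd i f g ==> wd i f' g' ==> wd i (%x. f x + f' x) (%x. g x + g' x)"
 by (simp add: wd_iff_inner cl_add L2_add inner_add_right)
lemma wd_diff: "wd i f g ==> wd i f' g' ==> wd i (%x. f x - f' x) (%x. g x - g' x)"
 by (simp add: wd_iff_inner cl_diff L2_diff inner_diff_right)

lemma conv_wd:
 assumes "wd i f g" "\<kappa> \<in> test_functions" shows "conv f (partial i \<kappa>) = conv g \<kappa>"
proof
 fix x
 have t: "(%y. \<kappa> (x - y)) \<in> test_functions" by (rule test_reflect[OF assms(2)])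
 have "(\<integral>y. partial i (%y. \<kappa> (x - y)) y * f y \<partial>lebesgue) = - (\<integral>y. \<kappa> (x - y) * g y \<partial>lebesgue)"
  using assms(1) t by (simp add: wd_def)
 then show "conv f (partial i \<kappa>) x = conv g \<kappa> x"
  by (simp add: conv_def partial_reflect[OF test_smooth[OF assms(2)]])
qed

lemma cutoff_partial_tendsto:
 assumes F: "F \<in> L2" and Fs: "smooth F" and dF: "partial i F \<in> L2"
 shows "(%k. cl (partial i (%x. cutoff_at k x * F x))) \<longlonglongrightarrow> cl (partial i F)"
proof -
 obtain C where C: "C > 0" "!!n i x. \<bar>partial i (cutoff_at n) x\<bar> <= C / real (Suc n)" using cutoff_at_partial by blast
 have pm: "partial i (cutoff_at k) \<in> borel_measurable lebesgue" for k
  by (rule smooth_measurable[OF smooth_partial[OF test_smooth[OF cutoff_at_test]]])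
 have b: "(%x. partial i (cutoff_at k) x *\<^sub>R F x) \<in> L2"
  "norm (cl (%x. partial i (cutoff_at k) x *\<^sub>R F x)) <= (C / real (Suc k)) * norm (cl F)" for k
 proof -
  have K: "0 <= C / real (Suc k)" using C(1) by simp
  have ae: "AE x in lebesgue. \<bar>partial i (cutoff_at k) x\<bar> <= C / real (Suc k)" by (rule AE_I2[OF C(2)])
  show "(%x. partial i (cutoff_at k) x *\<^sub>R F x) \<in> L2"
   "norm (cl (%x. partial i (cutoff_at k) x *\<^sub>R F x)) <= (C / real (Suc k)) * norm (cl F)"
   using norm_cl_scale_bound[OF F pm K ae] by auto
 qed
 have "partial i (%x. cutoff_at k x * F x) = (%x. partial i (cutoff_at k) x *\<^sub>R F x + cutoff_at k x * partial i F x)" for k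
  by (simp add: fun_eq_iff partial_mult smooth_differentiable Fs test_smooth cutoff_at_test)
 then have eq: "cl (partial i (%x. cutoff_at k x * F x)) = cl (%x. partial i (cutoff_at k) x *\<^sub>R F x) + cl (%x. cutoff_at k x * partial i F x)" for k
  by (simp only: cl_add[OF b(1) cutoff_at_L2(1)[OF dF]])
 have "(%k. (C / real (Suc k)) * norm (cl F)) \<longlonglongrightarrow> (C * 0) * norm (cl F)"
  unfolding divide_inverse by (intro tendsto_intros LIMSEQ_inverse_real_of_nat)
 then have "(%k. cl (%x. partial i (cutoff_at k) x *\<^sub>R F x)) \<longlonglongrightarrow> 0"
  by (intro Lim_null_comparison[OF eventuallyI[OF b(2)]]) simp
 from tendsto_add[OF this cutoff_at_L2(2)[OF dF]] show ?thesis unfolding eq by simp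
qed

text \<open>Mollification commutes with weak derivatives, and the gradient of a wide cutoff is small.\<close>

lemma H1_dense_eps:
 assumes f: "f \<in> L2" and g: "!!i. i \<in> I ==> wd i f (g i)" and e: "e > 0"
 obtains \<phi> where "\<phi> \<in> test_functions" "norm (cl \<phi> - cl f) < e"
  "!!i. i \<in> I ==> norm (cl (partial i \<phi>) - cl (g i)) < e"
proof -
 have fin: "finite I" by simp
 have fl: "loc_integrable f" by (rule L2_loc_integrable[OF f])
 have ev: "\<forall>\<^sub>F n in sequentially. norm (cl (conv h (mollifier n)) - cl h) < e/2" if "h \<in> L2" for h
  using tendstoD[OF conv_mollifier_L2[OF that], of "e/2"] e by (simp add: dist_norm)
 have "\<forall>\<^sub>F n in sequentially. \<forall>i\<in>I. norm (cl (conv (g i) (mollifier n)) - cl (g i)) < e/2"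
  by (rule eventually_ball_finite[OF fin]) (use ev g wd_L2 in blast)
 with ev[OF f] have "\<forall>\<^sub>F n in sequentially. norm (cl (conv f (mollifier n)) - cl f) < e/2 \<and>
   (\<forall>i\<in>I. norm (cl (conv (g i) (mollifier n)) - cl (g i)) < e/2)" by (rule eventually_conj)
 then obtain n where n: "norm (cl (conv f (mollifier n)) - cl f) < e/2"
  "!!i. i \<in> I ==> norm (cl (conv (g i) (mollifier n)) - cl (g i)) < e/2"
  by (auto simp: eventually_sequentially)
 let ?F = "conv f (mollifier n)"
 have F2: "?F \<in> L2" by (rule conv_L2(1)[OF f mollifier_test])
 have Fs: "smooth ?F" by (rule smooth_conv[OF fl mollifier_test])
 have pF: "partial i ?F = conv (g i) (mollifier n)" if "i \<in> I" for i
  unfolding partial_conv[OF fl mollifier_test] by (rule conv_wd[OF g[OF that] mollifier_test])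
 have pF2: "partial i ?F \<in> L2" if "i \<in> I" for i
  unfolding pF[OF that] by (rule conv_L2(1)[OF wd_L2(2)[OF g[OF that]] mollifier_test])
 define \<phi> where "\<phi> k x = cutoff_at k x * ?F x" for k x
 have \<phi>t: "\<phi> k \<in> test_functions" for k unfolding \<phi>_def by (rule test_mult_smooth[OF cutoff_at_test Fs])
 have lim0: "(%k. cl (\<phi> k)) \<longlonglongrightarrow> cl ?F" unfolding \<phi>_def by (rule cutoff_at_L2(2)[OF F2])
 have lim1: "(%k. cl (partial i (\<phi> k))) \<longlonglongrightarrow> cl (partial i ?F)" if i: "i \<in> I" for i
  unfolding \<phi>_def by (rule cutoff_partial_tendsto[OF F2 Fs pF2[OF i]])
 have ev1: "\<forall>\<^sub>F k in sequentially. norm (cl (\<phi> k) - cl ?F) < e/2"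
  using tendstoD[OF lim0, of "e/2"] e by (simp add: dist_norm)
 have "\<forall>\<^sub>F k in sequentially. \<forall>i\<in>I. norm (cl (partial i (\<phi> k)) - cl (partial i ?F)) < e/2"
  by (rule eventually_ball_finite[OF fin]) (use tendstoD[OF lim1, of _ "e/2"] e in \<open>simp add: dist_norm\<close>)
 with ev1 have "\<forall>\<^sub>F k in sequentially. norm (cl (\<phi> k) - cl ?F) < e/2 \<and>
   (\<forall>i\<in>I. norm (cl (partial i (\<phi> k)) - cl (partial i ?F)) < e/2)" by (rule eventually_conj)
 then obtain k where k: "norm (cl (\<phi> k) - cl ?F) < e/2"
  "!!i. i \<in> I ==> norm (cl (partial i (\<phi> k)) - cl (partial i ?F)) < e/2"
  by (auto simp: eventually_sequentially)
 have tri: "norm (a - c) < e" if "norm (a - b) < e/2" "norm (b - c) < e/2" for a b c :: "real hl"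
  using norm_triangle_ineq[of "a - b" "b - c"] that by simp
 show ?thesis
 proof (rule that[OF \<phi>t[of k]])
  show "norm (cl (\<phi> k) - cl f) < e" by (rule tri[OF k(1) n(1)])
  show "norm (cl (partial i (\<phi> k)) - cl (g i)) < e" if "i \<in> I" for i
   using tri[OF k(2)[OF that]] n(2)[OF that] unfolding pF[OF that] by blast
 qed
qed

lemma H1_dense:
 assumes f: "f \<in> L2" and g: "!!i. i \<in> I ==> wd i f (g i)"
 obtains \<phi> where "!!n. \<phi> n \<in> test_functions" "(%n::nat. cl (\<phi> n)) \<longlonglongrightarrow> cl f"
  "!!i. i \<in> I ==> (%n. cl (partial i (\<phi> n))) \<longlonglongrightarrow> cl (g i)"
proof -
 have "\<exists>\<phi>. \<phi> \<in> test_functions \<and> norm (cl \<phi> - cl f) < inverse (real (Suc n)) \<and>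
  (\<forall>i\<in>I. norm (cl (partial i \<phi>) - cl (g i)) < inverse (real (Suc n)))" for n
  by (rule H1_dense_eps[where e="inverse (real (Suc n))", OF f g]) auto
 then obtain \<phi> where \<phi>: "!!n. \<phi> n \<in> test_functions" "!!n. norm (cl (\<phi> n) - cl f) < inverse (real (Suc n))"
  "!!n i. i \<in> I ==> norm (cl (partial i (\<phi> n)) - cl (g i)) < inverse (real (Suc n))" by metis
 show ?thesis
 proof (rule that[OF \<phi>(1)])
  have "(%n. cl (\<phi> n) - cl f) \<longlonglongrightarrow> 0"
   by (rule Lim_null_comparison[OF eventuallyI LIMSEQ_inverse_real_of_nat]) (rule less_imp_le[OF \<phi>(2)])
  then show "(%n. cl (\<phi> n)) \<longlonglongrightarrow> cl f" by (rule LIM_zero_cancel)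
  show "(%n. cl (partial i (\<phi> n))) \<longlonglongrightarrow> cl (g i)" if "i \<in> I" for i
  proof -
   have "(%n. cl (partial i (\<phi> n)) - cl (g i)) \<longlonglongrightarrow> 0"
    by (rule Lim_null_comparison[OF eventuallyI LIMSEQ_inverse_real_of_nat]) (rule less_imp_le[OF \<phi>(3)[OF that]])
   then show ?thesis by (rule LIM_zero_cancel)
  qed
 qed
qed

lemma wd_by_parts:
 assumes f: "wd i f f'" and g: "wd i g g'" shows "cl f' \<bullet> cl g = - (cl f \<bullet> cl g')"
proof -
 obtain \<phi> where \<phi>: "!!n. \<phi> n \<in> test_functions" "(%n. cl (\<phi> n)) \<longlonglongrightarrow> cl g"
  "!!j. j \<in> {i} ==> (%n. cl (partial j (\<phi> n))) \<longlonglongrightarrow> cl g'"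
  by (rule H1_dense[of g "{i}" "%_. g'"]) (use g wd_L2 in auto)
 have "cl f' \<bullet> cl (\<phi> n) = - (cl f \<bullet> cl (partial i (\<phi> n)))" for n
  using f \<phi>(1)[of n] unfolding wd_iff_inner by (simp add: inner_commute)
 moreover have "(%n. cl f' \<bullet> cl (\<phi> n)) \<longlonglongrightarrow> cl f' \<bullet> cl g" by (intro tendsto_intros \<phi>(2))
 moreover have "(%n. - (cl f \<bullet> cl (partial i (\<phi> n)))) \<longlonglongrightarrow> - (cl f \<bullet> cl g')" by (intro tendsto_intros \<phi>(3)) simp
 ultimately show ?thesis using LIMSEQ_unique by (metis (no_types, lifting) ext)
qed

lemma wd_test_mult:
 assumes g: "wd i g g'" and t: "\<phi> \<in> test_functions"
 shows "wd i (%x. \<phi> x * g x) (%x. partial i \<phi> x * g x + \<phi> x * g' x)"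
proof -
 have m: "(%x. \<psi> x * h x) \<in> L2" if p: "\<psi> \<in> test_functions" and h: "h \<in> L2" for \<psi> h :: "R3 => real"
 proof -
  obtain K where K: "K > 0" "!!x. \<bar>\<psi> x\<bar> <= K" using test_bounded[OF p] by blast
  show ?thesis using norm_cl_scale_bound(1)[OF h smooth_measurable[OF test_smooth[OF p]], of K] K by simp
 qed
 note L = wd_L2[OF g]
 have "(\<integral>x. partial i \<psi> x * (\<phi> x * g x) \<partial>lebesgue) = - (\<integral>x. \<psi> x * (partial i \<phi> x * g x + \<phi> x * g' x) \<partial>lebesgue)"
  if p: "\<psi> \<in> test_functions" for \<psi>
 proof -
  have tt: "(%x. \<psi> x * \<phi> x) \<in> test_functions" by (rule test_mult_smooth[OF p test_smooth[OF t]])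
  have t1: "(%x. partial i \<psi> x * \<phi> x) \<in> test_functions" by (rule test_mult_smooth[OF test_partial[OF p] test_smooth[OF t]])
  have t2: "(%x. \<psi> x * partial i \<phi> x) \<in> test_functions" by (rule test_mult_smooth[OF p test_smooth[OF test_partial[OF t]]])
  have pp: "partial i (%x. \<psi> x * \<phi> x) = (%x. partial i \<psi> x * \<phi> x + \<psi> x * partial i \<phi> x)"
   by (simp add: fun_eq_iff partial_mult smooth_differentiable test_smooth p t)
  have i: "integrable lebesgue (%x. partial i \<psi> x * \<phi> x * g x)" "integrable lebesgue (%x. \<psi> x * partial i \<phi> x * g x)"
   "integrable lebesgue (%x. \<psi> x * \<phi> x * g' x)"
   by (rule test_times_integrable[OF L2_loc_integrable[OF L(1)] t1], rule test_times_integrable[OF L2_loc_integrable[OF L(1)] t2],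
     rule test_times_integrable[OF L2_loc_integrable[OF L(2)] tt])
  have "(\<integral>x. (partial i \<psi> x * \<phi> x + \<psi> x * partial i \<phi> x) * g x \<partial>lebesgue) = - (\<integral>x. \<psi> x * \<phi> x * g' x \<partial>lebesgue)"
   using bspec[OF conjunct2[OF conjunct2[OF g[unfolded wd_def]]] tt] unfolding pp .
  then have "(\<integral>x. partial i \<psi> x * \<phi> x * g x \<partial>lebesgue) + (\<integral>x. \<psi> x * partial i \<phi> x * g x \<partial>lebesgue) = - (\<integral>x. \<psi> x * \<phi> x * g' x \<partial>lebesgue)"
   using i by (simp add: distrib_right)
  then show ?thesis using i by (simp add: distrib_left mult.assoc)
 qed
 then show ?thesis unfolding wd_def using m[OF t L(1)] m[OF t L(2)] m[OF test_partial[OF t] L(1)] by (simp add: L2_add)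
qed

lemma wd_product:
 assumes f: "wd i f f'" and g: "wd i g g'" and A: "A >= 0" "AE x in lebesgue. \<bar>f x\<bar> <= A"
  and B: "B >= 0" "AE x in lebesgue. \<bar>g x\<bar> <= B"
 shows "wd i (%x. f x * g x) (%x. f' x * g x + f x * g' x)"
proof -
 note Lf = wd_L2[OF f] and Lg = wd_L2[OF g]
 have p1: "(%x. f x * g x) \<in> L2" "(%x. f x * g' x) \<in> L2"
  using norm_cl_scale_bound(1)[OF Lg(1) L2_measurable[OF Lf(1)] A] norm_cl_scale_bound(1)[OF Lg(2) L2_measurable[OF Lf(1)] A] by simp_all
 have p2: "(%x. f' x * g x) \<in> L2"
  using norm_cl_scale_bound(1)[OF Lf(2) L2_measurable[OF Lg(1)] B] by (simp add: mult.commute)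
 have "(\<integral>x. partial i \<phi> x * (f x * g x) \<partial>lebesgue) = - (\<integral>x. \<phi> x * (f' x * g x + f x * g' x) \<partial>lebesgue)"
  if t: "\<phi> \<in> test_functions" for \<phi>
 proof -
  note m = wd_test_mult[OF g t]
  have i: "integrable lebesgue (%x. partial i \<phi> x * (f x * g x))" "integrable lebesgue (%x. \<phi> x * (f x * g' x))"
   "integrable lebesgue (%x. \<phi> x * (f' x * g x))"
   by (rule test_times_integrable[OF L2_loc_integrable[OF p1(1)] test_partial[OF t]],
     rule test_times_integrable[OF L2_loc_integrable[OF p1(2)] t], rule test_times_integrable[OF L2_loc_integrable[OF p2] t])
  have "(\<integral>x. f' x * (\<phi> x * g x) \<partial>lebesgue) = - (\<integral>x. f x * (partial i \<phi> x * g x + \<phi> x * g' x) \<partial>lebesgue)"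
   using wd_by_parts[OF f m] by (simp add: inner_cl[OF Lf(2) wd_L2(1)[OF m]] inner_cl[OF Lf(1) wd_L2(2)[OF m]])
  also have "(%x. f x * (partial i \<phi> x * g x + \<phi> x * g' x)) = (%x. partial i \<phi> x * (f x * g x) + \<phi> x * (f x * g' x))"
   by (simp add: fun_eq_iff algebra_simps)
  also have "(%x. f' x * (\<phi> x * g x)) = (%x. \<phi> x * (f' x * g x))" by (simp add: fun_eq_iff ac_simps)
  finally show ?thesis using i by (simp add: distrib_left)
 qed
 then show ?thesis unfolding wd_def using p1 p2 by (simp add: L2_add)
qed

section \<open>Sobolev embedding\<close>

text \<open>All weak derivatives up to order \<open>k\<close> have \<open>L\<^sup>2\<close> norm at most \<open>K\<close>.\<close>

primrec W :: "nat => real => (R3 => real) => bool" where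
 "W 0 K f \<longleftrightarrow> f \<in> L2 \<and> norm (cl f) <= K"
| "W (Suc k) K f \<longleftrightarrow> f \<in> L2 \<and> norm (cl f) <= K \<and> (\<forall>i. \<exists>g. wd i f g \<and> W k K g)"

lemma W_L2: "W k K f ==> f \<in> L2" by (cases k) auto
lemma W_norm: "W k K f ==> norm (cl f) <= K" by (cases k) auto

lemma AE_swap: "AE x in M. f x = g x ==> AE x in M. g x = f x"
 by (erule eventually_mono) simp

definition unit_cube :: "R3 set" where "unit_cube = cbox 0 (\<chi> i. 1)"

lemma unit_cube_coord: "z \<in> unit_cube ==> \<bar>z $ i\<bar> <= 1"
 by (auto simp: unit_cube_def mem_box_cart)

lemma unit_cube_measure: "measure lebesgue unit_cube = 1"
proof -
 have "unit_cube ~= {}" by (auto simp: unit_cube_def mem_box_cart interval_ne_empty_cart)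
 then show ?thesis unfolding unit_cube_def using content_cbox_cart[of 0 "\<chi> i::3. 1"] by simp
qed

lemma cube_average_bound:
 fixes h w :: "R3 => real"
 assumes hc: "continuous_on UNIV h" and h: "h \<in> L2" and r: "r > 0"
  and wc: "continuous_on UNIV w" and w: "!!z. z \<in> unit_cube ==> \<bar>w z\<bar> <= 1"
 shows "\<bar>integral unit_cube (%z. w z * h (x + r *\<^sub>R z))\<bar> <= norm (cl h) / (r * sqrt r)"
proof -
 let ?a = "%z. indicator unit_cube z * w z" and ?b = "%z. h (x + r *\<^sub>R z)"
 have cm: "unit_cube \<in> sets lebesgue" unfolding unit_cube_def by simp
 have am: "?a \<in> borel_measurable lebesgue"
  by (intro borel_measurable_times borel_measurable_indicator cm continuous_measurable_lebesgue wc)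
 have ab: "\<bar>?a z\<bar> <= 1" for z using w by (auto split: split_indicator)
 have as: "?a z = 0" if "norm z > 3" for z
 proof -
  have "z \<notin> unit_cube"
  proof
   assume "z \<in> unit_cube"
   then have "norm z <= 3 * 1" by (intro norm_le_three unit_cube_coord)
   then show False using that by simp
  qed
  then show ?thesis by simp
 qed
 have a2: "?a \<in> L2" by (rule bounded_support_integrable(2)[OF am as ab])
 have hm: "(%x. (norm (h x))\<^sup>2) \<in> borel_measurable lebesgue"
  using continuous_measurable_lebesgue[OF hc] by measurable
 have b2: "?b \<in> L2" unfolding L2_iff
  using measurable_affine[OF continuous_measurable_lebesgue[OF hc], of r x] integrable_affine[OF L2_integrable[OF h], of r x] r by simp
 have "(norm (cl h))\<^sup>2 = r ^ 3 * (norm (cl ?b))\<^sup>2"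
  using integral_affine[OF hm, of r x] r by (simp add: norm_cl_sq[OF h] norm_cl_sq[OF b2])
 also have "\<dots> = (r * sqrt r * norm (cl ?b))\<^sup>2" using r by (simp add: power_mult_distrib power3_eq_cube power2_eq_square)
 finally have hb: "norm (cl h) = r * sqrt r * norm (cl ?b)"
  by (rule power2_eq_imp_eq) (use r in auto)
 have na: "norm (cl ?a) <= 1"
 proof -
  have "(norm (cl ?a))\<^sup>2 <= (\<integral>z. indicator unit_cube z \<partial>lebesgue)"
   unfolding norm_cl_sq[OF a2]
  proof (rule integral_mono[OF L2_integrable[OF a2]])
   show "integrable lebesgue (indicator unit_cube :: R3 => real)"
    using emeasure_lborel_cbox_finite[of "0::R3" "\<chi> i. 1"] by (simp add: integrable_indicator_iff unit_cube_def)
   show "(norm (indicator unit_cube z * w z))\<^sup>2 <= indicator unit_cube z" for z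
    using power_mono[OF w[of z] abs_ge_zero, of 2] by (auto split: split_indicator)
  qed
  also have "\<dots> = 1\<^sup>2" using unit_cube_measure cm by simp
  finally show ?thesis by (rule power2_le_imp_le) simp
 qed
 have cont: "continuous_on unit_cube (%z. w z * h (x + r *\<^sub>R z))"
  by (intro continuous_on_mult continuous_on_subset[OF wc] continuous_on_compose2[OF hc] continuous_intros) auto
 have si: "set_integrable lebesgue unit_cube (%z. w z * h (x + r *\<^sub>R z))"
  using borel_integrable_compact[of unit_cube "%z. w z * h (x + r *\<^sub>R z)"] cont
   integrable_completion[of "%z. indicator unit_cube z *\<^sub>R (w z * h (x + r *\<^sub>R z))" lborel]
  unfolding set_integrable_def unit_cube_def by (auto simp: if_distrib indicator_def cong: if_cong dest: borel_measurable_integrable)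
 have eq: "integral unit_cube (%z. w z * h (x + r *\<^sub>R z)) = cl ?a \<bullet> cl ?b"
  using set_lebesgue_integral_eq_integral(2)[OF si]
  by (simp add: inner_cl[OF a2 b2] set_lebesgue_integral_def mult.assoc)
 have "\<bar>integral unit_cube (%z. w z * h (x + r *\<^sub>R z))\<bar> <= norm (cl ?a) * norm (cl ?b)"
  unfolding eq by (rule Cauchy_Schwarz_ineq2)
 also have "\<dots> <= 1 * norm (cl ?b)" by (rule mult_right_mono[OF na]) simp
 also have "\<dots> = norm (cl h) / (r * sqrt r)" using r by (simp add: hb)
 finally show ?thesis .
qed

lemma smooth_line_deriv:
 assumes "smooth g"
 shows "((%r. g (x + r *\<^sub>R z)) has_real_derivative (\<Sum>i\<in>UNIV. z $ i * partial i g (x + r *\<^sub>R z))) (at r within S)"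
proof -
 have "((%r. x + r *\<^sub>R z) has_derivative (%h. h *\<^sub>R z)) (at r within S)"
  by (auto intro!: derivative_eq_intros)
 from has_derivative_compose[OF this smooth_has_derivative[OF assms]] show ?thesis
  unfolding has_field_derivative_def
  by (rule has_derivative_eq_rhs) (simp add: fun_eq_iff grad_def inner_vec_def sum_distrib_left mult_ac)
qed

text \<open>With \<open>\<Phi>(r) = \<integral>\<^sub>Q g(x+rz) - r z\<cdot>\<nabla>g(x+rz) dz\<close> over the unit cube \<open>Q\<close>, the first derivatives cancel in
 \<open>\<Phi>'(r)\<close>, which is thus bounded by \<open>r\<close> times averages of \<open>\<nabla>\<^sup>2g\<close> over cubes of side \<open>r\<close>. By Cauchy-Schwarz
 these are \<open>O(r\<^bsup>-3/2\<^esup>)\<close>, and \<open>r\<^bsup>-1/2\<^esup>\<close> is integrable at \<open>0\<close>, where \<open>\<Phi>(0) = g(x)\<close>.\<close>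

lemma sobolev_smooth:
 assumes g: "smooth g" and g0: "g \<in> L2" "norm (cl g) <= K"
  and g1: "!!i. partial i g \<in> L2" "!!i. norm (cl (partial i g)) <= K"
  and g2: "!!i j. partial j (partial i g) \<in> L2" "!!i j. norm (cl (partial j (partial i g))) <= K"
 shows "\<bar>g x\<bar> <= 22 * K"
proof -
 define F where "F r z = g (x + r *\<^sub>R z) - r * (\<Sum>i\<in>UNIV. z $ i * partial i g (x + r *\<^sub>R z))" for r :: real and z
 define F' where "F' r z = - r * (\<Sum>i\<in>UNIV. \<Sum>j\<in>UNIV. (z $ i * z $ j) * partial j (partial i g) (x + r *\<^sub>R z))" for r :: real and z
 have cg: "continuous_on UNIV g" "continuous_on UNIV (partial i g)" "continuous_on UNIV (partial j (partial i g))" for i j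
  by (intro smooth_continuous smooth_partial g)+
 have dF: "((%r. F r z) has_vector_derivative F' r z) (at r within {0..1})" for r z
 proof -
  have "((%r. F r z) has_real_derivative (\<Sum>i\<in>UNIV. z $ i * partial i g (x + r *\<^sub>R z))
    - (1 * (\<Sum>i\<in>UNIV. z $ i * partial i g (x + r *\<^sub>R z))
     + (\<Sum>i\<in>UNIV. z $ i * (\<Sum>j\<in>UNIV. z $ j * partial j (partial i g) (x + r *\<^sub>R z))) * r)) (at r within {0..1})"
   unfolding F_def
   by (intro DERIV_diff DERIV_mult DERIV_ident DERIV_sum DERIV_cmult smooth_line_deriv smooth_partial g)
  moreover have "(\<Sum>i\<in>UNIV. z $ i * partial i g (x + r *\<^sub>R z))
    - (1 * (\<Sum>i\<in>UNIV. z $ i * partial i g (x + r *\<^sub>R z))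
     + (\<Sum>i\<in>UNIV. z $ i * (\<Sum>j\<in>UNIV. z $ j * partial j (partial i g) (x + r *\<^sub>R z))) * r) = F' r z"
   by (simp add: F'_def sum_distrib_left mult.assoc mult.commute[of _ r] flip: sum_negf)
  ultimately show ?thesis by (simp add: has_real_derivative_iff_has_vector_derivative)
 qed
 have cF: "continuous_on unit_cube (F r)" for r unfolding F_def
  by (intro continuous_intros continuous_on_compose2[OF cg(1)] continuous_on_compose2[OF cg(2)]) auto
 have cF': "continuous_on (Sigma {0..1} (%_. unit_cube)) (%(r, z). F' r z)" unfolding F'_def case_prod_beta
  by (intro continuous_intros continuous_on_compose2[OF cg(3)]) auto
 define P where "P r = integral unit_cube (F r)" for r
 define P' where "P' r = integral unit_cube (F' r)" for r
 have dP: "(P has_vector_derivative P' r) (at r within {0..1})" if "r \<in> {0..1}" for r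
  unfolding P_def P'_def unit_cube_def
  by (rule leibniz_rule_vector_derivative[OF dF _ cF'[unfolded unit_cube_def] that])
    (use integrable_continuous[OF cF[unfolded unit_cube_def]] in auto)
 have P0: "P 0 = g x"
 proof -
  have "P 0 = integral unit_cube (%z. g x)" by (simp add: P_def F_def[abs_def])
  also have "\<dots> = measure lborel unit_cube *\<^sub>R g x" unfolding unit_cube_def by (rule integral_const)
  also have "measure lborel unit_cube = 1" using unit_cube_measure by (simp add: unit_cube_def)
  finally show ?thesis by simp
 qed
 have io: "h integrable_on unit_cube" if "continuous_on UNIV h" for h :: "R3 => real"
  unfolding unit_cube_def by (rule integrable_continuous[OF continuous_on_subset[OF that]]) simp
 have P1: "\<bar>P 1\<bar> <= 4 * K"
 proof -
  have i1: "(%z. z $ i * partial i g (x + 1 *\<^sub>R z)) integrable_on unit_cube" for i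
   by (rule io) (intro continuous_intros continuous_on_compose2[OF cg(2)], auto)
  have i0: "(%z. 1 * g (x + 1 *\<^sub>R z)) integrable_on unit_cube"
   by (rule io) (intro continuous_intros continuous_on_compose2[OF cg(1)], auto)
  have e: "P 1 = integral unit_cube (%z. 1 * g (x + 1 *\<^sub>R z)) - (\<Sum>i\<in>UNIV. integral unit_cube (%z. z $ i * partial i g (x + 1 *\<^sub>R z)))"
  proof -
   have "P 1 = integral unit_cube (%z. 1 * g (x + 1 *\<^sub>R z) - (\<Sum>i\<in>UNIV. z $ i * partial i g (x + 1 *\<^sub>R z)))"
    by (simp add: P_def F_def[abs_def])
   also have "\<dots> = integral unit_cube (%z. 1 * g (x + 1 *\<^sub>R z)) - integral unit_cube (%z. \<Sum>i\<in>UNIV. z $ i * partial i g (x + 1 *\<^sub>R z))"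
    by (rule Henstock_Kurzweil_Integration.integral_diff[OF i0 integrable_sum]) (use i1 in auto)
   finally show ?thesis by (subst (asm) integral_sum) (use i1 in auto)
  qed
  have "\<bar>integral unit_cube (%z. 1 * g (x + 1 *\<^sub>R z))\<bar> <= norm (cl g) / (1 * sqrt 1)"
   by (rule cube_average_bound[OF cg(1) g0(1)]) (auto intro: continuous_intros)
  then have a: "\<bar>integral unit_cube (%z. 1 * g (x + 1 *\<^sub>R z))\<bar> <= K" using g0(2) by simp
  have "\<bar>integral unit_cube (%z. z $ i * partial i g (x + 1 *\<^sub>R z))\<bar> <= norm (cl (partial i g)) / (1 * sqrt 1)" for i
   by (rule cube_average_bound[OF cg(2) g1(1)]) (auto intro: continuous_intros unit_cube_coord)
  then have b: "\<bar>integral unit_cube (%z. z $ i * partial i g (x + 1 *\<^sub>R z))\<bar> <= K" for i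
   using g1(2)[of i] order_trans by fastforce
  have "\<bar>\<Sum>i\<in>UNIV. integral unit_cube (%z. z $ i * partial i g (x + 1 *\<^sub>R z))\<bar> <= (\<Sum>i\<in>(UNIV::3 set). K)"
   by (rule order_trans[OF sum_abs sum_mono]) (rule b)
  then show ?thesis using a unfolding e by simp
 qed
 have P'_bound: "\<bar>P' r\<bar> <= 9 * K / sqrt r" if r: "r > 0" for r
 proof -
  have c: "continuous_on UNIV (%z::R3. z $ i * z $ j)" for i j by (intro continuous_intros)
  have ii: "(%z. (z $ i * z $ j) * partial j (partial i g) (x + r *\<^sub>R z)) integrable_on unit_cube" for i j
   by (rule io) (intro continuous_intros continuous_on_compose2[OF cg(3)], auto)
  have e: "P' r = - r * (\<Sum>i\<in>UNIV. \<Sum>j\<in>UNIV. integral unit_cube (%z. (z $ i * z $ j) * partial j (partial i g) (x + r *\<^sub>R z)))"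
   unfolding P'_def F'_def by (simp add: integral_sum ii integrable_sum)
  have b: "\<bar>integral unit_cube (%z. (z $ i * z $ j) * partial j (partial i g) (x + r *\<^sub>R z))\<bar> <= K / (r * sqrt r)" for i j
  proof -
   have w: "\<bar>z $ i * z $ j\<bar> <= 1" if "z \<in> unit_cube" for z
    using mult_mono[OF unit_cube_coord[OF that, of i] unit_cube_coord[OF that, of j]] by (simp add: abs_mult)
   show ?thesis
    by (rule order_trans[OF cube_average_bound[OF cg(3) g2(1) r c w]])
      (use r g2(2)[of j i] in \<open>auto intro: divide_right_mono\<close>)
  qed
  have "\<bar>\<Sum>i\<in>UNIV. \<Sum>j\<in>UNIV. integral unit_cube (%z. (z $ i * z $ j) * partial j (partial i g) (x + r *\<^sub>R z))\<bar>
    <= (\<Sum>i\<in>(UNIV::3 set). \<Sum>j\<in>(UNIV::3 set). K / (r * sqrt r))"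
   by (rule order_trans[OF sum_abs sum_mono]) (rule order_trans[OF sum_abs sum_mono], rule b)
  also have "\<dots> = 9 * (K / (r * sqrt r))" by simp
  finally have "r * \<bar>\<Sum>i\<in>UNIV. \<Sum>j\<in>UNIV. integral unit_cube (%z. (z $ i * z $ j) * partial j (partial i g) (x + r *\<^sub>R z))\<bar>
    <= r * (9 * (K / (r * sqrt r)))" by (rule mult_left_mono) (use r in simp)
  then show ?thesis using r unfolding e by (simp add: abs_mult)
 qed
 have Pc: "continuous_on {0..1} P"
  unfolding continuous_on_eq_continuous_within using has_vector_derivative_continuous[OF dP] by blast
 have Pd: "(P has_real_derivative P' r) (at r)" if "0 < r" "r < 1" for r
  using dP[of r] that at_within_Icc_at[of 0 r 1] by (simp add: has_real_derivative_iff_has_vector_derivative)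
 have sd: "((%r. 18 * K * sqrt r) has_real_derivative 9 * K / sqrt r) (at r)" if "r > 0" for r
  using that by (auto intro!: derivative_eq_intros simp: field_simps)
 have up: "P 1 - 18 * K * sqrt 1 <= P 0 - 18 * K * sqrt 0"
 proof (rule DERIV_nonpos_imp_decreasing_open[of 0 1 "%r. P r - 18 * K * sqrt r"])
  fix r :: real assume r: "0 < r" "r < 1"
  have "((%r. P r - 18 * K * sqrt r) has_real_derivative P' r - 9 * K / sqrt r) (at r)"
   by (intro DERIV_diff Pd sd r)
  moreover have "P' r - 9 * K / sqrt r <= 0" using P'_bound[OF r(1)] by linarith
  ultimately show "\<exists>y. ((%r. P r - 18 * K * sqrt r) has_real_derivative y) (at r) \<and> y <= 0" by blast
 qed (auto intro!: continuous_intros Pc)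
 have lo: "- P 1 - 18 * K * sqrt 1 <= - P 0 - 18 * K * sqrt 0"
 proof (rule DERIV_nonpos_imp_decreasing_open[of 0 1 "%r. - P r - 18 * K * sqrt r"])
  fix r :: real assume r: "0 < r" "r < 1"
  have "((%r. - P r - 18 * K * sqrt r) has_real_derivative - P' r - 9 * K / sqrt r) (at r)"
   by (intro DERIV_diff DERIV_minus Pd sd r)
  moreover have "- P' r - 9 * K / sqrt r <= 0" using P'_bound[OF r(1)] by linarith
  ultimately show "\<exists>y. ((%r. - P r - 18 * K * sqrt r) has_real_derivative y) (at r) \<and> y <= 0" by blast
 qed (auto intro!: continuous_intros Pc)
 show ?thesis using up lo P1 unfolding P0 by (simp add: abs_le_iff)
qed

lemma L2_limit_bounded:
 fixes f :: "R3 => real"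
 assumes "f \<in> L2" "!!n. s n \<in> L2" "(%n. cl (s n)) \<longlonglongrightarrow> cl f" "!!n x. \<bar>s n x\<bar> <= C"
 shows "AE x in lebesgue. \<bar>f x\<bar> <= C"
proof -
 obtain r where "strict_mono r" "AE x in lebesgue. (%n. s (r n) x) \<longlonglongrightarrow> f x"
  by (rule L2_AE_subseq[OF assms(1-3)])
 from this(2) show ?thesis
 proof eventually_elim
  case (elim x)
  have "(%n. \<bar>s (r n) x\<bar>) \<longlonglongrightarrow> \<bar>f x\<bar>" by (intro tendsto_intros elim)
  then show ?case by (rule Lim_bounded[of _ _ 0]) (use assms(4) in blast)
 qed
qed

lemma sobolev:
 assumes "W 2 K f" shows "AE x in lebesgue. \<bar>f x\<bar> <= 22 * K"
proof -
 have f: "f \<in> L2" "norm (cl f) <= K" using W_L2[OF assms] W_norm[OF assms] .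
 have fl: "loc_integrable f" by (rule L2_loc_integrable[OF f(1)])
 have "\<forall>i. \<exists>g. wd i f g \<and> W 1 K g" using assms by (simp add: numeral_2_eq_2)
 then obtain g where g: "!!i. wd i f (g i)" "!!i. W 1 K (g i)" by metis
 have "\<forall>i j. \<exists>h. wd j (g i) h \<and> W 0 K h" using g(2) by simp
 then obtain h where h: "!!i j. wd j (g i) (h i j)" "!!i j. W 0 K (h i j)" by metis
 note mt = mollifier_test
 have p1: "partial i (conv f (mollifier n)) = conv (g i) (mollifier n)" for i n
  unfolding partial_conv[OF fl mt] by (rule conv_wd[OF g(1) mt])
 have p2: "partial j (conv (g i) (mollifier n)) = conv (h i j) (mollifier n)" for i j n
  unfolding partial_conv[OF L2_loc_integrable[OF W_L2[OF g(2)]] mt] by (rule conv_wd[OF h(1) mt])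
 have nm: "conv k (mollifier n) \<in> L2" "norm (cl (conv k (mollifier n))) <= K" if "k \<in> L2" "norm (cl k) <= K" for k n
  using conv_L2[OF that(1) mt, of n] that(2) by (simp_all add: mollifier_nonneg mollifier_integral)
 have bd: "\<bar>conv f (mollifier n) x\<bar> <= 22 * K" for n x
  by (rule sobolev_smooth; (unfold p1 p2)?)
    (intro smooth_conv fl mt nm f W_L2[OF g(2)] W_norm[OF g(2)] W_L2[OF h(2)] W_norm[OF h(2)])+
 show ?thesis by (rule L2_limit_bounded[OF f(1) nm(1)[OF f] conv_mollifier_L2[OF f(1)] bd])
qed

section \<open>Curls of test fields are dense in the divergence-free fields\<close>

lemma norm_cl_nth_le: fixes F :: "R3 => R3" assumes "F \<in> L2" shows "norm (cl (%x. F x $ i)) <= norm (cl F)"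
 using norm_cl_le(2)[OF assms L2_measurable[OF L2_nth[OF assms]], of 1 i]
 by (simp add: component_le_norm_cart)

lemma norm_cl_vec_le: fixes F :: "R3 => R3" assumes "F \<in> L2"
 shows "norm (cl F) <= (\<Sum>i\<in>UNIV. norm (cl (%x. F x $ i)))"
proof -
 have a: "(%x. F x $ i *\<^sub>R axis i (1::real)) \<in> L2" for i
  by (rule L2_bounded_linear[OF L2_nth[OF assms] bounded_linear_scaleR_left])
 have n: "norm (cl (%x. F x $ i *\<^sub>R axis i (1::real) :: R3)) = norm (cl (%x. F x $ i))" for i
  by (simp add: norm_cl[OF a] norm_cl[OF L2_nth[OF assms]] norm_axis_1)
 have "F = (%x. \<Sum>i\<in>UNIV. F x $ i *\<^sub>R axis i (1::real))"
  by (simp add: fun_eq_iff vec_eq_iff axis_def if_distrib cong: if_cong)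
 then have eq: "cl F = (\<Sum>i\<in>UNIV. cl (%x. F x $ i *\<^sub>R axis i (1::real)))"
  using cl_sum[of UNIV "%i x. F x $ i *\<^sub>R axis i (1::real)", OF a] by simp
 have "norm (cl F) <= (\<Sum>i\<in>UNIV. norm (cl (%x. F x $ i *\<^sub>R axis i (1::real) :: R3)))"
  unfolding eq by (rule norm_sum)
 then show ?thesis by (simp only: n)
qed

definition test_curl :: "(3 => R3 => real) => R3 => R3" where
 "test_curl \<psi> x = vector [partial 2 (\<psi> 3) x - partial 3 (\<psi> 2) x,
   partial 3 (\<psi> 1) x - partial 1 (\<psi> 3) x, partial 1 (\<psi> 2) x - partial 2 (\<psi> 1) x]"

lemma test_curl_nth:
 "test_curl \<psi> x $ 1 = partial 2 (\<psi> 3) x - partial 3 (\<psi> 2) x"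
 "test_curl \<psi> x $ 2 = partial 3 (\<psi> 1) x - partial 1 (\<psi> 3) x"
 "test_curl \<psi> x $ 3 = partial 1 (\<psi> 2) x - partial 2 (\<psi> 1) x"
 by (simp_all add: test_curl_def vector_3)

lemma test_curl_test: assumes "!!k. \<psi> k \<in> test_functions" shows "(%x. test_curl \<psi> x $ k) \<in> test_functions"
proof -
 have "\<forall>k. (%x. test_curl \<psi> x $ k) \<in> test_functions"
  unfolding forall_3 test_curl_nth using assms by (auto intro!: test_diff test_partial)
 then show ?thesis by blast
qed

lemma test_curl_L2: assumes "!!k. \<psi> k \<in> test_functions" shows "test_curl \<psi> \<in> L2"
 using test_L2[OF test_curl_test[OF assms]] by (simp add: L2_vec_iff)

lemma step'_bound: obtains S where "S > 0" "!!t. step' t <= S"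
proof -
 have "compact (step' ` {-1..1})"
  by (intro compact_continuous_image continuous_on_subset[OF step'_continuous]) auto
 then obtain K where K: "!!y. y \<in> step' ` {-1..1} ==> norm y <= K"
  using compact_imp_bounded bounded_iff by metis
 have "step' t <= max K 1" for t
 proof (cases "\<bar>t\<bar> >= 1")
  case True then show ?thesis using step'_outside by simp
 next
  case False
  then have "norm (step' t) <= K" by (intro K imageI) auto
  then show ?thesis by simp
 qed
 then show ?thesis using that[of "max K 1"] by simp
qed

lemma prod_three: "(\<Prod>i\<in>(UNIV::3 set). f i) = f 1 * f 2 * (f 3 :: real)"
 unfolding UNIV_3 by (simp add: mult.assoc)

lemma cbox_sym_volume: "(\<Prod>i\<in>(UNIV::3 set). (vector [a, b, c] :: R3) $ i - (- vector [a, b, c]) $ i) = 8 * (a * b * c)" for a b c :: real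
 unfolding prod_three vector_uminus_component vector_3 by (simp add: algebra_simps)

lemma cbox_sym_mem: "x \<in> cbox (- vector [a, b, c]) (vector [a, b, c] :: R3) \<longleftrightarrow> \<bar>x $ 1\<bar> <= a \<and> \<bar>x $ 2\<bar> <= b \<and> \<bar>x $ 3\<bar> <= c"
 by (auto simp: mem_box_cart forall_3 vector_3)

lemma bump_upper:
 assumes S: "S > 0" "!!t. step' t <= S" and L: "L > 0" and e: "e > 0"
 shows "bump L e x <= S^3 / (L * e * e)"
proof -
 have "bump L e x <= (S / L) * (S / e) * (S / e)" unfolding bump_def
  by (intro mult_mono divide_right_mono mult_nonneg_nonneg divide_nonneg_pos step'_nonneg) (use S L e less_imp_le in auto)
 then show ?thesis by (simp add: power3_eq_cube)
qed

lemma bump_L1: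
 assumes S: "S > 0" "!!t. step' t <= S" and L: "L > 0" and e: "e > 0"
 shows "(\<integral>y. \<bar>bump L e y\<bar> \<partial>lebesgue) <= 8 * S^3"
proof -
 have "(\<integral>y. \<bar>bump L e y\<bar> \<partial>lebesgue) <= (S^3 / (L * e * e)) * (\<Prod>i\<in>UNIV. (vector [L, e, e] :: R3) $ i - (- vector [L, e, e]) $ i)"
 proof (rule box_bound(2))
  show "(%y. \<bar>bump L e y\<bar>) \<in> borel_measurable lebesgue"
   using smooth_measurable[OF bump_smooth] by measurable
  show "\<bar>bump L e x\<bar> = 0" if "x \<notin> cbox (- vector [L, e, e]) (vector [L, e, e])" for x
   using bump_support[OF L e, of x] that unfolding cbox_sym_mem by auto
  show "\<bar>\<bar>bump L e x\<bar>\<bar> <= S^3 / (L * e * e)" for x using bump_upper[OF assms] bump_nonneg[OF L e, of x] by simp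
  have "0 \<in> cbox (- vector [L, e, e]) (vector [L, e, e] :: R3)" unfolding cbox_sym_mem using L e by simp
  then show "cbox (- vector [L, e, e]) (vector [L, e, e] :: R3) ~= {}" by blast
 qed
 then show ?thesis unfolding cbox_sym_volume using L e by simp
qed

text \<open>A bump that is stretched in one direction smears \<open>f\<close> out: the amplitude decays like \<open>1/L\<close> on a
 support of volume \<open>O(L)\<close>.\<close>

lemma conv_bump_vanishes:
 assumes f: "f \<in> L2" and e: "e > 0"
 shows "(%n. cl (conv f (bump (real (Suc n)) e))) \<longlonglongrightarrow> 0"
proof (rule LIMSEQ_I)
 fix d :: real assume d: "d > 0"
 obtain S where S: "S > 0" "!!t. step' t <= S" using step'_bound by blast
 define Y where "Y = 8 * S^3 + 1"
 have Y: "Y > 0" using S(1) by (simp add: Y_def add_pos_pos)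
 obtain g R where g: "continuous_on UNIV g" "!!x. norm x > R ==> g x = 0" "g \<in> L2" "norm (cl f - cl g) < d / (2 * Y)" "R > 0"
  using L2_continuous_dense[OF f, of "d / (2 * Y)"] d Y by auto
 have gl: "loc_integrable g" "loc_integrable f" using L2_loc_integrable g(3) f by blast+
 have gm: "g \<in> borel_measurable lebesgue" by (rule L2_measurable[OF g(3)])
 obtain Kg where Kg: "Kg > 0" "!!x. \<bar>g x\<bar> <= Kg" using continuous_support_bounded[OF g(1,2)] by blast
 have gi: "integrable lebesgue g" by (rule bounded_support_integrable(1)[OF gm g(2) Kg(2)])
 define G where "G = (\<integral>y. \<bar>g y\<bar> \<partial>lebesgue)"
 have G: "G >= 0" by (simp add: G_def)
 define C where "C = (S^3 / (e * e) * G)\<^sup>2 * (8 * ((1 + R) * (e + R) * (e + R)))"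
 have C: "C >= 0" unfolding C_def using e g(5) by (intro mult_nonneg_nonneg) auto
 have est: "(norm (cl (conv g (bump L e))))\<^sup>2 <= C / L" if L: "L >= 1" for L
 proof -
  have L0: "L > 0" using L by simp
  have bt: "bump L e \<in> test_functions" by (rule bump_test[OF L0 e])
  have c2: "conv g (bump L e) \<in> L2" by (rule conv_L2(1)[OF g(3) bt])
  define A where "A = S^3 / (L * e * e) * G"
  have A: "A >= 0" unfolding A_def using S L0 e G by simp
  have cb: "\<bar>conv g (bump L e) x\<bar> <= A" for x
  proof -
   have "\<bar>conv g (bump L e) x\<bar> <= (\<integral>y. \<bar>bump L e (x - y) * g y\<bar> \<partial>lebesgue)"
    unfolding conv_def by (rule integral_abs_bound)
   also have "\<dots> <= (\<integral>y. (S^3 / (L * e * e)) * \<bar>g y\<bar> \<partial>lebesgue)"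
   proof (rule integral_mono)
    show "integrable lebesgue (%y. \<bar>bump L e (x - y) * g y\<bar>)"
     by (rule integrable_abs[OF conv_integrable[OF gl(1) bt]])
    show "integrable lebesgue (%y. (S^3 / (L * e * e)) * \<bar>g y\<bar>)" using gi by simp
    show "\<bar>bump L e (x - y) * g y\<bar> <= (S^3 / (L * e * e)) * \<bar>g y\<bar>" for y
     unfolding abs_mult using bump_upper[OF S L0 e, of "x - y"] bump_nonneg[OF L0 e, of "x - y"]
     by (intro mult_right_mono) auto
   qed
   also have "\<dots> = A" by (simp add: A_def G_def)
   finally show ?thesis .
  qed
  have cs: "conv g (bump L e) x = 0" if x: "x \<notin> cbox (- vector [L + R, e + R, e + R]) (vector [L + R, e + R, e + R])" for x
  proof -
   have z: "bump L e (x - y) * g y = 0" for y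
   proof (rule ccontr)
    assume "bump L e (x - y) * g y ~= 0"
    then have nz: "bump L e (x - y) ~= 0" "\<not> norm y > R" using g(2) by auto
    have yR: "\<bar>y $ i\<bar> <= R" for i using component_le_norm_cart[of y i] nz(2) by linarith
    have "\<bar>x $ 1\<bar> <= L + R" "\<bar>x $ 2\<bar> <= e + R" "\<bar>x $ 3\<bar> <= e + R"
     using bump_support[OF L0 e nz(1)] yR[of 1] yR[of 2] yR[of 3] unfolding vector_minus_component by linarith+
    then show False using x unfolding cbox_sym_mem by blast
   qed
   show ?thesis unfolding conv_def z by simp
  qed
  have "(norm (cl (conv g (bump L e))))\<^sup>2 = (\<integral>x. (norm (conv g (bump L e) x))\<^sup>2 \<partial>lebesgue)" by (rule norm_cl_sq[OF c2])
  also have "\<dots> <= A\<^sup>2 * (\<Prod>i\<in>UNIV. (vector [L + R, e + R, e + R] :: R3) $ i - (- vector [L + R, e + R, e + R]) $ i)"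
  proof (rule box_bound(2))
   show "(%x. (norm (conv g (bump L e) x))\<^sup>2) \<in> borel_measurable lebesgue" using L2_measurable[OF c2] by measurable
   show "(norm (conv g (bump L e) x))\<^sup>2 = 0" if "x \<notin> cbox (- vector [L + R, e + R, e + R]) (vector [L + R, e + R, e + R])" for x
    using cs[OF that] by simp
   show "\<bar>(norm (conv g (bump L e) x))\<^sup>2\<bar> <= A\<^sup>2" for x using power_mono[OF cb abs_ge_zero, of x 2] by simp
   have "0 \<in> cbox (- vector [L + R, e + R, e + R]) (vector [L + R, e + R, e + R] :: R3)" unfolding cbox_sym_mem using L0 e g(5) by simp
   then show "cbox (- vector [L + R, e + R, e + R]) (vector [L + R, e + R, e + R] :: R3) ~= {}" by blast
  qed
  also have "\<dots> = A\<^sup>2 * (8 * ((L + R) * (e + R) * (e + R)))" by (simp only: cbox_sym_volume)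
  also have "\<dots> <= A\<^sup>2 * (8 * ((L * (1 + R)) * (e + R) * (e + R)))"
  proof -
   have "L + R <= L * (1 + R)" using L g(5) by (simp add: distrib_left)
   then show ?thesis using e g(5) by (intro mult_left_mono mult_right_mono) auto
  qed
  also have "\<dots> = C / L"
  proof -
   have "(Z / L)\<^sup>2 * (8 * ((L * r) * s * s)) = Z\<^sup>2 * (8 * (r * s * s)) / L" for Z r s :: real
    using L0 by (simp add: power2_eq_square)
   moreover have "A = (S^3 / (e * e) * G) / L" by (simp add: A_def)
   ultimately show ?thesis by (simp only: C_def)
  qed
  finally show ?thesis .
 qed
 obtain N where N: "4 * C / d\<^sup>2 < real N" using reals_Archimedean2 by blast
 show "\<exists>no. \<forall>n\<ge>no. norm (cl (conv f (bump (real (Suc n)) e)) - 0) < d"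
 proof (intro exI allI impI)
  fix n assume n: "n >= N"
  let ?L = "real (Suc n)"
  have bt: "bump ?L e \<in> test_functions" by (rule bump_test) (use e in auto)
  have fg: "(%x. f x - g x) \<in> L2" by (rule L2_diff[OF f g(3)])
  have cf: "conv f (bump ?L e) \<in> L2" "conv g (bump ?L e) \<in> L2" using conv_L2(1)[OF f bt] conv_L2(1)[OF g(3) bt] .
  have "(norm (cl (conv g (bump ?L e))))\<^sup>2 <= C / ?L" by (rule est) simp
  also have "\<dots> < (d/2)\<^sup>2"
  proof -
   have "4 * C / d\<^sup>2 < ?L" using N n by simp
   then show ?thesis using d by (simp add: field_simps power2_eq_square)
  qed
  finally have b1: "norm (cl (conv g (bump ?L e))) < d/2" by (rule power2_less_imp_less) (use d in simp)
  have "cl (conv f (bump ?L e)) - cl (conv g (bump ?L e)) = cl (conv (%x. f x - g x) (bump ?L e))"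
   unfolding cl_diff[OF cf, symmetric]
   by (rule arg_cong[where f=cl], rule ext, rule conv_diff[OF gl(2) gl(1) bt, symmetric])
  then have "norm (cl (conv f (bump ?L e)) - cl (conv g (bump ?L e))) <= (\<integral>y. \<bar>bump ?L e y\<bar> \<partial>lebesgue) * norm (cl (%x. f x - g x))"
   using conv_L2(2)[OF fg bt] by simp
  also have "\<dots> <= Y * norm (cl f - cl g)"
   unfolding cl_diff[OF f g(3)] using bump_L1[OF S, of ?L e] e by (intro mult_right_mono) (auto simp: Y_def)
  also have "\<dots> <= Y * (d / (2 * Y))" using g(4) Y by (intro mult_left_mono) auto
  also have "\<dots> = d/2" using Y by simp
  finally have "norm (cl (conv f (bump ?L e)) - cl (conv g (bump ?L e))) <= d/2" .
  then show "norm (cl (conv f (bump (real (Suc n)) e)) - 0) < d"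
   using b1 norm_triangle_ineq[of "cl (conv f (bump ?L e)) - cl (conv g (bump ?L e))" "cl (conv g (bump ?L e))"] by simp
 qed
qed

lemma conv_divide: "conv f (%x. \<kappa> x / c) x = conv f \<kappa> x / c"
 by (simp add: conv_def)

lemma div_free_conv:
 assumes v: "v \<in> L2" "div_free v" and k: "\<kappa> \<in> test_functions"
 shows "conv (%x. v x $ 1) (partial 1 \<kappa>) x + conv (%x. v x $ 2) (partial 2 \<kappa>) x + conv (%x. v x $ 3) (partial 3 \<kappa>) x = 0"
proof -
 have t: "(%y. \<kappa> (x - y)) \<in> test_functions" by (rule test_reflect[OF k])
 have i: "integrable lebesgue (%y. partial j \<kappa> (x - y) * v y $ j)" for j
  by (rule conv_integrable[OF L2_loc_integrable[OF L2_nth[OF v(1)]] test_partial[OF k]])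
 have "(\<integral>y. v y \<bullet> grad (%y. \<kappa> (x - y)) y \<partial>lebesgue) = 0" using v(2) t by (simp add: div_free_def)
 moreover have "v y \<bullet> grad (%y. \<kappa> (x - y)) y = - (partial 1 \<kappa> (x - y) * v y $ 1) - partial 2 \<kappa> (x - y) * v y $ 2 - partial 3 \<kappa> (x - y) * v y $ 3" for y
  by (simp add: inner_vec_def sum_3 grad_def partial_reflect[OF test_smooth[OF k]] mult.commute)
 ultimately have "(\<integral>y. - (partial 1 \<kappa> (x - y) * v y $ 1) - partial 2 \<kappa> (x - y) * v y $ 2 - partial 3 \<kappa> (x - y) * v y $ 3 \<partial>lebesgue) = 0"
  by simp
 then show ?thesis using i by (simp add: conv_def)
qed

text \<open>Mollify \<open>v\<close>, and replace the mollifier by one that is stretched far in the first direction.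
 The difference of the two kernels is \<open>\<partial>\<^sub>1\<kappa>\<close>, and for the divergence-free field \<open>w = v * \<kappa>\<close> one has
 \<open>\<partial>\<^sub>1 w = - curl (e\<^sub>1 \<times> w)\<close>; the part with the stretched kernel is small.\<close>

lemma test_curl_dense:
 assumes v: "v \<in> L2" "div_free v" and e: "e > 0"
 obtains \<psi> where "!!k. \<psi> k \<in> test_functions" "norm (cl v - cl (test_curl \<psi>)) < e"
proof -
 have v2: "(%x. v x $ k) \<in> L2" for k by (rule L2_nth[OF v(1)])
 have vl: "loc_integrable (%x. v x $ k)" for k by (rule L2_loc_integrable[OF v2])
 define d where "d = e / 9"
 have d: "d > 0" using e by (simp add: d_def)
 have "\<forall>\<^sub>F n in sequentially. \<forall>k\<in>(UNIV::3 set). norm (cl (conv (%x. v x $ k) (mollifier n)) - cl (%x. v x $ k)) < d"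
  by (rule eventually_ball_finite) (use tendstoD[OF conv_mollifier_L2[OF v2] d] in \<open>auto simp: dist_norm\<close>)
 then obtain n where n: "!!k. norm (cl (conv (%x. v x $ k) (mollifier n)) - cl (%x. v x $ k)) < d"
  by (auto simp: eventually_sequentially)
 define \<epsilon> where "\<epsilon> = 1 / real (Suc n)"
 have \<epsilon>: "\<epsilon> > 0" by (simp add: \<epsilon>_def)
 have dm: "d * bump_mass > 0" using d bump_mass_pos by simp
 have "\<forall>\<^sub>F m in sequentially. \<forall>k\<in>(UNIV::3 set). norm (cl (conv (%x. v x $ k) (bump (real (Suc m)) \<epsilon>))) < d * bump_mass"
  by (rule eventually_ball_finite) (use tendstoD[OF conv_bump_vanishes[OF v2 \<epsilon>] dm] in \<open>auto simp: dist_norm\<close>)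
 then obtain m where m: "!!k. norm (cl (conv (%x. v x $ k) (bump (real (Suc m)) \<epsilon>))) < d * bump_mass"
  by (auto simp: eventually_sequentially)
 define L where "L = real (Suc m)"
 have L: "L > 0" by (simp add: L_def)
 define \<kappa> where "\<kappa> x = bump_potential \<epsilon> L x / bump_mass" for x
 have kt: "\<kappa> \<in> test_functions" unfolding \<kappa>_def by (rule test_divide[OF bump_potential_test[OF \<epsilon> L]])
 define \<nu> where "\<nu> x = bump L \<epsilon> x / bump_mass" for x
 have nt: "\<nu> \<in> test_functions" unfolding \<nu>_def by (rule test_divide[OF bump_test[OF L \<epsilon>]])
 have dk: "partial 1 \<kappa> = (%x. mollifier n x - \<nu> x)"
 proof
  fix x
  have "\<kappa> = (%x. inverse bump_mass * bump_potential \<epsilon> L x)" by (simp add: \<kappa>_def fun_eq_iff field_simps)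
  then have "partial 1 \<kappa> x = inverse bump_mass * partial 1 (bump_potential \<epsilon> L) x"
   by (simp add: partial_cmult[OF smooth_differentiable[OF bump_potential_smooth]])
  also have "\<dots> = inverse bump_mass * (bump \<epsilon> \<epsilon> x - bump L \<epsilon> x)"
   by (simp only: bump_potential_partial[OF \<epsilon> L])
  finally show "partial 1 \<kappa> x = mollifier n x - \<nu> x"
   unfolding mollifier_def \<nu>_def \<epsilon>_def[symmetric] by (simp add: divide_inverse right_diff_distrib mult.commute)
 qed
 define w where "w k = conv (%x. v x $ k) \<kappa>" for k
 have ws: "smooth (w k)" for k unfolding w_def by (rule smooth_conv[OF vl kt])
 have w2: "w k \<in> L2" for k unfolding w_def by (rule conv_L2(1)[OF v2 kt])
 have dw: "partial i (w k) = conv (%x. v x $ k) (partial i \<kappa>)" for i k unfolding w_def by (rule partial_conv[OF vl kt])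
 have dw2: "partial i (w k) \<in> L2" for i k unfolding dw by (rule conv_L2(1)[OF v2 test_partial[OF kt]])
 have dv: "partial 2 (w 2) x + partial 3 (w 3) x = - partial 1 (w 1) x" for x
  using div_free_conv[OF v kt, of x] unfolding dw by simp
 have d1: "partial 1 (w k) x = conv (%x. v x $ k) (mollifier n) x - conv (%x. v x $ k) \<nu> x" for k x
  unfolding dw dk by (rule conv_diff_kernel[OF vl mollifier_test nt])
 have c\<nu>2: "conv (%x. v x $ k) \<nu> \<in> L2" for k by (rule conv_L2(1)[OF v2 nt])
 have cm2: "conv (%x. v x $ k) (mollifier n) \<in> L2" for k by (rule conv_L2(1)[OF v2 mollifier_test])
 have small: "norm (cl (conv (%x. v x $ k) \<nu>)) < d" for k
 proof -
  have c2: "conv (%x. v x $ k) (bump L \<epsilon>) \<in> L2" by (rule conv_L2(1)[OF v2 bump_test[OF L \<epsilon>]])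
  have "conv (%x. v x $ k) \<nu> = (%x. inverse bump_mass *\<^sub>R conv (%x. v x $ k) (bump L \<epsilon>) x)"
   unfolding \<nu>_def by (simp add: fun_eq_iff conv_divide field_simps)
  then have "norm (cl (conv (%x. v x $ k) \<nu>)) = inverse bump_mass * norm (cl (conv (%x. v x $ k) (bump L \<epsilon>)))"
   using bump_mass_pos by (simp only: cl_scaleR[OF c2] norm_scaleR) simp
  also have "\<dots> < inverse bump_mass * (d * bump_mass)" using m[of k] bump_mass_pos unfolding L_def by (intro mult_strict_left_mono) auto
  also have "\<dots> = d" using bump_mass_pos by simp
  finally show ?thesis .
 qed
 have close1: "norm (cl (partial 1 (w k)) - cl (%x. v x $ k)) < 2 * d" for k
 proof -
  have "cl (partial 1 (w k)) = cl (conv (%x. v x $ k) (mollifier n)) - cl (conv (%x. v x $ k) \<nu>)"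
   unfolding cl_diff[OF cm2 c\<nu>2, symmetric] d1[symmetric] ..
  then have "cl (partial 1 (w k)) - cl (%x. v x $ k)
    = (cl (conv (%x. v x $ k) (mollifier n)) - cl (%x. v x $ k)) - cl (conv (%x. v x $ k) \<nu>)" by simp
  then have "norm (cl (partial 1 (w k)) - cl (%x. v x $ k))
    <= norm (cl (conv (%x. v x $ k) (mollifier n)) - cl (%x. v x $ k)) + norm (cl (conv (%x. v x $ k) \<nu>))"
   by (simp only: norm_triangle_ineq4)
  then show ?thesis using n[of k] small[of k] by linarith
 qed
 define \<psi> where "\<psi> r = (%k::3. if k = 1 then (%x. 0) else if k = 2 then (%x. cutoff_at r x * w 3 x) else (%x. cutoff_at r x * (- w 2 x)))" for r
 have \<psi>t: "\<psi> r k \<in> test_functions" for r k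
  unfolding \<psi>_def
  using test_zero test_mult_smooth[OF cutoff_at_test ws] test_mult_smooth[OF cutoff_at_test smooth_uminus[OF ws]] by simp
 have w2m: "(%x. - w 2 x) \<in> L2" by (rule L2_uminus[OF w2])
 have pm: "partial i (%x. - w 2 x) = (%x. - partial i (w 2) x)" for i
  by (simp add: fun_eq_iff partial_uminus smooth_differentiable ws)
 have dw2m: "partial i (%x. - w 2 x) \<in> L2" for i unfolding pm by (rule L2_uminus[OF dw2])
 have L3: "(%r. cl (partial i (\<psi> r 3))) \<longlonglongrightarrow> - cl (partial i (w 2))" for i
  using cutoff_partial_tendsto[OF w2m smooth_uminus[OF ws] dw2m, of i] by (simp add: \<psi>_def pm cl_uminus[OF dw2])
 have L2': "(%r. cl (partial i (\<psi> r 2))) \<longlonglongrightarrow> cl (partial i (w 3))" for i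
  using cutoff_partial_tendsto[OF w2 ws dw2, of i] by (simp add: \<psi>_def)
 have L1: "partial i (\<psi> r 1) = (%x. 0)" for i r by (simp add: \<psi>_def fun_eq_iff partial_const)
 have t2: "partial i (\<psi> r k) \<in> L2" for i r k by (rule test_L2[OF test_partial[OF \<psi>t]])
 have lim: "(%r. cl (%x. test_curl (\<psi> r) x $ k)) \<longlonglongrightarrow> cl (partial 1 (w k))" for k
 proof -
  have "cl (partial 1 (w 1)) = - (cl (partial 2 (w 2)) + cl (partial 3 (w 3)))"
  proof -
   have "partial 1 (w 1) = (%x. - (partial 2 (w 2) x + partial 3 (w 3) x))" using dv by (simp add: fun_eq_iff)
   then show ?thesis by (simp only: cl_uminus[OF L2_add[OF dw2 dw2]] cl_add[OF dw2 dw2])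
  qed
  then have w1: "cl (partial 1 (w 1)) = - cl (partial 2 (w 2)) - cl (partial 3 (w 3))" by simp
  have 1: "(%r. cl (%x. test_curl (\<psi> r) x $ 1)) \<longlonglongrightarrow> cl (partial 1 (w 1))"
   unfolding test_curl_nth cl_diff[OF t2 t2] w1 by (intro tendsto_diff L3 L2')
  have 2: "(%r. cl (%x. test_curl (\<psi> r) x $ 2)) \<longlonglongrightarrow> cl (partial 1 (w 2))"
   unfolding test_curl_nth cl_diff[OF t2 t2] L1 cl_zero using tendsto_minus[OF L3[of 1]] by (simp add: cl_uminus[OF t2])
  have 3: "(%r. cl (%x. test_curl (\<psi> r) x $ 3)) \<longlonglongrightarrow> cl (partial 1 (w 3))"
   unfolding test_curl_nth cl_diff[OF t2 t2] L1 cl_zero using L2'[of 1] by simp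
  show ?thesis using 1 2 3 exhaust_three[of k] by metis
 qed
 have "\<forall>\<^sub>F r in sequentially. \<forall>k\<in>(UNIV::3 set). norm (cl (%x. test_curl (\<psi> r) x $ k) - cl (partial 1 (w k))) < d"
  by (rule eventually_ball_finite) (use tendstoD[OF lim d] in \<open>auto simp: dist_norm\<close>)
 then obtain r where r: "!!k. norm (cl (%x. test_curl (\<psi> r) x $ k) - cl (partial 1 (w k))) < d"
  by (auto simp: eventually_sequentially)
 have tc2: "test_curl (\<psi> r) \<in> L2" by (rule test_curl_L2[OF \<psi>t])
 have comp: "norm (cl (%x. (v x - test_curl (\<psi> r) x) $ k)) < 3 * d" for k
 proof -
  have "cl (%x. (v x - test_curl (\<psi> r) x) $ k) = cl (%x. v x $ k) - cl (%x. test_curl (\<psi> r) x $ k)"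
   using cl_diff[OF v2 L2_nth[OF tc2]] by simp
  also have "norm \<dots> <= norm (cl (%x. v x $ k) - cl (partial 1 (w k))) + norm (cl (partial 1 (w k)) - cl (%x. test_curl (\<psi> r) x $ k))"
   using norm_triangle_ineq[of "cl (%x. v x $ k) - cl (partial 1 (w k))" "cl (partial 1 (w k)) - cl (%x. test_curl (\<psi> r) x $ k)"] by simp
  also have "\<dots> < 3 * d" using close1[of k] r[of k] by (simp add: norm_minus_commute)
  finally show ?thesis .
 qed
 have "norm (cl v - cl (test_curl (\<psi> r))) <= (\<Sum>k\<in>UNIV. norm (cl (%x. (v x - test_curl (\<psi> r) x) $ k)))"
  unfolding cl_diff[OF v(1) tc2, symmetric] by (rule norm_cl_vec_le[OF L2_diff[OF v(1) tc2]])
 also have "\<dots> < e" using comp[of 1] comp[of 2] comp[of 3] by (simp add: sum_3 d_def)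
 finally show ?thesis by (rule that[of "\<psi> r", OF \<psi>t])
qed

lemma test_curl_div:
 assumes t: "!!k. \<psi> k \<in> test_functions"
 shows "partial 1 (%x. test_curl \<psi> x $ 1) x + partial 2 (%x. test_curl \<psi> x $ 2) x + partial 3 (%x. test_curl \<psi> x $ 3) x = 0"
proof -
 have s: "smooth (\<psi> k)" for k by (rule test_smooth[OF t])
 have c: "partial i (partial j (\<psi> k)) = partial j (partial i (\<psi> k))" for i j k by (rule partial_commute[OF s])
 show ?thesis unfolding test_curl_nth
  using c[of 1 2 3] c[of 1 3 2] c[of 2 3 1]
  by (simp add: partial_diff smooth_differentiable smooth_partial s)
qed

lemma weak_grad_works:
 assumes "weakly_differentiable (q :: R3 => real)"
 shows "loc_integrable q" "loc_integrable (%x. weak_grad q x $ i)"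
  "\<phi> \<in> test_functions ==> (\<integral>x. partial i \<phi> x * q x \<partial>lebesgue) = - (\<integral>x. \<phi> x * weak_grad q x $ i \<partial>lebesgue)"
proof -
 obtain g where "has_weak_deriv (axis i 1) q g" using assms by (auto simp: weakly_differentiable_def)
 from weak_deriv_works[OF this] have *: "has_weak_deriv (axis i 1) q (weak_partial i q)" .
 show "loc_integrable q" "loc_integrable (%x. weak_grad q x $ i)"
  using * by (auto simp: has_weak_deriv_def weak_grad_def)
 assume "\<phi> \<in> test_functions"
 then show "(\<integral>x. partial i \<phi> x * q x \<partial>lebesgue) = - (\<integral>x. \<phi> x * weak_grad q x $ i \<partial>lebesgue)"
  using * by (simp add: has_weak_deriv_def weak_grad_def multi_partial_axis mi_order_axis del: One_nat_def)
qed

lemma test_curl_weak_grad: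
 assumes q: "weakly_differentiable (q :: R3 => real)" and t: "!!k. \<psi> k \<in> test_functions"
 shows "(\<integral>x. test_curl \<psi> x \<bullet> weak_grad q x \<partial>lebesgue) = 0"
proof -
 let ?c = "%k x. test_curl \<psi> x $ k"
 have ct: "?c k \<in> test_functions" for k by (rule test_curl_test[OF t])
 have i1: "integrable lebesgue (%x. ?c k x * weak_grad q x $ k)" for k
  by (rule test_times_integrable[OF weak_grad_works(2)[OF q] ct])
 have i2: "integrable lebesgue (%x. partial k (?c k) x * q x)" for k
  by (rule test_times_integrable[OF weak_grad_works(1)[OF q] test_partial[OF ct]])
 have "(\<integral>x. test_curl \<psi> x \<bullet> weak_grad q x \<partial>lebesgue) = (\<Sum>k\<in>UNIV. \<integral>x. ?c k x * weak_grad q x $ k \<partial>lebesgue)"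
  unfolding inner_vec_def inner_real_def by (rule Bochner_Integration.integral_sum) (rule i1)
 also have "\<dots> = (\<Sum>k\<in>UNIV. - (\<integral>x. partial k (?c k) x * q x \<partial>lebesgue))"
  by (simp add: weak_grad_works(3)[OF q ct])
 also have "\<dots> = - (\<integral>x. (\<Sum>k\<in>UNIV. partial k (?c k) x * q x) \<partial>lebesgue)"
  by (subst Bochner_Integration.integral_sum[OF i2]) (simp add: sum_negf)
 also have "(%x. \<Sum>k\<in>UNIV. partial k (?c k) x * q x) = (%x. 0)"
  using test_curl_div[OF t] by (simp add: fun_eq_iff sum_3 flip: distrib_right)
 finally show ?thesis by simp
qed

text \<open>Gradients are orthogonal to curls of test fields, which are dense in the divergence-free fields.\<close>

lemma grad_orthogonal_div_free:
 assumes v: "v \<in> L2" "div_free v" and q: "weakly_differentiable (q :: R3 => real)" and g: "weak_grad q \<in> L2"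
 shows "cl v \<bullet> cl (weak_grad q) = 0"
proof (rule ccontr)
 assume ne: "cl v \<bullet> cl (weak_grad q) ~= 0"
 define a where "a = \<bar>cl v \<bullet> cl (weak_grad q)\<bar>"
 define N where "N = norm (cl (weak_grad q)) + 1"
 have N: "N > 0" by (simp add: N_def add_nonneg_pos)
 have a: "a > 0" using ne by (simp add: a_def)
 obtain \<psi> where \<psi>: "!!k. \<psi> k \<in> test_functions" "norm (cl v - cl (test_curl \<psi>)) < a / N"
  using test_curl_dense[OF v, of "a / N"] a N by auto
 have "cl (test_curl \<psi>) \<bullet> cl (weak_grad q) = 0"
  unfolding inner_cl[OF test_curl_L2[OF \<psi>(1)] g] by (rule test_curl_weak_grad[OF q \<psi>(1)])
 then have "a = \<bar>(cl v - cl (test_curl \<psi>)) \<bullet> cl (weak_grad q)\<bar>" by (simp add: a_def inner_diff_left)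
 also have "\<dots> <= norm (cl v - cl (test_curl \<psi>)) * norm (cl (weak_grad q))" by (rule Cauchy_Schwarz_ineq2)
 also have "\<dots> <= norm (cl v - cl (test_curl \<psi>)) * N" by (rule mult_left_mono) (simp_all add: N_def)
 also have "\<dots> < a / N * N" by (rule mult_strict_right_mono[OF \<psi>(2) N])
 finally show False using N by simp
qed

section \<open>Fields with Sobolev regularity\<close>

lemma L2_of_nth: fixes F :: "R3 => R3" shows "(!!k. (%x. F x $ k) \<in> L2) ==> F \<in> L2"
 by (simp add: L2_vec_iff)

lemma Hspace_L2: "f \<in> Hspace m ==> f \<in> L2"
 by (simp add: Hspace_def)

lemma Hspace_weak_deriv:
 assumes "f \<in> Hspace m" "mi_order \<alpha> <= m"
 shows "has_weak_deriv \<alpha> f (weak_deriv \<alpha> f)" "weak_deriv \<alpha> f \<in> L2"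
proof -
 obtain g where g: "g \<in> L2" "has_weak_deriv \<alpha> f g" using assms by (auto simp: Hspace_def)
 show "has_weak_deriv \<alpha> f (weak_deriv \<alpha> f)" by (rule weak_deriv_works[OF g(2)])
 show "weak_deriv \<alpha> f \<in> L2" by (rule L2_cong_AE[OF g(1) AE_swap[OF weak_deriv_AE[OF g(2)]]])
qed

lemma finite_multi_indices: "finite {\<alpha>. mi_order \<alpha> <= m}"
proof (rule finite_subset)
 show "{\<alpha>. mi_order \<alpha> <= m} \<subseteq> (\<Union>a\<in>{..m}. \<Union>b\<in>{..m}. (%c. vector [a, b, c]) ` {..m})"
 proof
  fix \<alpha> :: multi_index assume "\<alpha> \<in> {\<alpha>. mi_order \<alpha> <= m}"
  then have "\<alpha> $ 1 <= m" "\<alpha> $ 2 <= m" "\<alpha> $ 3 <= m" by (simp_all add: mi_order_def sum_3)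
  moreover have "\<alpha> = vector [\<alpha> $ 1, \<alpha> $ 2, \<alpha> $ 3]" by (simp add: vec_eq_iff forall_3 vector_3)
  ultimately show "\<alpha> \<in> (\<Union>a\<in>{..m}. \<Union>b\<in>{..m}. (%c. vector [a, b, c]) ` {..m})" by blast
 qed
qed auto

lemma Hnorm_eq:
 assumes f: "f \<in> Hspace m"
 shows "Hnorm m f = ennreal (sqrt (\<Sum>\<beta> | mi_order \<beta> <= m. (norm (cl (weak_deriv \<beta> f)))\<^sup>2))"
proof -
 have L: "weak_deriv \<beta> f \<in> L2" if "mi_order \<beta> <= m" for \<beta> by (rule Hspace_weak_deriv(2)[OF f that])
 have "(\<Sum>\<beta> | mi_order \<beta> <= m. (L2norm (weak_deriv \<beta> f))\<^sup>2) = (\<Sum>\<beta> | mi_order \<beta> <= m. ennreal ((norm (cl (weak_deriv \<beta> f)))\<^sup>2))"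
  by (rule sum.cong) (auto simp: L2norm_cl[OF L] ennreal_power)
 also have "\<dots> = ennreal (\<Sum>\<beta> | mi_order \<beta> <= m. (norm (cl (weak_deriv \<beta> f)))\<^sup>2)" by (rule sum_ennreal) simp
 finally show ?thesis using f by (simp add: Hnorm_def ennpowr_half sum_nonneg)
qed

lemma Hnorm_weak_deriv_le:
 assumes f: "f \<in> Hspace m" and K: "K >= 0" "Hnorm m f <= ennreal K" and a: "mi_order \<alpha> <= m"
 shows "norm (cl (weak_deriv \<alpha> f)) <= K"
proof -
 let ?S = "\<Sum>\<beta> | mi_order \<beta> <= m. (norm (cl (weak_deriv \<beta> f)))\<^sup>2"
 have "sqrt ?S <= K" using K Hnorm_eq[OF f] by simp
 moreover have "(norm (cl (weak_deriv \<alpha> f)))\<^sup>2 <= ?S"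
  by (rule member_le_sum) (use a finite_multi_indices in auto)
 then have "norm (cl (weak_deriv \<alpha> f)) <= sqrt ?S" by (rule real_le_rsqrt)
 ultimately show ?thesis by linarith
qed

lemma has_weak_deriv_nth:
 fixes f :: "R3 => R3"
 assumes "has_weak_deriv \<alpha> f g" "\<phi> \<in> test_functions"
 shows "(\<integral>x. multi_partial \<alpha> \<phi> x * f x $ j \<partial>lebesgue) = (-1) ^ mi_order \<alpha> * (\<integral>x. \<phi> x * g x $ j \<partial>lebesgue)"
proof -
 have l: "loc_integrable f" "loc_integrable g" using assms(1) by (auto simp: has_weak_deriv_def)
 have "(\<integral>x. multi_partial \<alpha> \<phi> x *\<^sub>R f x \<partial>lebesgue) = (-1) ^ mi_order \<alpha> *\<^sub>R (\<integral>x. \<phi> x *\<^sub>R g x \<partial>lebesgue)"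
  using assms by (simp add: has_weak_deriv_def)
 from arg_cong[OF this, of "%v. v $ j"] show ?thesis
  using integral_bounded_linear[OF bounded_linear_vec_nth[of j] test_scale_integrable[OF l(1) multi_partial_test[OF assms(2), of \<alpha>]]]
   integral_bounded_linear[OF bounded_linear_vec_nth[of j] test_scale_integrable[OF l(2) assms(2)]] by simp
qed

lemma weak_deriv_wd:
 fixes f :: "R3 => R3"
 assumes f: "f \<in> Hspace m" and a: "mi_order \<alpha> + 1 <= m"
 shows "wd i (%x. weak_deriv \<alpha> f x $ j) (%x. weak_deriv (\<alpha> + axis i 1) f x $ j)"
proof -
 have o: "mi_order (\<alpha> + axis i 1) <= m" "mi_order \<alpha> <= m" using a by (simp_all add: mi_order_add mi_order_axis del: One_nat_def)
 note A = Hspace_weak_deriv[OF f o(2)] and B = Hspace_weak_deriv[OF f o(1)]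
 have "(\<integral>x. partial i \<phi> x * weak_deriv \<alpha> f x $ j \<partial>lebesgue) = - (\<integral>x. \<phi> x * weak_deriv (\<alpha> + axis i 1) f x $ j \<partial>lebesgue)"
  if t: "\<phi> \<in> test_functions" for \<phi>
 proof -
  have "(-1) ^ mi_order \<alpha> * (\<integral>x. partial i \<phi> x * weak_deriv \<alpha> f x $ j \<partial>lebesgue) = (\<integral>x. multi_partial (\<alpha> + axis i 1) \<phi> x * f x $ j \<partial>lebesgue)"
   using has_weak_deriv_nth[OF A(1) test_partial[OF t], of i j] multi_partial_add_axis[OF test_smooth[OF t], of \<alpha> i] by simp
  also have "\<dots> = (-1) ^ mi_order (\<alpha> + axis i 1) * (\<integral>x. \<phi> x * weak_deriv (\<alpha> + axis i 1) f x $ j \<partial>lebesgue)"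
   by (rule has_weak_deriv_nth[OF B(1) t])
  also have "\<dots> = (-1) ^ mi_order \<alpha> * (- (\<integral>x. \<phi> x * weak_deriv (\<alpha> + axis i 1) f x $ j \<partial>lebesgue))"
   by (simp add: mi_order_add mi_order_axis del: One_nat_def) simp
  finally show ?thesis by (simp only: mult_cancel_left) simp
 qed
 then show ?thesis unfolding wd_def using L2_nth A(2) B(2) by blast
qed

lemma Hspace_W:
 fixes f :: "R3 => R3"
 assumes f: "f \<in> Hspace m" and K: "K >= 0" "Hnorm m f <= ennreal K"
 shows "mi_order \<alpha> + k <= m ==> W k K (%x. weak_deriv \<alpha> f x $ j)"
proof (induction k arbitrary: \<alpha>)
 case 0
 then have o: "mi_order \<alpha> <= m" by simp
 show ?case using L2_nth[OF Hspace_weak_deriv(2)[OF f o]]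
   order_trans[OF norm_cl_nth_le[OF Hspace_weak_deriv(2)[OF f o]] Hnorm_weak_deriv_le[OF f K o]] by simp
next
 case (Suc k)
 then have o: "mi_order \<alpha> <= m" "mi_order \<alpha> + 1 <= m" by simp_all
 have "wd i (%x. weak_deriv \<alpha> f x $ j) (%x. weak_deriv (\<alpha> + axis i 1) f x $ j)
   \<and> W k K (%x. weak_deriv (\<alpha> + axis i 1) f x $ j)" for i
  using weak_deriv_wd[OF f o(2)] Suc by (simp add: mi_order_add mi_order_axis del: One_nat_def)
 then show ?case using L2_nth[OF Hspace_weak_deriv(2)[OF f o(1)]]
   order_trans[OF norm_cl_nth_le[OF Hspace_weak_deriv(2)[OF f o(1)]] Hnorm_weak_deriv_le[OF f K o(1)]] by auto
qed

lemma weak_deriv_zero: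
 assumes "f \<in> Hspace m" shows "AE x in lebesgue. weak_deriv 0 f x = f x"
proof (rule weak_deriv_AE)
 show "has_weak_deriv 0 f f"
  using L2_loc_integrable[OF Hspace_L2[OF assms]] by (simp add: has_weak_deriv_def multi_partial_zero)
qed

lemma AE_norm_vec3:
 fixes F :: "R3 => R3"
 assumes "!!j. AE x in lebesgue. \<bar>F x $ j\<bar> <= c" shows "AE x in lebesgue. norm (F x) <= 3 * c"
proof -
 have "AE x in lebesgue. \<forall>j\<in>UNIV. \<bar>F x $ j\<bar> <= c" by (intro AE_finite_allI assms) simp
 then show ?thesis by eventually_elim (rule norm_le_three, blast)
qed

lemma Hspace_bounded:
 fixes f :: "R3 => R3"
 assumes f: "f \<in> Hspace m" and K: "K >= 0" "Hnorm m f <= ennreal K" and a: "mi_order \<alpha> + 2 <= m"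
 shows "AE x in lebesgue. norm (weak_deriv \<alpha> f x) <= 66 * K"
 using AE_norm_vec3[of "weak_deriv \<alpha> f" "22 * K"] sobolev[OF Hspace_W[OF f K a]] by simp

lemma Hspace_field:
 fixes f :: "R3 => R3"
 assumes f: "f \<in> Hspace m" and m: "3 <= m"
 shows "weak_partial i f \<in> L2"
  "wd i (%x. f x $ k) (%x. weak_partial i f x $ k)"
  "wd j (%x. weak_partial i f x $ k) (%x. weak_deriv (axis i 1 + axis j 1) f x $ k)"
  "weak_deriv (axis i 1 + axis j 1) f \<in> L2"
proof -
 show "weak_partial i f \<in> L2" by (rule Hspace_weak_deriv(2)[OF f]) (use m in \<open>simp add: mi_order_axis del: One_nat_def\<close>)
 show "weak_deriv (axis i 1 + axis j 1) f \<in> L2"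
  by (rule Hspace_weak_deriv(2)[OF f]) (use m in \<open>simp add: mi_order_add mi_order_axis del: One_nat_def\<close>)
 show "wd j (%x. weak_partial i f x $ k) (%x. weak_deriv (axis i 1 + axis j 1) f x $ k)"
  by (rule weak_deriv_wd[OF f]) (use m in \<open>simp add: mi_order_axis del: One_nat_def\<close>)
 have "wd i (%x. weak_deriv 0 f x $ k) (%x. weak_deriv (0 + axis i 1) f x $ k)"
  by (rule weak_deriv_wd[OF f]) (use m in \<open>simp add: multi_partial_zero\<close>)
 then have w: "wd i (%x. weak_deriv 0 f x $ k) (%x. weak_partial i f x $ k)" by simp
 have "AE x in lebesgue. weak_deriv 0 f x $ k = f x $ k"
  using weak_deriv_zero[OF f] by eventually_elim simp
 then show "wd i (%x. f x $ k) (%x. weak_partial i f x $ k)"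
  by (rule wd_cong_AE[OF w]) simp
qed

text \<open>As \<open>m >= 3\<close>, the Sobolev embedding applies to the components of the field and of its first
derivatives; \<open>66 = 3 * 22\<close>.\<close>

lemma Hspace_field_bounds:
 fixes f :: "R3 => R3"
 assumes f: "f \<in> Hspace m" and m: "3 <= m" and K: "K >= 0" "Hnorm m f <= ennreal K"
 shows "norm (cl f) <= K" "norm (cl (weak_partial i f)) <= K"
  "norm (cl (weak_deriv (axis i 1 + axis j 1) f)) <= K"
  "AE x in lebesgue. norm (f x) <= 66 * K" "AE x in lebesgue. norm (weak_partial i f x) <= 66 * K"
proof -
 note o = mi_order_add mi_order_axis multi_partial_zero
 have "cl (weak_deriv 0 f) = cl f"
  by (rule cl_cong[OF Hspace_weak_deriv(2)[OF f] weak_deriv_zero[OF f]]) (simp add: o)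
 moreover have "norm (cl (weak_deriv 0 f)) <= K" by (rule Hnorm_weak_deriv_le[OF f K]) (simp add: o)
 ultimately show "norm (cl f) <= K" by simp
 show "norm (cl (weak_partial i f)) <= K" by (rule Hnorm_weak_deriv_le[OF f K]) (use m in \<open>simp add: o del: One_nat_def\<close>)
 show "norm (cl (weak_deriv (axis i 1 + axis j 1) f)) <= K" by (rule Hnorm_weak_deriv_le[OF f K]) (use m in \<open>simp add: o del: One_nat_def\<close>)
 show "AE x in lebesgue. norm (weak_partial i f x) <= 66 * K" by (rule Hspace_bounded[OF f K]) (use m in \<open>simp add: o del: One_nat_def\<close>)
 have "AE x in lebesgue. norm (weak_deriv 0 f x) <= 66 * K" by (rule Hspace_bounded[OF f K]) (use m in \<open>simp add: o\<close>)
 then show "AE x in lebesgue. norm (f x) <= 66 * K"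
  using weak_deriv_zero[OF f] by eventually_elim simp
qed

lemma weak_deriv_diff_AE:
 fixes f g :: "R3 => R3"
 assumes "has_weak_deriv \<alpha> f f'" "has_weak_deriv \<alpha> g g'"
 shows "has_weak_deriv \<alpha> (%x. f x - g x) (%x. f' x - g' x)"
 using assms unfolding has_weak_deriv_def
 by (simp add: loc_integrable_diff scaleR_diff_right test_scale_integrable multi_partial_test)

lemma Hnorm_finite_Hspace: "Hnorm m f <= ennreal K ==> f \<in> Hspace m"
 by (auto simp: Hnorm_def top_unique split: if_splits)

lemma Hspace_finite_norm:
 assumes f: "f \<in> Hspace m" obtains K where "K >= 0" "Hnorm m f <= ennreal K"
proof -
 show ?thesis
  by (rule that[of "sqrt (\<Sum>\<beta> | mi_order \<beta> <= m. (norm (cl (weak_deriv \<beta> f)))\<^sup>2)"])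
   (simp_all add: Hnorm_eq[OF f] sum_nonneg)
qed

subsection \<open>Continuity in time\<close>

lemma CHspace_Hspace: "f \<in> CHspace T m ==> t \<in> {0..T} ==> f t \<in> Hspace m"
 by (simp add: CHspace_def)

lemma CHspace_close:
 assumes f: "f \<in> CHspace T m" and t: "t \<in> {0..T}" and e: "e > 0"
 obtains d where "d > 0" "!!s. s \<in> {0..T} ==> \<bar>s - t\<bar> < d ==> Hnorm m (%x. f s x - f t x) <= ennreal e"
proof -
 have "((%s. Hnorm m (%x. f s x - f t x)) \<longlongrightarrow> 0) (at t within {0..T})" using f t by (simp add: CHspace_def)
 then have "\<forall>\<^sub>F s in at t within {0..T}. Hnorm m (%x. f s x - f t x) < ennreal e"
  by (rule order_tendstoD(2)) (use e in simp)
 then obtain d where d: "d > 0" "!!s. s \<in> {0..T} ==> s ~= t ==> dist s t < d ==> Hnorm m (%x. f s x - f t x) < ennreal e"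
  unfolding eventually_at by blast
 have z: "Hnorm m (%x. f t x - f t x) <= ennreal e"
 proof -
  have h: "has_weak_deriv \<alpha> (%x::R3. 0::'a) (%x. 0)" for \<alpha>
   by (simp add: has_weak_deriv_def loc_integrable_def set_integrable_def)
  then have hs: "(%x::R3. 0::'a) \<in> Hspace m" unfolding Hspace_def using L2_zero by blast
  have "L2norm (weak_deriv \<alpha> (%x::R3. 0::'a)) = 0" for \<alpha>
  proof -
   have ae: "AE x in lebesgue. weak_deriv \<alpha> (%x::R3. 0::'a) x = 0" by (rule weak_deriv_AE[OF h])
   have L: "weak_deriv \<alpha> (%x::R3. 0::'a) \<in> L2" by (rule L2_cong_AE[OF L2_zero AE_swap[OF ae]])
   show ?thesis using cl_cong[OF L ae] by (simp add: L2norm_cl[OF L] cl_zero)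
  qed
  then have "Hnorm m (%x::R3. 0::'a) = 0" using hs by (simp add: Hnorm_def ennpowr_def)
  then show ?thesis by simp
 qed
 show ?thesis
 proof (rule that[OF d(1)])
  fix s assume "s \<in> {0..T}" "\<bar>s - t\<bar> < d"
  then show "Hnorm m (%x. f s x - f t x) <= ennreal e"
   using d(2)[of s] z by (cases "s = t") (auto simp: dist_real_def intro: less_imp_le)
 qed
qed

lemma CHspace_continuous:
 fixes f :: "real => R3 => R3"
 assumes f: "f \<in> CHspace T m" and a: "mi_order \<alpha> <= m"
 shows "continuous_on {0..T} (%t. cl (weak_deriv \<alpha> (f t)))"
 unfolding continuous_on_iff
proof (intro ballI allI impI)
 fix t e :: real assume t: "t \<in> {0..T}" and e: "e > 0"
 obtain d where d: "d > 0" "!!s. s \<in> {0..T} ==> \<bar>s - t\<bar> < d ==> Hnorm m (%x. f s x - f t x) <= ennreal (e/2)"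
  using CHspace_close[OF f t, of "e/2"] e by auto
 have "dist (cl (weak_deriv \<alpha> (f s))) (cl (weak_deriv \<alpha> (f t))) < e" if s: "s \<in> {0..T}" "dist s t < d" for s
 proof -
  note H = d(2)[OF s(1) s(2)[unfolded dist_real_def]]
  note fs = Hspace_weak_deriv[OF CHspace_Hspace[OF f s(1)] a] and ft = Hspace_weak_deriv[OF CHspace_Hspace[OF f t] a]
  have "AE x in lebesgue. weak_deriv \<alpha> (%x. f s x - f t x) x = weak_deriv \<alpha> (f s) x - weak_deriv \<alpha> (f t) x"
   by (rule weak_deriv_AE[OF weak_deriv_diff_AE[OF fs(1) ft(1)]])
  from cl_cong[OF Hspace_weak_deriv(2)[OF Hnorm_finite_Hspace[OF H] a] this]
  have "cl (weak_deriv \<alpha> (f s)) - cl (weak_deriv \<alpha> (f t)) = cl (weak_deriv \<alpha> (%x. f s x - f t x))"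
   by (simp add: cl_diff[OF fs(2) ft(2)])
  moreover have "norm (cl (weak_deriv \<alpha> (%x. f s x - f t x))) <= e/2"
   by (rule Hnorm_weak_deriv_le[OF Hnorm_finite_Hspace[OF H] _ H a]) (use e in simp)
  ultimately show ?thesis using e by (simp add: dist_norm)
 qed
 then show "\<exists>d>0. \<forall>s\<in>{0..T}. dist s t < d \<longrightarrow> dist (cl (weak_deriv \<alpha> (f s))) (cl (weak_deriv \<alpha> (f t))) < e"
  using d(1) by blast
qed

lemma CHspace_continuous_field:
 fixes f :: "real => R3 => R3"
 assumes f: "f \<in> CHspace T m" shows "continuous_on {0..T} (%t. cl (f t))"
proof -
 have eq: "cl (weak_deriv 0 (f t)) = cl (f t)" if "t \<in> {0..T}" for t
  by (rule cl_cong[OF Hspace_weak_deriv(2)[OF CHspace_Hspace[OF f that]] weak_deriv_zero[OF CHspace_Hspace[OF f that]]])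
   (simp add: multi_partial_zero)
 have "continuous_on {0..T} (%t. cl (weak_deriv 0 (f t)))"
  by (rule CHspace_continuous[OF f]) (simp add: multi_partial_zero)
 then show ?thesis by (rule continuous_on_eq) (rule eq)
qed

text \<open>Stated through almost everywhere bounds, the form in which products are estimated.\<close>

definition Linf_continuous :: "real => (real => R3 => 'b::euclidean_space) => bool" where
 "Linf_continuous T a \<longleftrightarrow> (\<forall>t\<in>{0..T}. a t \<in> borel_measurable lebesgue \<and>
   (\<exists>K\<ge>0. AE x in lebesgue. norm (a t x) <= K) \<and>
   (\<forall>e>0. \<exists>d>0. \<forall>s\<in>{0..T}. \<bar>s - t\<bar> < d \<longrightarrow> (AE x in lebesgue. norm (a s x - a t x) <= e)))"

lemma Linf_continuousD:
 "Linf_continuous T a ==> t \<in> {0..T} ==> e > 0 ==>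
  \<exists>d>0. \<forall>s\<in>{0..T}. \<bar>s - t\<bar> < d \<longrightarrow> (AE x in lebesgue. norm (a s x - a t x) <= e)"
 by (simp add: Linf_continuous_def)

lemma continuous_on_dist:
 "continuous_on S f ==> t \<in> S ==> e > 0 ==> \<exists>d>0. \<forall>s\<in>S. dist s t < d \<longrightarrow> dist (f s) (f t) < e"
 by (simp add: continuous_on_iff)

lemma CHspace_Linf_continuous:
 fixes f :: "real => R3 => R3"
 assumes f: "f \<in> CHspace T m" and m: "3 <= m" shows "Linf_continuous T f"
 unfolding Linf_continuous_def
proof (intro ballI conjI allI impI)
 fix t assume t: "t \<in> {0..T}"
 note H = CHspace_Hspace[OF f t]
 show "f t \<in> borel_measurable lebesgue" by (rule L2_measurable[OF Hspace_L2[OF H]])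
 obtain K where K: "K >= 0" "Hnorm m (f t) <= ennreal K" using Hspace_finite_norm[OF H] by blast
 show "\<exists>K\<ge>0. AE x in lebesgue. norm (f t x) <= K"
  using Hspace_field_bounds(4)[OF H m K] K(1) by (intro exI[of _ "66 * K"]) simp
 fix e :: real assume e: "e > 0"
 obtain d where d: "d > 0" "!!s. s \<in> {0..T} ==> \<bar>s - t\<bar> < d ==> Hnorm m (%x. f s x - f t x) <= ennreal (e/66)"
  using CHspace_close[OF f t, of "e/66"] e by auto
 have "AE x in lebesgue. norm (f s x - f t x) <= e" if "s \<in> {0..T}" "\<bar>s - t\<bar> < d" for s
  using Hspace_field_bounds(4)[OF Hnorm_finite_Hspace[OF d(2)[OF that]] m _ d(2)[OF that]] e by simp
 then show "\<exists>d>0. \<forall>s\<in>{0..T}. \<bar>s - t\<bar> < d \<longrightarrow> (AE x in lebesgue. norm (f s x - f t x) <= e)"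
  using d(1) by blast
qed

lemma product_L2:
 fixes P :: "'a::euclidean_space => 'b::euclidean_space => 'c::euclidean_space"
 assumes P: "bounded_bilinear P" and le: "!!x y. norm (P x y) <= norm x * norm y"
  and a: "a \<in> borel_measurable lebesgue" "AE x in lebesgue. norm (a x) <= K" "K >= 0" and b: "b \<in> L2"
 shows "(%x. P (a x) (b x)) \<in> L2" "norm (cl (%x. P (a x) (b x))) <= K * norm (cl b)"
proof -
 have c: "continuous_on UNIV (%z. P (fst z) (snd z))"
  by (intro bounded_bilinear.continuous_on[OF P] continuous_intros)
 have m: "(%x. P (a x) (b x)) \<in> borel_measurable lebesgue"
  using borel_measurable_continuous_Pair[OF a(1) L2_measurable[OF b] c] by simp
 have ae: "AE x in lebesgue. norm (P (a x) (b x)) <= K * norm (b x)"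
  using a(2) by eventually_elim (rule order_trans[OF le mult_right_mono], auto)
 show "(%x. P (a x) (b x)) \<in> L2" "norm (cl (%x. P (a x) (b x))) <= K * norm (cl b)"
  using norm_cl_le[OF b m a(3) ae] by auto
qed

lemma product_continuous:
 fixes P :: "'a::euclidean_space => 'b::euclidean_space => 'c::euclidean_space"
 assumes P: "bounded_bilinear P" and le: "!!x y. norm (P x y) <= norm x * norm y"
  and a: "Linf_continuous T a" and b: "continuous_on {0..T} (%t. cl (b t))" "!!t. t \<in> {0..T} ==> b t \<in> L2"
 shows "!!t. t \<in> {0..T} ==> (%x. P (a t x) (b t x)) \<in> L2"
  and "continuous_on {0..T} (%t. cl (%x. P (a t x) (b t x)))"
proof -
 have am: "a t \<in> borel_measurable lebesgue" "\<exists>K\<ge>0. AE x in lebesgue. norm (a t x) <= K" if "t \<in> {0..T}" for t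
  using a that by (simp_all add: Linf_continuous_def)
 show L: "(%x. P (a t x) (b t x)) \<in> L2" if t: "t \<in> {0..T}" for t
  using am[OF t] product_L2(1)[OF P le _ _ _ b(2)[OF t]] by blast
 show "continuous_on {0..T} (%t. cl (%x. P (a t x) (b t x)))"
  unfolding continuous_on_iff
 proof (intro ballI allI impI)
  fix t e :: real assume t: "t \<in> {0..T}" and e: "e > 0"
  obtain K where K: "K >= 0" "AE x in lebesgue. norm (a t x) <= K" using am(2)[OF t] by blast
  define N where "N = norm (cl (b t)) + 1"
  have N: "N > 0" by (simp add: N_def add_nonneg_pos)
  define e1 where "e1 = e / (4 * N)"
  define e2 where "e2 = min 1 (e / (4 * (K + 1)))"
  have e1: "e1 > 0" and e2: "e2 > 0" using e N K by (simp_all add: e1_def e2_def)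
  obtain d1 where d1: "d1 > 0" "!!s. s \<in> {0..T} ==> \<bar>s - t\<bar> < d1 ==> AE x in lebesgue. norm (a s x - a t x) <= e1"
   using Linf_continuousD[OF a t e1] by blast
  obtain d2 where d2: "d2 > 0" "!!s. s \<in> {0..T} ==> dist s t < d2 ==> dist (cl (b s)) (cl (b t)) < e2"
   using continuous_on_dist[OF b(1) t e2] by blast
  have "dist (cl (%x. P (a s x) (b s x))) (cl (%x. P (a t x) (b t x))) < e" if s: "s \<in> {0..T}" "dist s t < min d1 d2" for s
  proof -
   have ae: "AE x in lebesgue. norm (a s x - a t x) <= e1" using d1(2)[OF s(1)] s(2) by (simp add: dist_real_def)
   have db: "norm (cl (b s) - cl (b t)) < e2" using d2(2)[OF s(1)] s(2) by (simp add: dist_norm)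
   have mm: "(%x. a s x - a t x) \<in> borel_measurable lebesgue" using am(1)[OF s(1)] am(1)[OF t] by measurable
   have bd: "(%x. b s x - b t x) \<in> L2" by (rule L2_diff[OF b(2)[OF s(1)] b(2)[OF t]])
   note A = product_L2[OF P le mm ae less_imp_le[OF e1] b(2)[OF s(1)]]
   note B = product_L2[OF P le am(1)[OF t] K(2) K(1) bd]
   have "(%x. P (a s x) (b s x) - P (a t x) (b t x)) = (%x. P (a s x - a t x) (b s x) + P (a t x) (b s x - b t x))"
    by (simp add: fun_eq_iff bounded_bilinear.diff_left[OF P] bounded_bilinear.diff_right[OF P])
   then have "cl (%x. P (a s x) (b s x)) - cl (%x. P (a t x) (b t x)) = cl (%x. P (a s x - a t x) (b s x)) + cl (%x. P (a t x) (b s x - b t x))"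
    by (simp only: cl_diff[OF L[OF s(1)] L[OF t], symmetric] cl_add[OF A(1) B(1), symmetric])
   then have "norm (cl (%x. P (a s x) (b s x)) - cl (%x. P (a t x) (b t x))) <= norm (cl (%x. P (a s x - a t x) (b s x))) + norm (cl (%x. P (a t x) (b s x - b t x)))"
    by (simp only: norm_triangle_ineq)
   also have "\<dots> <= e1 * norm (cl (b s)) + K * norm (cl (b s) - cl (b t))"
    using A(2) B(2) by (simp only: cl_diff[OF b(2)[OF s(1)] b(2)[OF t]] add_mono)
   also have "\<dots> <= e1 * N + (K + 1) * (e / (4 * (K + 1)))"
   proof (rule add_mono)
    have "norm (cl (b s)) <= norm (cl (b t)) + norm (cl (b s) - cl (b t))" by (rule norm_triangle_sub)
    then have "norm (cl (b s)) <= N" using db by (simp add: N_def e2_def)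
    then show "e1 * norm (cl (b s)) <= e1 * N" using e1 by (intro mult_left_mono) auto
    show "K * norm (cl (b s) - cl (b t)) <= (K + 1) * (e / (4 * (K + 1)))"
     using db K(1) e by (intro mult_mono) (auto simp: e2_def)
   qed
   also have "\<dots> = e/4 + e/4"
   proof -
    have gen: "x * (y / (4 * x)) = y / 4" if "x > 0" for x y :: real using that by simp
    have "e1 * N = e / 4" unfolding e1_def using gen[OF N, of e] by (simp only: mult.commute[of _ N])
    moreover have "(K + 1) * (e / (4 * (K + 1))) = e / 4" by (rule gen) (use K(1) in simp)
    ultimately show ?thesis by (simp only:)
   qed
   also have "\<dots> < e" using e by simp
   finally show ?thesis by (simp add: dist_norm)
  qed
  then show "\<exists>d>0. \<forall>s\<in>{0..T}. dist s t < d \<longrightarrow> dist (cl (%x. P (a s x) (b s x))) (cl (%x. P (a t x) (b t x))) < e"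
   using d1(1) d2(1) by (intro exI[of _ "min d1 d2"]) auto
 qed
qed

section \<open>Differentiation in time\<close>

lemma has_real_derivative_withinI:
 fixes g :: "real => real"
 assumes "!!e. e > 0 ==> \<exists>d>0. \<forall>s\<in>S. \<bar>s - t\<bar> < d \<longrightarrow> \<bar>g s - g t - (s - t) * D\<bar> <= e * \<bar>s - t\<bar>"
 shows "(g has_real_derivative D) (at t within S)"
 unfolding has_field_derivative_def has_derivative_within_alt
proof (intro conjI allI impI)
 show "bounded_linear ((*) D)" by (rule bounded_linear_mult_right)
 fix e :: real assume "e > 0"
 from assms[OF this] obtain d where "d > 0" "!!s. s \<in> S ==> \<bar>s - t\<bar> < d ==> \<bar>g s - g t - (s - t) * D\<bar> <= e * \<bar>s - t\<bar>" by blast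
 then show "\<exists>d>0. \<forall>y\<in>S. norm (y - t) < d \<longrightarrow> norm (g y - g t - D * (y - t)) <= e * norm (y - t)"
  by (intro exI[of _ d]) (simp add: mult.commute)
qed

text \<open>A weak time derivative that is continuous with values in the Hilbert space gives a first
 order expansion tested with every \<open>v\<close> in the closure of the test vectors, uniformly in \<open>v\<close>. This
 allows to test with the solution itself.\<close>

lemma weak_time_expansion:
 fixes F h :: "real => 'h::real_inner"
 assumes deriv: "!!r v. r \<in> {0..T} ==> v \<in> D ==> ((%s. F s \<bullet> v) has_real_derivative h r \<bullet> v) (at r within {0..T})"
  and v: "v \<in> closure D" and t: "t \<in> {0..T}" and s: "s \<in> {0..T}"
  and w: "!!r. r \<in> {0..T} ==> \<bar>r - t\<bar> <= \<bar>s - t\<bar> ==> norm (h r - h t) <= w"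
 shows "\<bar>F s \<bullet> v - F t \<bullet> v - (s - t) * (h t \<bullet> v)\<bar> <= w * norm v * \<bar>s - t\<bar>"
proof -
 have est: "\<bar>F s \<bullet> v - F t \<bullet> v - (s - t) * (h t \<bullet> v)\<bar> <= w * norm v * \<bar>s - t\<bar>" if v: "v \<in> D" for v
 proof -
  let ?C = "{0..T} \<inter> cball t \<bar>s - t\<bar>"
  have d: "((%r. F r \<bullet> v - r * (h t \<bullet> v)) has_real_derivative h r \<bullet> v - h t \<bullet> v) (at r within ?C)" if r: "r \<in> ?C" for r
  proof -
   have "((%s. F s \<bullet> v) has_real_derivative h r \<bullet> v) (at r within ?C)"
    by (rule DERIV_subset[OF deriv[OF _ v]]) (use r in auto)
   moreover have "((%r. r * (h t \<bullet> v)) has_real_derivative h t \<bullet> v) (at r within ?C)"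
    by (auto intro!: derivative_eq_intros)
   ultimately show ?thesis by (rule DERIV_diff)
  qed
  have "norm ((F s \<bullet> v - s * (h t \<bullet> v)) - (F t \<bullet> v - t * (h t \<bullet> v))) <= (w * norm v) * norm (s - t)"
  proof (rule field_differentiable_bound[OF _ d])
   show "convex ?C" by (intro convex_Int convex_cball) simp
   fix r assume r: "r \<in> ?C"
   have "\<bar>(h r - h t) \<bullet> v\<bar> <= norm (h r - h t) * norm v" by (rule Cauchy_Schwarz_ineq2)
   also have "\<dots> <= w * norm v" using w[of r] r by (intro mult_right_mono) (auto simp: dist_real_def abs_minus_commute)
   finally show "norm (h r \<bullet> v - h t \<bullet> v) <= w * norm v" by (simp add: inner_diff_left)
  qed (use s t in \<open>auto simp: dist_real_def abs_minus_commute\<close>)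
  then show ?thesis by (simp add: algebra_simps)
 qed
 obtain x where x: "!!n. x n \<in> D" "x \<longlonglongrightarrow> v" using v unfolding closure_sequential by blast
 have "(%n. \<bar>F s \<bullet> x n - F t \<bullet> x n - (s - t) * (h t \<bullet> x n)\<bar>) \<longlonglongrightarrow> \<bar>F s \<bullet> v - F t \<bullet> v - (s - t) * (h t \<bullet> v)\<bar>"
  by (intro tendsto_intros x(2))
 moreover have "(%n. w * norm (x n) * \<bar>s - t\<bar>) \<longlonglongrightarrow> w * norm v * \<bar>s - t\<bar>" by (intro tendsto_intros x(2))
 ultimately show ?thesis by (rule LIMSEQ_le) (use est[OF x(1)] in blast)
qed

lemma weak_time_modulus:
 fixes h :: "real => 'h::real_inner"
 assumes h: "continuous_on {0..T} h" and t: "t \<in> {0..T}" and e: "e > 0"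
 obtains d where "d > 0" "!!s r. \<bar>s - t\<bar> < d ==> r \<in> {0..T} ==> \<bar>r - t\<bar> <= \<bar>s - t\<bar> ==> norm (h r - h t) <= e"
proof -
 obtain d where "d > 0" "!!r. r \<in> {0..T} ==> dist r t < d ==> dist (h r) (h t) < e"
  using continuous_on_dist[OF h t e] by blast
 then show ?thesis using that[of d] by (force simp: dist_real_def dist_norm intro: less_imp_le)
qed

lemma time_derivative_inner:
 fixes F h :: "real => 'h::real_inner"
 assumes deriv: "!!r v. r \<in> {0..T} ==> v \<in> D ==> ((%s. F s \<bullet> v) has_real_derivative h r \<bullet> v) (at r within {0..T})"
  and h: "continuous_on {0..T} h" and v: "v \<in> closure D" and t: "t \<in> {0..T}"
 shows "((%s. F s \<bullet> v) has_real_derivative h t \<bullet> v) (at t within {0..T})"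
proof (rule has_real_derivative_withinI)
 fix e :: real assume e: "e > 0"
 have n: "norm v + 1 > 0" by (simp add: add_nonneg_pos)
 obtain d where d: "d > 0" "!!s r. \<bar>s - t\<bar> < d ==> r \<in> {0..T} ==> \<bar>r - t\<bar> <= \<bar>s - t\<bar> ==> norm (h r - h t) <= e / (norm v + 1)"
  using weak_time_modulus[OF h t divide_pos_pos[OF e n]] by blast
 have "\<bar>F s \<bullet> v - F t \<bullet> v - (s - t) * (h t \<bullet> v)\<bar> <= e * \<bar>s - t\<bar>" if s: "s \<in> {0..T}" "\<bar>s - t\<bar> < d" for s
 proof -
  have "\<bar>F s \<bullet> v - F t \<bullet> v - (s - t) * (h t \<bullet> v)\<bar> <= e / (norm v + 1) * norm v * \<bar>s - t\<bar>"
   by (rule weak_time_expansion[OF deriv v t s(1) d(2)[OF s(2)]])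
  also have "\<dots> <= e * \<bar>s - t\<bar>"
  proof (rule mult_right_mono)
   have "e / (norm v + 1) * norm v <= e / (norm v + 1) * (norm v + 1)" using e n by (intro mult_left_mono) auto
   then show "e / (norm v + 1) * norm v <= e" using n by simp
  qed simp
  finally show ?thesis .
 qed
 then show "\<exists>d>0. \<forall>s\<in>{0..T}. \<bar>s - t\<bar> < d \<longrightarrow> \<bar>F s \<bullet> v - F t \<bullet> v - (s - t) * (h t \<bullet> v)\<bar> <= e * \<bar>s - t\<bar>"
  using d(1) by blast
qed

lemma time_derivative_norm:
 fixes F h :: "real => 'h::real_inner"
 assumes deriv: "!!r v. r \<in> {0..T} ==> v \<in> D ==> ((%s. F s \<bullet> v) has_real_derivative h r \<bullet> v) (at r within {0..T})"
  and h: "continuous_on {0..T} h" and F: "continuous_on {0..T} F" "!!r. r \<in> {0..T} ==> F r \<in> closure D" and t: "t \<in> {0..T}"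
 shows "((%s. (norm (F s))\<^sup>2) has_real_derivative 2 * (h t \<bullet> F t)) (at t within {0..T})"
proof (rule has_real_derivative_withinI)
 fix e :: real assume e: "e > 0"
 define N where "N = 2 * norm (F t) + norm (h t) + 2"
 have N: "N > 0" unfolding N_def by (simp add: add_nonneg_pos)
 define e1 where "e1 = min 1 (e / (2 * N))"
 have e1: "e1 > 0" using e N by (simp add: e1_def)
 obtain d where d: "d > 0" "!!s r. \<bar>s - t\<bar> < d ==> r \<in> {0..T} ==> \<bar>r - t\<bar> <= \<bar>s - t\<bar> ==> norm (h r - h t) <= e1"
  using weak_time_modulus[OF h t e1] by blast
 obtain d' where d': "d' > 0" "!!r. r \<in> {0..T} ==> dist r t < d' ==> dist (F r) (F t) < e1"
  using continuous_on_dist[OF F(1) t e1] by blast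
 have "\<bar>(norm (F s))\<^sup>2 - (norm (F t))\<^sup>2 - (s - t) * (2 * (h t \<bullet> F t))\<bar> <= e * \<bar>s - t\<bar>"
  if s: "s \<in> {0..T}" "\<bar>s - t\<bar> < min d d'" for s
 proof -
  have sd: "\<bar>s - t\<bar> < d" using s(2) by simp
  have close: "norm (F s - F t) < e1" using d'(2)[OF s(1)] s(2) by (simp add: dist_real_def dist_norm)
  have E: "\<bar>F s \<bullet> v - F t \<bullet> v - (s - t) * (h t \<bullet> v)\<bar> <= e1 * norm v * \<bar>s - t\<bar>" if "v \<in> closure D" for v
   by (rule weak_time_expansion[OF deriv that t s(1) d(2)[OF sd]])
  have A: "\<bar>F s \<bullet> F s - F t \<bullet> F s - (s - t) * (h t \<bullet> F s)\<bar> <= e1 * norm (F s) * \<bar>s - t\<bar>" by (rule E[OF F(2)[OF s(1)]])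
  have B: "\<bar>F s \<bullet> F t - F t \<bullet> F t - (s - t) * (h t \<bullet> F t)\<bar> <= e1 * norm (F t) * \<bar>s - t\<bar>" by (rule E[OF F(2)[OF t]])
  have C: "\<bar>(s - t) * (h t \<bullet> (F s - F t))\<bar> <= e1 * norm (h t) * \<bar>s - t\<bar>"
  proof -
   have "\<bar>h t \<bullet> (F s - F t)\<bar> <= norm (h t) * norm (F s - F t)" by (rule Cauchy_Schwarz_ineq2)
   also have "\<dots> <= norm (h t) * e1" using close by (intro mult_left_mono) auto
   finally have "\<bar>s - t\<bar> * \<bar>h t \<bullet> (F s - F t)\<bar> <= \<bar>s - t\<bar> * (norm (h t) * e1)" by (rule mult_left_mono) simp
   then show ?thesis by (simp add: abs_mult ac_simps)
  qed
  have eq: "(norm (F s))\<^sup>2 - (norm (F t))\<^sup>2 - (s - t) * (2 * (h t \<bullet> F t))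
   = (F s \<bullet> F s - F t \<bullet> F s - (s - t) * (h t \<bullet> F s)) + (F s \<bullet> F t - F t \<bullet> F t - (s - t) * (h t \<bullet> F t)) + (s - t) * (h t \<bullet> (F s - F t))"
   by (simp add: power2_norm_eq_inner inner_commute[of "F t" "F s"] inner_diff_right algebra_simps)
  have "\<bar>(norm (F s))\<^sup>2 - (norm (F t))\<^sup>2 - (s - t) * (2 * (h t \<bullet> F t))\<bar>
   <= e1 * norm (F s) * \<bar>s - t\<bar> + e1 * norm (F t) * \<bar>s - t\<bar> + e1 * norm (h t) * \<bar>s - t\<bar>"
   unfolding eq using A B C by linarith
  also have "\<dots> = (e1 * (norm (F s) + norm (F t) + norm (h t))) * \<bar>s - t\<bar>" by (simp add: algebra_simps)
  also have "\<dots> <= e * \<bar>s - t\<bar>"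
  proof (rule mult_right_mono)
   have "norm (F s) <= norm (F t) + norm (F s - F t)" by (rule norm_triangle_sub)
   then have "norm (F s) + norm (F t) + norm (h t) <= N" using close by (simp add: N_def e1_def)
   then have "e1 * (norm (F s) + norm (F t) + norm (h t)) <= e / (2 * N) * N"
    using e1 N e by (intro mult_mono) (auto simp: e1_def)
   also have "\<dots> = e / 2" using N by simp
   finally show "e1 * (norm (F s) + norm (F t) + norm (h t)) <= e" using e by simp
  qed simp
  finally show ?thesis .
 qed
 then show "\<exists>d>0. \<forall>s\<in>{0..T}. \<bar>s - t\<bar> < d \<longrightarrow> \<bar>(norm (F s))\<^sup>2 - (norm (F t))\<^sup>2 - (s - t) * (2 * (h t \<bullet> F t))\<bar> <= e * \<bar>s - t\<bar>"
  using d(1) d'(1) by (intro exI[of _ "min d d'"]) auto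
qed

definition test_fields :: "R3 hl set" where
 "test_fields = {cl v | v. \<forall>k. (%x. v x $ k) \<in> test_functions}"

definition test_curls :: "R3 hl set" where
 "test_curls = {cl (test_curl \<psi>) | \<psi>. \<forall>k. \<psi> k \<in> test_functions}"

lemma closure_test_fields:
 assumes f: "f \<in> L2" shows "cl f \<in> closure test_fields"
 unfolding closure_approachable
proof (intro allI impI)
 fix e :: real assume e: "e > 0"
 have "\<exists>\<phi>. \<phi> \<in> test_functions \<and> norm (cl \<phi> - cl (%x. f x $ k)) < e/3" for k
  by (rule H1_dense_eps[where I="{}" and f="%x. f x $ k" and e="e/3"]) (use L2_nth[OF f] e in auto)
 then obtain \<phi> where \<phi>: "!!k. \<phi> k \<in> test_functions" "!!k. norm (cl (\<phi> k) - cl (%x. f x $ k)) < e/3" by metis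
 define v where "v x = (\<chi> k. \<phi> k x)" for x
 have vk: "(%x. v x $ k) = \<phi> k" for k by (simp add: v_def)
 have v2: "v \<in> L2" by (rule L2_of_nth) (simp add: vk test_L2[OF \<phi>(1)])
 have "norm (cl v - cl f) <= (\<Sum>k\<in>UNIV. norm (cl (%x. (v x - f x) $ k)))"
  unfolding cl_diff[OF v2 f, symmetric] by (rule norm_cl_vec_le[OF L2_diff[OF v2 f]])
 also have "\<dots> = (\<Sum>k\<in>UNIV. norm (cl (\<phi> k) - cl (%x. f x $ k)))"
  using cl_diff[OF test_L2[OF \<phi>(1)] L2_nth[OF f]] by (simp add: v_def)
 also have "\<dots> < e" using \<phi>(2)[of 1] \<phi>(2)[of 2] \<phi>(2)[of 3] by (simp add: sum_3)
 finally have "dist (cl v) (cl f) < e" by (simp add: dist_norm)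
 moreover have "cl v \<in> test_fields" unfolding test_fields_def using \<phi>(1) vk by auto
 ultimately show "\<exists>y\<in>test_fields. dist y (cl f) < e" by blast
qed

lemma closure_test_curls:
 assumes "f \<in> L2" "div_free f" shows "cl f \<in> closure test_curls"
 unfolding closure_approachable
proof (intro allI impI)
 fix e :: real assume e: "e > 0"
 obtain \<psi> where "!!k. \<psi> k \<in> test_functions" "norm (cl f - cl (test_curl \<psi>)) < e"
  using test_curl_dense[OF assms e] by blast
 then show "\<exists>y\<in>test_curls. dist y (cl f) < e"
  unfolding test_curls_def by (auto simp: dist_norm norm_minus_commute intro!: exI)
qed

lemma time_derivative_test:
 assumes td: "has_time_deriv T f f'" and f2: "!!s. s \<in> {0..T} ==> f s \<in> L2"
  and v: "!!k. (%x. v x $ k) \<in> test_functions" and t: "t \<in> {0..T}"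
 shows "((%s. cl (f s) \<bullet> cl v) has_real_derivative (\<integral>x. v x \<bullet> f' t x \<partial>lebesgue)) (at t within {0..T})"
proof -
 have v2: "v \<in> L2" by (rule L2_of_nth) (rule test_L2[OF v])
 have e: "(\<integral>x. v x \<bullet> g x \<partial>lebesgue) = (\<Sum>k\<in>UNIV. (\<integral>x. v x $ k *\<^sub>R g x \<partial>lebesgue) $ k)" if g: "loc_integrable g" for g
 proof -
  have i: "integrable lebesgue (%x. v x $ k *\<^sub>R g x)" for k by (rule test_scale_integrable[OF g v])
  have "integrable lebesgue (%x. (v x $ k *\<^sub>R g x) $ k)" for k
   by (rule integrable_bounded_linear[OF bounded_linear_vec_nth i])
  then have i': "integrable lebesgue (%x. v x $ k * g x $ k)" for k by simp
  have "(\<integral>x. v x \<bullet> g x \<partial>lebesgue) = (\<Sum>k\<in>UNIV. \<integral>x. v x $ k * g x $ k \<partial>lebesgue)"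
   unfolding inner_vec_def inner_real_def by (rule Bochner_Integration.integral_sum) (rule i')
  also have "\<dots> = (\<Sum>k\<in>UNIV. (\<integral>x. v x $ k *\<^sub>R g x \<partial>lebesgue) $ k)"
   using integral_bounded_linear[OF bounded_linear_vec_nth i] by simp
  finally show ?thesis .
 qed
 have d: "((%s. \<Sum>k\<in>UNIV. (\<integral>x. v x $ k *\<^sub>R f s x \<partial>lebesgue) $ k) has_vector_derivative (\<Sum>k\<in>UNIV. (\<integral>x. v x $ k *\<^sub>R f' t x \<partial>lebesgue) $ k)) (at t within {0..T})"
 proof (intro has_vector_derivative_sum bounded_linear.has_vector_derivative[OF bounded_linear_vec_nth])
  fix k :: 3
  have "\<forall>\<phi>\<in>test_functions. ((%s. \<integral>x. \<phi> x *\<^sub>R f s x \<partial>lebesgue) has_vector_derivative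
    (\<integral>x. \<phi> x *\<^sub>R f' t x \<partial>lebesgue)) (at t within {0..T})"
   using td t by (simp add: has_time_deriv_def)
  from bspec[OF this v[of k]]
  show "((%s. \<integral>x. v x $ k *\<^sub>R f s x \<partial>lebesgue) has_vector_derivative (\<integral>x. v x $ k *\<^sub>R f' t x \<partial>lebesgue)) (at t within {0..T})" .
 qed
 have eq: "cl (f s) \<bullet> cl v = (\<Sum>k\<in>UNIV. (\<integral>x. v x $ k *\<^sub>R f s x \<partial>lebesgue) $ k)" if "s \<in> {0..T}" for s
  unfolding e[OF L2_loc_integrable[OF f2[OF that]], symmetric] by (simp add: inner_cl[OF v2 f2[OF that]] inner_commute[of "cl (f s)"])
 have l': "loc_integrable (f' t)" using td t by (simp add: has_time_deriv_def)
 show ?thesis unfolding has_real_derivative_iff_has_vector_derivative e[OF l']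
  by (rule has_vector_derivative_transform[OF t _ d]) (simp add: eq)
qed

lemma time_derivative_fields:
 assumes td: "has_time_deriv T f f'" and f2: "!!s. s \<in> {0..T} ==> f s \<in> L2"
  and ae: "AE x in lebesgue. f' t x = g x" and g: "g \<in> L2" and t: "t \<in> {0..T}" and v: "v \<in> test_fields"
 shows "((%s. cl (f s) \<bullet> v) has_real_derivative cl g \<bullet> v) (at t within {0..T})"
proof -
 obtain w where w: "v = cl w" "!!k. (%x. w x $ k) \<in> test_functions" using v unfolding test_fields_def by blast
 have w2: "w \<in> L2" by (rule L2_of_nth) (rule test_L2[OF w(2)])
 have f'2: "f' t \<in> L2" by (rule L2_cong_AE[OF g AE_swap[OF ae]])
 have "(\<integral>x. w x \<bullet> f' t x \<partial>lebesgue) = cl g \<bullet> cl w"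
  using cl_cong[OF f'2 ae] inner_cl[OF w2 f'2] by (simp add: inner_commute)
 then show ?thesis using time_derivative_test[OF td f2 w(2) t] by (simp add: w(1))
qed

lemma time_derivative_curls:
 assumes td: "has_time_deriv T f f'" and f2: "!!s. s \<in> {0..T} ==> f s \<in> L2"
  and ae: "AE x in lebesgue. f' t x = g x - weak_grad p x" and g: "g \<in> L2" and p: "weakly_differentiable (p :: R3 => real)"
  and t: "t \<in> {0..T}" and v: "v \<in> test_curls"
 shows "((%s. cl (f s) \<bullet> v) has_real_derivative cl g \<bullet> v) (at t within {0..T})"
proof -
 obtain \<psi> where w: "v = cl (test_curl \<psi>)" "!!k. \<psi> k \<in> test_functions" using v unfolding test_curls_def by blast
 let ?w = "test_curl \<psi>"
 have wk: "(%x. ?w x $ k) \<in> test_functions" for k by (rule test_curl_test[OF w(2)])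
 have w2: "?w \<in> L2" by (rule test_curl_L2[OF w(2)])
 have wm: "?w \<in> borel_measurable lebesgue" by (rule L2_measurable[OF w2])
 have ip: "integrable lebesgue (%x. ?w x \<bullet> weak_grad p x)"
  unfolding inner_vec_def inner_real_def
  by (intro Bochner_Integration.integrable_sum test_times_integrable[OF weak_grad_works(2)[OF p] wk])
 have pm: "weak_grad p \<in> borel_measurable lebesgue"
 proof -
  have "loc_integrable (%x. weak_grad p x $ i)" for i by (rule weak_grad_works(2)[OF p])
  then have "(%x. \<Sum>i\<in>UNIV. weak_grad p x $ i *\<^sub>R axis i (1::real)) \<in> borel_measurable lebesgue"
   by (intro borel_measurable_sum borel_measurable_scaleR borel_measurable_const loc_integrable_measurable)
  moreover have "(%x. \<Sum>i\<in>UNIV. weak_grad p x $ i *\<^sub>R axis i (1::real)) = weak_grad p"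
   by (simp add: fun_eq_iff vec_eq_iff axis_def if_distrib cong: if_cong)
  ultimately show ?thesis by simp
 qed
 have fm: "f' t \<in> borel_measurable lebesgue"
  using td t loc_integrable_measurable unfolding has_time_deriv_def by blast
 have gm: "g \<in> borel_measurable lebesgue" by (rule L2_measurable[OF g])
 have "(\<integral>x. ?w x \<bullet> f' t x \<partial>lebesgue) = (\<integral>x. ?w x \<bullet> g x - ?w x \<bullet> weak_grad p x \<partial>lebesgue)"
 proof (rule integral_cong_AE)
  show "AE x in lebesgue. ?w x \<bullet> f' t x = ?w x \<bullet> g x - ?w x \<bullet> weak_grad p x"
   using ae by eventually_elim (simp add: inner_diff_right)
 qed (use wm fm gm pm in measurable)
 also have "\<dots> = (\<integral>x. ?w x \<bullet> g x \<partial>lebesgue)"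
  using ip L2_inner_integrable[OF w2 g] test_curl_weak_grad[OF p w(2)] by simp
 also have "\<dots> = cl g \<bullet> cl ?w" by (simp add: inner_cl[OF g w2] inner_commute)
 finally show ?thesis using time_derivative_test[OF td f2 wk t] by (simp add: w(1))
qed

section \<open>Vector calculus in \<open>L\<^sup>2\<close>\<close>

definition H1_field :: "(R3 => R3) => (3 => R3 => R3) => bool" where
 "H1_field V dV \<longleftrightarrow> (\<forall>i k. wd i (%x. V x $ k) (%x. dV i x $ k))"

text \<open>The gradient is an argument, since weak derivatives have no canonical representative.\<close>

definition curl_of :: "(3 => R3 => R3) => R3 => R3" where
 "curl_of dV x = (\<Sum>i\<in>UNIV. axis i 1 \<times> dV i x)"

definition adv :: "(R3 => R3) => (3 => R3 => R3) => R3 => R3" where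
 "adv v dW x = (\<Sum>i\<in>UNIV. v x $ i *\<^sub>R dW i x)"

lemma axis_three: "axis 1 (1::real) = (vector [1, 0, 0] :: R3)" "axis 2 (1::real) = (vector [0, 1, 0] :: R3)"
 "axis 3 (1::real) = (vector [0, 0, 1] :: R3)"
 by (simp_all add: vec_eq_iff forall_3 vector_3 axis_def)

lemma curl_of_nth:
 "curl_of dV x $ 1 = dV 2 x $ 3 - dV 3 x $ 2"
 "curl_of dV x $ 2 = dV 3 x $ 1 - dV 1 x $ 3"
 "curl_of dV x $ 3 = dV 1 x $ 2 - dV 2 x $ 1"
 by (simp_all add: curl_of_def sum_3 axis_three cross3_def vector_3)

lemma weak_curl_eq: "weak_curl f = curl_of (%i. weak_partial i f)"
 by (simp add: fun_eq_iff vec_eq_iff forall_3 curl_of_nth weak_curl_def vector_3)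

lemma advect_eq: "advect v w = adv v (%i. weak_partial i w)"
 by (simp add: fun_eq_iff advect_def adv_def)

lemma norm_cross_le: "norm (x \<times> y) <= norm x * norm (y :: R3)"
proof (rule power2_le_imp_le)
 have "(norm (x \<times> y))\<^sup>2 + (x \<bullet> y)\<^sup>2 = (norm x * norm y)\<^sup>2" using norm_and_cross_eq_0 norm_cross_dot[of x y] by simp
 then show "(norm (x \<times> y))\<^sup>2 <= (norm x * norm y)\<^sup>2" using zero_le_power2[of "x \<bullet> y"] by linarith
qed simp

lemma H1_fieldD:
 assumes "H1_field V dV" shows "V \<in> L2" "dV i \<in> L2" "wd i (%x. V x $ k) (%x. dV i x $ k)"
 using assms unfolding H1_field_def by (auto intro!: L2_of_nth dest: wd_L2)

lemma H1_field_diff: "H1_field V dV ==> H1_field U dU ==> H1_field (%x. V x - U x) (%i x. dV i x - dU i x)"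
 by (simp add: H1_field_def wd_diff)

lemma cross_const_L2:
 assumes "F \<in> L2" shows "(%x. a \<times> F x) \<in> L2" "norm (cl (%x. a \<times> F x)) <= norm a * norm (cl F)"
 using product_L2[OF bilinear_conv_bounded_bilinear[THEN iffD1, OF bilinear_cross] norm_cross_le, of "%_. a" "norm a" F] assms by auto

lemma curl_of_L2: assumes "!!i. dV i \<in> L2" shows "curl_of dV \<in> L2"
 unfolding curl_of_def[abs_def] by (intro L2_sum cross_const_L2 assms)

lemma cl_curl_of: assumes "!!i. dV i \<in> L2" shows "cl (curl_of dV) = (\<Sum>i\<in>UNIV. cl (%x. axis i 1 \<times> dV i x))"
 unfolding curl_of_def[abs_def] by (intro cl_sum cross_const_L2 assms)

lemma norm_curl_of_le: assumes "!!i. dV i \<in> L2" shows "norm (cl (curl_of dV)) <= (\<Sum>i\<in>UNIV. norm (cl (dV i)))"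
 unfolding cl_curl_of[OF assms]
 by (rule order_trans[OF norm_sum sum_mono])
  (rule order_trans[OF cross_const_L2(2)[OF assms]], simp add: norm_axis_1)

lemma curl_of_bound: "(!!i. norm (dV i x) <= K) ==> norm (curl_of dV x) <= 3 * K"
proof -
 assume K: "!!i. norm (dV i x) <= K"
 have "norm (curl_of dV x) <= (\<Sum>i\<in>(UNIV::3 set). K)" unfolding curl_of_def
  by (rule order_trans[OF norm_sum sum_mono]) (rule order_trans[OF norm_cross_le], use K in \<open>simp add: norm_axis_1\<close>)
 then show ?thesis by simp
qed

lemma curl_of_diff: "curl_of (%i x. dV i x - dU i x) x = curl_of dV x - curl_of dU x"
 by (simp add: curl_of_def sum_subtractf Cross3.right_diff_distrib)

lemma inner_cl_vec:
 fixes F U :: "R3 => R3" assumes "F \<in> L2" "U \<in> L2"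
 shows "cl F \<bullet> cl U = (\<Sum>k\<in>UNIV. cl (%x. F x $ k) \<bullet> cl (%x. U x $ k))"
proof -
 have i: "integrable lebesgue (%x. F x $ k * U x $ k)" for k
  using L2_inner_integrable[OF L2_nth[OF assms(1)] L2_nth[OF assms(2)]] by simp
 have "cl F \<bullet> cl U = (\<integral>x. (\<Sum>k\<in>UNIV. F x $ k * U x $ k) \<partial>lebesgue)"
  by (simp add: inner_cl[OF assms] inner_vec_def)
 also have "\<dots> = (\<Sum>k\<in>UNIV. \<integral>x. F x $ k * U x $ k \<partial>lebesgue)"
  by (rule Bochner_Integration.integral_sum) (rule i)
 finally show ?thesis by (simp add: inner_cl[OF L2_nth[OF assms(1)] L2_nth[OF assms(2)]])
qed

lemma curl_by_parts:
 assumes V: "H1_field V dV" and U: "H1_field U dU"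
 shows "cl (curl_of dV) \<bullet> cl U = cl V \<bullet> cl (curl_of dU)"
proof -
 note v = H1_fieldD[OF V] and u = H1_fieldD[OF U]
 have p: "cl (%x. dV i x $ k) \<bullet> cl (%x. U x $ l) = - (cl (%x. V x $ k) \<bullet> cl (%x. dU i x $ l))" for i k l
  by (rule wd_by_parts[OF v(3) u(3)])
 have l: "(%x. dV i x $ k) \<in> L2" "(%x. dU i x $ k) \<in> L2" for i k using wd_L2(2)[OF v(3)] wd_L2(2)[OF u(3)] .
 show ?thesis
  unfolding inner_cl_vec[OF curl_of_L2[OF v(2)] u(1)] inner_cl_vec[OF v(1) curl_of_L2[OF u(2)]] sum_3 curl_of_nth
  by (simp add: cl_diff l inner_diff_left inner_diff_right p)
qed

lemma adv_diff_left: "adv v dW x - adv u dW x = adv (%x. v x - u x) dW x"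
 by (simp add: adv_def sum_subtractf scaleR_left_diff_distrib)
lemma adv_diff_right: "adv v dW x - adv v dU x = adv v (%i x. dW i x - dU i x) x"
 by (simp add: adv_def sum_subtractf scaleR_right_diff_distrib)

lemma adv_L2:
 assumes v: "v \<in> borel_measurable lebesgue" "AE x in lebesgue. norm (v x) <= K" "K >= 0" and d: "!!i. dW i \<in> L2"
 shows "(%x. v x $ i *\<^sub>R dW i x) \<in> L2" "adv v dW \<in> L2"
proof -
 have "bounded_linear (%x::R3. x $ i)" for i by (rule bounded_linear_vec_nth)
 have m: "(%x. v x $ i) \<in> borel_measurable lebesgue" for i
  by (rule measurable_compose[OF v(1) borel_measurable_continuous_onI[OF linear_continuous_on[OF bounded_linear_vec_nth]]])
 have a: "AE x in lebesgue. \<bar>v x $ i\<bar> <= K" for i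
  using v(2) by eventually_elim (rule order_trans[OF component_le_norm_cart])
 show *: "(%x. v x $ i *\<^sub>R dW i x) \<in> L2" for i by (rule norm_cl_scale_bound(1)[OF d m v(3) a])
 show "adv v dW \<in> L2" unfolding adv_def[abs_def] by (intro L2_sum *)
qed

lemma grad_L2: assumes "\<phi> \<in> test_functions" shows "grad \<phi> \<in> L2"
 by (rule L2_of_nth) (simp add: grad_def test_L2[OF test_partial[OF assms]])

text \<open>For test functions \<open>2 \<phi> v\<cdot>\<nabla>\<phi> = v\<cdot>\<nabla>(\<phi>\<^sup>2)\<close> has zero integral, and the general case follows by density.\<close>

lemma transport_orthogonal_scalar:
 assumes v: "v \<in> L2" "div_free v" "AE x in lebesgue. norm (v x) <= K" "K >= 0" and f: "!!i. wd i f (g i)"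
 shows "(\<Sum>i\<in>UNIV. cl (%x. v x $ i *\<^sub>R g i x) \<bullet> cl f) = 0"
proof -
 note f2 = wd_L2[OF f]
 have vm: "(%x. v x $ i) \<in> borel_measurable lebesgue" for i by (rule L2_measurable[OF L2_nth[OF v(1)]])
 have vb: "AE x in lebesgue. \<bar>v x $ i\<bar> <= K" for i using v(3) by eventually_elim (rule order_trans[OF component_le_norm_cart])
 obtain \<phi> where \<phi>: "!!n. \<phi> n \<in> test_functions" "(%n. cl (\<phi> n)) \<longlonglongrightarrow> cl f"
  "!!i. i \<in> UNIV ==> (%n. cl (partial i (\<phi> n))) \<longlonglongrightarrow> cl (g i)"
  using H1_dense[of f UNIV g, OF f2(1) f] by blast
 have pL: "partial i (\<phi> n) \<in> L2" for i n by (rule test_L2[OF test_partial[OF \<phi>(1)]])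
 note m1 = norm_cl_scale_bound[OF pL vm v(4) vb] and m2 = norm_cl_scale_bound[OF f2(2) vm v(4) vb]
 have lim: "(%n. cl (%x. v x $ i *\<^sub>R partial i (\<phi> n) x)) \<longlonglongrightarrow> cl (%x. v x $ i *\<^sub>R g i x)" for i
 proof (rule LIM_zero_cancel, rule Lim_null_comparison[OF eventuallyI])
  fix n
  have d: "(%x. partial i (\<phi> n) x - g i x) \<in> L2" by (rule L2_diff[OF pL f2(2)])
  have "cl (%x. v x $ i *\<^sub>R partial i (\<phi> n) x) - cl (%x. v x $ i *\<^sub>R g i x) = cl (%x. v x $ i *\<^sub>R (partial i (\<phi> n) x - g i x))"
   by (simp only: scaleR_right_diff_distrib cl_diff[OF m1(1) m2(1)])
  then show "norm (cl (%x. v x $ i *\<^sub>R partial i (\<phi> n) x) - cl (%x. v x $ i *\<^sub>R g i x)) <= K * norm (cl (partial i (\<phi> n)) - cl (g i))"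
   using norm_cl_scale_bound(2)[OF d vm v(4) vb] by (simp only: cl_diff[OF pL f2(2)])
 next
  have "(%n. K * norm (cl (partial i (\<phi> n)) - cl (g i))) \<longlonglongrightarrow> K * norm (cl (g i) - cl (g i))"
   by (intro tendsto_intros \<phi>(3)) simp
  then show "(%n. K * norm (cl (partial i (\<phi> n)) - cl (g i))) \<longlonglongrightarrow> 0" by simp
 qed
 have zero: "(\<Sum>i\<in>UNIV. cl (%x. v x $ i *\<^sub>R partial i (\<phi> n) x) \<bullet> cl (\<phi> n)) = 0" for n
 proof -
  let ?q = "%x. \<phi> n x * \<phi> n x"
  have s: "smooth (\<phi> n)" by (rule test_smooth[OF \<phi>(1)])
  have q: "?q \<in> test_functions" by (rule test_mult_smooth[OF \<phi>(1) s])
  have "grad ?q x $ i = 2 * (partial i (\<phi> n) x * \<phi> n x)" for x i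
   by (simp add: grad_def partial_mult smooth_differentiable s)
  then have e: "v x \<bullet> grad ?q x = 2 * (\<Sum>i\<in>UNIV. (v x $ i *\<^sub>R partial i (\<phi> n) x) \<bullet> \<phi> n x)" for x
   by (simp add: inner_vec_def sum_distrib_left ac_simps)
  have i: "integrable lebesgue (%x. (v x $ i *\<^sub>R partial i (\<phi> n) x) \<bullet> \<phi> n x)" for i
   by (rule L2_inner_integrable[OF m1(1) test_L2[OF \<phi>(1)]])
  have "(\<integral>x. v x \<bullet> grad ?q x \<partial>lebesgue) = 0" using v(2) q by (simp add: div_free_def)
  then have "(\<integral>x. (\<Sum>i\<in>UNIV. (v x $ i *\<^sub>R partial i (\<phi> n) x) \<bullet> \<phi> n x) \<partial>lebesgue) = 0" unfolding e by simp
  then show ?thesis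
   by (subst (asm) Bochner_Integration.integral_sum[OF i]) (simp only: inner_cl[OF m1(1) test_L2[OF \<phi>(1)]])
 qed
 have "(%n. \<Sum>i\<in>UNIV. cl (%x. v x $ i *\<^sub>R partial i (\<phi> n) x) \<bullet> cl (\<phi> n)) \<longlonglongrightarrow> (\<Sum>i\<in>UNIV. cl (%x. v x $ i *\<^sub>R g i x) \<bullet> cl f)"
  by (intro tendsto_intros lim \<phi>(2))
 then show ?thesis unfolding zero using LIMSEQ_unique[OF _ tendsto_const] by blast
qed

lemma transport_orthogonal:
 assumes v: "v \<in> L2" "div_free v" "AE x in lebesgue. norm (v x) <= K" "K >= 0" and w: "H1_field w dw"
 shows "cl (adv v dw) \<bullet> cl w = 0"
proof -
 note W = H1_fieldD[OF w]
 have a: "(%x. v x $ i *\<^sub>R dw i x) \<in> L2" "adv v dw \<in> L2" for i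
  by (rule adv_L2[OF L2_measurable[OF v(1)] v(3,4) W(2)])+
 have c: "cl (adv v dw) = (\<Sum>i\<in>UNIV. cl (%x. v x $ i *\<^sub>R dw i x))" unfolding adv_def[abs_def] by (rule cl_sum) (rule a)
 have "cl (adv v dw) \<bullet> cl w = (\<Sum>i\<in>UNIV. \<Sum>k\<in>UNIV. cl (%x. v x $ i *\<^sub>R dw i x $ k) \<bullet> cl (%x. w x $ k))"
  unfolding c inner_sum_left by (simp add: inner_cl_vec[OF a(1) W(1)])
 also have "\<dots> = (\<Sum>k\<in>UNIV. \<Sum>i\<in>UNIV. cl (%x. v x $ i *\<^sub>R dw i x $ k) \<bullet> cl (%x. w x $ k))" by (rule sum.swap)
 also have "\<dots> = (\<Sum>k\<in>(UNIV::3 set). 0)"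
  by (rule sum.cong[OF refl]) (rule transport_orthogonal_scalar[OF v W(3)])
 finally show ?thesis by simp
qed

lemma div_free_inner: "f \<in> L2 ==> div_free f \<longleftrightarrow> (\<forall>\<phi>\<in>test_functions. cl f \<bullet> cl (grad \<phi>) = 0)"
 by (simp add: div_free_def L2_loc_integrable inner_cl grad_L2)

lemma div_free_diff: "f \<in> L2 ==> g \<in> L2 ==> div_free f ==> div_free g ==> div_free (%x. f x - g x)"
 by (simp add: div_free_inner L2_diff cl_diff inner_diff_left)
lemma div_free_scaleR: "f \<in> L2 ==> div_free f ==> div_free (%x. a *\<^sub>R f x)"
 by (simp add: div_free_inner L2_scaleR cl_scaleR)

lemma test_wd: "\<phi> \<in> test_functions ==> wd i \<phi> (partial i \<phi>)"
 unfolding wd_def using test_L2 test_partial test_by_parts[OF _ test_smooth] by blast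

lemma div_free_curl_of:
 assumes V: "H1_field V dV" shows "div_free (curl_of dV)"
 unfolding div_free_inner[OF curl_of_L2[OF H1_fieldD(2)[OF V]]]
proof
 fix \<phi> assume t: "\<phi> \<in> test_functions"
 have g: "H1_field (grad \<phi>) (%i x. \<chi> k. partial i (partial k \<phi>) x)"
  unfolding H1_field_def grad_def using test_wd[OF test_partial[OF t]] by simp
 have "curl_of (%i x. \<chi> k. partial i (partial k \<phi>) x) = (%x. 0)"
  using partial_commute[OF test_smooth[OF t]] by (simp add: fun_eq_iff vec_eq_iff forall_3 curl_of_nth)
 then show "cl (curl_of dV) \<bullet> cl (grad \<phi>) = 0" using curl_by_parts[OF V g] by (simp add: cl_zero)
qed

lemma H1_field_has_weak_deriv:
 assumes "H1_field V dV" shows "has_weak_deriv (axis i 1) V (dV i)"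
proof -
 note v = H1_fieldD[OF assms]
 note l = L2_loc_integrable[OF v(1)] L2_loc_integrable[OF v(2)]
 have "(\<integral>x. partial i \<phi> x *\<^sub>R V x \<partial>lebesgue) = - (\<integral>x. \<phi> x *\<^sub>R dV i x \<partial>lebesgue)" if t: "\<phi> \<in> test_functions" for \<phi>
 proof -
  have "(\<integral>x. partial i \<phi> x *\<^sub>R V x \<partial>lebesgue) $ k = (\<integral>x. partial i \<phi> x * V x $ k \<partial>lebesgue)" for k
   using integral_bounded_linear[OF bounded_linear_vec_nth[of k] test_scale_integrable[OF l(1) test_partial[OF t, of i]]] by simp
  moreover have "(\<integral>x. \<phi> x *\<^sub>R dV i x \<partial>lebesgue) $ k = (\<integral>x. \<phi> x * dV i x $ k \<partial>lebesgue)" for k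
   using integral_bounded_linear[OF bounded_linear_vec_nth[of k] test_scale_integrable[OF l(2)[of i] t]] by simp
  moreover have "(\<integral>x. partial i \<phi> x * V x $ k \<partial>lebesgue) = - (\<integral>x. \<phi> x * dV i x $ k \<partial>lebesgue)" for k
   using v(3)[of i k] t by (simp add: wd_def)
  ultimately show ?thesis by (simp add: vec_eq_iff)
 qed
 then show ?thesis using l by (simp add: has_weak_deriv_def multi_partial_axis mi_order_axis del: One_nat_def)
qed

text \<open>The trace of the gradient is orthogonal to every test function.\<close>

lemma div_free_trace_zero:
 assumes V: "H1_field V dV" and d: "div_free V" shows "AE x in lebesgue. (\<Sum>k\<in>UNIV. dV k x $ k) = 0"
proof (rule fundamental_lemma_real)
 note v = H1_fieldD[OF V]
 have t2: "(%x. \<Sum>k\<in>UNIV. dV k x $ k) \<in> L2" by (intro L2_sum L2_nth v(2))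
 then show "loc_integrable (%x. \<Sum>k\<in>UNIV. dV k x $ k)" by (rule L2_loc_integrable)
 fix \<phi> assume t: "\<phi> \<in> test_functions"
 have "(\<integral>x. \<phi> x * (\<Sum>k\<in>UNIV. dV k x $ k) \<partial>lebesgue) = cl \<phi> \<bullet> cl (%x. \<Sum>k\<in>UNIV. dV k x $ k)"
  by (simp add: inner_cl[OF test_L2[OF t] t2])
 also have "\<dots> = (\<Sum>k\<in>UNIV. cl \<phi> \<bullet> cl (%x. dV k x $ k))"
  by (subst cl_sum) (simp_all add: L2_nth v(2) inner_sum_right)
 also have "\<dots> = - (\<Sum>k\<in>UNIV. cl (partial k \<phi>) \<bullet> cl (%x. V x $ k))"
  using v(3) t unfolding wd_iff_inner by (simp add: sum_negf)
 also have "\<dots> = - (cl V \<bullet> cl (grad \<phi>))"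
  unfolding inner_cl_vec[OF v(1) grad_L2[OF t]] by (simp add: grad_def inner_commute)
 also have "\<dots> = 0" using d t by (simp add: div_free_inner[OF v(1)])
 finally show "(\<integral>x. \<phi> x * (\<Sum>k\<in>UNIV. dV k x $ k) \<partial>lebesgue) = 0" .
qed

lemma cross_nth: "(a \<times> b) $ 1 = a $ 2 * b $ 3 - a $ 3 * b $ 2" "(a \<times> b) $ 2 = a $ 3 * b $ 1 - a $ 1 * b $ 3"
 "(a \<times> b) $ 3 = a $ 1 * b $ 2 - a $ 2 * (b $ 1 :: real)"
 by (simp_all add: cross3_def vector_3)

lemma H1_field_cross:
 assumes V: "H1_field V dV" and U: "H1_field U dU" and A: "A >= 0" "AE x in lebesgue. norm (V x) <= A"
  and B: "B >= 0" "AE x in lebesgue. norm (U x) <= B"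
 shows "H1_field (%x. V x \<times> U x) (%i x. dV i x \<times> U x + V x \<times> dU i x)"
proof -
 have a: "AE x in lebesgue. \<bar>V x $ k\<bar> <= A" for k using A(2) by eventually_elim (rule order_trans[OF component_le_norm_cart])
 have b: "AE x in lebesgue. \<bar>U x $ k\<bar> <= B" for k using B(2) by eventually_elim (rule order_trans[OF component_le_norm_cart])
 have p: "wd i (%x. V x $ k * U x $ l - V x $ k' * U x $ l')
  (%x. (dV i x $ k * U x $ l + V x $ k * dU i x $ l) - (dV i x $ k' * U x $ l' + V x $ k' * dU i x $ l'))" for i k l k' l'
  by (rule wd_diff[OF wd_product[OF H1_fieldD(3)[OF V] H1_fieldD(3)[OF U] A(1) a B(1) b]
     wd_product[OF H1_fieldD(3)[OF V] H1_fieldD(3)[OF U] A(1) a B(1) b]])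
 have "\<forall>k. wd i (%x. (V x \<times> U x) $ k) (%x. (dV i x \<times> U x + V x \<times> dU i x) $ k)" for i
  unfolding forall_3 vector_add_component cross_nth
  using p[of i 2 3 3 2] p[of i 3 1 1 3] p[of i 1 2 2 1] by (simp add: algebra_simps)
 then show ?thesis unfolding H1_field_def by blast
qed

lemma bounded_bilinear_cross: "bounded_bilinear ((\<times>) :: R3 => R3 => R3)"
 using bilinear_conv_bounded_bilinear bilinear_cross by blast

lemma Linf_continuous_const: "Linf_continuous T (%t x. a)"
 unfolding Linf_continuous_def
proof (intro ballI conjI)
 show "\<exists>K\<ge>0. AE x::R3 in lebesgue. norm a <= K" by (rule exI[of _ "norm a"]) simp
 show "\<forall>e>0. \<exists>d>0. \<forall>s\<in>{0..T}. \<bar>s - t\<bar> < d \<longrightarrow> (AE x::R3 in lebesgue. norm (a - a) <= e)" for t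
  by (auto intro: exI[of _ 1])
qed simp

lemma Linf_continuous_nth: assumes "Linf_continuous T (a :: real => R3 => R3)" shows "Linf_continuous T (%t x. a t x $ i)"
 unfolding Linf_continuous_def
proof (intro ballI conjI allI impI)
 fix t assume t: "t \<in> {0..T}"
 have m: "a t \<in> borel_measurable lebesgue" using assms t by (simp add: Linf_continuous_def)
 show "(%x. a t x $ i) \<in> borel_measurable lebesgue"
  by (rule measurable_compose[OF m borel_measurable_continuous_onI[OF linear_continuous_on[OF bounded_linear_vec_nth]]])
 obtain K where K: "K >= 0" "AE x in lebesgue. norm (a t x) <= K" using assms t unfolding Linf_continuous_def by blast
 have "AE x in lebesgue. norm (a t x $ i) <= K"
  using K(2) by eventually_elim (simp add: order_trans[OF component_le_norm_cart])
 then show "\<exists>K\<ge>0. AE x in lebesgue. norm (a t x $ i) <= K" using K(1) by blast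
 fix e :: real assume e: "e > 0"
 obtain d where d: "d > 0" "!!s. s \<in> {0..T} ==> \<bar>s - t\<bar> < d ==> AE x in lebesgue. norm (a s x - a t x) <= e"
  using Linf_continuousD[OF assms t e] by blast
 have "AE x in lebesgue. norm (a s x $ i - a t x $ i) <= e" if "s \<in> {0..T}" "\<bar>s - t\<bar> < d" for s
  using d(2)[OF that]
 proof eventually_elim
  case (elim x)
  then show ?case using order_trans[OF component_le_norm_cart[of "a s x - a t x" i]] by simp
 qed
 then show "\<exists>d>0. \<forall>s\<in>{0..T}. \<bar>s - t\<bar> < d \<longrightarrow> (AE x in lebesgue. norm (a s x $ i - a t x $ i) <= e)"
  using d(1) by blast
qed

lemma cross_continuous:
 assumes a: "Linf_continuous T a" and b: "continuous_on {0..T} (%t. cl (b t))" "!!t. t \<in> {0..T} ==> b t \<in> L2"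
 shows "!!t. t \<in> {0..T} ==> (%x. a t x \<times> b t x) \<in> L2" "continuous_on {0..T} (%t. cl (%x. a t x \<times> b t x))"
proof -
 show "(%x. a t x \<times> b t x) \<in> L2" if "t \<in> {0..T}" for t
  by (rule product_continuous(1)[OF bounded_bilinear_cross norm_cross_le a b that])
 show "continuous_on {0..T} (%t. cl (%x. a t x \<times> b t x))"
  by (rule product_continuous(2)[OF bounded_bilinear_cross norm_cross_le a b])
qed

lemma adv_continuous:
 assumes a: "Linf_continuous T v" and d: "!!i. continuous_on {0..T} (%t. cl (dW t i))" "!!t i. t \<in> {0..T} ==> dW t i \<in> L2"
 shows "!!t. t \<in> {0..T} ==> adv (v t) (dW t) \<in> L2" "continuous_on {0..T} (%t. cl (adv (v t) (dW t)))"
proof -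
 note P = product_continuous[OF bounded_bilinear_scaleR _ Linf_continuous_nth[OF a] d]
 have p: "(%x. v t x $ i *\<^sub>R dW t i x) \<in> L2" if "t \<in> {0..T}" for t i by (rule P(1)) (use that in auto)
 have c: "continuous_on {0..T} (%t. cl (%x. v t x $ i *\<^sub>R dW t i x))" for i by (rule P(2)) auto
 show "adv (v t) (dW t) \<in> L2" if "t \<in> {0..T}" for t unfolding adv_def[abs_def] by (intro L2_sum p that)
 have "continuous_on {0..T} (%t. \<Sum>i\<in>UNIV. cl (%x. v t x $ i *\<^sub>R dW t i x))" by (intro continuous_on_sum c)
 then show "continuous_on {0..T} (%t. cl (adv (v t) (dW t)))"
  by (rule continuous_on_eq) (simp add: adv_def[abs_def] cl_sum p)
qed

lemma curl_of_continuous: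
 fixes T :: real
 assumes d: "!!i. continuous_on {0..T} (%t. cl (dW t i))" "!!t i. t \<in> {0..T} ==> dW t i \<in> L2"
 shows "continuous_on {0..T} (%t. cl (curl_of (dW t)))"
proof -
 have "continuous_on {0..T} (%t. cl (%x. axis i 1 \<times> dW t i x))" for i
  using cross_continuous(2)[of T "%t x. axis i 1" "%t. dW t i"] Linf_continuous_const d by blast
 then have "continuous_on {0..T} (%t. \<Sum>i\<in>UNIV. cl (%x. axis i 1 \<times> dW t i x))"
  by (intro continuous_on_sum)
 then show ?thesis by (rule continuous_on_eq) (simp add: cl_curl_of d(2))
qed

section \<open>The Euler-Maxwell system\<close>

lemma Hspace_H1_field:
 "f \<in> Hspace m ==> 3 <= m ==> H1_field f (%i. weak_partial i f)"
 unfolding H1_field_def using Hspace_field(2) by blast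

lemma CHspace_partial_continuous:
 fixes f :: "real => R3 => R3"
 shows "f \<in> CHspace T m ==> 3 <= m ==> continuous_on {0..T} (%t. cl (weak_partial i (f t)))"
proof (rule CHspace_continuous)
 assume "3 <= m" then show "mi_order (axis i 1) <= m" unfolding mi_order_axis by linarith
qed

lemma CHspace_curl_continuous:
 fixes f :: "real => R3 => R3"
 assumes "f \<in> CHspace T m" "3 <= m" shows "continuous_on {0..T} (%t. cl (weak_curl (f t)))"
 unfolding weak_curl_eq
proof (rule curl_of_continuous)
 show "continuous_on {0..T} (%t. cl (weak_partial i (f t)))" for i by (rule CHspace_partial_continuous[OF assms])
 show "weak_partial i (f t) \<in> L2" if "t \<in> {0..T}" for t i
  by (rule Hspace_field(1)[OF CHspace_Hspace[OF assms(1) that] assms(2)])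
qed

lemma weak_curl_L2: "f \<in> Hspace m ==> 3 <= m ==> weak_curl f \<in> L2"
 unfolding weak_curl_eq by (rule curl_of_L2[OF Hspace_field(1)])

lemma cross_triple_L2:
 assumes "(%x. a x \<times> b x) \<in> L2" "(%x. w x \<times> b x) \<in> L2" "a \<in> L2" "w \<in> L2"
 shows "cl (%x. a x \<times> b x) \<bullet> cl w = - (cl (%x. w x \<times> b x) \<bullet> cl a)"
proof -
 have "(a x \<times> b x) \<bullet> w x = - ((w x \<times> b x) \<bullet> a x)" for x
  by (simp add: inner_vec_def sum_3 cross_nth algebra_simps)
 then show ?thesis by (simp add: inner_cl assms)
qed

lemma norm_le_if_inner: fixes d x :: "'h::real_inner" assumes "d \<bullet> d = x \<bullet> d" shows "norm d <= norm x"
proof (cases "d = 0")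
 case False
 have "norm d * norm d = x \<bullet> d" using assms by (simp add: power2_norm_eq_inner[symmetric] power2_eq_square)
 also have "\<dots> <= norm x * norm d" by (rule norm_cauchy_schwarz)
 finally show ?thesis using False by simp
qed simp

text \<open>Used for functions that are not given by a formula but whose increments are controlled.\<close>

lemma continuous_on_comparison:
 fixes f :: "real => 'a::real_normed_vector" and g :: "real => 'b::real_normed_vector" and h :: "real => 'c::real_normed_vector"
 assumes g: "continuous_on S g" and h: "continuous_on S h"
  and le: "!!s t. s \<in> S ==> t \<in> S ==> norm (f s - f t) <= norm (g s - g t) + norm (h s - h t)"
 shows "continuous_on S f"
 unfolding continuous_on_def
proof
 fix t assume t: "t \<in> S"
 have "((%s. norm (g s - g t) + norm (h s - h t)) \<longlongrightarrow> norm (g t - g t) + norm (h t - h t)) (at t within S)"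
  using g h t unfolding continuous_on_def by (intro tendsto_intros) auto
 then have z: "((%s. norm (g s - g t) + norm (h s - h t)) \<longlongrightarrow> 0) (at t within S)" by simp
 have "((%s. f s - f t) \<longlongrightarrow> 0) (at t within S)"
  by (rule Lim_null_comparison[OF _ z]) (use le t in \<open>auto simp: eventually_at_filter\<close>)
 then show "(f \<longlongrightarrow> f t) (at t within S)" by (rule LIM_zero_cancel)
qed

locale euler_maxwell =
 fixes c T :: real and m :: nat and u E B j :: "real => R3 => R3"
 assumes c: "c > 0" and T: "T > 0" and m: "3 <= m"
  and uC: "u \<in> CHspace T m" and EC: "E \<in> CHspace T m" and BC: "B \<in> CHspace T m"
  and EM: "Euler_Maxwell c T u E B j"
begin

lemma H: "t \<in> {0..T} ==> u t \<in> Hspace m" "t \<in> {0..T} ==> E t \<in> Hspace m" "t \<in> {0..T} ==> B t \<in> Hspace m"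
 using uC EC BC CHspace_Hspace by blast+

lemmas fields_L2 = H[THEN Hspace_L2]
lemmas fields_H1 = H[THEN Hspace_H1_field[OF _ m]]
lemmas curls_L2 = H[THEN weak_curl_L2[OF _ m]]
lemmas u_Linf = CHspace_Linf_continuous[OF uC m]
lemmas B_Linf = CHspace_Linf_continuous[OF BC m]

lemma solenoidal:
 assumes "t \<in> {0..T}" shows "div_free (u t)" "div_free (E t)" "div_free (B t)" "div_free (j t)"
 using EM assms unfolding Euler_Maxwell_def by blast+

lemma u_bounded: assumes "t \<in> {0..T}" obtains K where "K >= 0" "AE x in lebesgue. norm (u t x) <= K"
 using u_Linf assms unfolding Linf_continuous_def by blast

lemma uB: "t \<in> {0..T} ==> (%x. u t x \<times> B t x) \<in> L2" "continuous_on {0..T} (%t. cl (%x. u t x \<times> B t x))"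
proof -
 show "(%x. u t x \<times> B t x) \<in> L2" if "t \<in> {0..T}" for t
  by (rule cross_continuous(1)[OF u_Linf CHspace_continuous_field[OF BC] _ that]) (erule fields_L2(3))
 show "continuous_on {0..T} (%t. cl (%x. u t x \<times> B t x))"
  by (rule cross_continuous(2)[OF u_Linf CHspace_continuous_field[OF BC]]) (erule fields_L2(3))
qed

text \<open>The Leray projection changes a field by a gradient, which is invisible to divergence-free fields.\<close>

lemma ohm:
 assumes t: "t \<in> {0..T}" shows "j t \<in> L2"
  and "!!X. X \<in> L2 ==> div_free X ==> cl (j t) \<bullet> cl X = c * (cl (E t) \<bullet> cl X) + cl (%x. u t x \<times> B t x) \<bullet> cl X"
proof -
 obtain P where P: "is_Leray_projection (%x. u t x \<times> B t x) P"
  and ae: "AE x in lebesgue. j t x = c *\<^sub>R E t x + P x"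
 proof -
  from EM obtain u' E' B' p P where "\<forall>t\<in>{0..T}.
      weakly_differentiable (p t :: R3 => real) \<and>
      is_Leray_projection (%x. u t x \<times> B t x) (P t) \<and>
      j t \<in> borel_measurable lebesgue \<and>
      (AE x in lebesgue.
       u' t x + advect (u t) (u t) x + weak_grad (p t) x = j t x \<times> B t x \<and>
       (1/c) *\<^sub>R E' t x - weak_curl (B t) x = - j t x \<and>
       (1/c) *\<^sub>R B' t x + weak_curl (E t) x = 0 \<and>
       j t x = c *\<^sub>R E t x + P t x) \<and>
      div_free (u t) \<and> div_free (E t) \<and> div_free (B t) \<and> div_free (j t)"
   unfolding Euler_Maxwell_def by blast
  from bspec[OF this t] show ?thesis using that[of "P t"] by (auto elim: eventually_mono)
 qed
 obtain q where q: "P \<in> L2" "weakly_differentiable (q :: R3 => real)" "weak_grad q \<in> L2"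
  "AE x in lebesgue. P x = u t x \<times> B t x + weak_grad q x"
  using P unfolding is_Leray_projection_def by blast
 have cE: "(%x. c *\<^sub>R E t x) \<in> L2" by (rule L2_scaleR[OF fields_L2(2)[OF t]])
 have cEP: "(%x. c *\<^sub>R E t x + P x) \<in> L2" by (rule L2_add[OF cE q(1)])
 show j2: "j t \<in> L2" by (rule L2_cong_AE[OF cEP AE_swap[OF ae]])
 have cj: "cl (j t) = c *\<^sub>R cl (E t) + cl P"
  using cl_cong[OF j2 ae] by (simp only: cl_add[OF cE q(1)] cl_scaleR[OF fields_L2(2)[OF t]])
 have cP: "cl P = cl (%x. u t x \<times> B t x) + cl (weak_grad q)"
  using cl_cong[OF q(1,4)] by (simp only: cl_add[OF uB(1)[OF t] q(3)])
 fix X :: "R3 => R3" assume X: "X \<in> L2" "div_free X"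
 have "cl X \<bullet> cl (weak_grad q) = 0" by (rule grad_orthogonal_div_free[OF X q(2,3)])
 then show "cl (j t) \<bullet> cl X = c * (cl (E t) \<bullet> cl X) + cl (%x. u t x \<times> B t x) \<bullet> cl X"
  unfolding cj cP by (simp add: inner_add_left inner_commute[of "cl (weak_grad q)"])
qed

lemmas j_L2 = ohm(1)

text \<open>The current is determined only through a projection. An increment \<open>X\<close> of \<open>j - c E\<close> is
divergence-free, and testing Ohm's law with \<open>X\<close> itself bounds it by the increment of \<open>u \<times> B\<close>.\<close>

lemma j_continuous: "continuous_on {0..T} (%t. cl (j t))"
proof (rule continuous_on_comparison)
 show "continuous_on {0..T} (%t. c *\<^sub>R cl (E t))" by (intro continuous_intros CHspace_continuous_field[OF EC])
 show "continuous_on {0..T} (%t. cl (%x. u t x \<times> B t x))" by (rule uB(2))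
 fix s t assume s: "s \<in> {0..T}" and t: "t \<in> {0..T}"
 have 1: "(%x. j s x - j t x) \<in> L2" "div_free (%x. j s x - j t x)"
  using L2_diff[OF j_L2[OF s] j_L2[OF t]] div_free_diff[OF j_L2[OF s] j_L2[OF t] solenoidal(4)[OF s] solenoidal(4)[OF t]] .
 have 2: "(%x. E s x - E t x) \<in> L2" "div_free (%x. E s x - E t x)"
  using L2_diff[OF fields_L2(2)[OF s] fields_L2(2)[OF t]] div_free_diff[OF fields_L2(2)[OF s] fields_L2(2)[OF t] solenoidal(2)[OF s] solenoidal(2)[OF t]] .
 have 3: "(%x. c *\<^sub>R (E s x - E t x)) \<in> L2" "div_free (%x. c *\<^sub>R (E s x - E t x))"
  using L2_scaleR[OF 2(1)] div_free_scaleR[OF 2] .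
 define X where "X x = (j s x - j t x) - c *\<^sub>R (E s x - E t x)" for x
 have X: "X \<in> L2" "div_free X" unfolding X_def using L2_diff[OF 1(1) 3(1)] div_free_diff[OF 1(1) 3(1) 1(2) 3(2)] .
 have cX: "cl X = (cl (j s) - cl (j t)) - c *\<^sub>R (cl (E s) - cl (E t))"
  unfolding X_def by (simp only: cl_diff[OF 1(1) 3(1)] cl_scaleR[OF 2(1)] cl_diff[OF j_L2[OF s] j_L2[OF t]] cl_diff[OF fields_L2(2)[OF s] fields_L2(2)[OF t]])
 have "cl X \<bullet> cl X = ((cl (j s) - cl (j t)) - c *\<^sub>R (cl (E s) - cl (E t))) \<bullet> cl X" by (simp only: cX)
 also have "\<dots> = (cl (%x. u s x \<times> B s x) - cl (%x. u t x \<times> B t x)) \<bullet> cl X"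
  using ohm(2)[OF s X] ohm(2)[OF t X] by (simp add: inner_diff_left algebra_simps)
 finally have "norm (cl X) <= norm (cl (%x. u s x \<times> B s x) - cl (%x. u t x \<times> B t x))" by (rule norm_le_if_inner)
 moreover have "cl (j s) - cl (j t) = (c *\<^sub>R cl (E s) - c *\<^sub>R cl (E t)) + cl X" by (simp add: cX scaleR_right_diff_distrib)
 ultimately show "norm (cl (j s) - cl (j t)) <= norm (c *\<^sub>R cl (E s) - c *\<^sub>R cl (E t)) + norm (cl (%x. u s x \<times> B s x) - cl (%x. u t x \<times> B t x))"
  using norm_triangle_ineq[of "c *\<^sub>R cl (E s) - c *\<^sub>R cl (E t)" "cl X"] by simp
qed

lemma jB: "t \<in> {0..T} ==> (%x. j t x \<times> B t x) \<in> L2" "continuous_on {0..T} (%t. cl (%x. j t x \<times> B t x))"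
proof -
 have C1: "(%x. B t x \<times> j t x) \<in> L2" if "t \<in> {0..T}" for t
  by (rule cross_continuous(1)[OF B_Linf j_continuous _ that]) (erule j_L2)
 have C2: "continuous_on {0..T} (%t. cl (%x. B t x \<times> j t x))"
  by (rule cross_continuous(2)[OF B_Linf j_continuous]) (erule j_L2)
 have sk: "(%x. j t x \<times> B t x) = (%x. - (B t x \<times> j t x))" for t by (rule ext) (rule cross_skew)
 show "(%x. j t x \<times> B t x) \<in> L2" if "t \<in> {0..T}" for t unfolding sk by (rule L2_uminus[OF C1[OF that]])
 have "continuous_on {0..T} (%t. - cl (%x. B t x \<times> j t x))" by (rule continuous_on_minus[OF C2])
 then show "continuous_on {0..T} (%t. cl (%x. j t x \<times> B t x))"
  by (rule continuous_on_eq) (simp only: sk cl_uminus[OF C1])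
qed

lemma uu: "t \<in> {0..T} ==> advect (u t) (u t) \<in> L2" "continuous_on {0..T} (%t. cl (advect (u t) (u t)))"
proof -
 have d: "continuous_on {0..T} (%t. cl (weak_partial i (u t)))" for i by (rule CHspace_partial_continuous[OF uC m])
 have l: "weak_partial i (u t) \<in> L2" if "t \<in> {0..T}" for t i by (rule Hspace_field(1)[OF H(1)[OF that] m])
 show "advect (u t) (u t) \<in> L2" if "t \<in> {0..T}" for t
  unfolding advect_eq by (rule adv_continuous(1)[where dW="%t i. weak_partial i (u t)", OF u_Linf d l that])
 show "continuous_on {0..T} (%t. cl (advect (u t) (u t)))"
  unfolding advect_eq by (rule adv_continuous(2)[where dW="%t i. weak_partial i (u t)", OF u_Linf d l])
qed

definition u_rhs where "u_rhs t = cl (%x. j t x \<times> B t x) - cl (advect (u t) (u t))"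
definition E_rhs where "E_rhs t = c *\<^sub>R (cl (weak_curl (B t)) - cl (j t))"
definition B_rhs where "B_rhs t = - (c *\<^sub>R cl (weak_curl (E t)))"

lemma rhs_continuous: "continuous_on {0..T} u_rhs" "continuous_on {0..T} E_rhs" "continuous_on {0..T} B_rhs"
 unfolding u_rhs_def E_rhs_def B_rhs_def
 by (intro continuous_intros jB(2) uu(2) j_continuous CHspace_curl_continuous[OF BC m] CHspace_curl_continuous[OF EC m])+

lemma time_derivatives:
 assumes t: "t \<in> {0..T}"
 shows "v \<in> test_curls ==> ((%s. cl (u s) \<bullet> v) has_real_derivative u_rhs t \<bullet> v) (at t within {0..T})"
  and "v \<in> test_fields ==> ((%s. cl (E s) \<bullet> v) has_real_derivative E_rhs t \<bullet> v) (at t within {0..T})"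
  and "v \<in> test_fields ==> ((%s. cl (B s) \<bullet> v) has_real_derivative B_rhs t \<bullet> v) (at t within {0..T})"
proof -
 from EM obtain u' E' B' p P where td: "has_time_deriv T u u'" "has_time_deriv T E E'" "has_time_deriv T B B'"
  and all: "\<forall>t\<in>{0..T}.
      weakly_differentiable (p t :: R3 => real) \<and>
      is_Leray_projection (%x. u t x \<times> B t x) (P t) \<and>
      j t \<in> borel_measurable lebesgue \<and>
      (AE x in lebesgue.
       u' t x + advect (u t) (u t) x + weak_grad (p t) x = j t x \<times> B t x \<and>
       (1/c) *\<^sub>R E' t x - weak_curl (B t) x = - j t x \<and>
       (1/c) *\<^sub>R B' t x + weak_curl (E t) x = 0 \<and>
       j t x = c *\<^sub>R E t x + P t x) \<and>
      div_free (u t) \<and> div_free (E t) \<and> div_free (B t) \<and> div_free (j t)"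
  unfolding Euler_Maxwell_def by blast
 from bspec[OF all t] have p: "weakly_differentiable (p t)"
  and ae: "AE x in lebesgue.
       u' t x + advect (u t) (u t) x + weak_grad (p t) x = j t x \<times> B t x \<and>
       (1/c) *\<^sub>R E' t x - weak_curl (B t) x = - j t x \<and>
       (1/c) *\<^sub>R B' t x + weak_curl (E t) x = 0 \<and>
       j t x = c *\<^sub>R E t x + P t x" by blast+
 have inv: "y = c *\<^sub>R z" if "(1/c) *\<^sub>R y = z" for y z :: R3 using that c by (auto simp: field_simps)
 { assume v: "v \<in> test_curls"
  have "AE x in lebesgue. u' t x = (j t x \<times> B t x - advect (u t) (u t) x) - weak_grad (p t) x"
   using ae by eventually_elim (auto simp: algebra_simps)
  from time_derivative_curls[OF td(1) fields_L2(1) this L2_diff[OF jB(1)[OF t] uu(1)[OF t]] p t v]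
  show "((%s. cl (u s) \<bullet> v) has_real_derivative u_rhs t \<bullet> v) (at t within {0..T})"
   unfolding u_rhs_def by (simp only: cl_diff[OF jB(1)[OF t] uu(1)[OF t]]) }
 { assume v: "v \<in> test_fields"
  have d: "(%x. weak_curl (B t) x - j t x) \<in> L2" by (rule L2_diff[OF curls_L2(3)[OF t] j_L2[OF t]])
  have "AE x in lebesgue. E' t x = c *\<^sub>R (weak_curl (B t) x - j t x)"
   using ae
  proof eventually_elim
   case (elim x)
   then have "(1/c) *\<^sub>R E' t x - weak_curl (B t) x = - j t x" by blast
   then have "(1/c) *\<^sub>R E' t x = weak_curl (B t) x - j t x" by (simp add: diff_eq_eq)
   then show ?case by (rule inv)
  qed
  from time_derivative_fields[OF td(2) fields_L2(2) this L2_scaleR[OF d] t v]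
  show "((%s. cl (E s) \<bullet> v) has_real_derivative E_rhs t \<bullet> v) (at t within {0..T})"
   unfolding E_rhs_def by (simp only: cl_scaleR[OF d] cl_diff[OF curls_L2(3)[OF t] j_L2[OF t]])
  have "AE x in lebesgue. B' t x = - (c *\<^sub>R weak_curl (E t) x)"
   using ae
  proof eventually_elim
   case (elim x)
   then have "(1/c) *\<^sub>R B' t x + weak_curl (E t) x = 0" by blast
   then have "(1/c) *\<^sub>R B' t x = - weak_curl (E t) x" by (simp only: eq_neg_iff_add_eq_0)
   from inv[OF this] show ?case by (simp only: scaleR_minus_right)
  qed
  from time_derivative_fields[OF td(3) fields_L2(3) this L2_uminus[OF L2_scaleR[OF curls_L2(2)[OF t]]] t v]
  show "((%s. cl (B s) \<bullet> v) has_real_derivative B_rhs t \<bullet> v) (at t within {0..T})"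
   unfolding B_rhs_def by (simp only: cl_uminus[OF L2_scaleR[OF curls_L2(2)[OF t]]] cl_scaleR[OF curls_L2(2)[OF t]]) }
qed

lemma curl_EB: "t \<in> {0..T} ==> cl (weak_curl (E t)) \<bullet> cl (B t) = cl (E t) \<bullet> cl (weak_curl (B t))"
 unfolding weak_curl_eq by (rule curl_by_parts[OF fields_H1(2) fields_H1(3)])

text \<open>The Lorentz force cancels against the electromotive part of Ohm's law.\<close>

lemma energy_derivative:
 assumes t: "t \<in> {0..T}"
 shows "((%s. (norm (cl (u s)))\<^sup>2 + (norm (cl (E s)))\<^sup>2 + (norm (cl (B s)))\<^sup>2) has_real_derivative - 2 * (norm (cl (j t)))\<^sup>2) (at t within {0..T})"
proof -
 have d1: "((%s. (norm (cl (u s)))\<^sup>2) has_real_derivative 2 * (u_rhs t \<bullet> cl (u t))) (at t within {0..T})"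
  by (rule time_derivative_norm[OF time_derivatives(1) rhs_continuous(1) CHspace_continuous_field[OF uC] closure_test_curls[OF fields_L2(1) solenoidal(1)] t])
 have d2: "((%s. (norm (cl (E s)))\<^sup>2) has_real_derivative 2 * (E_rhs t \<bullet> cl (E t))) (at t within {0..T})"
  by (rule time_derivative_norm[OF time_derivatives(2) rhs_continuous(2) CHspace_continuous_field[OF EC] closure_test_fields[OF fields_L2(2)] t])
 have d3: "((%s. (norm (cl (B s)))\<^sup>2) has_real_derivative 2 * (B_rhs t \<bullet> cl (B t))) (at t within {0..T})"
  by (rule time_derivative_norm[OF time_derivatives(3) rhs_continuous(3) CHspace_continuous_field[OF BC] closure_test_fields[OF fields_L2(3)] t])
 obtain K where K: "K >= 0" "AE x in lebesgue. norm (u t x) <= K" using u_bounded[OF t] by blast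
 have a: "cl (advect (u t) (u t)) \<bullet> cl (u t) = 0"
  unfolding advect_eq by (rule transport_orthogonal[OF fields_L2(1)[OF t] solenoidal(1)[OF t] K(2,1) fields_H1(1)[OF t]])
 have l: "cl (%x. j t x \<times> B t x) \<bullet> cl (u t) = - (cl (%x. u t x \<times> B t x) \<bullet> cl (j t))"
  by (rule cross_triple_L2[OF jB(1)[OF t] uB(1)[OF t] j_L2[OF t] fields_L2(1)[OF t]])
 have o: "cl (j t) \<bullet> cl (j t) = c * (cl (E t) \<bullet> cl (j t)) + cl (%x. u t x \<times> B t x) \<bullet> cl (j t)"
  by (rule ohm(2)[OF t j_L2[OF t] solenoidal(4)[OF t]])
 have "2 * (u_rhs t \<bullet> cl (u t)) + 2 * (E_rhs t \<bullet> cl (E t)) + 2 * (B_rhs t \<bullet> cl (B t)) = - 2 * (norm (cl (j t)))\<^sup>2"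
  using a l o curl_EB[OF t] unfolding u_rhs_def E_rhs_def B_rhs_def power2_norm_eq_inner
  by (simp add: inner_diff_left inner_commute[of "cl (weak_curl (B t))"] inner_commute[of "cl (j t)" "cl (E t)"] algebra_simps)
 then show ?thesis using DERIV_add[OF DERIV_add[OF d1 d2] d3] by simp
qed

end

section \<open>The limit system\<close>

text \<open>The second derivatives of a divergence-free field have zero trace. The diffusion term becomes a
curl, and the induction equation of the limit takes the form \<open>Bbar' = - curl G\<close>.\<close>

lemma laplacian_curl_curl:
 fixes B :: "R3 => R3"
 assumes B: "B \<in> Hspace m" "3 <= m" and d: "div_free B"
 shows "AE x in lebesgue. weak_laplacian B x = - curl_of (%i. curl_of (%k. weak_deriv (axis k 1 + axis i 1) B)) x"
proof -
 let ?D = "%k i. weak_deriv (axis k 1 + axis i 1) B"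
 have tr: "AE x in lebesgue. (\<Sum>k\<in>UNIV. weak_partial k B x $ k) = 0"
  by (rule div_free_trace_zero[OF Hspace_H1_field[OF B] d])
 have dtr: "AE x in lebesgue. (\<Sum>k\<in>UNIV. ?D k i x $ k) = 0" for i
 proof -
  have "wd i (%x. weak_partial 1 B x $ 1 + weak_partial 2 B x $ 2 + weak_partial 3 B x $ 3) (%x. ?D 1 i x $ 1 + ?D 2 i x $ 2 + ?D 3 i x $ 3)"
   by (intro wd_add Hspace_field(3)[OF B])
  then have w: "wd i (%x. \<Sum>k\<in>UNIV. weak_partial k B x $ k) (%x. \<Sum>k\<in>UNIV. ?D k i x $ k)" by (simp only: sum_3)
  have "wd i (%x. 0) (%x. \<Sum>k\<in>UNIV. ?D k i x $ k)" by (rule wd_cong_AE[OF w tr]) simp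
  moreover have "wd i (%x. 0) (%x. 0)" by (simp add: wd_def)
  ultimately show ?thesis by (rule wd_unique)
 qed
 have ax: "axis i (2::nat) = axis i 1 + axis i 1" for i :: 3 by (simp add: vec_eq_iff axis_def)
 have sym: "?D k i = ?D i k" for k i by (simp only: add.commute)
 have lap: "weak_laplacian B x = ?D 1 1 x + ?D 2 2 x + ?D 3 3 x" for x
  unfolding weak_laplacian_def ax sum_3 ..
 show ?thesis
  using dtr[of 1] dtr[of 2] dtr[of 3]
 proof eventually_elim
  case (elim x)
  have e: "?D 1 1 x $ 1 + ?D 2 1 x $ 2 + ?D 3 1 x $ 3 = 0" "?D 1 2 x $ 1 + ?D 2 2 x $ 2 + ?D 3 2 x $ 3 = 0"
   "?D 1 3 x $ 1 + ?D 2 3 x $ 2 + ?D 3 3 x $ 3 = 0" using elim by (simp_all only: sum_3)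
  show ?case unfolding lap vec_eq_iff forall_3 vector_add_component vector_uminus_component curl_of_nth
   using e unfolding sym[of 2 1] sym[of 3 1] sym[of 3 2] by (intro conjI; linarith)
 qed
qed

locale mhd =
 fixes T :: real and m :: nat and ubar Bbar :: "real => R3 => R3" and Mbar :: real
 assumes mhd_m: "3 <= m" and ubarC: "ubar \<in> CHspace T m" and BbarC: "Bbar \<in> CHspace T m"
  and mhd: "MHD T ubar Bbar" and Mbar: "Mbar >= 0"
  and ubar_bound: "!!t. t \<in> {0..T} ==> Hnorm m (ubar t) <= ennreal Mbar"
  and Bbar_bound: "!!t. t \<in> {0..T} ==> Hnorm m (Bbar t) <= ennreal Mbar"
begin

lemma bar_H: "t \<in> {0..T} ==> ubar t \<in> Hspace m" "t \<in> {0..T} ==> Bbar t \<in> Hspace m"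
 using ubarC BbarC CHspace_Hspace by blast+

lemmas bar_L2 = bar_H[THEN Hspace_L2]
lemmas bar_H1 = bar_H[THEN Hspace_H1_field[OF _ mhd_m]]
lemmas bar_partial_L2 = bar_H[THEN Hspace_field(1)[OF _ mhd_m]]
lemmas jbar_L2 = bar_H(2)[THEN weak_curl_L2[OF _ mhd_m]]
lemmas ubar_Linf = CHspace_Linf_continuous[OF ubarC mhd_m]
lemmas Bbar_Linf = CHspace_Linf_continuous[OF BbarC mhd_m]

definition "A = 66 * Mbar"

lemma A: "A >= 0" using Mbar by (simp add: A_def)

lemma bar_bounds:
 assumes t: "t \<in> {0..T}"
 shows "AE x in lebesgue. norm (ubar t x) <= A" "AE x in lebesgue. norm (weak_partial i (ubar t) x) <= A"
  "AE x in lebesgue. norm (Bbar t x) <= A" "AE x in lebesgue. norm (weak_curl (Bbar t) x) <= 3 * A"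
proof -
 note U = Hspace_field_bounds[OF bar_H(1)[OF t] mhd_m Mbar ubar_bound[OF t]]
 note V = Hspace_field_bounds[OF bar_H(2)[OF t] mhd_m Mbar Bbar_bound[OF t]]
 show "AE x in lebesgue. norm (ubar t x) <= A" "AE x in lebesgue. norm (weak_partial i (ubar t) x) <= A"
  "AE x in lebesgue. norm (Bbar t x) <= A" using U V by (simp_all add: A_def)
 have "AE x in lebesgue. \<forall>i\<in>UNIV. norm (weak_partial i (Bbar t) x) <= A"
  by (intro AE_finite_allI) (use V(5) in \<open>simp_all add: A_def\<close>)
 then show "AE x in lebesgue. norm (weak_curl (Bbar t) x) <= 3 * A"
  unfolding weak_curl_eq by eventually_elim (rule curl_of_bound, blast)
qed

lemma bar_solenoidal: "t \<in> {0..T} ==> div_free (ubar t)" "t \<in> {0..T} ==> div_free (Bbar t)"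
 using mhd unfolding MHD_def by blast+

lemma ubBb: "t \<in> {0..T} ==> (%x. ubar t x \<times> Bbar t x) \<in> L2" "continuous_on {0..T} (%t. cl (%x. ubar t x \<times> Bbar t x))"
proof -
 show "(%x. ubar t x \<times> Bbar t x) \<in> L2" if "t \<in> {0..T}" for t
  by (rule cross_continuous(1)[OF ubar_Linf CHspace_continuous_field[OF BbarC] _ that]) (erule bar_L2(2))
 show "continuous_on {0..T} (%t. cl (%x. ubar t x \<times> Bbar t x))"
  by (rule cross_continuous(2)[OF ubar_Linf CHspace_continuous_field[OF BbarC]]) (erule bar_L2(2))
qed

text \<open>The rescaled electric field \<open>curl B - u \<times> B\<close> of the limit, up to a gradient.\<close>

definition G where "G t x = weak_curl (Bbar t) x - ubar t x \<times> Bbar t x"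
definition dG where "dG t i x = curl_of (%k. weak_deriv (axis k 1 + axis i 1) (Bbar t)) x
 - (ubar t x \<times> weak_partial i (Bbar t) x - Bbar t x \<times> weak_partial i (ubar t) x)"

lemma ubar_cross_Bbar_H1:
 assumes t: "t \<in> {0..T}"
 shows "H1_field (%x. ubar t x \<times> Bbar t x) (%i x. ubar t x \<times> weak_partial i (Bbar t) x - Bbar t x \<times> weak_partial i (ubar t) x)"
proof -
 have "(%i x. weak_partial i (ubar t) x \<times> Bbar t x + ubar t x \<times> weak_partial i (Bbar t) x)
   = (%i x. ubar t x \<times> weak_partial i (Bbar t) x - Bbar t x \<times> weak_partial i (ubar t) x)"
 proof (intro ext)
  fix i x
  have "weak_partial i (ubar t) x \<times> Bbar t x = - (Bbar t x \<times> weak_partial i (ubar t) x)" by (rule cross_skew)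
  then show "weak_partial i (ubar t) x \<times> Bbar t x + ubar t x \<times> weak_partial i (Bbar t) x
   = ubar t x \<times> weak_partial i (Bbar t) x - Bbar t x \<times> weak_partial i (ubar t) x"
   by (simp only: uminus_add_conv_diff)
 qed
 then show ?thesis using H1_field_cross[OF bar_H1(1)[OF t] bar_H1(2)[OF t] A bar_bounds(1)[OF t] A bar_bounds(3)[OF t]] by simp
qed

lemma jbar_H1:
 assumes t: "t \<in> {0..T}"
 shows "H1_field (weak_curl (Bbar t)) (%i. curl_of (%k. weak_deriv (axis k 1 + axis i 1) (Bbar t)))"
 unfolding H1_field_def forall_3 weak_curl_eq curl_of_nth
 by (intro conjI wd_diff Hspace_field(3)[OF bar_H(2)[OF t] mhd_m])

lemma G_H1: assumes t: "t \<in> {0..T}" shows "H1_field (G t) (dG t)"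
 unfolding G_def[abs_def] dG_def[abs_def] by (rule H1_field_diff[OF jbar_H1[OF t] ubar_cross_Bbar_H1[OF t]])

lemma G_continuous: "continuous_on {0..T} (%t. cl (G t))" "continuous_on {0..T} (%t. cl (curl_of (dG t)))"
proof -
 have "continuous_on {0..T} (%t. cl (weak_curl (Bbar t)) - cl (%x. ubar t x \<times> Bbar t x))"
  by (intro continuous_intros CHspace_curl_continuous[OF BbarC mhd_m] ubBb(2))
 then show "continuous_on {0..T} (%t. cl (G t))"
  by (rule continuous_on_eq) (simp only: G_def[abs_def] cl_diff[OF jbar_L2 ubBb(1)])
 have D: "continuous_on {0..T} (%t. cl (weak_deriv (axis k 1 + axis i 1) (Bbar t)))" for k i :: 3
  by (rule CHspace_continuous[OF BbarC]) (use mhd_m in \<open>simp add: mi_order_add mi_order_axis del: One_nat_def\<close>)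
 have D2: "weak_deriv (axis k 1 + axis i 1) (Bbar t) \<in> L2" if "t \<in> {0..T}" for k i :: 3 and t
  by (rule Hspace_field(4)[OF bar_H(2)[OF that] mhd_m])
 have C1: "continuous_on {0..T} (%t. cl (curl_of (%k. weak_deriv (axis k 1 + axis i 1) (Bbar t))))" for i
  by (rule curl_of_continuous[OF D]) (erule D2)
 have c1: "curl_of (%k. weak_deriv (axis k 1 + axis i 1) (Bbar t)) \<in> L2" if "t \<in> {0..T}" for i t
  by (rule curl_of_L2[OF D2[OF that]])
 have C2: "(%x. ubar t x \<times> weak_partial i (Bbar t) x) \<in> L2" if "t \<in> {0..T}" for t i
  by (rule cross_continuous(1)[OF ubar_Linf CHspace_partial_continuous[OF BbarC mhd_m] _ that]) (erule bar_partial_L2(2))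
 have C2': "continuous_on {0..T} (%t. cl (%x. ubar t x \<times> weak_partial i (Bbar t) x))" for i
  by (rule cross_continuous(2)[OF ubar_Linf CHspace_partial_continuous[OF BbarC mhd_m]]) (erule bar_partial_L2(2))
 have C3: "(%x. Bbar t x \<times> weak_partial i (ubar t) x) \<in> L2" if "t \<in> {0..T}" for t i
  by (rule cross_continuous(1)[OF Bbar_Linf CHspace_partial_continuous[OF ubarC mhd_m] _ that]) (erule bar_partial_L2(1))
 have C3': "continuous_on {0..T} (%t. cl (%x. Bbar t x \<times> weak_partial i (ubar t) x))" for i
  by (rule cross_continuous(2)[OF Bbar_Linf CHspace_partial_continuous[OF ubarC mhd_m]]) (erule bar_partial_L2(1))
 have dG2: "dG t i \<in> L2" if "t \<in> {0..T}" for t i by (rule H1_fieldD(2)[OF G_H1[OF that]])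
 have "continuous_on {0..T} (%t. cl (curl_of (%k. weak_deriv (axis k 1 + axis i 1) (Bbar t)))
   - (cl (%x. ubar t x \<times> weak_partial i (Bbar t) x) - cl (%x. Bbar t x \<times> weak_partial i (ubar t) x)))" for i
  by (intro continuous_on_diff C1 C2' C3')
 then have "continuous_on {0..T} (%t. cl (dG t i))" for i
  by (rule continuous_on_eq) (simp only: dG_def[abs_def] cl_diff[OF c1 L2_diff[OF C2 C3]] cl_diff[OF C2 C3])
 then show "continuous_on {0..T} (%t. cl (curl_of (dG t)))" by (rule curl_of_continuous) (erule dG2)
qed

definition ubar_rhs where "ubar_rhs t = cl (%x. weak_curl (Bbar t) x \<times> Bbar t x) - cl (advect (ubar t) (ubar t))"
definition Bbar_rhs where "Bbar_rhs t = - cl (curl_of (dG t))"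

lemma jbarBbar: "t \<in> {0..T} ==> (%x. weak_curl (Bbar t) x \<times> Bbar t x) \<in> L2"
 "continuous_on {0..T} (%t. cl (%x. weak_curl (Bbar t) x \<times> Bbar t x))"
proof -
 note cc = CHspace_curl_continuous[OF BbarC mhd_m]
 have C1: "(%x. Bbar t x \<times> weak_curl (Bbar t) x) \<in> L2" if "t \<in> {0..T}" for t
  by (rule cross_continuous(1)[OF Bbar_Linf cc _ that]) (erule jbar_L2)
 have C2: "continuous_on {0..T} (%t. cl (%x. Bbar t x \<times> weak_curl (Bbar t) x))"
  by (rule cross_continuous(2)[OF Bbar_Linf cc]) (erule jbar_L2)
 have sk: "(%x. weak_curl (Bbar t) x \<times> Bbar t x) = (%x. - (Bbar t x \<times> weak_curl (Bbar t) x))" for t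
  by (rule ext) (rule cross_skew)
 show "(%x. weak_curl (Bbar t) x \<times> Bbar t x) \<in> L2" if "t \<in> {0..T}" for t unfolding sk by (rule L2_uminus[OF C1[OF that]])
 have "continuous_on {0..T} (%t. - cl (%x. Bbar t x \<times> weak_curl (Bbar t) x))" by (rule continuous_on_minus[OF C2])
 then show "continuous_on {0..T} (%t. cl (%x. weak_curl (Bbar t) x \<times> Bbar t x))"
  by (rule continuous_on_eq) (simp only: sk cl_uminus[OF C1])
qed

lemma ubub: "t \<in> {0..T} ==> advect (ubar t) (ubar t) \<in> L2" "continuous_on {0..T} (%t. cl (advect (ubar t) (ubar t)))"
proof -
 have d: "continuous_on {0..T} (%t. cl (weak_partial i (ubar t)))" for i by (rule CHspace_partial_continuous[OF ubarC mhd_m])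
 have l: "weak_partial i (ubar t) \<in> L2" if "t \<in> {0..T}" for t i by (rule bar_partial_L2(1)[OF that])
 show "advect (ubar t) (ubar t) \<in> L2" if "t \<in> {0..T}" for t
  unfolding advect_eq by (rule adv_continuous(1)[where dW="%t i. weak_partial i (ubar t)", OF ubar_Linf d l that])
 show "continuous_on {0..T} (%t. cl (advect (ubar t) (ubar t)))"
  unfolding advect_eq by (rule adv_continuous(2)[where dW="%t i. weak_partial i (ubar t)", OF ubar_Linf d l])
qed

lemma bar_rhs_continuous: "continuous_on {0..T} ubar_rhs" "continuous_on {0..T} Bbar_rhs"
 unfolding ubar_rhs_def Bbar_rhs_def
 by (intro continuous_intros jbarBbar(2) ubub(2) G_continuous(2))+

lemma bar_time_derivatives:
 assumes t: "t \<in> {0..T}"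
 shows "v \<in> test_curls ==> ((%s. cl (ubar s) \<bullet> v) has_real_derivative ubar_rhs t \<bullet> v) (at t within {0..T})"
  and "v \<in> test_fields ==> ((%s. cl (Bbar s) \<bullet> v) has_real_derivative Bbar_rhs t \<bullet> v) (at t within {0..T})"
proof -
 from mhd obtain u' B' p where td: "has_time_deriv T ubar u'" "has_time_deriv T Bbar B'"
  and all: "\<forall>t\<in>{0..T}.
      weakly_differentiable (p t :: R3 => real) \<and>
      (AE x in lebesgue.
       u' t x + advect (ubar t) (ubar t) x + weak_grad (p t) x = weak_curl (Bbar t) x \<times> Bbar t x \<and>
       B' t x - weak_laplacian (Bbar t) x = weak_curl (%y. ubar t y \<times> Bbar t y) x) \<and>
      div_free (ubar t) \<and> div_free (Bbar t)"
  unfolding MHD_def by blast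
 from bspec[OF all t] have p: "weakly_differentiable (p t)"
  and ae: "AE x in lebesgue.
       u' t x + advect (ubar t) (ubar t) x + weak_grad (p t) x = weak_curl (Bbar t) x \<times> Bbar t x \<and>
       B' t x - weak_laplacian (Bbar t) x = weak_curl (%y. ubar t y \<times> Bbar t y) x" by blast+
 { assume v: "v \<in> test_curls"
  have "AE x in lebesgue. u' t x = (weak_curl (Bbar t) x \<times> Bbar t x - advect (ubar t) (ubar t) x) - weak_grad (p t) x"
   using ae by eventually_elim (auto simp: algebra_simps)
  from time_derivative_curls[OF td(1) bar_L2(1) this L2_diff[OF jbarBbar(1)[OF t] ubub(1)[OF t]] p t v]
  show "((%s. cl (ubar s) \<bullet> v) has_real_derivative ubar_rhs t \<bullet> v) (at t within {0..T})"
   unfolding ubar_rhs_def by (simp only: cl_diff[OF jbarBbar(1)[OF t] ubub(1)[OF t]]) }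
 { assume v: "v \<in> test_fields"
  let ?dc = "%i x. ubar t x \<times> weak_partial i (Bbar t) x - Bbar t x \<times> weak_partial i (ubar t) x"
  have "AE x in lebesgue. \<forall>i\<in>UNIV. weak_partial i (%y. ubar t y \<times> Bbar t y) x = ?dc i x"
   by (intro AE_finite_allI weak_deriv_AE[OF H1_field_has_weak_deriv[OF ubar_cross_Bbar_H1[OF t]]]) simp
  then have "AE x in lebesgue. weak_curl (%y. ubar t y \<times> Bbar t y) x = curl_of ?dc x"
   unfolding weak_curl_eq by eventually_elim (simp add: curl_of_def)
  with ae laplacian_curl_curl[OF bar_H(2)[OF t] mhd_m bar_solenoidal(2)[OF t]]
  have "AE x in lebesgue. B' t x = - curl_of (dG t) x"
  proof eventually_elim
   case (elim x)
   have "curl_of (dG t) x = curl_of (%i. curl_of (%k. weak_deriv (axis k 1 + axis i 1) (Bbar t))) x - curl_of ?dc x"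
    unfolding dG_def[abs_def] by (rule curl_of_diff)
   moreover have "B' t x - weak_laplacian (Bbar t) x = weak_curl (%y. ubar t y \<times> Bbar t y) x" using elim by blast
   then have "B' t x = weak_laplacian (Bbar t) x + weak_curl (%y. ubar t y \<times> Bbar t y) x" by (simp only: diff_eq_eq add.commute)
   ultimately show ?case using elim(2,3) by simp
  qed
  note td2 = time_derivative_fields[OF td(2) bar_L2(2) this L2_uminus[OF curl_of_L2[OF H1_fieldD(2)[OF G_H1[OF t]]]] t v]
  then show "((%s. cl (Bbar s) \<bullet> v) has_real_derivative Bbar_rhs t \<bullet> v) (at t within {0..T})"
   unfolding Bbar_rhs_def by (simp only: cl_uminus[OF curl_of_L2[OF H1_fieldD(2)[OF G_H1[OF t]]]]) }
qed

end

section \<open>Differential inequalities\<close>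

lemma increment_le:
 fixes f g :: "real => real"
 assumes f: "!!t. t \<in> {0..T} ==> (f has_real_derivative f' t) (at t within {0..T})"
  and g: "!!t. t \<in> {0..T} ==> (g has_real_derivative g' t) (at t within {0..T})"
  and st: "0 <= s" "s <= r" "r <= T"
  and le: "!!t. t \<in> {s..r} ==> f' t <= g' t"
 shows "f r - f s <= g r - g s"
proof -
 let ?h = "%t. f t - g t"
 have d: "(?h has_real_derivative f' t - g' t) (at t within {0..T})" if "t \<in> {0..T}" for t
  by (rule DERIV_diff[OF f[OF that] g[OF that]])
 have "?h r <= ?h s"
 proof (rule DERIV_nonpos_imp_decreasing_open[OF st(2)])
  fix x assume x: "s < x" "x < r"
  then have "at x within {0..T} = at x" using st by (intro at_within_Icc_at) linarith+
  moreover have "x \<in> {0..T}" "x \<in> {s..r}" using x st by simp_all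
  ultimately show "\<exists>y. DERIV ?h x :> y \<and> y <= 0"
   using d[of x] le[of x] by (intro exI[of _ "f' x - g' x"]) simp
 next
  show "continuous_on {s..r} ?h"
   by (rule continuous_on_subset[OF DERIV_continuous_on[OF d]]) (use st in simp_all)
 qed
 then show ?thesis by simp
qed

lemma integral_derivative:
 fixes f :: "real => real"
 assumes "continuous_on {0..T} f" "t \<in> {0..T}"
 shows "((%t. integral {0..t} f) has_real_derivative f t) (at t within {0..T})"
 by (rule integral_has_real_derivative[OF assms])

text \<open>The primitive \<open>R\<close> of the forcing is subtracted from \<open>y\<close>. The difference satisfies a homogeneous inequality up to
 \<open>K * R <= K * \<rho>\<close>, so only the integral of the forcing has to be small.\<close>

lemma gronwall:
 assumes y: "!!t. t \<in> {0..T} ==> (y has_real_derivative y' t) (at t within {0..T})"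
  and r: "continuous_on {0..T} r" and K: "K >= 0"
  and le: "!!t. t \<in> {0..T} ==> y' t <= K * y t + r t"
  and \<rho>: "!!t. t \<in> {0..T} ==> integral {0..t} r <= \<rho>" and t: "t \<in> {0..T}"
 shows "y t <= (y 0 + \<rho>) * exp (K * t)"
proof -
 define R where "R t = integral {0..t} r" for t
 define z where "z s = (y s - R s + \<rho>) * exp (- (K * s))" for s
 have z: "(z has_real_derivative ((y' s - r s) * exp (- (K * s)) + (y s - R s + \<rho>) * (- K * exp (- (K * s))))) (at s within {0..T})"
  if s: "s \<in> {0..T}" for s
  unfolding z_def[abs_def] R_def using y[OF s] integral_derivative[OF r s]
  by (auto intro!: derivative_eq_intros simp: algebra_simps)
 have "z t - z 0 <= (%_. 0) t - (%_. 0) (0::real)"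
 proof (rule increment_le[OF z])
  show "((%_. 0) has_real_derivative (%_. 0) s) (at s within {0..T})" for s by simp
  fix s assume "s \<in> {0..t}"
  then have s: "s \<in> {0..T}" using t by simp
  have "K * (R s - \<rho>) <= 0" using K \<rho>[OF s] unfolding R_def by (simp add: mult_nonneg_nonpos)
  then have "y' s - r s - K * (y s - R s + \<rho>) <= 0" using le[OF s] by (simp add: algebra_simps)
  then have "(y' s - r s - K * (y s - R s + \<rho>)) * exp (- (K * s)) <= 0" by (simp add: mult_nonpos_nonneg)
  then show "(y' s - r s) * exp (- (K * s)) + (y s - R s + \<rho>) * (- K * exp (- (K * s))) <= 0"
   by (simp add: algebra_simps)
 qed (use t in simp_all)
 then have "(y t - R t + \<rho>) * exp (- (K * t)) <= y 0 + \<rho>" by (simp add: z_def R_def)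
 then have "(y t - R t + \<rho>) * exp (- (K * t)) * exp (K * t) <= (y 0 + \<rho>) * exp (K * t)" by simp
 then have "y t - R t + \<rho> <= (y 0 + \<rho>) * exp (K * t)" by (simp add: mult.assoc exp_minus_inverse flip: exp_add)
 then show ?thesis using \<rho>[OF t] unfolding R_def by linarith
qed

section \<open>Bounds for products\<close>

lemma cross_L2_left:
 assumes "a \<in> borel_measurable lebesgue" "AE x in lebesgue. norm (a x) <= K" "K >= 0" "b \<in> L2"
 shows "(%x. a x \<times> b x) \<in> L2" "norm (cl (%x. a x \<times> b x)) <= K * norm (cl b)"
 by (rule product_L2[OF bounded_bilinear_cross norm_cross_le assms])+

lemma cross_L2_right:
 assumes "a \<in> L2" "b \<in> borel_measurable lebesgue" "AE x in lebesgue. norm (b x) <= K" "K >= 0"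
 shows "(%x. a x \<times> b x) \<in> L2" "norm (cl (%x. a x \<times> b x)) <= K * norm (cl a)"
proof -
 note P = cross_L2_left[OF assms(2-4) assms(1)]
 have sk: "(%x. a x \<times> b x) = (%x. - (b x \<times> a x))" by (rule ext) (rule cross_skew)
 show "(%x. a x \<times> b x) \<in> L2" unfolding sk by (rule L2_uminus[OF P(1)])
 show "norm (cl (%x. a x \<times> b x)) <= K * norm (cl a)"
  unfolding sk cl_uminus[OF P(1)] using P(2) by simp
qed

lemma adv_bounded_gradient:
 assumes w: "w \<in> L2" and d: "!!i. d i \<in> borel_measurable lebesgue" "!!i. AE x in lebesgue. norm (d i x) <= K" and K: "K >= 0"
 shows "adv w d \<in> L2" "norm (cl (adv w d)) <= 3 * K * norm (cl w)"
proof -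
 have wi: "(%x. w x $ i) \<in> borel_measurable lebesgue" for i by (rule L2_measurable[OF L2_nth[OF w]])
 have me: "adv w d \<in> borel_measurable lebesgue"
  unfolding adv_def[abs_def] by (intro borel_measurable_sum borel_measurable_scaleR wi d(1))
 have "AE x in lebesgue. \<forall>i\<in>UNIV. norm (d i x) <= K" by (intro AE_finite_allI d(2)) simp
 then have ae: "AE x in lebesgue. norm (adv w d x) <= 3 * K * norm (w x)"
 proof eventually_elim
  case (elim x)
  have "norm (w x $ i *\<^sub>R d i x) <= norm (w x) * K" for i
   unfolding norm_scaleR using elim by (intro mult_mono component_le_norm_cart) auto
  then have "norm (adv w d x) <= (\<Sum>i\<in>(UNIV::3 set). norm (w x) * K)"
   unfolding adv_def by (intro order_trans[OF norm_sum sum_mono])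
  then show ?case by (simp add: mult_ac)
 qed
 show "adv w d \<in> L2" "norm (cl (adv w d)) <= 3 * K * norm (cl w)"
  by (rule norm_cl_le[OF w me _ ae]; use K in simp)+
qed

lemma Linf_continuous_norm:
 assumes a: "Linf_continuous T a" and t: "t \<in> {0..T}"
 shows "AE x in lebesgue. norm (a t x) <= enn2real (Linfnorm (a t))" "Linfnorm (a t) = ennreal (enn2real (Linfnorm (a t)))"
proof -
 have "a t \<in> borel_measurable lebesgue" using a t unfolding Linf_continuous_def by blast
 then have m: "(%x. ennreal (norm (a t x))) \<in> borel_measurable lebesgue" by simp
 obtain K where K: "K >= 0" "AE x in lebesgue. norm (a t x) <= K" using a t unfolding Linf_continuous_def by blast
 have "AE x in lebesgue. ennreal (norm (a t x)) <= ennreal K" using K(2) by eventually_elim (rule ennreal_leI)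
 then have "Linfnorm (a t) <= ennreal K" unfolding Linfnorm_def by (rule esssup_I[OF m])
 then have "Linfnorm (a t) < top" by (rule le_less_trans) simp
 then show e: "Linfnorm (a t) = ennreal (enn2real (Linfnorm (a t)))" by simp
 have "AE x in lebesgue. ennreal (norm (a t x)) <= Linfnorm (a t)" unfolding Linfnorm_def by (rule esssup_AE)
 then show "AE x in lebesgue. norm (a t x) <= enn2real (Linfnorm (a t))"
  by eventually_elim (subst (asm) e, simp)
qed

lemma Linf_norm_le:
 assumes "a \<in> borel_measurable lebesgue" "AE x in lebesgue. norm (a x) <= K" "K >= 0"
 shows "enn2real (Linfnorm a) <= K"
proof -
 have m: "(%x. ennreal (norm (a x))) \<in> borel_measurable lebesgue" using assms(1) by simp
 have "AE x in lebesgue. ennreal (norm (a x)) <= ennreal K" using assms(2) by eventually_elim (rule ennreal_leI)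
 then have "Linfnorm a <= ennreal K" unfolding Linfnorm_def by (rule esssup_I[OF m])
 then show ?thesis using assms(3) by (metis enn2real_mono enn2real_ennreal ennreal_less_top)
qed

lemma Linf_continuous_norm_continuous:
 assumes a: "Linf_continuous T a"
 shows "continuous_on {0..T} (%t. enn2real (Linfnorm (a t)))"
 unfolding continuous_on_iff
proof (intro ballI allI impI)
 fix t e :: real assume t: "t \<in> {0..T}" and e: "e > 0"
 have m: "a s \<in> borel_measurable lebesgue" if "s \<in> {0..T}" for s using a that unfolding Linf_continuous_def by blast
 obtain d where d: "d > 0" "\<forall>s\<in>{0..T}. \<bar>s - t\<bar> < d \<longrightarrow> (AE x in lebesgue. norm (a s x - a t x) <= e/2)"
  using Linf_continuousD[OF a t, of "e/2"] e by auto
 show "\<exists>d>0. \<forall>s\<in>{0..T}. dist s t < d \<longrightarrow> dist (enn2real (Linfnorm (a s))) (enn2real (Linfnorm (a t))) < e"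
 proof (intro exI[of _ d] conjI ballI impI d(1))
  fix s assume s: "s \<in> {0..T}" "dist s t < d"
  have ae: "AE x in lebesgue. norm (a s x - a t x) <= e/2" using d(2) s by (simp add: dist_real_def)
  have "AE x in lebesgue. norm (a s x) <= enn2real (Linfnorm (a t)) + e/2"
   using ae Linf_continuous_norm(1)[OF a t]
   by eventually_elim (use norm_triangle_sub in \<open>smt (verit)\<close>)
  then have 1: "enn2real (Linfnorm (a s)) <= enn2real (Linfnorm (a t)) + e/2"
   by (rule Linf_norm_le[OF m[OF s(1)]]) (use e in simp)
  have "AE x in lebesgue. norm (a t x) <= enn2real (Linfnorm (a s)) + e/2"
   using ae Linf_continuous_norm(1)[OF a s(1)]
   by eventually_elim (use norm_triangle_sub norm_minus_commute in \<open>smt (verit)\<close>)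
  then have 2: "enn2real (Linfnorm (a t)) <= enn2real (Linfnorm (a s)) + e/2"
   by (rule Linf_norm_le[OF m[OF t]]) (use e in simp)
  show "dist (enn2real (Linfnorm (a s))) (enn2real (Linfnorm (a t))) < e"
   using 1 2 e unfolding dist_real_def by linarith
 qed
qed

section \<open>The relative energy\<close>

text \<open>The algebra behind the relative energy identity. The Lorentz force of the current deviation
 \<open>R\<close> cancels against Ohm's law tested with \<open>R\<close>, which produces the only dissipative term
 \<open>- R \<bullet> R\<close>; the fast field \<open>\<delta> E0\<close> leaves its cross product with \<open>B\<close> and its curl.\<close>

lemma relative_energy_identity:
 fixes J :: "'h::real_inner"
 assumes J: "J = R + cd *\<^sub>R E0 + jb" and UB: "UB = UbBb + Wb + ub"
  and JB: "JB = RB + cd *\<^sub>R E0B + jbb + jbBb"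
  and Au: "Au = Aub + A1 + A2" "A1 \<bullet> w = 0"
  and lorentz: "RB \<bullet> w = - (Wb \<bullet> R)" and ohm: "J \<bullet> R = c * (E \<bullet> R) + UB \<bullet> R"
  and parts: "cE \<bullet> B = E \<bullet> cB" "cE \<bullet> Bb = E \<bullet> jb" "cE0 \<bullet> B = E0 \<bullet> cB" "cE0 \<bullet> Bb = E0 \<bullet> jb" "CG \<bullet> B = G \<bullet> cB" "CG \<bullet> Bb = G \<bullet> jb"
  and G: "G = jb - UbBb" and e: "e = cB - J + cd *\<^sub>R E0" and cd: "cd = c * \<delta>"
 shows "((JB - Au) - (jbBb - Aub)) \<bullet> w + (- (c *\<^sub>R cE) - (- CG)) \<bullet> (B - Bb) + (c *\<^sub>R e) \<bullet> (E - \<delta> *\<^sub>R E0)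
  = - (R \<bullet> R) + ub \<bullet> R + jbb \<bullet> w - A2 \<bullet> w + (G \<bullet> e + cd * (E0B \<bullet> w - cE0 \<bullet> (B - Bb)))"
proof -
 have 1: "((JB - Au) - (jbBb - Aub)) \<bullet> w = - (Wb \<bullet> R) + cd * (E0B \<bullet> w) + jbb \<bullet> w - A2 \<bullet> w"
  unfolding JB Au using Au(2) lorentz by (simp add: inner_add_left inner_diff_left)
 have 2: "(- (c *\<^sub>R cE) - (- CG)) \<bullet> (B - Bb) = - c * (E \<bullet> cB) + c * (E \<bullet> jb) + G \<bullet> cB - G \<bullet> jb"
  using parts by (simp add: inner_add_left inner_diff_left inner_diff_right algebra_simps)
 have 3: "(c *\<^sub>R e) \<bullet> (E - \<delta> *\<^sub>R E0) = c * (e \<bullet> E) - cd * (e \<bullet> E0)"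
  by (simp add: inner_diff_right cd algebra_simps)
 have eR: "e = (cB - jb) - R" unfolding e J by simp
 have 4: "c * (e \<bullet> E) = c * (E \<bullet> cB) - c * (E \<bullet> jb) - c * (E \<bullet> R)"
  unfolding eR by (simp add: inner_diff_left inner_commute[of E] right_diff_distrib)
 have 5: "cd * (e \<bullet> E0) = cd * (cE0 \<bullet> (B - Bb)) - cd * (E0 \<bullet> R)"
  unfolding eR by (simp add: inner_diff_left inner_diff_right parts inner_commute[of E0] right_diff_distrib)
 have 6: "c * (E \<bullet> R) = R \<bullet> R + cd * (E0 \<bullet> R) + jb \<bullet> R - (UbBb \<bullet> R + Wb \<bullet> R + ub \<bullet> R)"
  using ohm unfolding J UB by (simp add: inner_add_left)
 have 7: "G \<bullet> e = G \<bullet> cB - G \<bullet> jb - (jb \<bullet> R - UbBb \<bullet> R)"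
  unfolding eR by (simp add: inner_diff_right) (simp add: G inner_diff_left)
 show ?thesis unfolding 1 2 3 4 5 using 6 7 by (simp add: right_diff_distrib)
qed

definition decay :: "real => real => real" where "decay c t = exp (- (c\<^sup>2 * t))"

lemma decay_bounds: "0 < decay c t" "t >= 0 ==> decay c t <= 1" "decay c 0 = 1"
 by (simp_all add: decay_def)

lemma decay_derivative: "(decay c has_real_derivative - (c\<^sup>2 * decay c t)) (at t within S)"
 unfolding decay_def[abs_def] by (auto intro!: derivative_eq_intros)

lemma decay_continuous: "continuous_on S (decay c)" unfolding decay_def[abs_def] by (intro continuous_intros)

locale comparison = euler_maxwell c T m u E B j + mhd T m ubar Bbar Mbar
 for c T :: real and m :: nat and u E B j ubar Bbar :: "real => R3 => R3" and Mbar :: real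
begin

definition "w t = cl (u t) - cl (ubar t)"
definition "b t = cl (B t) - cl (Bbar t)"

text \<open>The electric field after removal of its initial layer, and \<open>1/c\<close> times its time derivative.\<close>

definition "er t = cl (E t) - decay c t *\<^sub>R cl (E 0)"
definition "e t = cl (weak_curl (B t)) - cl (j t) + (c * decay c t) *\<^sub>R cl (E 0)"

definition "y t = (norm (w t))\<^sup>2 + (norm (b t))\<^sup>2 + (norm (er t))\<^sup>2"
definition "rem t = cl (G t) \<bullet> e t + c * decay c t * (cl (%x. E 0 x \<times> B t x) \<bullet> w t - cl (weak_curl (E 0)) \<bullet> b t)"
definition "y' t = 2 * ((u_rhs t - ubar_rhs t) \<bullet> w t) + 2 * ((B_rhs t - Bbar_rhs t) \<bullet> b t) + 2 * ((c *\<^sub>R e t) \<bullet> er t)"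

lemma zero: "0 \<in> {0..T}" using T by simp

lemma E0B: "t \<in> {0..T} ==> (%x. E 0 x \<times> B t x) \<in> L2" "continuous_on {0..T} (%t. cl (%x. E 0 x \<times> B t x))"
proof -
 have k: "continuous_on {0..T} (%t. cl (E 0))" by simp
 have C1: "(%x. B t x \<times> E 0 x) \<in> L2" if "t \<in> {0..T}" for t
  by (rule cross_continuous(1)[OF B_Linf k _ that]) (rule fields_L2(2)[OF zero])
 have C2: "continuous_on {0..T} (%t. cl (%x. B t x \<times> E 0 x))"
  by (rule cross_continuous(2)[OF B_Linf k]) (rule fields_L2(2)[OF zero])
 have sk: "(%x. E 0 x \<times> B t x) = (%x. - (B t x \<times> E 0 x))" for t by (rule ext) (rule cross_skew)
 show "(%x. E 0 x \<times> B t x) \<in> L2" if "t \<in> {0..T}" for t unfolding sk by (rule L2_uminus[OF C1[OF that]])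
 have "continuous_on {0..T} (%t. - cl (%x. B t x \<times> E 0 x))" by (rule continuous_on_minus[OF C2])
 then show "continuous_on {0..T} (%t. cl (%x. E 0 x \<times> B t x))"
  by (rule continuous_on_eq) (simp only: sk cl_uminus[OF C1])
qed

lemma deviations_continuous: "continuous_on {0..T} w" "continuous_on {0..T} b" "continuous_on {0..T} er" "continuous_on {0..T} e"
 unfolding w_def[abs_def] b_def[abs_def] er_def[abs_def] e_def[abs_def]
 by (intro continuous_intros decay_continuous j_continuous CHspace_curl_continuous[OF BC m]
   CHspace_continuous_field[OF uC] CHspace_continuous_field[OF BC] CHspace_continuous_field[OF EC]
   CHspace_continuous_field[OF ubarC] CHspace_continuous_field[OF BbarC])+

lemma rem_continuous: "continuous_on {0..T} rem"
 unfolding rem_def[abs_def] by (intro continuous_intros decay_continuous deviations_continuous G_continuous(1) E0B(2))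

lemma er_derivative_test:
 assumes t: "t \<in> {0..T}" and v: "((%s. cl (E s) \<bullet> v) has_real_derivative E_rhs t \<bullet> v) (at t within {0..T})"
 shows "((%s. er s \<bullet> v) has_real_derivative (c *\<^sub>R e t) \<bullet> v) (at t within {0..T})"
proof -
 have "((%s. cl (E s) \<bullet> v - decay c s * (cl (E 0) \<bullet> v)) has_real_derivative
   E_rhs t \<bullet> v - (- (c\<^sup>2 * decay c t)) * (cl (E 0) \<bullet> v)) (at t within {0..T})"
  by (intro DERIV_diff[OF v] DERIV_cmult_right decay_derivative)
 moreover have "E_rhs t \<bullet> v - (- (c\<^sup>2 * decay c t)) * (cl (E 0) \<bullet> v) = (c *\<^sub>R e t) \<bullet> v"
  unfolding E_rhs_def e_def by (simp add: inner_add_left inner_diff_left power2_eq_square algebra_simps)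
 ultimately show ?thesis unfolding er_def by (simp add: inner_diff_left)
qed

lemma er_derivative:
 assumes t: "t \<in> {0..T}" and X: "X \<in> L2"
 shows "((%s. er s \<bullet> cl X) has_real_derivative c * (e t \<bullet> cl X)) (at t within {0..T})"
 using er_derivative_test[OF t time_derivative_inner[OF time_derivatives(2) rhs_continuous(2) closure_test_fields[OF X] t]] by simp

lemma y_derivative:
 assumes t: "t \<in> {0..T}"
 shows "(y has_real_derivative y' t) (at t within {0..T})"
proof -
 note i = inner_diff_left
 have "((%s. (norm (w s))\<^sup>2) has_real_derivative 2 * ((u_rhs t - ubar_rhs t) \<bullet> w t)) (at t within {0..T})"
 proof (rule time_derivative_norm[where D=test_curls and h="%t. u_rhs t - ubar_rhs t", OF _ _ deviations_continuous(1) _ t])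
  show "((%s. w s \<bullet> v) has_real_derivative (u_rhs r - ubar_rhs r) \<bullet> v) (at r within {0..T})"
   if "r \<in> {0..T}" "v \<in> test_curls" for r v
   unfolding w_def i by (rule DERIV_diff[OF time_derivatives(1)[OF that] bar_time_derivatives(1)[OF that]])
  show "continuous_on {0..T} (%t. u_rhs t - ubar_rhs t)" by (rule continuous_on_diff[OF rhs_continuous(1) bar_rhs_continuous(1)])
  show "w r \<in> closure test_curls" if r: "r \<in> {0..T}" for r
   unfolding w_def cl_diff[OF fields_L2(1)[OF r] bar_L2(1)[OF r], symmetric]
   by (rule closure_test_curls[OF L2_diff[OF fields_L2(1)[OF r] bar_L2(1)[OF r]]
     div_free_diff[OF fields_L2(1)[OF r] bar_L2(1)[OF r] solenoidal(1)[OF r] bar_solenoidal(1)[OF r]]])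
 qed
 moreover have "((%s. (norm (b s))\<^sup>2) has_real_derivative 2 * ((B_rhs t - Bbar_rhs t) \<bullet> b t)) (at t within {0..T})"
 proof (rule time_derivative_norm[where D=test_fields and h="%t. B_rhs t - Bbar_rhs t", OF _ _ deviations_continuous(2) _ t])
  show "((%s. b s \<bullet> v) has_real_derivative (B_rhs r - Bbar_rhs r) \<bullet> v) (at r within {0..T})"
   if "r \<in> {0..T}" "v \<in> test_fields" for r v
   unfolding b_def i by (rule DERIV_diff[OF time_derivatives(3)[OF that] bar_time_derivatives(2)[OF that]])
  show "continuous_on {0..T} (%t. B_rhs t - Bbar_rhs t)" by (rule continuous_on_diff[OF rhs_continuous(3) bar_rhs_continuous(2)])
  show "b r \<in> closure test_fields" if r: "r \<in> {0..T}" for r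
   unfolding b_def cl_diff[OF fields_L2(3)[OF r] bar_L2(2)[OF r], symmetric]
   by (rule closure_test_fields[OF L2_diff[OF fields_L2(3)[OF r] bar_L2(2)[OF r]]])
 qed
 moreover have "((%s. (norm (er s))\<^sup>2) has_real_derivative 2 * ((c *\<^sub>R e t) \<bullet> er t)) (at t within {0..T})"
 proof (rule time_derivative_norm[where D=test_fields and h="%t. c *\<^sub>R e t", OF _ _ deviations_continuous(3) _ t])
  show "((%s. er s \<bullet> v) has_real_derivative (c *\<^sub>R e r) \<bullet> v) (at r within {0..T})"
   if "r \<in> {0..T}" "v \<in> test_fields" for r v
   by (rule er_derivative_test[OF that(1) time_derivatives(2)[OF that]])
  show "continuous_on {0..T} (%t. c *\<^sub>R e t)" by (intro continuous_intros deviations_continuous(4))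
  show "er r \<in> closure test_fields" if r: "r \<in> {0..T}" for r
   unfolding er_def cl_scaleR[OF fields_L2(2)[OF zero], symmetric] cl_diff[OF fields_L2(2)[OF r] L2_scaleR[OF fields_L2(2)[OF zero]], symmetric]
   by (rule closure_test_fields[OF L2_diff[OF fields_L2(2)[OF r] L2_scaleR[OF fields_L2(2)[OF zero]]]])
 qed
 ultimately show ?thesis unfolding y_def[abs_def] y'_def by (intro DERIV_add)
qed

text \<open>The only terms without a sign are quadratic in the deviations,
 with coefficients bounded through the limit solution, and the remainder.\<close>

lemma y'_le:
 assumes t: "t \<in> {0..T}"
 shows "y' t <= (2 * (A\<^sup>2 + 5 * A)) * y t + 2 * rem t"
proof -
 define wf where "wf x = u t x - ubar t x" for x
 define bf where "bf x = B t x - Bbar t x" for x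
 define dw where "dw i x = weak_partial i (u t) x - weak_partial i (ubar t) x" for i x
 define Jf where "Jf x = (j t x - (c * decay c t) *\<^sub>R E 0 x) - weak_curl (Bbar t) x" for x
 note E0 = fields_L2(2)[OF zero]
 note L = fields_L2[OF t] bar_L2[OF t] and D = solenoidal[OF t] bar_solenoidal[OF t]
 have wf: "wf \<in> L2" "div_free wf" "cl wf = w t" and bf: "bf \<in> L2" "cl bf = b t"
  unfolding wf_def[abs_def] bf_def[abs_def] w_def b_def
  by (rule L2_diff[OF L(1,4)] div_free_diff[OF L(1,4) D(1,5)] cl_diff[OF L(1,4)] L2_diff[OF L(3,5)] cl_diff[OF L(3,5)])+
 have sE0: "(%x. (c * decay c t) *\<^sub>R E 0 x) \<in> L2" "div_free (%x. (c * decay c t) *\<^sub>R E 0 x)"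
  by (rule L2_scaleR[OF E0] div_free_scaleR[OF E0 solenoidal(2)[OF zero]])+
 have J1: "(%x. j t x - (c * decay c t) *\<^sub>R E 0 x) \<in> L2" "div_free (%x. j t x - (c * decay c t) *\<^sub>R E 0 x)"
  by (rule L2_diff[OF j_L2[OF t] sE0(1)] div_free_diff[OF j_L2[OF t] sE0(1) D(4) sE0(2)])+
 have djbar: "div_free (weak_curl (Bbar t))" unfolding weak_curl_eq by (rule div_free_curl_of[OF bar_H1(2)[OF t]])
 have Jf: "Jf \<in> L2" "div_free Jf"
  unfolding Jf_def[abs_def] by (rule L2_diff[OF J1(1) jbar_L2[OF t]] div_free_diff[OF J1(1) jbar_L2[OF t] J1(2) djbar])+
 have cJf: "cl Jf = cl (j t) - (c * decay c t) *\<^sub>R cl (E 0) - cl (weak_curl (Bbar t))"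
  unfolding Jf_def[abs_def] by (simp only: cl_diff[OF J1(1) jbar_L2[OF t]] cl_diff[OF j_L2[OF t] sE0(1)] cl_scaleR[OF E0])
 obtain KB where KB: "KB >= 0" "AE x in lebesgue. norm (B t x) <= KB" using B_Linf t unfolding Linf_continuous_def by blast
 obtain Ku where Ku: "Ku >= 0" "AE x in lebesgue. norm (u t x) <= Ku" using u_bounded[OF t] by blast
 have A3: "3 * A >= 0" using A by simp
 note wB = cross_L2_right[OF wf(1) L2_measurable[OF L(3)] KB(2,1)]
 note JfB = cross_L2_right[OF Jf(1) L2_measurable[OF L(3)] KB(2,1)]
 note ub = cross_L2_left[OF L2_measurable[OF L(4)] bar_bounds(1)[OF t] A bf(1)]
 note jb = cross_L2_left[OF L2_measurable[OF jbar_L2[OF t]] bar_bounds(4)[OF t] A3 bf(1)]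
 have UB: "cl (%x. u t x \<times> B t x) = cl (%x. ubar t x \<times> Bbar t x) + cl (%x. wf x \<times> B t x) + cl (%x. ubar t x \<times> bf x)"
 proof -
  have s: "(%x. u t x \<times> B t x) = (%x. (ubar t x \<times> Bbar t x + wf x \<times> B t x) + ubar t x \<times> bf x)"
   unfolding wf_def bf_def by (simp add: fun_eq_iff Cross3.left_diff_distrib Cross3.right_diff_distrib)
  show ?thesis unfolding s by (simp only: cl_add[OF L2_add[OF ubBb(1)[OF t] wB(1)] ub(1)] cl_add[OF ubBb(1)[OF t] wB(1)])
 qed
 have JB: "cl (%x. j t x \<times> B t x) = cl (%x. Jf x \<times> B t x) + (c * decay c t) *\<^sub>R cl (%x. E 0 x \<times> B t x)
   + cl (%x. weak_curl (Bbar t) x \<times> bf x) + cl (%x. weak_curl (Bbar t) x \<times> Bbar t x)"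
 proof -
  have s: "(%x. j t x \<times> B t x) = (%x. ((Jf x \<times> B t x + (c * decay c t) *\<^sub>R (E 0 x \<times> B t x))
    + weak_curl (Bbar t) x \<times> bf x) + weak_curl (Bbar t) x \<times> Bbar t x)"
   unfolding Jf_def bf_def by (simp add: fun_eq_iff Cross3.left_diff_distrib Cross3.right_diff_distrib cross_mult_left)
  note a = L2_scaleR[OF E0B(1)[OF t], of "c * decay c t"]
  note a2 = L2_add[OF JfB(1) a] note a3 = L2_add[OF a2 jb(1)]
  show ?thesis unfolding s by (simp only: cl_add[OF a3 jbarBbar(1)[OF t]] cl_add[OF a2 jb(1)] cl_add[OF JfB(1) a] cl_scaleR[OF E0B(1)[OF t]])
 qed
 have dwH: "H1_field wf dw" unfolding wf_def[abs_def] dw_def[abs_def] by (rule H1_field_diff[OF fields_H1(1)[OF t] bar_H1(1)[OF t]])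
 note a1 = adv_L2(2)[where dW=dw, OF L2_measurable[OF L(1)] Ku(2,1) H1_fieldD(2)[OF dwH]]
 have a2: "adv wf (%i. weak_partial i (ubar t)) \<in> L2" "norm (cl (adv wf (%i. weak_partial i (ubar t)))) <= 3 * A * norm (cl wf)"
  by (rule adv_bounded_gradient[OF wf(1) L2_measurable[OF bar_partial_L2(1)[OF t]] bar_bounds(2)[OF t] A])+
 have Au: "cl (advect (u t) (u t)) = cl (advect (ubar t) (ubar t)) + cl (adv (u t) dw) + cl (adv wf (%i. weak_partial i (ubar t)))"
 proof -
  have s: "advect (u t) (u t) = (%x. (advect (ubar t) (ubar t) x + adv (u t) dw x) + adv wf (%i. weak_partial i (ubar t)) x)"
   unfolding advect_eq wf_def[abs_def] dw_def[abs_def] adv_diff_left[symmetric] adv_diff_right[symmetric] by (simp add: fun_eq_iff)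
  show ?thesis by (subst s) (simp only: cl_add[OF L2_add[OF ubub(1)[OF t] a1] a2(1)] cl_add[OF ubub(1)[OF t] a1])
 qed
 have tr: "cl (adv (u t) dw) \<bullet> w t = 0"
  unfolding wf(3)[symmetric] by (rule transport_orthogonal[OF L(1) D(1) Ku(2,1) dwH])
 have lor: "cl (%x. Jf x \<times> B t x) \<bullet> w t = - (cl (%x. wf x \<times> B t x) \<bullet> cl Jf)"
  unfolding wf(3)[symmetric] by (rule cross_triple_L2[OF JfB(1) wB(1) Jf(1) wf(1)])
 have G: "cl (G t) = cl (weak_curl (Bbar t)) - cl (%x. ubar t x \<times> Bbar t x)"
  by (simp only: G_def[abs_def] cl_diff[OF jbar_L2[OF t] ubBb(1)[OF t]])
 have id: "(u_rhs t - ubar_rhs t) \<bullet> w t + (B_rhs t - Bbar_rhs t) \<bullet> b t + (c *\<^sub>R e t) \<bullet> er t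
  = - (cl Jf \<bullet> cl Jf) + cl (%x. ubar t x \<times> bf x) \<bullet> cl Jf + cl (%x. weak_curl (Bbar t) x \<times> bf x) \<bullet> w t
   - cl (adv wf (%i. weak_partial i (ubar t))) \<bullet> w t + rem t"
  unfolding u_rhs_def ubar_rhs_def B_rhs_def Bbar_rhs_def rem_def b_def er_def
 proof (rule relative_energy_identity[OF _ UB JB Au tr lor ohm(2)[OF t Jf]])
  show "cl (j t) = cl Jf + (c * decay c t) *\<^sub>R cl (E 0) + cl (weak_curl (Bbar t))" unfolding cJf by simp
  show "cl (weak_curl (E t)) \<bullet> cl (B t) = cl (E t) \<bullet> cl (weak_curl (B t))"
   "cl (weak_curl (E t)) \<bullet> cl (Bbar t) = cl (E t) \<bullet> cl (weak_curl (Bbar t))"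
   "cl (weak_curl (E 0)) \<bullet> cl (B t) = cl (E 0) \<bullet> cl (weak_curl (B t))"
   "cl (weak_curl (E 0)) \<bullet> cl (Bbar t) = cl (E 0) \<bullet> cl (weak_curl (Bbar t))"
   unfolding weak_curl_eq by (intro curl_by_parts fields_H1 bar_H1 t zero)+
  show "cl (curl_of (dG t)) \<bullet> cl (B t) = cl (G t) \<bullet> cl (weak_curl (B t))"
   "cl (curl_of (dG t)) \<bullet> cl (Bbar t) = cl (G t) \<bullet> cl (weak_curl (Bbar t))"
   unfolding weak_curl_eq by (intro curl_by_parts fields_H1 bar_H1 G_H1 t)+
  show "e t = cl (weak_curl (B t)) - cl (j t) + (c * decay c t) *\<^sub>R cl (E 0)" by (rule e_def)
 qed (rule G refl)+
 define R where "R = norm (cl Jf)"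
 define W where "W = norm (w t)"
 define V where "V = norm (b t)"
 have n: "R >= 0" "W >= 0" "V >= 0" by (simp_all add: R_def W_def V_def)
 have 1: "cl (%x. ubar t x \<times> bf x) \<bullet> cl Jf <= A * V * R"
  using order_trans[OF norm_cauchy_schwarz mult_right_mono[OF ub(2) norm_ge_zero]] unfolding bf(2) V_def R_def .
 have 2: "cl (%x. weak_curl (Bbar t) x \<times> bf x) \<bullet> w t <= 3 * A * V * W"
  using order_trans[OF norm_cauchy_schwarz mult_right_mono[OF jb(2) norm_ge_zero]] unfolding bf(2) V_def W_def .
 have 3: "- (cl (adv wf (%i. weak_partial i (ubar t))) \<bullet> w t) <= 3 * A * W * W"
 proof -
  have "(- cl (adv wf (%i. weak_partial i (ubar t)))) \<bullet> w t <= norm (- cl (adv wf (%i. weak_partial i (ubar t)))) * W"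
   unfolding W_def by (rule norm_cauchy_schwarz)
  then have "- (cl (adv wf (%i. weak_partial i (ubar t))) \<bullet> w t) <= norm (cl (adv wf (%i. weak_partial i (ubar t)))) * W" by simp
  then show ?thesis using mult_right_mono[OF a2(2) n(2)] unfolding wf(3) W_def[symmetric] by linarith
 qed
 have 4: "- R\<^sup>2 + A * V * R <= A\<^sup>2 * V\<^sup>2"
 proof -
  have "0 <= (R - A * V / 2)\<^sup>2" "0 <= A\<^sup>2 * V\<^sup>2" by simp_all
  then show ?thesis by (simp add: power2_eq_square algebra_simps)
 qed
 have 5: "3 * A * V * W <= 2 * A * V\<^sup>2 + 2 * A * W\<^sup>2"
 proof -
  have "0 <= A * (3 * (V - W)\<^sup>2 + V\<^sup>2 + W\<^sup>2)" using A by simp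
  then have "2 * (3 * A * V * W) <= 2 * (2 * A * V\<^sup>2 + 2 * A * W\<^sup>2)" by (simp add: power2_eq_square algebra_simps)
  then show ?thesis by simp
 qed
 have "(u_rhs t - ubar_rhs t) \<bullet> w t + (B_rhs t - Bbar_rhs t) \<bullet> b t + (c *\<^sub>R e t) \<bullet> er t
   <= A\<^sup>2 * V\<^sup>2 + 2 * A * V\<^sup>2 + 5 * A * W\<^sup>2 + rem t"
  unfolding id power2_norm_eq_inner[symmetric] R_def[symmetric] using 1 2 3 4 5 by (simp add: power2_eq_square)
 also have "\<dots> <= (A\<^sup>2 + 5 * A) * y t + rem t"
 proof -
  have "0 <= A * V\<^sup>2" "0 <= A\<^sup>2 * W\<^sup>2" "0 <= (A\<^sup>2 + 5 * A) * (norm (er t))\<^sup>2" using A by simp_all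
  then show ?thesis unfolding y_def W_def[symmetric] V_def[symmetric] by (simp add: algebra_simps)
 qed
 finally show ?thesis unfolding y'_def by (simp add: algebra_simps)
qed

end

section \<open>The remainder\<close>

lemma Linf_square_integral:
 assumes a: "Linf_continuous T a" and M: "(\<integral>\<^sup>+t. (Linfnorm (a t))\<^sup>2 \<partial>lebesgue_on {0..T}) <= ennreal M" "M >= 0"
 shows "integral {0..T} (%t. (enn2real (Linfnorm (a t)))\<^sup>2) <= M"
proof -
 let ?b = "%t. (enn2real (Linfnorm (a t)))\<^sup>2"
 have i: "integrable (lebesgue_on {0..T}) ?b"
  by (intro continuous_imp_integrable_real continuous_intros Linf_continuous_norm_continuous[OF a])
 have "(\<integral>\<^sup>+t. (Linfnorm (a t))\<^sup>2 \<partial>lebesgue_on {0..T}) = (\<integral>\<^sup>+t. ennreal (?b t) \<partial>lebesgue_on {0..T})"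
 proof (rule nn_integral_cong)
  fix t assume "t \<in> space (lebesgue_on {0..T})"
  then have t: "t \<in> {0..T}" by simp
  show "(Linfnorm (a t))\<^sup>2 = ennreal (?b t)"
   by (subst Linf_continuous_norm(2)[OF a t]) (simp add: ennreal_power)
 qed
 also have "\<dots> = ennreal (integral\<^sup>L (lebesgue_on {0..T}) ?b)" by (rule nn_integral_eq_integral[OF i]) simp
 also have "integral\<^sup>L (lebesgue_on {0..T}) ?b = integral {0..T} ?b" by (rule lebesgue_integral_eq_integral[OF i]) simp
 finally show ?thesis using M by simp
qed

context euler_maxwell
begin

definition "energy t = (norm (cl (u t)))\<^sup>2 + (norm (cl (E t)))\<^sup>2 + (norm (cl (B t)))\<^sup>2"

lemma energy_le: assumes t: "t \<in> {0..T}" shows "energy t <= energy 0"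
proof -
 have "energy t - energy 0 <= (%_. 0) t - (%_. 0) (0::real)"
  by (rule increment_le[where T=T and f'="%t. - 2 * (norm (cl (j t)))\<^sup>2" and g'="%_. 0"])
   (use energy_derivative t in \<open>simp_all add: energy_def[abs_def]\<close>)
 then show ?thesis by simp
qed

lemma energy_bounds:
 assumes C: "energy 0 <= C\<^sup>2" "C >= 0" and t: "t \<in> {0..T}"
 shows "norm (cl (u t)) <= C" "norm (cl (E t)) <= C" "norm (cl (B t)) <= C"
proof -
 have "energy t <= C\<^sup>2" using energy_le[OF t] C by simp
 then have "(norm (cl (u t)))\<^sup>2 <= C\<^sup>2" "(norm (cl (E t)))\<^sup>2 <= C\<^sup>2" "(norm (cl (B t)))\<^sup>2 <= C\<^sup>2"
  unfolding energy_def using zero_le_power2[of "norm (cl (u t))"] zero_le_power2[of "norm (cl (E t))"]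
   zero_le_power2[of "norm (cl (B t))"] by linarith+
 then show "norm (cl (u t)) <= C" "norm (cl (E t)) <= C" "norm (cl (B t)) <= C"
  using C(2) power2_le_imp_le by blast+
qed

end

lemma inner_le: fixes x y :: "'h::real_inner" assumes "norm x <= a" "norm y <= b" "0 <= a" shows "x \<bullet> y <= a * b"
 by (rule order_trans[OF norm_cauchy_schwarz mult_mono]) (use assms in auto)

context comparison
begin

text \<open>The term \<open>G \<bullet> e\<close> is small only in the mean: \<open>c e\<close> is the time derivative of the bounded
 field \<open>er\<close>, so that its integral against a field frozen in time is \<open>O(1/c)\<close>, whatever the
 size of \<open>e\<close>. The limit field \<open>G\<close> is replaced by its values on a time grid.
 Up to a factor, \<open>\<Psi>\<close> is a primitive of a bound for the error; the energy enters as a primitive of \<open>\<parallel>j\<parallel>\<^sup>2\<close>.\<close>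

definition "\<Phi> t = integral {0..t} (%s. cl (G s) \<bullet> e s)"
definition "\<Psi> C t = (C + 1/2) * t - energy t / 4 - C * decay c t / c"

lemma \<Phi>_derivative: "t \<in> {0..T} ==> (\<Phi> has_real_derivative cl (G t) \<bullet> e t) (at t within {0..T})"
 unfolding \<Phi>_def[abs_def] by (rule integral_derivative) (intro continuous_intros G_continuous(1) deviations_continuous(4))

lemma \<Psi>_derivative:
 assumes t: "t \<in> {0..T}"
 shows "(\<Psi> C has_real_derivative C + 1/2 + (norm (cl (j t)))\<^sup>2 / 2 + C * (c * decay c t)) (at t within {0..T})"
proof -
 have "((%t. (C + 1/2) * t - energy t / 4 - C * decay c t / c) has_real_derivative
   (C + 1/2) * 1 - (- 2 * (norm (cl (j t)))\<^sup>2) / 4 - C * (- (c\<^sup>2 * decay c t)) / c) (at t within {0..T})"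
  by (intro DERIV_diff DERIV_cmult DERIV_cdivide DERIV_ident decay_derivative) (use energy_derivative[OF t] in \<open>simp add: energy_def[abs_def]\<close>)
 moreover have "(C + 1/2) * 1 - (- 2 * (norm (cl (j t)))\<^sup>2) / 4 - C * (- (c\<^sup>2 * decay c t)) / c
   = C + 1/2 + (norm (cl (j t)))\<^sup>2 / 2 + C * (c * decay c t)" using c by (simp add: field_simps power2_eq_square)
 ultimately show ?thesis unfolding \<Psi>_def[abs_def] by simp
qed

lemma er_bound:
 assumes C: "energy 0 <= C\<^sup>2" "C >= 0" and t: "t \<in> {0..T}" shows "norm (er t) <= 2 * C"
proof -
 have "norm (er t) <= norm (cl (E t)) + norm (decay c t *\<^sub>R cl (E 0))" unfolding er_def by (rule norm_triangle_ineq4)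
 also have "norm (decay c t *\<^sub>R cl (E 0)) <= 1 * norm (cl (E 0))"
  unfolding norm_scaleR using decay_bounds(1)[of c t] decay_bounds(2)[of t c] t by (intro mult_right_mono) auto
 finally show ?thesis using energy_bounds(2)[OF C t] energy_bounds(2)[OF C zero] by simp
qed

lemma frozen_step:
 assumes C: "energy 0 <= C\<^sup>2" "C >= 0" and Mg: "!!t. t \<in> {0..T} ==> norm (cl (G t)) <= Mg" and \<eta>: "\<eta> >= 0"
  and sr: "0 <= s" "s <= r" "r <= T"
  and G1: "!!t. t \<in> {s..r} ==> norm (cl (G t) - cl (G s)) <= \<eta>"
  and G2: "!!t. t \<in> {s..r} ==> norm (cl (curl_of (dG t)) - cl (curl_of (dG s))) <= \<eta>"
 shows "\<Phi> r - \<Phi> s <= 4 * Mg * C / c + \<eta> * (\<Psi> C r - \<Psi> C s)"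
proof -
 have s: "s \<in> {0..T}" and r: "r \<in> {0..T}" using sr by simp_all
 have GL: "G t \<in> L2" if "t \<in> {0..T}" for t by (rule H1_fieldD(1)[OF G_H1[OF that]])
 let ?f = "%t. \<Phi> t - (er t \<bullet> cl (G s)) / c"
 have "?f r - ?f s <= \<eta> * \<Psi> C r - \<eta> * \<Psi> C s"
 proof (rule increment_le[OF _ _ sr])
  show "(?f has_real_derivative cl (G t) \<bullet> e t - c * (e t \<bullet> cl (G s)) / c) (at t within {0..T})" if "t \<in> {0..T}" for t
   by (intro DERIV_diff DERIV_cdivide \<Phi>_derivative er_derivative GL that s)
  show "((%t. \<eta> * \<Psi> C t) has_real_derivative \<eta> * (C + 1/2 + (norm (cl (j t)))\<^sup>2 / 2 + C * (c * decay c t))) (at t within {0..T})"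
   if "t \<in> {0..T}" for t by (intro DERIV_cmult \<Psi>_derivative that)
  fix t assume tr: "t \<in> {s..r}"
  then have t: "t \<in> {0..T}" using sr by simp
  let ?d = "cl (G t) - cl (G s)"
  have cb: "cl (curl_of (dG q)) \<bullet> cl (B t) = cl (G q) \<bullet> cl (weak_curl (B t))" if "q \<in> {0..T}" for q
   unfolding weak_curl_eq by (rule curl_by_parts[OF G_H1[OF that] fields_H1(3)[OF t]])
  have 1: "?d \<bullet> cl (weak_curl (B t)) <= \<eta> * C"
   unfolding inner_diff_left cb[OF t, symmetric] cb[OF s, symmetric]
   unfolding inner_diff_left[symmetric] by (rule inner_le[OF G2[OF tr] energy_bounds(3)[OF C t] \<eta>])
  have 2: "?d \<bullet> (- cl (j t)) <= \<eta> * norm (cl (j t))" by (rule inner_le[OF G1[OF tr] _ \<eta>]) simp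
  have 3: "?d \<bullet> cl (E 0) <= \<eta> * C" by (rule inner_le[OF G1[OF tr] energy_bounds(2)[OF C zero] \<eta>])
  have 4: "norm (cl (j t)) <= 1/2 + (norm (cl (j t)))\<^sup>2 / 2"
   using zero_le_power2[of "norm (cl (j t)) - 1"] by (simp add: power2_eq_square algebra_simps)
  have d0: "0 <= c * decay c t" using c decay_bounds(1)[of c t] by simp
  have "cl (G t) \<bullet> e t - c * (e t \<bullet> cl (G s)) / c = ?d \<bullet> e t" using c by (simp add: inner_diff_left inner_diff_right inner_commute)
  also have "\<dots> = ?d \<bullet> cl (weak_curl (B t)) + ?d \<bullet> (- cl (j t)) + (c * decay c t) * (?d \<bullet> cl (E 0))"
   unfolding e_def by (simp add: inner_add_right inner_diff_right del: inner_diff_left)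
  also have "\<dots> <= \<eta> * C + \<eta> * (1/2 + (norm (cl (j t)))\<^sup>2 / 2) + (c * decay c t) * (\<eta> * C)"
   by (intro add_mono 1 order_trans[OF 2] mult_left_mono 3 4 \<eta> d0)
  also have "\<dots> = \<eta> * (C + 1/2 + (norm (cl (j t)))\<^sup>2 / 2 + C * (c * decay c t))" by (simp add: algebra_simps)
  finally show "cl (G t) \<bullet> e t - c * (e t \<bullet> cl (G s)) / c <= \<eta> * (C + 1/2 + (norm (cl (j t)))\<^sup>2 / 2 + C * (c * decay c t))" .
 qed
 moreover have "(er r \<bullet> cl (G s)) / c - (er s \<bullet> cl (G s)) / c <= 4 * Mg * C / c"
 proof -
  have a: "norm (er r - er s) <= 4 * C" using norm_triangle_ineq4[of "er r" "er s"] er_bound[OF C r] er_bound[OF C s] by simp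
  have "(er r - er s) \<bullet> cl (G s) <= (4 * C) * Mg" by (rule inner_le[OF a Mg[OF s]]) (use C in simp)
  then have "((er r - er s) \<bullet> cl (G s)) / c <= (4 * C) * Mg / c" using c by (simp add: divide_right_mono)
  then show ?thesis by (simp add: inner_diff_left diff_divide_distrib mult_ac)
 qed
 ultimately show ?thesis by (simp add: right_diff_distrib)
qed

lemma frozen_bound:
 assumes C: "energy 0 <= C\<^sup>2" "C >= 0" and Mg: "!!t. t \<in> {0..T} ==> norm (cl (G t)) <= Mg" and \<eta>: "\<eta> >= 0" and N: "N > 0"
  and grid: "!!s t. s \<in> {0..T} ==> t \<in> {0..T} ==> \<bar>t - s\<bar> <= T / real N ==>
    norm (cl (G t) - cl (G s)) <= \<eta> \<and> norm (cl (curl_of (dG t)) - cl (curl_of (dG s))) <= \<eta>"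
  and t: "t \<in> {0..T}"
 shows "\<Phi> t <= real N * (4 * Mg * C / c) + \<eta> * ((C + 1/2) * T + C\<^sup>2 / 4 + C / c)"
proof -
 let ?K = "4 * Mg * C / c" and ?h = "T / real N"
 have h: "?h > 0" using T N by simp
 have Mg0: "Mg >= 0" using Mg[OF zero] norm_ge_zero order_trans by blast
 have K: "?K >= 0" using Mg0 C c by simp
 have "\<forall>t\<in>{0..T}. t <= real k * ?h \<longrightarrow> \<Phi> t <= real k * ?K + \<eta> * (\<Psi> C t - \<Psi> C 0)" for k
 proof (induction k)
  case 0
  have "\<Phi> 0 = 0" by (simp add: \<Phi>_def)
  then show ?case by auto
 next
  case (Suc k)
  show ?case
  proof (intro ballI impI)
   fix r assume r: "r \<in> {0..T}" "r <= real (Suc k) * ?h"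
   define s where "s = max 0 (r - ?h)"
   have kh: "real (Suc k) * ?h = real k * ?h + ?h" by (simp only: of_nat_Suc distrib_right mult_1_left add.commute)
   have kh0: "0 <= real k * ?h" by (rule mult_nonneg_nonneg[OF of_nat_0_le_iff less_imp_le[OF h]])
   have s: "0 <= s" "s <= r" "s <= real k * ?h" "r - s <= ?h" using r kh kh0 h unfolding s_def by (auto simp del: of_nat_Suc)
   have sT: "s \<in> {0..T}" using s r by simp
   have "\<Phi> r - \<Phi> s <= ?K + \<eta> * (\<Psi> C r - \<Psi> C s)"
   proof (rule frozen_step[OF C Mg \<eta> s(1,2)])
    show "r <= T" using r by simp
    fix q assume q: "q \<in> {s..r}"
    then have "q \<in> {0..T}" "\<bar>q - s\<bar> <= ?h" using s r by auto
    from grid[OF sT this] show "norm (cl (G q) - cl (G s)) <= \<eta>" "norm (cl (curl_of (dG q)) - cl (curl_of (dG s))) <= \<eta>" by blast+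
   qed
   moreover have "\<Phi> s <= real k * ?K + \<eta> * (\<Psi> C s - \<Psi> C 0)" using Suc sT s(3) by blast
   ultimately show "\<Phi> r <= real (Suc k) * ?K + \<eta> * (\<Psi> C r - \<Psi> C 0)" by (simp add: algebra_simps add_divide_distrib)
  qed
 qed
 from this[of N] have "\<Phi> t <= real N * ?K + \<eta> * (\<Psi> C t - \<Psi> C 0)" using t N by simp
 moreover have "\<Psi> C t - \<Psi> C 0 <= (C + 1/2) * T + C\<^sup>2 / 4 + C / c"
 proof -
  have "(C + 1/2) * t <= (C + 1/2) * T" using t C by (intro mult_left_mono) auto
  moreover have "0 <= energy t" by (simp add: energy_def)
  moreover have "0 <= C * decay c t / c" using C c decay_bounds(1)[of c t] by simp
  ultimately show ?thesis unfolding \<Psi>_def using C(1) decay_bounds(3)[of c] by simp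
 qed
 ultimately show ?thesis using mult_left_mono[OF _ \<eta>] by (smt (verit))
qed

text \<open>The product of the initial layer with \<open>B\<close> is controlled by splitting the initial electric field
 into a part that is small in \<open>L\<^sup>2\<close>, paired with the \<open>L\<^sup>\<infinity>\<close> norm of \<open>B\<close>, and a bounded part.\<close>

lemma remainder_bound:
 assumes C: "energy 0 <= C\<^sup>2" "C >= 0" and Mg: "!!t. t \<in> {0..T} ==> norm (cl (G t)) <= Mg" and \<eta>: "\<eta> >= 0" and N: "N > 0"
  and grid: "!!s t. s \<in> {0..T} ==> t \<in> {0..T} ==> \<bar>t - s\<bar> <= T / real N ==>
    norm (cl (G t) - cl (G s)) <= \<eta> \<and> norm (cl (curl_of (dG t)) - cl (curl_of (dG s))) <= \<eta>"
  and S: "S \<in> L2" "norm (cl S) <= \<delta>" and L: "L \<in> borel_measurable lebesgue" "!!x. norm (L x) <= \<Lambda>" and split: "!!x. E 0 x = S x + L x"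
  and C1: "norm (cl (weak_curl (E 0))) <= C1"
  and M: "(\<integral>\<^sup>+t. (Linfnorm (B t))\<^sup>2 \<partial>lebesgue_on {0..T}) <= ennreal M" "M >= 0"
  and t: "t \<in> {0..T}"
 shows "integral {0..t} rem <= real N * (4 * Mg * C / c) + \<eta> * ((C + 1/2) * T + C\<^sup>2 / 4 + C / c)
   + (C + Mbar) * \<delta> * (1 + M) + (\<Lambda> * C + C1) * (C + Mbar) / c"
proof -
 define \<beta> where "\<beta> t = enn2real (Linfnorm (B t))" for t
 define I where "I t = integral {0..t} (%t. (\<beta> t)\<^sup>2)" for t
 define Q where "Q = C + Mbar"
 define K where "K = (\<Lambda> * C + C1) * Q"
 have \<beta>c: "continuous_on {0..T} (%t. (\<beta> t)\<^sup>2)"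
  unfolding \<beta>_def by (intro continuous_intros Linf_continuous_norm_continuous[OF B_Linf])
 have Id: "(I has_real_derivative (\<beta> t)\<^sup>2) (at t within {0..T})" if "t \<in> {0..T}" for t
  unfolding I_def[abs_def] by (rule integral_derivative[OF \<beta>c that])
 have IT: "I T <= M" unfolding I_def \<beta>_def by (rule Linf_square_integral[OF B_Linf M])
 have "(%_. 0) T - (%_. 0) t <= I T - I t"
  by (rule increment_le[where T=T and f'="%_. 0", OF _ Id]) (use t in simp_all)
 then have It: "I t <= M" using IT by simp
 have nn: "Q >= 0" "\<delta> >= 0" "\<Lambda> >= 0" "C1 >= 0"
  using C Mbar order_trans[OF norm_ge_zero S(2)] order_trans[OF norm_ge_zero L(2)[of 0]] order_trans[OF norm_ge_zero C1]
  by (simp_all add: Q_def)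
 let ?g = "%t. \<Phi> t + (Q * \<delta> / 2) * (- ((decay c t)\<^sup>2 / 2) + I t) - K * decay c t / c"
 have "integral {0..t} rem - integral {0..0} rem <= ?g t - ?g 0"
 proof (rule increment_le[where T=T])
  show "((%t. integral {0..t} rem) has_real_derivative rem s) (at s within {0..T})" if "s \<in> {0..T}" for s
   by (rule integral_derivative[OF rem_continuous that])
  show "(?g has_real_derivative cl (G s) \<bullet> e s + (Q * \<delta> / 2) * (- (2 * (decay c s * - (c\<^sup>2 * decay c s)) / 2) + (\<beta> s)\<^sup>2) - K * (- (c\<^sup>2 * decay c s)) / c) (at s within {0..T})"
   if s: "s \<in> {0..T}" for s
  proof -
   have "((%t. (decay c t)\<^sup>2) has_real_derivative 2 * (decay c s * - (c\<^sup>2 * decay c s))) (at s within {0..T})"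
    using DERIV_power[OF decay_derivative[of c s "{0..T}"], where n=2] by (simp add: mult_ac)
   then show ?thesis
    by (intro DERIV_diff DERIV_add DERIV_cmult DERIV_cdivide DERIV_minus \<Phi>_derivative Id s decay_derivative)
  qed
  fix s assume "s \<in> {0..t}"
  then have s: "s \<in> {0..T}" using t by simp
  note Lc = L2_measurable[OF fields_L2(3)[OF s]]
  have \<beta>: "AE x in lebesgue. norm (B s x) <= \<beta> s" "\<beta> s >= 0" unfolding \<beta>_def by (rule Linf_continuous_norm(1)[OF B_Linf s]) simp
  note SB = cross_L2_right[OF S(1) Lc \<beta>]
  have aL: "AE x in lebesgue. norm (L x) <= \<Lambda>" using L(2) by simp
  note LB = cross_L2_left[OF L(1) aL nn(3) fields_L2(3)[OF s]]
  have sp: "(%x. E 0 x \<times> B s x) = (%x. S x \<times> B s x + L x \<times> B s x)" by (simp add: fun_eq_iff split Cross3.left_diff_distrib cross_add_left)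
  have n1: "norm (cl (%x. E 0 x \<times> B s x)) <= \<beta> s * \<delta> + \<Lambda> * C"
   unfolding sp cl_add[OF SB(1) LB(1)]
   by (intro order_trans[OF norm_triangle_ineq] add_mono order_trans[OF SB(2)] order_trans[OF LB(2)] mult_left_mono S(2) \<beta>(2) nn(3) energy_bounds(3)[OF C s])
  have bars: "norm (cl (ubar s)) <= Mbar" "norm (cl (Bbar s)) <= Mbar"
   by (rule Hspace_field_bounds(1)[OF bar_H(1)[OF s] mhd_m Mbar ubar_bound[OF s]] Hspace_field_bounds(1)[OF bar_H(2)[OF s] mhd_m Mbar Bbar_bound[OF s]])+
  have wQ: "norm (w s) <= Q" using norm_triangle_ineq4[of "cl (u s)" "cl (ubar s)"] energy_bounds(1)[OF C s] bars(1) unfolding w_def Q_def by linarith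
  have bQ: "norm (b s) <= Q" using norm_triangle_ineq4[of "cl (B s)" "cl (Bbar s)"] energy_bounds(3)[OF C s] bars(2) unfolding b_def Q_def by linarith
  have "cl (%x. E 0 x \<times> B s x) \<bullet> w s <= (\<beta> s * \<delta> + \<Lambda> * C) * Q"
   by (rule inner_le[OF n1 wQ]) (use nn \<beta>(2) C in simp)
  moreover have "(- cl (weak_curl (E 0))) \<bullet> b s <= C1 * Q" by (rule inner_le[OF _ bQ nn(4)]) (use C1 in simp)
  ultimately have i: "cl (%x. E 0 x \<times> B s x) \<bullet> w s - cl (weak_curl (E 0)) \<bullet> b s <= (Q * \<delta>) * \<beta> s + K"
   unfolding K_def by (simp add: algebra_simps)
  have d0: "0 <= c * decay c s" using c decay_bounds(1)[of c s] by simp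
  have y: "(c * decay c s) * \<beta> s <= ((c * decay c s)\<^sup>2 + (\<beta> s)\<^sup>2) / 2"
   using zero_le_power2[of "c * decay c s - \<beta> s"] by (simp add: power2_eq_square algebra_simps)
  have "rem s <= cl (G s) \<bullet> e s + (c * decay c s) * ((Q * \<delta>) * \<beta> s + K)"
   unfolding rem_def by (intro add_left_mono mult_left_mono i d0)
  also have "\<dots> = cl (G s) \<bullet> e s + ((Q * \<delta>) * ((c * decay c s) * \<beta> s) + K * (c * decay c s))" by (simp add: algebra_simps)
  also have "\<dots> <= cl (G s) \<bullet> e s + ((Q * \<delta>) * (((c * decay c s)\<^sup>2 + (\<beta> s)\<^sup>2) / 2) + K * (c * decay c s))"
   by (intro add_left_mono add_right_mono mult_left_mono y) (use nn in simp)
  also have "\<dots> = cl (G s) \<bullet> e s + (Q * \<delta> / 2) * (- (2 * (decay c s * - (c\<^sup>2 * decay c s)) / 2) + (\<beta> s)\<^sup>2) - K * (- (c\<^sup>2 * decay c s)) / c"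
   using c by (simp add: field_simps power2_eq_square)
  finally show "rem s <= \<dots>" .
 qed (use t in simp_all)
 moreover have "?g t - ?g 0 <= \<Phi> t + Q * \<delta> * (1 + M) + K / c"
 proof -
  have d: "0 <= (decay c t)\<^sup>2" "0 <= K * decay c t / c"
   using decay_bounds(1)[of c t] c nn C unfolding K_def by simp_all
  have "(Q * \<delta> / 2) * ((- ((decay c t)\<^sup>2 / 2) + I t) - (- ((decay c 0)\<^sup>2 / 2) + I 0)) <= (Q * \<delta> / 2) * (2 * (1 + M))"
  proof (rule mult_left_mono)
   have I0: "I 0 = 0" by (simp add: I_def)
   have "(- (D / 2) + J) - (- (1 / 2) + 0) <= 2 * (1 + M)" if "0 <= D" "J <= M" for D J :: real using that M(2) by simp
   from this[OF d(1) It] show "(- ((decay c t)\<^sup>2 / 2) + I t) - (- ((decay c 0)\<^sup>2 / 2) + I 0) <= 2 * (1 + M)"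
    unfolding decay_bounds(3) I0 one_power2 .
  qed (use nn in simp)
  moreover have "\<Phi> 0 = 0" by (simp add: \<Phi>_def)
  ultimately show ?thesis using d(2) by (simp add: decay_bounds(3) algebra_simps)
 qed
 ultimately show ?thesis using frozen_bound[OF C Mg \<eta> N grid t] unfolding Q_def K_def by simp
qed

theorem comparison_bound:
 assumes \<rho>: "!!t. t \<in> {0..T} ==> integral {0..t} rem <= \<rho>" and t: "t \<in> {0..T}"
 shows "y t <= ((norm (w 0))\<^sup>2 + (norm (b 0))\<^sup>2 + 2 * \<rho>) * exp (2 * (A\<^sup>2 + 5 * A) * T)"
  "norm (cl (E t)) <= decay c t * norm (cl (E 0)) + sqrt (y t)"
proof -
 have "er 0 = 0" by (simp add: er_def decay_bounds)
 then have y0: "y 0 = (norm (w 0))\<^sup>2 + (norm (b 0))\<^sup>2" by (simp add: y_def)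
 have \<rho>0: "\<rho> >= 0" using \<rho>[OF zero] by simp
 have K: "2 * (A\<^sup>2 + 5 * A) >= 0" using A by simp
 have "y t <= (y 0 + 2 * \<rho>) * exp (2 * (A\<^sup>2 + 5 * A) * t)"
 proof (rule gronwall[OF y_derivative _ K y'_le _ t])
  show "continuous_on {0..T} (%t. 2 * rem t)" by (intro continuous_intros rem_continuous)
  show "integral {0..s} (%t. 2 * rem t) <= 2 * \<rho>" if "s \<in> {0..T}" for s using \<rho>[OF that] by simp
 qed
 also have "\<dots> <= (y 0 + 2 * \<rho>) * exp (2 * (A\<^sup>2 + 5 * A) * T)"
 proof (rule mult_left_mono)
  show "exp (2 * (A\<^sup>2 + 5 * A) * t) <= exp (2 * (A\<^sup>2 + 5 * A) * T)"
   unfolding exp_le_cancel_iff by (rule mult_left_mono[OF _ K]) (use t in simp)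
 qed (use y0 \<rho>0 in simp)
 finally show "y t <= ((norm (w 0))\<^sup>2 + (norm (b 0))\<^sup>2 + 2 * \<rho>) * exp (2 * (A\<^sup>2 + 5 * A) * T)" unfolding y0 .
 have "norm (er t) <= sqrt (y t)" by (rule real_le_rsqrt) (simp add: y_def)
 moreover have "cl (E t) = decay c t *\<^sub>R cl (E 0) + er t" by (simp add: er_def)
 then have "norm (cl (E t)) <= decay c t * norm (cl (E 0)) + norm (er t)"
  using norm_triangle_ineq[of "decay c t *\<^sub>R cl (E 0)" "er t"] decay_bounds(1)[of c t] by simp
 ultimately show "norm (cl (E t)) <= decay c t * norm (cl (E 0)) + sqrt (y t)" by linarith
qed

end

section \<open>Mollification of fields in \<open>H\<^sup>1\<close> with a rate\<close>

lemma norm_cl_reflect: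
 fixes f :: "R3 => real"
 assumes f: "f \<in> L2" shows "(%y. f (x - y)) \<in> L2" "norm (cl (%y. f (x - y))) = norm (cl f)"
proof -
 have m: "(%y. f (x - y)) \<in> borel_measurable lebesgue"
  using measurable_affine[OF L2_measurable[OF f], of "- 1" x] by simp
 have i: "integrable lebesgue (%y. (norm (f (x - y)))\<^sup>2)"
  using integrable_affine[of "%y. (norm (f y))\<^sup>2" "- 1" x] L2_integrable[OF f] by simp
 show r: "(%y. f (x - y)) \<in> L2" unfolding L2_iff using m i by blast
 have "(\<integral>y. (norm (f y))\<^sup>2 \<partial>lebesgue) = (\<integral>y. (norm (f (x - y)))\<^sup>2 \<partial>lebesgue)"
  using integral_affine[of "%y. (norm (f y))\<^sup>2" "- 1" x] L2_measurable[OF f] by simp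
 then show "norm (cl (%y. f (x - y))) = norm (cl f)" by (simp only: norm_cl[OF f] norm_cl[OF r])
qed

lemma conv_sup:
 assumes f: "f \<in> L2" and k: "\<kappa> \<in> test_functions" shows "\<bar>conv f \<kappa> x\<bar> <= norm (cl \<kappa>) * norm (cl f)"
proof -
 note r = norm_cl_reflect[OF test_L2[OF k], of x]
 have "conv f \<kappa> x = cl (%y. \<kappa> (x - y)) \<bullet> cl f" by (simp add: conv_def inner_cl[OF r(1) f])
 then show ?thesis using Cauchy_Schwarz_ineq2[of "cl (%y. \<kappa> (x - y))" "cl f"] by (simp only: r(2))
qed

lemma conv_increment:
 assumes f: "f \<in> L2" and k: "\<phi> \<in> test_functions"
 shows "\<bar>conv f \<phi> a - conv f \<phi> b\<bar> <= (\<Sum>i\<in>UNIV. norm (cl (partial i \<phi>))) * norm (cl f) * norm (a - b)"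
proof -
 have "norm (conv f \<phi> a - conv f \<phi> b) <= ((\<Sum>i\<in>UNIV. norm (cl (partial i \<phi>))) * norm (cl f)) * norm (a - b)"
 proof (rule differentiable_bound[where S=UNIV])
  fix x :: R3
  show "(conv f \<phi> has_derivative (%h. (\<chi> i. conv f (partial i \<phi>) x) \<bullet> h)) (at x within UNIV)"
   using conv_has_derivative[OF L2_loc_integrable[OF f] k] by simp
  have "norm (\<chi> i. conv f (partial i \<phi>) x) <= (\<Sum>i\<in>UNIV. \<bar>(\<chi> i. conv f (partial i \<phi>) x) $ i\<bar>)" by (rule norm_le_l1_cart)
  also have "\<dots> <= (\<Sum>i\<in>UNIV. norm (cl (partial i \<phi>)) * norm (cl f))"
   by (rule sum_mono) (simp only: vec_lambda_beta conv_sup[OF f test_partial[OF k]])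
  also have "\<dots> = (\<Sum>i\<in>UNIV. norm (cl (partial i \<phi>))) * norm (cl f)" by (simp only: sum_distrib_right)
  finally have g: "norm (\<chi> i. conv f (partial i \<phi>) x) <= (\<Sum>i\<in>UNIV. norm (cl (partial i \<phi>))) * norm (cl f)" .
  show "onorm (%h. (\<chi> i. conv f (partial i \<phi>) x) \<bullet> h) <= (\<Sum>i\<in>UNIV. norm (cl (partial i \<phi>))) * norm (cl f)"
  proof (rule onorm_le)
   fix h :: R3
   have "norm ((\<chi> i. conv f (partial i \<phi>) x) \<bullet> h) <= norm (\<chi> i. conv f (partial i \<phi>) x) * norm h" by (rule Cauchy_Schwarz_ineq2[folded real_norm_def])
   also have "\<dots> <= ((\<Sum>i\<in>UNIV. norm (cl (partial i \<phi>))) * norm (cl f)) * norm h" by (rule mult_right_mono[OF g norm_ge_zero])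
   finally show "norm ((\<chi> i. conv f (partial i \<phi>) x) \<bullet> h) <= ((\<Sum>i\<in>UNIV. norm (cl (partial i \<phi>))) * norm (cl f)) * norm h" .
  qed
 qed simp_all
 then show ?thesis by simp
qed

lemma conv_inner_swap:
 assumes S: "S \<in> test_functions" and f: "\<phi> \<in> test_functions" and k: "\<kappa> \<in> test_functions"
 shows "(\<integral>x. S x * conv \<phi> \<kappa> x \<partial>lebesgue) = (\<integral>z. \<kappa> z * conv (%y. S (- y)) \<phi> (- z) \<partial>lebesgue)"
proof -
 have c: "continuous_on UNIV S" "continuous_on UNIV \<phi>" "continuous_on UNIV \<kappa>"
  using S f k by (auto intro: smooth_continuous test_smooth)
 have bm: "h \<in> borel_measurable borel" if "continuous_on UNIV h" for h :: "R3 => real"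
  by (rule borel_measurable_continuous_onI[OF that])
 have leb: "(\<integral>x. h x \<partial>lebesgue) = (\<integral>x. h x \<partial>lborel)" if "continuous_on UNIV h" for h :: "R3 => real"
  by (rule integral_completion) (use bm[OF that] in simp)
 have cc: "continuous_on UNIV (%x. h (a x))" if "continuous_on UNIV h" "continuous_on UNIV a" for h :: "R3 => real" and a :: "R3 => R3"
  by (rule continuous_on_compose2[OF that subset_UNIV])
 have a1: "continuous_on UNIV (%y::R3. x - y)" "continuous_on UNIV (%y::R3. y - x)" "continuous_on UNIV (%y::R3. - y)" for x
  by (intro continuous_intros)+
 have ref: "(%y. S (- y)) \<in> test_functions" using test_reflect[OF S, of 0] by simp
 have 1: "conv \<phi> \<kappa> x = (\<integral>z. \<kappa> z * \<phi> (x - z) \<partial>lborel)" for x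
 proof -
  have "continuous_on UNIV (%y. \<kappa> (x - y) * \<phi> y)" by (rule continuous_on_mult[OF cc[OF c(3) a1(1)] c(2)])
  then have m: "(%y. \<kappa> (x - y) * \<phi> y) \<in> borel_measurable lebesgue" by (rule continuous_measurable_lebesgue)
  have "conv \<phi> \<kappa> x = (\<integral>z. \<kappa> z * \<phi> (x - z) \<partial>lebesgue)"
   unfolding conv_def using integral_affine[OF m, of "- 1" x] by simp
  also have "\<dots> = (\<integral>z. \<kappa> z * \<phi> (x - z) \<partial>lborel)" by (rule leb[OF continuous_on_mult[OF c(3) cc[OF c(2) a1(1)]]])
  finally show ?thesis .
 qed
 have 2: "conv (%y. S (- y)) \<phi> (- z) = (\<integral>x. \<phi> (x - z) * S x \<partial>lborel)" for z
 proof -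
  have "continuous_on UNIV (%y. \<phi> (- z - y) * S (- y))" by (rule continuous_on_mult[OF cc[OF c(2) a1(1)] cc[OF c(1) a1(3)]])
  then have m: "(%y. \<phi> (- z - y) * S (- y)) \<in> borel_measurable lebesgue" by (rule continuous_measurable_lebesgue)
  have "conv (%y. S (- y)) \<phi> (- z) = (\<integral>x. \<phi> (x - z) * S x \<partial>lebesgue)"
   unfolding conv_def using integral_affine[OF m, of "- 1" 0] by simp
  also have "\<dots> = (\<integral>x. \<phi> (x - z) * S x \<partial>lborel)" by (rule leb[OF continuous_on_mult[OF cc[OF c(2) a1(2)] c(1)]])
  finally show ?thesis .
 qed
 have sc: "continuous_on UNIV (conv \<phi> \<kappa>)" "continuous_on UNIV (conv (%y. S (- y)) \<phi>)"
  by (rule smooth_continuous[OF smooth_conv[OF L2_loc_integrable[OF test_L2[OF f]] k]]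
    smooth_continuous[OF smooth_conv[OF L2_loc_integrable[OF test_L2[OF ref]] f]])+
 obtain K where K: "K > 0" "!!x. \<bar>\<phi> x\<bar> <= K" using test_bounded[OF f] by blast
 have Si: "integrable lborel S" and ki: "integrable lborel \<kappa>"
  using test_integrable[OF S] test_integrable[OF k] bm[OF c(1)] bm[OF c(3)] by (simp_all add: integrable_completion)
 have pm: "(%p. S (fst p) * (\<kappa> (snd p) * \<phi> (fst p - snd p))) \<in> borel_measurable (lborel \<Otimes>\<^sub>M lborel)"
  using bm[OF c(1)] bm[OF c(2)] bm[OF c(3)] by measurable
 have "integrable (lborel \<Otimes>\<^sub>M lborel) (%p. \<bar>S (fst p)\<bar> * \<bar>\<kappa> (snd p)\<bar> * K)"
 proof (rule lborel_pair.Fubini_integrable)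
  show "(%p. \<bar>S (fst p)\<bar> * \<bar>\<kappa> (snd p)\<bar> * K) \<in> borel_measurable (lborel \<Otimes>\<^sub>M lborel)"
   using bm[OF c(1)] bm[OF c(3)] by measurable
  show "integrable lborel (%x. LINT y|lborel. norm (\<bar>S (fst (x, y))\<bar> * \<bar>\<kappa> (snd (x, y))\<bar> * K))"
   using Si K(1) by (simp add: abs_mult)
  show "AE x in lborel. integrable lborel (%y. \<bar>S (fst (x, y))\<bar> * \<bar>\<kappa> (snd (x, y))\<bar> * K)" using ki by simp
 qed
 then have ip: "integrable (lborel \<Otimes>\<^sub>M lborel) (%p. S (fst p) * (\<kappa> (snd p) * \<phi> (fst p - snd p)))"
 proof (rule Bochner_Integration.integrable_bound[OF _ pm])
  show "AE p in lborel \<Otimes>\<^sub>M lborel. norm (S (fst p) * (\<kappa> (snd p) * \<phi> (fst p - snd p))) <= norm (\<bar>S (fst p)\<bar> * \<bar>\<kappa> (snd p)\<bar> * K)"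
   using K by (intro AE_I2) (simp add: abs_mult mult.assoc mult_left_mono)
 qed
 have "(\<integral>x. S x * conv \<phi> \<kappa> x \<partial>lebesgue) = (\<integral>x. S x * conv \<phi> \<kappa> x \<partial>lborel)"
  by (rule leb[OF continuous_on_mult[OF c(1) sc(1)]])
 also have "\<dots> = (\<integral>x. (\<integral>z. S x * (\<kappa> z * \<phi> (x - z)) \<partial>lborel) \<partial>lborel)"
  unfolding 1 by simp
 also have "\<dots> = (\<integral>z. (\<integral>x. S x * (\<kappa> z * \<phi> (x - z)) \<partial>lborel) \<partial>lborel)"
  by (rule lborel_pair.Fubini_integral[symmetric]) (use ip in \<open>simp add: case_prod_beta'\<close>)
 also have "\<dots> = (\<integral>z. \<kappa> z * conv (%y. S (- y)) \<phi> (- z) \<partial>lborel)"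
  unfolding 2 by (simp add: mult_ac flip: integral_mult_right_zero)
 also have "\<dots> = (\<integral>z. \<kappa> z * conv (%y. S (- y)) \<phi> (- z) \<partial>lebesgue)"
  by (rule leb[symmetric, OF continuous_on_mult[OF c(3) cc[OF sc(2) a1(3)]]])
 finally show ?thesis .
qed

text \<open>The square of the norm of the mollification error \<open>S\<close> is the average over the small support of the
 mollifier of increments of the function \<open>z \<mapsto> \<integral> S(x) \<phi>(x - z) dx\<close>, whose gradient is at most
 \<open>\<parallel>S\<parallel> \<parallel>\<nabla>\<phi>\<parallel>\<close>.\<close>

lemma mollify_test:
 assumes f: "\<phi> \<in> test_functions"
 shows "norm (cl \<phi> - cl (conv \<phi> (mollifier n))) <= 3 / real (Suc n) * (\<Sum>i\<in>UNIV. norm (cl (partial i \<phi>)))"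
proof -
 define \<kappa> where "\<kappa> = mollifier n"
 define S where "S x = \<phi> x - conv \<phi> \<kappa> x" for x
 define N where "N = (\<Sum>i\<in>UNIV. norm (cl (partial i \<phi>)))"
 have N: "N >= 0" by (simp add: N_def sum_nonneg)
 have k: "\<kappa> \<in> test_functions" by (simp add: \<kappa>_def mollifier_test)
 have fL: "loc_integrable \<phi>" by (rule L2_loc_integrable[OF test_L2[OF f]])
 have ct: "conv \<phi> \<kappa> \<in> test_functions"
 proof -
  obtain R where R: "!!x. norm x > R ==> \<phi> x = 0" using test_supportE[OF f] by blast
  obtain Q where Q: "!!x. norm x > Q ==> \<kappa> x = 0" using test_supportE[OF k] by blast
  have "conv \<phi> \<kappa> x = 0" if x: "norm x > R + Q" for x
  proof -
   have "\<kappa> (x - y) * \<phi> y = 0" for y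
   proof (cases "norm y > R")
    case False
    then have "norm (x - y) > Q" using x norm_triangle_ineq2[of x y] by linarith
    then show ?thesis using Q by simp
   qed (simp add: R)
   then have "(%y. \<kappa> (x - y) * \<phi> y) = (%y. 0)" by (rule ext)
   then show ?thesis unfolding conv_def by (simp only: Bochner_Integration.integral_zero)
  qed
  then have "\<forall>x. conv \<phi> \<kappa> x ~= 0 \<longrightarrow> norm x <= R + Q" by (meson not_le)
  then show ?thesis unfolding test_iff using smooth_conv[OF fL k] by blast
 qed
 have S: "S \<in> test_functions" unfolding S_def[abs_def] by (rule test_diff[OF f ct])
 define v where "v y = S (- y)" for y
 have v: "v \<in> L2" "norm (cl v) = norm (cl S)"
  using norm_cl_reflect[OF test_L2[OF S], of 0] unfolding v_def[abs_def] by simp_all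
 define P where "P z = conv v \<phi> (- z)" for z
 have P0: "(\<integral>x. S x * \<phi> x \<partial>lebesgue) = P 0"
 proof -
  have m: "(%x. S x * \<phi> x) \<in> borel_measurable lebesgue" by (rule L2_measurable[OF test_L2[OF test_mult_smooth[OF S test_smooth[OF f]]]])
  show ?thesis unfolding P_def conv_def v_def using integral_affine[OF m, of "- 1" 0] by (simp add: mult.commute)
 qed
 have inc: "\<bar>P 0 - P z\<bar> <= N * norm (cl S) * norm z" for z
  using conv_increment[OF v(1) f, of 0 "- z"] unfolding P_def N_def v(2) by simp
 have Pm: "P \<in> borel_measurable lebesgue" unfolding P_def[abs_def]
  by (rule continuous_measurable_lebesgue[OF continuous_on_compose2[OF smooth_continuous[OF smooth_conv[OF L2_loc_integrable[OF v(1)] f]] _ subset_UNIV]])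
   (intro continuous_intros)
 have kP: "integrable lebesgue (%z. \<kappa> z * (P 0 - P z))" and kb: "\<kappa> z * (P 0 - P z) <= \<kappa> z * (N * norm (cl S) * (3 / real (Suc n)))" for z
 proof -
  have b: "\<bar>\<kappa> z * (P 0 - P z)\<bar> <= \<kappa> z * (N * norm (cl S) * (3 / real (Suc n)))" for z
  proof (cases "norm z > 3 / real (Suc n)")
   case True then show ?thesis using mollifier_support[of n z] by (simp add: \<kappa>_def)
  next
   case False
   then have "N * norm (cl S) * norm z <= N * norm (cl S) * (3 / real (Suc n))" using N by (intro mult_left_mono) auto
   then have "\<bar>P 0 - P z\<bar> <= N * norm (cl S) * (3 / real (Suc n))" using inc[of z] by linarith
   then show ?thesis unfolding \<kappa>_def abs_mult abs_of_nonneg[OF mollifier_nonneg] by (rule mult_left_mono[OF _ mollifier_nonneg])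
  qed
  show "integrable lebesgue (%z. \<kappa> z * (P 0 - P z))"
  proof (rule Bochner_Integration.integrable_bound[where f="%z. \<kappa> z * (N * norm (cl S) * (3 / real (Suc n)))"])
   show "integrable lebesgue (%z. \<kappa> z * (N * norm (cl S) * (3 / real (Suc n))))" using test_integrable[OF k] by simp
   show "(%z. \<kappa> z * (P 0 - P z)) \<in> borel_measurable lebesgue" using Pm L2_measurable[OF test_L2[OF k]] by simp
   show "AE z in lebesgue. norm (\<kappa> z * (P 0 - P z)) <= norm (\<kappa> z * (N * norm (cl S) * (3 / real (Suc n))))"
    using b by (intro AE_I2) (simp only: real_norm_def, meson abs_ge_self order_trans)
  qed
  show "\<kappa> z * (P 0 - P z) <= \<kappa> z * (N * norm (cl S) * (3 / real (Suc n)))" for z using b[of z] by linarith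
 qed
 have k1: "(\<integral>z. \<kappa> z \<partial>lebesgue) = 1" by (simp add: \<kappa>_def mollifier_integral)
 have kPz: "integrable lebesgue (%z. \<kappa> z * P z)"
 proof -
  have "integrable lebesgue (%z. \<kappa> z * P 0 - \<kappa> z * (P 0 - P z))"
   by (rule Bochner_Integration.integrable_diff[OF _ kP]) (use test_integrable[OF k] in simp)
  then show ?thesis by (simp add: right_diff_distrib)
 qed
 have gen: "x <= a" if "x * x <= a * x" "0 <= x" "0 <= a" for x a :: real
  using that by (cases "x = 0") auto
 have "(norm (cl S))\<^sup>2 = cl S \<bullet> (cl \<phi> - cl (conv \<phi> \<kappa>))"
  unfolding power2_norm_eq_inner unfolding S_def[abs_def] by (simp only: cl_diff[OF test_L2[OF f] test_L2[OF ct]])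
 also have "\<dots> = P 0 - (\<integral>z. \<kappa> z * P z \<partial>lebesgue)"
  unfolding inner_diff_right inner_cl[OF test_L2[OF S] test_L2[OF f]] inner_cl[OF test_L2[OF S] test_L2[OF ct]]
  using P0 conv_inner_swap[OF S f k] unfolding P_def v_def[abs_def] by simp
 also have "\<dots> = (\<integral>z. \<kappa> z * (P 0 - P z) \<partial>lebesgue)"
  using test_integrable[OF k] kPz k1 by (simp add: right_diff_distrib)
 also have "\<dots> <= (\<integral>z. \<kappa> z * (N * norm (cl S) * (3 / real (Suc n))) \<partial>lebesgue)"
  by (rule integral_mono[OF kP _ kb]) (use test_integrable[OF k] in simp)
 also have "\<dots> = (3 / real (Suc n) * N) * norm (cl S)" by (simp add: k1)
 finally have "norm (cl S) * norm (cl S) <= (3 / real (Suc n) * N) * norm (cl S)" by (simp only: power2_eq_square)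
 then have "norm (cl S) <= 3 / real (Suc n) * N"
  by (intro gen[of "norm (cl S)"] mult_nonneg_nonneg divide_nonneg_nonneg N) simp_all
 then show ?thesis unfolding N_def S_def[abs_def] \<kappa>_def[symmetric] by (simp only: cl_diff[OF test_L2[OF f] test_L2[OF ct]])
qed

lemma mollify_H1:
 assumes f: "!!i. wd i f (g i)"
 shows "norm (cl f - cl (conv f (mollifier n))) <= 3 / real (Suc n) * (\<Sum>i\<in>UNIV. norm (cl (g i)))"
proof -
 let ?k = "mollifier n"
 note k = mollifier_test[of n]
 have f2: "f \<in> L2" by (rule wd_L2(1)[OF f])
 obtain \<phi> where \<phi>: "!!n. \<phi> n \<in> test_functions" "(%n::nat. cl (\<phi> n)) \<longlonglongrightarrow> cl f"
  "!!i. i \<in> UNIV ==> (%n. cl (partial i (\<phi> n))) \<longlonglongrightarrow> cl (g i)"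
  using H1_dense[of f UNIV g, OF f2 f] by blast
 have mass: "(\<integral>y. \<bar>?k y\<bar> \<partial>lebesgue) = 1" using mollifier_integral[of n] mollifier_nonneg[of n] by simp
 have "norm (cl (conv (\<phi> m) ?k) - cl (conv f ?k)) <= norm (cl (\<phi> m) - cl f)" for m
 proof -
  note p2 = test_L2[OF \<phi>(1)[of m]]
  note d = L2_diff[OF p2 f2]
  have c: "conv (%x. \<phi> m x - f x) ?k = (%x. conv (\<phi> m) ?k x - conv f ?k x)"
   by (rule ext) (rule conv_diff[OF L2_loc_integrable[OF p2] L2_loc_integrable[OF f2] k])
  show ?thesis using conv_L2(2)[OF d k] unfolding c mass cl_diff[OF conv_L2(1)[OF p2 k] conv_L2(1)[OF f2 k]] cl_diff[OF p2 f2] by simp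
 qed
 then have "(%m. cl (conv (\<phi> m) ?k) - cl (conv f ?k)) \<longlonglongrightarrow> 0"
  by (rule Lim_null_comparison[OF always_eventually[OF allI]]) (use \<phi>(2) in \<open>simp add: norm_tendsto_zero_iff[symmetric]\<close>)
 then have c: "(%m. cl (conv (\<phi> m) ?k)) \<longlonglongrightarrow> cl (conv f ?k)" by (rule LIM_zero_cancel)
 show ?thesis
 proof (rule LIMSEQ_le)
  show "(%m. norm (cl (\<phi> m) - cl (conv (\<phi> m) ?k))) \<longlonglongrightarrow> norm (cl f - cl (conv f ?k))"
   by (intro tendsto_intros \<phi>(2) c)
  show "(%m. 3 / real (Suc n) * (\<Sum>i\<in>UNIV. norm (cl (partial i (\<phi> m))))) \<longlonglongrightarrow> 3 / real (Suc n) * (\<Sum>i\<in>UNIV. norm (cl (g i)))"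
   by (intro tendsto_intros \<phi>(3) UNIV_I)
  show "\<exists>N. \<forall>m\<ge>N. norm (cl (\<phi> m) - cl (conv (\<phi> m) ?k)) <= 3 / real (Suc n) * (\<Sum>i\<in>UNIV. norm (cl (partial i (\<phi> m))))"
   using mollify_test[OF \<phi>(1)] by blast
 qed
qed

text \<open>The bounded part is the mollification at a scale that depends on \<open>K\<close> and \<open>\<delta>\<close> only.\<close>

lemma H1_split:
 assumes K: "K >= 0" and \<delta>: "\<delta> > 0"
 obtains \<Lambda> where "!!F dF. H1_field F dF ==> norm (cl F) <= K ==> (!!i. norm (cl (dF i)) <= K) ==>
  \<exists>S L. S \<in> L2 \<and> norm (cl S) <= \<delta> \<and> L \<in> borel_measurable lebesgue \<and> (\<forall>x. norm (L x) <= \<Lambda>) \<and> (\<forall>x. F x = S x + L x)"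
proof -
 \<comment> \<open>27 counts the rate 3 of \<open>mollify_H1\<close>, three derivatives and three components.\<close>
 obtain n :: nat where n: "27 * K / \<delta> < real n" using reals_Archimedean2 by blast
 let ?k = "mollifier n"
 note k = mollifier_test[of n]
 have n27: "27 * K / real (Suc n) <= \<delta>"
 proof -
  have "27 * K / \<delta> <= real (Suc n)" using n by simp
  then show ?thesis using \<delta> by (simp add: field_simps)
 qed
 have main: "\<exists>S L. S \<in> L2 \<and> norm (cl S) <= \<delta> \<and> L \<in> borel_measurable lebesgue \<and> (\<forall>x. norm (L x) <= 3 * (norm (cl ?k) * K)) \<and> (\<forall>x. F x = S x + L x)"
  if F: "H1_field F dF" and FK: "norm (cl F) <= K" and dK: "!!i. norm (cl (dF i)) <= K" for F dF
 proof -
  note h = H1_fieldD[OF F]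
  define L where "L x = (\<chi> q. conv (%x. F x $ q) ?k x)" for x
  define S where "S x = F x - L x" for x
  have Lq: "(%x. L x $ q) \<in> L2" for q unfolding L_def vec_lambda_beta by (rule conv_L2(1)[OF L2_nth[OF h(1)] k])
  have L: "L \<in> L2" by (rule L2_of_nth[OF Lq])
  have S: "S \<in> L2" unfolding S_def[abs_def] by (rule L2_diff[OF h(1) L])
  have Sq: "norm (cl (%x. S x $ q)) <= 9 * K / real (Suc n)" for q
  proof -
   have "cl (%x. S x $ q) = cl (%x. F x $ q) - cl (conv (%x. F x $ q) ?k)"
    unfolding S_def vector_minus_component using cl_diff[OF L2_nth[OF h(1)] Lq, of q q] unfolding L_def vec_lambda_beta .
   also have "norm \<dots> <= 3 / real (Suc n) * (\<Sum>i\<in>UNIV. norm (cl (%x. dF i x $ q)))" by (rule mollify_H1[OF h(3)])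
   also have "\<dots> <= 3 / real (Suc n) * (\<Sum>i\<in>(UNIV::3 set). K)"
    by (intro mult_left_mono sum_mono order_trans[OF norm_cl_nth_le[OF h(2)] dK]) simp
   also have "\<dots> = 9 * K / real (Suc n)" by simp
   finally show ?thesis .
  qed
  have "norm (cl S) <= (\<Sum>q\<in>UNIV. norm (cl (%x. S x $ q)))" by (rule norm_cl_vec_le[OF S])
  also have "\<dots> <= (\<Sum>q\<in>(UNIV::3 set). 9 * K / real (Suc n))" by (rule sum_mono[OF Sq])
  also have "\<dots> = 27 * K / real (Suc n)" by simp
  finally have Sd: "norm (cl S) <= \<delta>" using n27 by linarith
  have Lb: "norm (L x) <= 3 * (norm (cl ?k) * K)" for x
  proof -
   have "norm (L x) <= (\<Sum>q\<in>UNIV. \<bar>L x $ q\<bar>)" by (rule norm_le_l1_cart)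
   also have "\<dots> <= (\<Sum>q\<in>(UNIV::3 set). norm (cl ?k) * K)"
    unfolding L_def vec_lambda_beta
    by (intro sum_mono order_trans[OF conv_sup[OF L2_nth[OF h(1)] k]] mult_left_mono order_trans[OF norm_cl_nth_le[OF h(1)] FK] norm_ge_zero)
   finally show ?thesis by simp
  qed
  show ?thesis using S Sd L2_measurable[OF L] Lb by (intro exI[of _ S] exI[of _ L]) (simp add: S_def)
 qed
 show ?thesis by (rule that[OF main])
qed

section \<open>Vanishing of the relative energy\<close>

lemma divide_tendsto_zero: "((%c::real. a / c) \<longlongrightarrow> 0) at_top"
 by (rule tendsto_divide_0[OF tendsto_const filterlim_at_top_imp_at_infinity[OF filterlim_ident]])

locale singular_limit = mhd T m ubar Bbar Mbar
 for T :: real and m :: nat and ubar Bbar :: "real => R3 => R3" and Mbar :: real +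
 fixes u E B j :: "real => real => R3 => R3" and c0 M K :: real
 assumes c0: "c0 > 0" and M: "M >= 0" and K: "K >= 0"
  and family: "!!c. c >= c0 ==> euler_maxwell c T m (u c) (E c) (B c) (j c)"
  and B_bound: "!!c. c >= c0 ==> (\<integral>\<^sup>+t. (Linfnorm (B c t))\<^sup>2 \<partial>lebesgue_on {0..T}) <= ennreal M"
  and E0_bound: "!!c. c >= c0 ==> norm (cl (E c 0)) <= K" "!!c i. c >= c0 ==> norm (cl (weak_partial i (E c 0))) <= K"
  and u0_limit: "((%c. norm (cl (u c 0) - cl (ubar 0))) \<longlongrightarrow> 0) at_top"
  and B0_limit: "((%c. norm (cl (B c 0) - cl (Bbar 0))) \<longlongrightarrow> 0) at_top"
begin

lemma T: "T > 0" using family[of c0] unfolding euler_maxwell_def by simp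

lemma zero: "0 \<in> {0..T}" using T by simp

lemma G_grid:
 assumes \<eta>: "\<eta> > 0"
 obtains N :: nat where "N > 0" "!!s t. s \<in> {0..T} ==> t \<in> {0..T} ==> \<bar>t - s\<bar> <= T / real N ==>
    norm (cl (G t) - cl (G s)) <= \<eta> \<and> norm (cl (curl_of (dG t)) - cl (curl_of (dG s))) <= \<eta>"
proof -
 have "uniformly_continuous_on {0..T} (%t. cl (G t))" by (rule compact_uniformly_continuous[OF G_continuous(1) compact_Icc])
 then obtain d1 where d1: "d1 > 0" "!!s t. s \<in> {0..T} ==> t \<in> {0..T} ==> dist t s < d1 ==> dist (cl (G t)) (cl (G s)) < \<eta>"
  using \<eta> unfolding uniformly_continuous_on_def by metis
 have "uniformly_continuous_on {0..T} (%t. cl (curl_of (dG t)))" by (rule compact_uniformly_continuous[OF G_continuous(2) compact_Icc])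
 then obtain d2 where d2: "d2 > 0" "!!s t. s \<in> {0..T} ==> t \<in> {0..T} ==> dist t s < d2 ==> dist (cl (curl_of (dG t))) (cl (curl_of (dG s))) < \<eta>"
  using \<eta> unfolding uniformly_continuous_on_def by metis
 obtain N :: nat where N: "T / min d1 d2 < real N" using reals_Archimedean2 by blast
 have d: "min d1 d2 > 0" using d1 d2 by simp
 have N0: "real N > 0" using N T d by (meson divide_pos_pos less_trans)
 have TN: "T / real N < min d1 d2" using N by (simp only: pos_divide_less_eq[OF d] pos_divide_less_eq[OF N0] mult.commute)
 show ?thesis
 proof (rule that[of N])
  show "N > 0" using N0 by simp
  fix s t assume st: "s \<in> {0..T}" "t \<in> {0..T}" "\<bar>t - s\<bar> <= T / real N"
  then have "dist t s < d1" "dist t s < d2" using TN by (simp_all add: dist_real_def)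
  then show "norm (cl (G t) - cl (G s)) <= \<eta> \<and> norm (cl (curl_of (dG t)) - cl (curl_of (dG s))) <= \<eta>"
   using d1(2)[OF st(1,2)] d2(2)[OF st(1,2)] by (simp add: dist_norm less_imp_le)
 qed
qed

lemma G_bounded: obtains Mg where "Mg >= 0" "!!t. t \<in> {0..T} ==> norm (cl (G t)) <= Mg"
proof -
 have "bounded ((%t. cl (G t)) ` {0..T})" by (rule compact_imp_bounded[OF compact_continuous_image[OF G_continuous(1) compact_Icc]])
 then obtain Mg where Mg: "\<forall>t\<in>{0..T}. norm (cl (G t)) <= Mg" unfolding bounded_iff by blast
 moreover have "Mg >= 0" using Mg zero norm_ge_zero order_trans by blast
 ultimately show ?thesis using that by blast
qed

text \<open>The grid and the splitting of the initial field depend on the target accuracy only. Once they are fixed,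
every other contribution tends to zero with \<open>1/c\<close> or with the initial deviations.\<close>

lemma relative_energy_vanishes:
 assumes \<epsilon>: "\<epsilon> > 0"
 shows "\<forall>\<^sub>F c in at_top. c >= c0 \<and> (\<forall>t\<in>{0..T}.
   (norm (cl (u c t) - cl (ubar t)))\<^sup>2 + (norm (cl (B c t) - cl (Bbar t)))\<^sup>2 <= \<epsilon>
   \<and> norm (cl (E c t)) <= decay c t * norm (cl (E c 0)) + sqrt \<epsilon>)"
proof -
 \<comment> \<open>\<open>C\<^sup>2\<close> bounds the initial energy once the initial deviations are at most 1.\<close>
 define C where "C = 2 * (Mbar + 1) + K"
 define X where "X = exp (2 * (A\<^sup>2 + 5 * A) * T)"
 define e1 where "e1 = \<epsilon> / X"
 define Z where "Z = (C + 1/2) * T + C\<^sup>2 / 4"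
 define Q where "Q = C + Mbar"
 define \<eta> where "\<eta> = e1 / (8 * (Z + 1))"
 define \<delta> where "\<delta> = e1 / (8 * (Q * (1 + M) + 1))"
 have X: "X > 0" by (simp add: X_def)
 have e1: "e1 > 0" using \<epsilon> X by (simp add: e1_def)
 have C: "C >= 0" using Mbar K by (simp add: C_def)
 have Z: "Z >= 0" using C T by (simp add: Z_def)
 have Q: "Q >= 0" using C Mbar by (simp add: Q_def)
 have QM: "Q * (1 + M) >= 0" using Q M by simp
 have \<eta>: "\<eta> > 0" "2 * (\<eta> * Z) <= e1 / 4" using e1 Z by (auto simp: \<eta>_def field_simps)
 have \<delta>: "\<delta> > 0" "2 * (Q * \<delta> * (1 + M)) <= e1 / 4"
 proof -
  show "\<delta> > 0" unfolding \<delta>_def using e1 QM by (intro divide_pos_pos) auto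
  have "Q * \<delta> * (1 + M) = (Q * (1 + M)) * e1 / (8 * (Q * (1 + M) + 1))" by (simp add: \<delta>_def)
  also have "\<dots> <= e1 / 8" using QM e1 by (simp add: field_simps)
  finally show "2 * (Q * \<delta> * (1 + M)) <= e1 / 4" by simp
 qed
 obtain Mg where Mg: "Mg >= 0" "!!t. t \<in> {0..T} ==> norm (cl (G t)) <= Mg" using G_bounded by blast
 obtain N :: nat where N: "N > 0" "!!s t. s \<in> {0..T} ==> t \<in> {0..T} ==> \<bar>t - s\<bar> <= T / real N ==>
    norm (cl (G t) - cl (G s)) <= \<eta> \<and> norm (cl (curl_of (dG t)) - cl (curl_of (dG s))) <= \<eta>"
  using G_grid[OF \<eta>(1)] by blast
 obtain \<Lambda> where \<Lambda>: "!!F dF. H1_field F dF ==> norm (cl F) <= K ==> (!!i. norm (cl (dF i)) <= K) ==>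
  \<exists>S L. S \<in> L2 \<and> norm (cl S) <= \<delta> \<and> L \<in> borel_measurable lebesgue \<and> (\<forall>x. norm (L x) <= \<Lambda>) \<and> (\<forall>x. F x = S x + L x)"
  using H1_split[OF K \<delta>(1)] by blast
 define a where "a c = norm (cl (u c 0) - cl (ubar 0))" for c
 define b where "b c = norm (cl (B c 0) - cl (Bbar 0))" for c
 define f where "f c = (a c)\<^sup>2 + (b c)\<^sup>2 + 2 * (real N * (4 * Mg * C / c) + \<eta> * (C / c) + (\<Lambda> * C + 3 * K) * Q / c)" for c
 have a0: "(a \<longlongrightarrow> 0) at_top" and b0: "(b \<longlongrightarrow> 0) at_top" using u0_limit B0_limit unfolding a_def[abs_def] b_def[abs_def] .
 have "(f \<longlongrightarrow> 0\<^sup>2 + 0\<^sup>2 + 2 * (real N * 0 + \<eta> * 0 + 0)) at_top"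
  unfolding f_def[abs_def] by (intro tendsto_intros divide_tendsto_zero a0 b0)
 then have "(f \<longlongrightarrow> 0) at_top" by simp
 then have "\<forall>\<^sub>F c in at_top. f c < e1 / 2" by (rule order_tendstoD(2)) (use e1 in simp)
 moreover have "\<forall>\<^sub>F c in at_top. a c < 1" "\<forall>\<^sub>F c in at_top. b c < 1" by (rule order_tendstoD(2)[OF a0] order_tendstoD(2)[OF b0], simp)+
 moreover have "\<forall>\<^sub>F c in at_top. c >= c0" by (rule eventually_ge_at_top)
 ultimately show ?thesis
 proof eventually_elim
  case (elim c)
  interpret EM: euler_maxwell c T m "u c" "E c" "B c" "j c" by (rule family[OF elim(4)])
  interpret C: comparison c T m "u c" "E c" "B c" "j c" ubar Bbar Mbar ..
  have bars: "norm (cl (ubar 0)) <= Mbar" "norm (cl (Bbar 0)) <= Mbar"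
   by (rule Hspace_field_bounds(1)[OF bar_H(1)[OF zero] mhd_m Mbar ubar_bound[OF zero]] Hspace_field_bounds(1)[OF bar_H(2)[OF zero] mhd_m Mbar Bbar_bound[OF zero]])+
  have n: "norm (cl (u c 0)) <= Mbar + 1" "norm (cl (B c 0)) <= Mbar + 1"
   using elim(2,3) bars norm_triangle_sub[of "cl (u c 0)" "cl (ubar 0)"] norm_triangle_sub[of "cl (B c 0)" "cl (Bbar 0)"]
   unfolding a_def b_def by linarith+
  have sq: "(norm (cl (u c 0)))\<^sup>2 <= (Mbar + 1)\<^sup>2" "(norm (cl (B c 0)))\<^sup>2 <= (Mbar + 1)\<^sup>2" "(norm (cl (E c 0)))\<^sup>2 <= K\<^sup>2"
   by (rule power_mono[OF n(1) norm_ge_zero] power_mono[OF n(2) norm_ge_zero] power_mono[OF E0_bound(1)[OF elim(4)] norm_ge_zero])+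
  have "2 * (Mbar + 1)\<^sup>2 + K\<^sup>2 <= C\<^sup>2"
  proof -
   have "0 <= (Mbar + 1) * K" "0 <= (Mbar + 1)\<^sup>2" using Mbar K by simp_all
   then show ?thesis unfolding C_def by (simp add: power2_eq_square algebra_simps)
  qed
  then have en: "EM.energy 0 <= C\<^sup>2" unfolding EM.energy_def using sq by linarith
  have "norm (cl (weak_curl (E c 0))) <= (\<Sum>i\<in>UNIV. norm (cl (weak_partial i (E c 0))))"
   unfolding weak_curl_eq by (rule norm_curl_of_le[OF H1_fieldD(2)[OF EM.fields_H1(2)[OF zero]]])
  also have "\<dots> <= (\<Sum>i\<in>(UNIV::3 set). K)" by (rule sum_mono[OF E0_bound(2)[OF elim(4)]])
  finally have cE: "norm (cl (weak_curl (E c 0))) <= 3 * K" by simp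
  obtain S L where SL: "S \<in> L2" "norm (cl S) <= \<delta>" "L \<in> borel_measurable lebesgue" "!!x. norm (L x) <= \<Lambda>" "!!x. E c 0 x = S x + L x"
   using \<Lambda>[OF EM.fields_H1(2)[OF zero] E0_bound(1)[OF elim(4)] E0_bound(2)[OF elim(4)]] by blast
  define \<rho> where "\<rho> = real N * (4 * Mg * C / c) + \<eta> * ((C + 1/2) * T + C\<^sup>2 / 4 + C / c)
   + (C + Mbar) * \<delta> * (1 + M) + (\<Lambda> * C + 3 * K) * (C + Mbar) / c"
  have \<rho>: "integral {0..t} C.rem <= \<rho>" if "t \<in> {0..T}" for t
   unfolding \<rho>_def by (rule C.remainder_bound[OF en C Mg(2) less_imp_le[OF \<eta>(1)] N SL cE B_bound[OF elim(4)] M that])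
  have w0: "norm (C.w 0) = a c" "norm (C.b 0) = b c" by (simp_all add: C.w_def C.b_def a_def b_def)
  have "2 * \<rho> = 2 * (real N * (4 * Mg * C / c) + \<eta> * (C / c) + (\<Lambda> * C + 3 * K) * Q / c) + 2 * (\<eta> * Z) + 2 * (Q * \<delta> * (1 + M))"
   unfolding \<rho>_def Z_def Q_def by (simp add: algebra_simps)
  then have "(norm (C.w 0))\<^sup>2 + (norm (C.b 0))\<^sup>2 + 2 * \<rho> <= e1"
   using elim(1) \<eta>(2) \<delta>(2) unfolding w0 f_def by linarith
  then have le: "((norm (C.w 0))\<^sup>2 + (norm (C.b 0))\<^sup>2 + 2 * \<rho>) * X <= \<epsilon>"
   using mult_right_mono[OF _ less_imp_le[OF X], of _ e1] X by (simp add: e1_def)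
  have y: "C.y t <= \<epsilon>" if "t \<in> {0..T}" for t
   using C.comparison_bound(1)[of \<rho>, OF \<rho> that] le unfolding X_def by linarith
  show ?case
  proof (intro conjI ballI elim(4))
   fix t assume t: "t \<in> {0..T}"
   have "(norm (C.w t))\<^sup>2 + (norm (C.b t))\<^sup>2 <= \<epsilon>" using y[OF t] zero_le_power2[of "norm (C.er t)"] unfolding C.y_def by linarith
   then show "(norm (cl (u c t) - cl (ubar t)))\<^sup>2 + (norm (cl (B c t) - cl (Bbar t)))\<^sup>2 <= \<epsilon>" by (simp only: C.w_def C.b_def)
   have "sqrt (C.y t) <= sqrt \<epsilon>" using y[OF t] by simp
   then show "norm (cl (E c t)) <= decay c t * norm (cl (E c 0)) + sqrt \<epsilon>"
    using C.comparison_bound(2)[of \<rho>, OF \<rho> t] by linarith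
  qed
 qed
qed

end

section \<open>Norms of space-time fields\<close>

lemma ennreal_tendsto_zeroI:
 assumes "!!\<epsilon>::real. \<epsilon> > 0 ==> \<forall>\<^sub>F c in F. f c <= ennreal \<epsilon>" shows "(f \<longlongrightarrow> 0) F"
proof (rule order_tendstoI)
 fix a :: ennreal assume a: "0 < a"
 obtain r where r: "r > 0" "ennreal r < a"
 proof (cases a)
  case (real x)
  then have "x > 0" using a by simp
  then have "x / 2 > 0" "ennreal (x / 2) < a" using real by (simp_all add: ennreal_less_iff)
  then show ?thesis by (rule that)
 next
  case top then show ?thesis using that[of 1] by simp
 qed
 show "\<forall>\<^sub>F c in F. f c < a" using assms[OF r(1)] by eventually_elim (rule le_less_trans[OF _ r(2)])
qed simp

lemma L2norm_Pair:
 fixes f g :: "R3 => R3" assumes f: "f \<in> L2" and g: "g \<in> L2"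
 shows "L2norm (%x. (f x, g x)) = ennreal (sqrt ((norm (cl f))\<^sup>2 + (norm (cl g))\<^sup>2))"
proof -
 have n: "(norm (f x, g x))\<^sup>2 = (norm (f x))\<^sup>2 + (norm (g x))\<^sup>2" for x by (simp add: norm_Pair)
 have "(%x. (f x, g x)) \<in> borel_measurable lebesgue" using L2_measurable[OF f] L2_measurable[OF g] by (rule borel_measurable_Pair)
 then have p: "(%x. (f x, g x)) \<in> L2" unfolding L2_iff n using L2_integrable[OF f] L2_integrable[OF g] by simp
 show ?thesis unfolding L2norm_eq[OF p] n norm_cl_sq[OF f] norm_cl_sq[OF g]
  using L2_integrable[OF f] L2_integrable[OF g] by simp
qed

lemma continuous_measurable_Icc:
 fixes g :: "real => real"
 shows "continuous_on {0..T} g ==> g \<in> borel_measurable (lebesgue_on {0..T})"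
 by (rule borel_measurable_integrable[OF continuous_imp_integrable_real])

lemma LinfL2norm_le:
 assumes g: "continuous_on {0..T} g" and eq: "!!t. t \<in> {0..T} ==> L2norm (f t) = ennreal (g t)" and le: "!!t. t \<in> {0..T} ==> g t <= K"
 shows "LinfL2norm T f <= ennreal K"
 unfolding LinfL2norm_def
proof (rule esssup_I)
 have "(%t. ennreal (g t)) \<in> borel_measurable (lebesgue_on {0..T})" using continuous_measurable_Icc[OF g] by simp
 then show "(%t. L2norm (f t)) \<in> borel_measurable (lebesgue_on {0..T})"
  by (rule iffD2[OF measurable_cong, rotated]) (use eq in simp)
 show "AE t in lebesgue_on {0..T}. L2norm (f t) <= ennreal K" using eq le by (intro AE_I2) (simp add: ennreal_leI)
qed

lemma ennpowr_mono:
 assumes "a <= ennreal X" "r > 0" "X >= 0" shows "ennpowr a r <= ennreal (X powr r)"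
proof (cases a)
 case (real x)
 then have "x <= X" using assms by simp
 then show ?thesis unfolding ennpowr_def using real assms(2) by (simp add: ennreal_leI powr_mono2)
next
 case top then show ?thesis using assms by (simp add: top_unique)
qed

text \<open>Since \<open>g <= K + 1\<close>, the power \<open>g\<^sup>p\<close> is at most \<open>(K + 1)\<^sup>p\<^sup>-\<^sup>1 g\<close>; this leaves the integral of the layer, which has
 width \<open>1/c\<^sup>2\<close>.\<close>

lemma LpL2norm_layer_le:
 assumes T: "T > 0" and c: "c > 0" and p: "p >= 1" and g: "!!t. t \<in> {0..T} ==> L2norm (f t) = ennreal (g t)"
  and g0: "!!t. g t >= 0" and le: "!!t. t \<in> {0..T} ==> g t <= decay c t * K + \<epsilon>" and K: "K >= 0" and \<epsilon>: "0 <= \<epsilon>" "\<epsilon> <= 1"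
 shows "LpL2norm p T f <= ennreal (((K + 1) powr (p - 1) * (K / c\<^sup>2 + \<epsilon> * T)) powr (1/p))"
 unfolding LpL2norm_def
proof (rule ennpowr_mono)
 let ?D = "(K + 1) powr (p - 1)"
 let ?h = "%t. ?D * (K * decay c t + \<epsilon>)"
 let ?H = "%t. ?D * (K * (- decay c t / c\<^sup>2) + \<epsilon> * t)"
 have cont: "continuous_on {0..T} ?h" by (intro continuous_intros decay_continuous)
 have i: "integrable (lebesgue_on {0..T}) ?h" by (rule continuous_imp_integrable_real[OF cont])
 have h0: "0 <= ?h t" for t using K \<epsilon> decay_bounds(1)[of c t] by simp
 have "(\<integral>\<^sup>+t. ennpowr (L2norm (f t)) p \<partial>lebesgue_on {0..T}) <= (\<integral>\<^sup>+t. ennreal (?h t) \<partial>lebesgue_on {0..T})"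
 proof (rule nn_integral_mono)
  fix t assume "t \<in> space (lebesgue_on {0..T})"
  then have t: "t \<in> {0..T}" by simp
  have a: "g t <= K * decay c t + \<epsilon>" using le[OF t] by (simp add: mult.commute)
  have "K * decay c t <= K * 1" by (rule mult_left_mono) (use K t decay_bounds(2) in auto)
  then have b: "g t <= K + 1" using a \<epsilon> by simp
  have "g t powr p = g t powr (p - 1) * g t"
  proof -
   have "g t powr p = g t powr (p - 1) * g t powr 1" by (simp only: powr_add[symmetric] diff_add_cancel)
   then show ?thesis by (simp only: powr_one[OF g0])
  qed
  also have "\<dots> <= ?h t" using a b g0[of t] p by (intro mult_mono powr_mono2) auto
  finally show "ennpowr (L2norm (f t)) p <= ennreal (?h t)" unfolding g[OF t] ennpowr_def using g0[of t] by (simp add: ennreal_leI)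
 qed
 also have "\<dots> = ennreal (integral\<^sup>L (lebesgue_on {0..T}) ?h)" by (rule nn_integral_eq_integral[OF i]) (use h0 in simp)
 also have "integral\<^sup>L (lebesgue_on {0..T}) ?h = integral {0..T} ?h" by (rule lebesgue_integral_eq_integral[OF i]) simp
 also have "integral {0..T} ?h = ?H T - ?H 0"
 proof (rule integral_unique[OF fundamental_theorem_of_calculus])
  fix t assume "t \<in> {0..T}"
  have "(?H has_real_derivative ?D * (K * (- (- (c\<^sup>2 * decay c t)) / c\<^sup>2) + \<epsilon> * 1)) (at t within {0..T})"
   by (intro DERIV_cmult DERIV_add DERIV_cdivide DERIV_minus DERIV_ident decay_derivative)
  then show "(?H has_vector_derivative ?h t) (at t within {0..T})"
   using c by (simp add: has_real_derivative_iff_has_vector_derivative)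
 qed (use T in simp)
 also have "?H T - ?H 0 <= ?D * (K / c\<^sup>2 + \<epsilon> * T)"
 proof -
  have "0 <= ?D * (K * (decay c T / c\<^sup>2))" using K decay_bounds(1)[of c T] by simp
  then show ?thesis by (simp add: decay_bounds(3) algebra_simps)
 qed
 finally show "(\<integral>\<^sup>+t. ennpowr (L2norm (f t)) p \<partial>lebesgue_on {0..T}) <= ennreal (?D * (K / c\<^sup>2 + \<epsilon> * T))"
  by (simp add: ennreal_leI)
 show "1 / p > 0" using p by simp
 show "0 <= ?D * (K / c\<^sup>2 + \<epsilon> * T)" using K \<epsilon> T by simp
qed

lemma AE_Icc_witness:
 fixes T d :: real
 assumes ae: "AE t in lebesgue_on {0..T}. P t" and d: "0 < d" "d <= T"
 obtains t where "t \<in> {0..d}" "P t"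
proof -
 have "\<exists>t\<in>{0..d}. P t"
 proof (rule ccontr)
  assume n: "\<not> (\<exists>t\<in>{0..d}. P t)"
  have sets: "{0..T} \<inter> space lebesgue \<in> sets lebesgue" by simp
  have "AE t in lebesgue. t \<in> {0..T} \<longrightarrow> P t" using ae unfolding AE_restrict_space_iff[OF sets] .
  then have "AE t in lebesgue. t \<notin> {0..d}" by eventually_elim (use n d in auto)
  then have "{0..d} \<in> null_sets lebesgue" by (simp add: AE_iff_null_sets)
  then have "emeasure lebesgue {0..d} = 0" by blast
  then show False using d by simp
 qed
 then show ?thesis using that by blast
qed

section \<open>Convergence\<close>

context singular_limit
begin

lemma E_L2: "c >= c0 ==> t \<in> {0..T} ==> E c t \<in> L2"
 by (rule euler_maxwell.fields_L2(2)[OF family])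

lemma E_continuous: assumes "c >= c0" shows "continuous_on {0..T} (%t. cl (E c t))"
 by (rule CHspace_continuous_field[OF euler_maxwell.EC[OF family[OF assms]]])

lemma flow_converges: "((%c. LinfL2norm T (%t x. (u c t x - ubar t x, B c t x - Bbar t x))) \<longlongrightarrow> 0) at_top"
proof (rule ennreal_tendsto_zeroI)
 fix \<epsilon> :: real assume \<epsilon>: "\<epsilon> > 0"
 from relative_energy_vanishes[OF zero_less_power[OF \<epsilon>, of 2]]
 show "\<forall>\<^sub>F c in at_top. LinfL2norm T (%t x. (u c t x - ubar t x, B c t x - Bbar t x)) <= ennreal \<epsilon>"
 proof eventually_elim
  case (elim c)
  then have c: "c >= c0" and le: "!!t. t \<in> {0..T} ==> (norm (cl (u c t) - cl (ubar t)))\<^sup>2 + (norm (cl (B c t) - cl (Bbar t)))\<^sup>2 <= \<epsilon>\<^sup>2" by blast+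
  note L = euler_maxwell.fields_L2[OF family[OF c]]
  note C = euler_maxwell.uC[OF family[OF c]] euler_maxwell.BC[OF family[OF c]]
  show ?case
  proof (rule LinfL2norm_le)
   show "continuous_on {0..T} (%t. sqrt ((norm (cl (u c t) - cl (ubar t)))\<^sup>2 + (norm (cl (B c t) - cl (Bbar t)))\<^sup>2))"
    by (intro continuous_intros CHspace_continuous_field[OF C(1)] CHspace_continuous_field[OF C(2)]
      CHspace_continuous_field[OF ubarC] CHspace_continuous_field[OF BbarC])
   fix t assume t: "t \<in> {0..T}"
   show "L2norm (%x. (u c t x - ubar t x, B c t x - Bbar t x))
     = ennreal (sqrt ((norm (cl (u c t) - cl (ubar t)))\<^sup>2 + (norm (cl (B c t) - cl (Bbar t)))\<^sup>2))"
    unfolding L2norm_Pair[OF L2_diff[OF L(1)[OF t] bar_L2(1)[OF t]] L2_diff[OF L(3)[OF t] bar_L2(2)[OF t]]]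
    by (simp only: cl_diff[OF L(1)[OF t] bar_L2(1)[OF t]] cl_diff[OF L(3)[OF t] bar_L2(2)[OF t]])
   show "sqrt ((norm (cl (u c t) - cl (ubar t)))\<^sup>2 + (norm (cl (B c t) - cl (Bbar t)))\<^sup>2) <= \<epsilon>"
    by (rule real_le_lsqrt[OF _ le[OF t]]) (use \<epsilon> in simp_all)
  qed
 qed
qed

lemma E_layer:
 assumes "\<epsilon> > 0"
 shows "\<forall>\<^sub>F c in at_top. c >= c0 \<and> (\<forall>t\<in>{0..T}. norm (cl (E c t)) <= decay c t * norm (cl (E c 0)) + \<epsilon>)"
 using relative_energy_vanishes[OF zero_less_power[OF assms, of 2]] by eventually_elim (use assms in simp)

lemma E_Lp_vanishes:
 assumes p: "p >= 1" shows "((%c. LpL2norm p T (E c)) \<longlongrightarrow> 0) at_top"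
proof (rule ennreal_tendsto_zeroI)
 fix e :: real assume e: "e > 0"
 define D where "D = (K + 1) powr (p - 1)"
 define X where "X = e powr p"
 define s where "s = min 1 (X / (2 * D * T))"
 have D: "D > 0" using K by (simp add: D_def)
 have X: "X > 0" using e by (simp add: X_def)
 have s: "s > 0" "s <= 1" using D T X by (simp_all add: s_def)
 have sX: "D * (s * T) <= X / 2"
 proof -
  have "s <= X / (2 * D * T)" by (simp add: s_def)
  then have "s * (2 * D * T) <= X" using D T by (simp add: pos_le_divide_eq)
  then show ?thesis by (simp add: mult_ac)
 qed
 have "((%c. (D * K / c) * (1 / c)) \<longlongrightarrow> 0 * 0) at_top" by (intro tendsto_mult divide_tendsto_zero)
 then have "\<forall>\<^sub>F c in at_top. (D * K / c) * (1 / c) < X / 2" by (rule order_tendstoD(2)) (use X in simp)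
 with E_layer[OF s(1)] show "\<forall>\<^sub>F c in at_top. LpL2norm p T (E c) <= ennreal e"
 proof eventually_elim
  case (elim c)
  then have c: "c >= c0" and le: "!!t. t \<in> {0..T} ==> norm (cl (E c t)) <= decay c t * norm (cl (E c 0)) + s" by blast+
  have c1: "c > 0" using c c0 by simp
  have "LpL2norm p T (E c) <= ennreal (((K + 1) powr (p - 1) * (K / c\<^sup>2 + s * T)) powr (1/p))"
  proof (rule LpL2norm_layer_le[OF T c1 p L2norm_cl[OF E_L2[OF c]] norm_ge_zero _ K less_imp_le[OF s(1)] s(2)])
   fix t assume t: "t \<in> {0..T}"
   have "decay c t * norm (cl (E c 0)) <= decay c t * K"
    by (rule mult_left_mono[OF E0_bound(1)[OF c] less_imp_le[OF decay_bounds(1)]])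
   then show "norm (cl (E c t)) <= decay c t * K + s" using le[OF t] by simp
  qed
  also have "\<dots> <= ennreal e"
  proof (rule ennreal_leI)
   have "D * (K / c\<^sup>2) = (D * K / c) * (1 / c)" by (simp add: power2_eq_square)
   then have "D * (K / c\<^sup>2 + s * T) <= X" using elim(2) sX unfolding distrib_left by linarith
   moreover have "0 <= D * (K / c\<^sup>2 + s * T)" using D K s T by simp
   ultimately have "(D * (K / c\<^sup>2 + s * T)) powr (1/p) <= X powr (1/p)" using p by (intro powr_mono2) auto
   also have "X powr (1/p) = e" using e p by (simp add: X_def powr_powr)
   finally show "((K + 1) powr (p - 1) * (K / c\<^sup>2 + s * T)) powr (1/p) <= e" unfolding D_def .
  qed
  finally show ?case .
 qed
qed

lemma E_Linf_vanishes:
 assumes E0: "((%c. norm (cl (E c 0))) \<longlongrightarrow> 0) at_top" shows "((%c. LinfL2norm T (E c)) \<longlongrightarrow> 0) at_top"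
proof (rule ennreal_tendsto_zeroI)
 fix \<epsilon> :: real assume "\<epsilon> > 0"
 then have \<epsilon>: "\<epsilon> / 2 > 0" by simp
 from E_layer[OF \<epsilon>] order_tendstoD(2)[OF E0 \<epsilon>]
 show "\<forall>\<^sub>F c in at_top. LinfL2norm T (E c) <= ennreal \<epsilon>"
 proof eventually_elim
  case (elim c)
  then have c: "c >= c0" and le: "!!t. t \<in> {0..T} ==> norm (cl (E c t)) <= decay c t * norm (cl (E c 0)) + \<epsilon> / 2" by blast+
  show ?case
  proof (rule LinfL2norm_le[OF continuous_on_norm[OF E_continuous[OF c]] L2norm_cl[OF E_L2[OF c]]])
   fix t assume t: "t \<in> {0..T}"
   have "decay c t * norm (cl (E c 0)) <= 1 * norm (cl (E c 0))" by (rule mult_right_mono) (use decay_bounds(2) t in auto)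
   then show "norm (cl (E c t)) <= \<epsilon>" using le[OF t] elim(2) by simp
  qed
 qed
qed

text \<open>At a fixed positive time the layer factor \<open>exp(-c\<^sup>2 t)\<close> is at most \<open>1/(c\<^sup>2 t)\<close>.\<close>

lemma E_pointwise_vanishes:
 assumes t: "t \<in> {0..T}" "t ~= 0" shows "((%c. norm (cl (E c t))) \<longlongrightarrow> 0) at_top"
proof (rule tendstoI)
 fix e :: real assume "e > 0"
 then have e: "e / 2 > 0" by simp
 have t0: "t > 0" using t by simp
 have "((%c. (K / t / c) * (1 / c)) \<longlongrightarrow> 0 * 0) at_top" by (intro tendsto_mult divide_tendsto_zero)
 then have "\<forall>\<^sub>F c in at_top. (K / t / c) * (1 / c) < e / 2" by (rule order_tendstoD(2)) (use e in simp)
 with E_layer[OF e] show "\<forall>\<^sub>F c in at_top. dist (norm (cl (E c t))) 0 < e"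
 proof eventually_elim
  case (elim c)
  then have c: "c >= c0" and le: "norm (cl (E c t)) <= decay c t * norm (cl (E c 0)) + e / 2" using t by blast+
  have c1: "c > 0" using c c0 by simp
  have q: "c\<^sup>2 * t > 0" using c1 t0 by simp
  have "decay c t = 1 / exp (c\<^sup>2 * t)" by (simp add: decay_def exp_minus field_simps)
  also have "\<dots> <= 1 / (c\<^sup>2 * t)"
  proof (rule divide_left_mono)
   show "c\<^sup>2 * t <= exp (c\<^sup>2 * t)" by (rule order_trans[OF _ exp_ge_add_one_self]) simp
  qed (use q in simp_all)
  finally have "decay c t * norm (cl (E c 0)) <= 1 / (c\<^sup>2 * t) * K"
   by (intro mult_mono E0_bound(1)[OF c]) (use q in auto)
  also have "\<dots> = (K / t / c) * (1 / c)" by (simp add: power2_eq_square)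
  finally have "norm (cl (E c t)) < e" using le elim(2) by linarith
  then show ?case by simp
 qed
qed

text \<open>A limit in \<open>L\<^sup>\<infinity>(0,T;L\<^sup>2)\<close> must vanish, since the fields vanish at every positive time; by continuity
 at the initial time the initial fields then vanish as well.\<close>

lemma initial_field_vanishes:
 assumes G: "F \<in> LinfL2 T" and lim: "((%c. LinfL2norm T (%t x. E c t x - F t x)) \<longlongrightarrow> 0) at_top"
 shows "((%c. L2norm (E c 0)) \<longlongrightarrow> 0) at_top"
proof (rule ennreal_tendsto_zeroI)
 fix \<epsilon> :: real assume \<epsilon>: "\<epsilon> > 0"
 define e where "e = \<epsilon> / 2"
 have e: "e > 0" using \<epsilon> by (simp add: e_def)
 have "\<forall>\<^sub>F c in at_top. LinfL2norm T (%t x. E c t x - F t x) < ennreal e" by (rule order_tendstoD(2)[OF lim]) (use e in simp)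
 then have "\<forall>\<^sub>F c in at_top. LinfL2norm T (%t x. E c t x - F t x) < ennreal e \<and> c >= c0"
  using eventually_ge_at_top[of c0] by (rule eventually_conj)
 then obtain c1 where c1: "!!c. c >= c1 ==> LinfL2norm T (%t x. E c t x - F t x) < ennreal e" "!!c. c >= c1 ==> c >= c0"
  unfolding eventually_at_top_linorder by blast
 have near: "AE t in lebesgue_on {0..T}. L2norm (%x. E c t x - F t x) <= ennreal e" if c: "c >= c1" for c
 proof -
  have "AE t in lebesgue_on {0..T}. L2norm (%x. E c t x - F t x) <= LinfL2norm T (%t x. E c t x - F t x)"
   unfolding LinfL2norm_def by (rule esssup_AE)
  then show ?thesis by eventually_elim (rule order_trans[OF _ less_imp_le[OF c1(1)[OF c]]])
 qed
 have tri: "norm (cl (E c t) - cl (F t)) <= e"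
  if "c >= c1" "t \<in> {0..T}" "F t \<in> L2" "L2norm (%x. E c t x - F t x) <= ennreal e" for c t
  using that(4) e unfolding L2norm_cl[OF L2_diff[OF E_L2[OF c1(2)[OF that(1)] that(2)] that(3)]] cl_diff[OF E_L2[OF c1(2)[OF that(1)] that(2)] that(3)]
  by simp
 have space: "AE t in lebesgue_on {0..T}. t \<in> {0..T}" by (rule AE_I2) simp
 have GL2: "AE t in lebesgue_on {0..T}. F t \<in> L2" using G by (simp add: LinfL2_def)
 have sets: "{0..T} \<inter> space lebesgue \<in> sets lebesgue" by simp
 have "AE t in lebesgue. t ~= (0::real)" by (rule AE_completion[OF AE_lborel_singleton])
 then have pos: "AE t in lebesgue_on {0..T}. t ~= 0"
  unfolding AE_restrict_space_iff[OF sets] by eventually_elim simp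
 have all: "AE t in lebesgue_on {0..T}. \<forall>n. L2norm (%x. E (c1 + real n) t x - F t x) <= ennreal e"
  unfolding AE_all_countable by (intro allI near) simp
 have Ge: "AE t in lebesgue_on {0..T}. norm (cl (F t)) <= e"
  using space GL2 pos all
 proof eventually_elim
  case (elim t)
  have "filterlim (%n. c1 + real n) at_top sequentially"
   by (rule filterlim_tendsto_add_at_top[OF tendsto_const filterlim_real_sequentially])
  from filterlim_compose[OF E_pointwise_vanishes[OF elim(1,3)] this]
  have "(%n. norm (cl (E (c1 + real n) t)) + e) \<longlonglongrightarrow> 0 + e" by (intro tendsto_add tendsto_const)
  moreover have "norm (cl (F t)) <= norm (cl (E (c1 + real n) t)) + e" for n
  proof -
   have "norm (cl (E (c1 + real n) t) - cl (F t)) <= e" using elim(4) by (intro tri elim(1,2)) simp_all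
   then show ?thesis using norm_triangle_sub[of "cl (F t)" "cl (E (c1 + real n) t)"] by (simp add: norm_minus_commute)
  qed
  ultimately have "norm (cl (F t)) <= 0 + e" by (intro LIMSEQ_le_const) blast+
  then show ?case by simp
 qed
 have "L2norm (E c 0) <= ennreal \<epsilon>" if c: "c >= c1" for c
 proof -
  have ae: "AE t in lebesgue_on {0..T}. t \<in> {0..T} \<and> norm (cl (E c t)) <= \<epsilon>"
   using space GL2 near[OF c] Ge
  proof eventually_elim
   case (elim t)
   have "norm (cl (E c t) - cl (F t)) <= e" by (rule tri[OF c elim(1,2,3)])
   then show ?case using elim(1,4) norm_triangle_sub[of "cl (E c t)" "cl (F t)"] by (simp add: e_def)
  qed
  have "norm (cl (E c 0)) <= \<epsilon>"
  proof (rule ccontr)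
   assume n: "\<not> norm (cl (E c 0)) <= \<epsilon>"
   obtain d where d: "d > 0" "\<forall>t\<in>{0..T}. dist t 0 < d \<longrightarrow> dist (cl (E c t)) (cl (E c 0)) < norm (cl (E c 0)) - \<epsilon>"
    using continuous_on_dist[OF E_continuous[OF c1(2)[OF c]] zero, of "norm (cl (E c 0)) - \<epsilon>"] n by auto
   obtain t where t: "t \<in> {0..min (d/2) T}" "t \<in> {0..T} \<and> norm (cl (E c t)) <= \<epsilon>"
    by (rule AE_Icc_witness[OF ae, of "min (d/2) T"]) (use d(1) T in auto)
   have "dist t 0 < d" using t d(1) by (simp add: dist_real_def)
   then have "dist (cl (E c t)) (cl (E c 0)) < norm (cl (E c 0)) - \<epsilon>" using d(2) t by blast
   then show False using t(2) norm_triangle_sub[of "cl (E c 0)" "cl (E c t)"] by (simp add: dist_norm norm_minus_commute)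
  qed
  then show ?thesis unfolding L2norm_cl[OF E_L2[OF c1(2)[OF c] zero]] by (rule ennreal_leI)
 qed
 then show "\<forall>\<^sub>F c in at_top. L2norm (E c 0) <= ennreal \<epsilon>" unfolding eventually_at_top_linorder by blast
qed

end

text \<open>The representative of the weak derivative is chosen from the same set of functions.\<close>

lemma weak_deriv_cong_AE:
 assumes "loc_integrable f" "loc_integrable f'" and ae: "AE x in lebesgue. f x = f' x"
 shows "weak_deriv \<alpha> f = weak_deriv \<alpha> f'"
proof -
 have "(\<integral>x. multi_partial \<alpha> \<phi> x *\<^sub>R f x \<partial>lebesgue) = (\<integral>x. multi_partial \<alpha> \<phi> x *\<^sub>R f' x \<partial>lebesgue)" if t: "\<phi> \<in> test_functions" for \<phi>
 proof (rule integral_cong_AE)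
  have m: "multi_partial \<alpha> \<phi> \<in> borel_measurable lebesgue" by (rule L2_measurable[OF test_L2[OF multi_partial_test[OF t]]])
  show "(%x. multi_partial \<alpha> \<phi> x *\<^sub>R f x) \<in> borel_measurable lebesgue" "(%x. multi_partial \<alpha> \<phi> x *\<^sub>R f' x) \<in> borel_measurable lebesgue"
   by (rule borel_measurable_scaleR[OF m loc_integrable_measurable[OF assms(1)]] borel_measurable_scaleR[OF m loc_integrable_measurable[OF assms(2)]])+
  show "AE x in lebesgue. multi_partial \<alpha> \<phi> x *\<^sub>R f x = multi_partial \<alpha> \<phi> x *\<^sub>R f' x" using ae by eventually_elim simp
 qed
 then have "has_weak_deriv \<alpha> f g = has_weak_deriv \<alpha> f' g" for g using assms(1,2) by (simp add: has_weak_deriv_def)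
 then have "has_weak_deriv \<alpha> f = has_weak_deriv \<alpha> f'" by (rule ext)
 then show ?thesis unfolding weak_deriv_def by simp
qed

section \<open>Convergence of the Euler-Maxwell system to the MHD system\<close>

theorem corollary1p4:
  fixes c0 T M Mbar :: real and m :: nat
    and u0 E0 B0 :: "real \<Rightarrow> R3 \<Rightarrow> R3"
    and u0lim B0lim :: "R3 \<Rightarrow> R3"
    and u E B j :: "real \<Rightarrow> real \<Rightarrow> R3 \<Rightarrow> R3"
    and ubar Bbar :: "real \<Rightarrow> R3 \<Rightarrow> R3"
  assumes "c0 > 0" and "real m > 5/2"
    and initial_data: "\<And>c. c \<ge> c0 \<Longrightarrow>
          u0 c \<in> Hspace m \<and> E0 c \<in> Hspace m \<and> B0 c \<in> Hspace m \<and>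
          div_free (u0 c) \<and> div_free (E0 c) \<and> div_free (B0 c)"
    and "u0lim \<in> Hspace m" and "B0lim \<in> Hspace m"
    and initial_conv:
      "((\<lambda>c. L2norm (\<lambda>x. (u0 c x - u0lim x, B0 c x - B0lim x))) \<longlongrightarrow> 0) at_top"
    and "(SUP c\<in>{c0..}. Hnorm 1 (E0 c)) < \<infinity>"
    and "T > 0"
    and EM_solution: "\<And>c. c \<ge> c0 \<Longrightarrow>
          u c \<in> CHspace T m \<and> E c \<in> CHspace T m \<and> B c \<in> CHspace T m \<and>
          Euler_Maxwell c T (u c) (E c) (B c) (j c) \<and>
          (AE x in lebesgue. u c 0 x = u0 c x \<and> E c 0 x = E0 c x \<and> B c 0 x = B0 c x)"
    and MHD_solution:
      "ubar \<in> CHspace T m" "Bbar \<in> CHspace T m" "MHD T ubar Bbar"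
      "AE x in lebesgue. ubar 0 x = u0lim x \<and> Bbar 0 x = B0lim x"
    and "M > 0" and "Mbar > 0"
    and EM_bound: "\<And>c. c \<ge> c0 \<Longrightarrow>
          (\<integral>\<^sup>+t. (Linfnorm (B c t))\<^sup>2 \<partial>lebesgue_on {0..T})
          + (\<integral>\<^sup>+t. Linfnorm (j c t) \<partial>lebesgue_on {0..T}) \<le> ennreal M"
    and MHD_bound:
      "(SUP t\<in>{0..T}. Hnorm m (ubar t) + Hnorm m (Bbar t))
       + ennpowr (\<integral>\<^sup>+t. (Hnorm m (weak_grad (Bbar t)))\<^sup>2 \<partial>lebesgue_on {0..T}) (1/2)
       \<le> ennreal Mbar"
  shows "((\<lambda>c. LinfL2norm T (\<lambda>t x. (u c t x - ubar t x, B c t x - Bbar t x))) \<longlongrightarrow> 0) at_top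
    \<and> (\<forall>p::real. p \<ge> 1 \<longrightarrow> ((\<lambda>c. LpL2norm p T (E c)) \<longlongrightarrow> 0) at_top)
    \<and> (((\<lambda>c. L2norm (E0 c)) \<longlongrightarrow> 0) at_top \<longrightarrow>
         ((\<lambda>c. LinfL2norm T (E c)) \<longlongrightarrow> 0) at_top)
    \<and> (\<not> ((\<lambda>c. L2norm (E0 c)) \<longlongrightarrow> 0) at_top \<longrightarrow>
         \<not> (\<exists>G\<in>LinfL2 T. ((\<lambda>c. LinfL2norm T (\<lambda>t x. E c t x - G t x)) \<longlongrightarrow> 0) at_top))"
proof -
 have "real 2 < real m" using assms(2) by simp
 then have m: "3 <= m" by (simp only: of_nat_less_iff)
 have zero: "0 \<in> {0..T}" using assms(8) by simp
 define K where "K = enn2real (SUP c\<in>{c0..}. Hnorm 1 (E0 c))"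
 have K: "K >= 0" by (simp add: K_def)
 have HK: "Hnorm 1 (E0 c) <= ennreal K" if "c >= c0" for c
 proof -
  have "(SUP c\<in>{c0..}. Hnorm 1 (E0 c)) = ennreal K" using assms(7) by (simp add: K_def less_top)
  moreover have "Hnorm 1 (E0 c) <= (SUP c\<in>{c0..}. Hnorm 1 (E0 c))" by (rule SUP_upper) (use that in simp)
  ultimately show ?thesis by simp
 qed
 have Hbar: "Hnorm m (ubar t) + Hnorm m (Bbar t) <= ennreal Mbar" if "t \<in> {0..T}" for t
 proof -
  have "Hnorm m (ubar t) + Hnorm m (Bbar t) <= (SUP t\<in>{0..T}. Hnorm m (ubar t) + Hnorm m (Bbar t))" by (rule SUP_upper[OF that])
  also have "\<dots> <= (SUP t\<in>{0..T}. Hnorm m (ubar t) + Hnorm m (Bbar t))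
    + ennpowr (\<integral>\<^sup>+t. (Hnorm m (weak_grad (Bbar t)))\<^sup>2 \<partial>lebesgue_on {0..T}) (1/2)" by (rule add_increasing2[OF zero_le order_refl])
  finally show ?thesis using MHD_bound by (rule order_trans)
 qed
 have L: "mhd T m ubar Bbar Mbar"
 proof (rule mhd.intro[OF m MHD_solution(1,2,3)])
  show "Mbar >= 0" using assms(15) by simp
  show "Hnorm m (ubar t) <= ennreal Mbar" "Hnorm m (Bbar t) <= ennreal Mbar" if "t \<in> {0..T}" for t
   using order_trans[OF add_increasing2[OF zero_le order_refl] Hbar[OF that]]
    order_trans[OF add_increasing[OF zero_le order_refl] Hbar[OF that]] by blast+
 qed
 have fam: "euler_maxwell c T m (u c) (E c) (B c) (j c)" if c: "c >= c0" for c
  by (rule euler_maxwell.intro) (use c assms(1,8) m EM_solution[OF c] in auto)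
 have at0: "cl (u c 0) = cl (u0 c)" "cl (E c 0) = cl (E0 c)" "cl (B c 0) = cl (B0 c)" if c: "c >= c0" for c
 proof -
  have ae: "AE x in lebesgue. u c 0 x = u0 c x \<and> E c 0 x = E0 c x \<and> B c 0 x = B0 c x" using EM_solution[OF c] by blast
  note L2 = euler_maxwell.fields_L2[OF fam[OF c] zero]
  have "AE x in lebesgue. u c 0 x = u0 c x" using ae by eventually_elim blast
  then show "cl (u c 0) = cl (u0 c)" by (rule cl_cong[OF L2(1)])
  have "AE x in lebesgue. E c 0 x = E0 c x" using ae by eventually_elim blast
  then show "cl (E c 0) = cl (E0 c)" by (rule cl_cong[OF L2(2)])
  have "AE x in lebesgue. B c 0 x = B0 c x" using ae by eventually_elim blast
  then show "cl (B c 0) = cl (B0 c)" by (rule cl_cong[OF L2(3)])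
 qed
 have bar0: "cl (ubar 0) = cl u0lim" "cl (Bbar 0) = cl B0lim"
 proof -
  have "AE x in lebesgue. ubar 0 x = u0lim x" using MHD_solution(4) by eventually_elim blast
  then show "cl (ubar 0) = cl u0lim" by (rule cl_cong[OF mhd.bar_L2(1)[OF L zero]])
  have "AE x in lebesgue. Bbar 0 x = B0lim x" using MHD_solution(4) by eventually_elim blast
  then show "cl (Bbar 0) = cl B0lim" by (rule cl_cong[OF mhd.bar_L2(2)[OF L zero]])
 qed
 have init: "(norm (cl (u c 0) - cl (ubar 0)) < e \<and> norm (cl (B c 0) - cl (Bbar 0)) < e)"
  if c: "c >= c0" and l: "L2norm (%x. (u0 c x - u0lim x, B0 c x - B0lim x)) < ennreal e" for c e
 proof -
  have d: "u0 c \<in> L2" "B0 c \<in> L2" "u0lim \<in> L2" "B0lim \<in> L2"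
   using initial_data[OF c] assms(4,5) Hspace_L2 by blast+
  let ?a = "norm (cl (u c 0) - cl (ubar 0))" and ?b = "norm (cl (B c 0) - cl (Bbar 0))"
  have "ennreal (sqrt (?a\<^sup>2 + ?b\<^sup>2)) < ennreal e"
   using l unfolding L2norm_Pair[OF L2_diff[OF d(1,3)] L2_diff[OF d(2,4)]] cl_diff[OF d(1,3)] cl_diff[OF d(2,4)] at0[OF c] bar0 .
  then have s: "sqrt (?a\<^sup>2 + ?b\<^sup>2) < e" by (simp add: ennreal_less_iff)
  have "?a <= sqrt (?a\<^sup>2 + ?b\<^sup>2)" "?b <= sqrt (?a\<^sup>2 + ?b\<^sup>2)" by (rule real_sqrt_sum_squares_ge1 real_sqrt_sum_squares_ge2)+
  then show ?thesis using s by linarith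
 qed
 have ev: "\<forall>\<^sub>F c in at_top. norm (cl (u c 0) - cl (ubar 0)) < e \<and> norm (cl (B c 0) - cl (Bbar 0)) < e" if e: "e > 0" for e
 proof -
  have "\<forall>\<^sub>F c in at_top. L2norm (%x. (u0 c x - u0lim x, B0 c x - B0lim x)) < ennreal e"
   by (rule order_tendstoD(2)[OF initial_conv]) (use e in simp)
  then show ?thesis using eventually_ge_at_top[of c0] by eventually_elim (rule init)
 qed
 have S: "singular_limit T m ubar Bbar Mbar u E B j c0 M K"
 proof (rule singular_limit.intro[OF L singular_limit_axioms.intro])
  show "c0 > 0" "M >= 0" "K >= 0" using assms(1,14) K by simp_all
  fix c assume c: "c >= c0"
  show "euler_maxwell c T m (u c) (E c) (B c) (j c)" by (rule fam[OF c])
  show "(\<integral>\<^sup>+t. (Linfnorm (B c t))\<^sup>2 \<partial>lebesgue_on {0..T}) <= ennreal M"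
   by (rule order_trans[OF add_increasing2[OF zero_le order_refl] EM_bound[OF c]])
  have H1: "E0 c \<in> Hspace 1" by (rule Hnorm_finite_Hspace[OF HK[OF c]])
  have "cl (weak_deriv 0 (E0 c)) = cl (E0 c)"
   by (rule cl_cong[OF Hspace_weak_deriv(2)[OF H1] weak_deriv_zero[OF H1]]) (simp add: multi_partial_zero)
  moreover have "norm (cl (weak_deriv 0 (E0 c))) <= K"
   by (rule Hnorm_weak_deriv_le[OF H1 K HK[OF c]]) (simp add: multi_partial_zero)
  ultimately show "norm (cl (E c 0)) <= K" by (simp only: at0(2)[OF c])
  fix i :: 3
  have "AE x in lebesgue. E c 0 x = E0 c x" using EM_solution[OF c] by (auto elim: eventually_mono)
  then have "weak_partial i (E c 0) = weak_partial i (E0 c)"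
   by (rule weak_deriv_cong_AE[OF L2_loc_integrable[OF euler_maxwell.fields_L2(2)[OF fam[OF c] zero]] L2_loc_integrable[OF Hspace_L2[OF H1]]])
  moreover have "norm (cl (weak_partial i (E0 c))) <= K"
  proof (rule Hnorm_weak_deriv_le[OF H1 K HK[OF c]])
   show "mi_order (axis i 1) <= 1" unfolding mi_order_axis by (rule order_refl)
  qed
  ultimately show "norm (cl (weak_partial i (E c 0))) <= K" by (simp only:)
 next
  show "((%c. norm (cl (u c 0) - cl (ubar 0))) \<longlongrightarrow> 0) at_top"
  proof (rule tendstoI)
   fix e :: real assume "e > 0"
   from ev[OF this] show "\<forall>\<^sub>F c in at_top. dist (norm (cl (u c 0) - cl (ubar 0))) 0 < e" by eventually_elim simp
  qed
  show "((%c. norm (cl (B c 0) - cl (Bbar 0))) \<longlongrightarrow> 0) at_top"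
  proof (rule tendstoI)
   fix e :: real assume "e > 0"
   from ev[OF this] show "\<forall>\<^sub>F c in at_top. dist (norm (cl (B c 0) - cl (Bbar 0))) 0 < e" by eventually_elim simp
  qed
 qed
 have n0: "L2norm (E0 c) = ennreal (norm (cl (E c 0)))" if c: "c >= c0" for c
  using initial_data[OF c] Hspace_L2 unfolding at0(2)[OF c] by (intro L2norm_cl) blast
 have n0': "L2norm (E c 0) = L2norm (E0 c)" if c: "c >= c0" for c
  unfolding n0[OF c] by (rule L2norm_cl[OF euler_maxwell.fields_L2(2)[OF fam[OF c] zero]])
 show ?thesis
 proof (intro conjI allI impI)
  show "((%c. LinfL2norm T (%t x. (u c t x - ubar t x, B c t x - Bbar t x))) \<longlongrightarrow> 0) at_top"
   by (rule singular_limit.flow_converges[OF S])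
  show "((%c. LpL2norm p T (E c)) \<longlongrightarrow> 0) at_top" if "p >= 1" for p
   by (rule singular_limit.E_Lp_vanishes[OF S that])
  show "((%c. LinfL2norm T (E c)) \<longlongrightarrow> 0) at_top" if lim: "((%c. L2norm (E0 c)) \<longlongrightarrow> 0) at_top"
  proof (rule singular_limit.E_Linf_vanishes[OF S], rule tendstoI)
   fix e :: real assume "e > 0"
   then have "\<forall>\<^sub>F c in at_top. L2norm (E0 c) < ennreal e" by (intro order_tendstoD(2)[OF lim]) simp
   then show "\<forall>\<^sub>F c in at_top. dist (norm (cl (E c 0))) 0 < e"
    using eventually_ge_at_top[of c0] by eventually_elim (simp add: n0 ennreal_less_iff)
  qed
  show "\<not> (\<exists>G\<in>LinfL2 T. ((%c. LinfL2norm T (%t x. E c t x - G t x)) \<longlongrightarrow> 0) at_top)"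
   if no: "\<not> ((%c. L2norm (E0 c)) \<longlongrightarrow> 0) at_top"
  proof
   assume "\<exists>G\<in>LinfL2 T. ((%c. LinfL2norm T (%t x. E c t x - G t x)) \<longlongrightarrow> 0) at_top"
   then obtain G where G: "G \<in> LinfL2 T" "((%c. LinfL2norm T (%t x. E c t x - G t x)) \<longlongrightarrow> 0) at_top" by blast
   have "((%c. L2norm (E c 0)) \<longlongrightarrow> 0) at_top" by (rule singular_limit.initial_field_vanishes[OF S G])
   moreover have "\<forall>\<^sub>F c in at_top. L2norm (E c 0) = L2norm (E0 c)"
    using eventually_ge_at_top[of c0] by eventually_elim (rule n0')
   ultimately have "((%c. L2norm (E0 c)) \<longlongrightarrow> 0) at_top" by (rule Lim_transform_eventually)
   with no show False by blast
  qed
 qed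
qed

end
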